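(* Let $f:\partial\Omega\to\mathbb{R}$ be a bounded $P_\Omega$-measurable function with $\int_{\partial\Omega} f\,dP_\Omega=0$, and let \[ I(v)=\int_\Omega g_v^p\,d\mu+\int_{\partial\Omega} Tv\, f\,dP_\Omega ,\qquad v\in N^{1,p}(\Omega). \] Let $N^{1,p}_*(\Omega)=\{v\in N^{1,p}(\Omega):\int_\Omega v\,d\mu=0\}$. Then there is $u\in N^{1,p}_*(\Omega)$ such that \[ I(u)=\inf_{v\in N^{1,p}_*(\Omega)} I(v). \]
   Context: Setting. $1<p<\infty$ and $(X,d,\mu)$ is a complete metric measure space; $\mu$ is doubling, i.e. there is $C_D$ with $0<\mu(B(z,2r))\le C_D\,\mu(B(z,r))<\infty$ for all $z\in X$, $r>0$. Fix $s>1$ and $C>0$ with $\mu(B(x,r))/\mu(B(y,R))\ge C(r/R)^s$ for all $0<r\le R$, $y\in X$, $x\in B(y,R)$ (such $s$ exists by doubling). A Borel function $g\ge 0$ is an upper gradient of $u$ if $|u(y)-u(x)|\le\int_\gamma g\,ds$ for every rectifiable curve $\gamma$ with end points $x,y$ (the right-hand side being required to be $\infty$ if $u(x)$ or $u(y)$ is not finite); $g$ is a $p$-weak upper gradient if this holds outside a family of curves of zero $p$-modulus; $g_u$ denotes the minimal ($\mu$-a.e. smallest) $p$-weak upper gradient of $u$ in $L^p$. $N^{1,p}$ of a space is the set of (everywhere defined) functions in $L^p$ having an upper gradient in $L^p$, with norm $\|u\|_{L^p}+\inf_g\|g\|_{L^p}$; $N^{1,p}(\Omega)$ is this space for $\Omega$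 viewed as a metric measure space, and $g_u$ is then taken in $\Omega$. A space supports a $p$-Poincaré inequality (with dilation $\lambda$) if there is $C$ with $\fint_B|u-u_B|\,d\mu\le C\,\mathrm{rad}(B)\,(\fint_{\lambda B}g^p\,d\mu)^{1/p}$ for all balls $B$, all $u$ integrable on bounded sets, and all upper gradients $g$ of $u$, where $u_B=\fint_B u\,d\mu=\mu(B)^{-1}\int_B u\,d\mu$. $X$ supports a $p$-Poincaré inequality. Perimeter: for open $U\subset X$, $P_E(U)=\inf\{\liminf_k\int_U g_{u_k}\,d\mu: u_k\in N^{1,1}(U),\ u_k\to\chi_{E\cap U}\text{ in }L^1(U)\}$; $E$ has finite perimeter if $P_E(X)<\infty$, and then $P_E$ extends to a finite Radon measure on $X$. Domain. $\Omega\subset X$ is a bounded domain (nonempty connected open set) of finite perimeter, $\mu(X\setminus\Omega)>0$, and there is $C\ge1$ such that for all $x\in\partial\Omega$, $z\in\Omega$, $0<r\le\mathrm{diam}(\Omega)$: $\mu(B(z,r)\cap\Omega)\ge C^{-1}\mu(B(z,r))$ and $C^{-1}\mu(B(x,r))/r\le P_\Omega(B(x,r))\le C\mu(B(x,r))/r$. Moreover $(\Omega,d|_\Omega,\mu|_\Omega)$ supports a $p$-Poincaré inequality with $\lambda=1$. Trace. Under these assumptions there is a bounded linear trace operator $T:N^{1,p}(\Omega)\to L^{\tilde p}(\partial\Omega,P_\Omega)$ for every $\tilde p<p^*$, where $p^*=p(s-1)/(s-p)$ if $p<s$ and $p^*=\infty$ if $p\ge s$ ($\tilde p=\infty$ is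 allowed if $p>s$), determined by $\lim_{r\to0^+}\fint_{B(x,r)\cap\Omega}|u-Tu(x)|\,d\mu=0$ for almost every $x\in\partial\Omega$ with respect to the co-dimension 1 Hausdorff measure. *)

theory Defs
  imports "HOL-Analysis.Analysis"
begin

text \<open>
  The ambient space \<open>X\<close> is a type of class \<^class>\<open>complete_space\<close>. A metric measure space is
  given by a measure \<open>N\<close> on the Borel sets of the subset \<^term>\<open>space N\<close>: \<open>X\<close> itself is a measure
  \<open>M\<close> with \<^prop>\<open>sets M = sets borel\<close>, and an open set \<open>U\<close>, viewed as a metric measure space of
  its own, is \<^term>\<open>restrict_space M U\<close>. ``Borel'' means measurable for \<open>N\<close>, and
  ``\<open>\<mu>\<close>-measurable'' means measurable for \<^term>\<open>completion N\<close>. Functions take values in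
  \<^typ>\<open>ereal\<close>, and their values outside \<^term>\<open>space N\<close> are irrelevant.
\<close>

definition ennreal_powr :: "ennreal \<Rightarrow> real \<Rightarrow> ennreal" where
  "ennreal_powr x p = (if x = \<infinity> then \<infinity> else ennreal (enn2real x powr p))"


subsection \<open>Curves and line integrals\<close>

definition curve_length :: "(real \<Rightarrow> 'a::metric_space) \<Rightarrow> real \<Rightarrow> real \<Rightarrow> ennreal" where
  "curve_length \<gamma> a b =
    (SUP (n, t) \<in> {(n::nat, t::nat \<Rightarrow> real). mono t \<and> range t \<subseteq> {a..b}}.
      ennreal (\<Sum>i<n. dist (\<gamma> (t i)) (\<gamma> (t (Suc i)))))"

text \<open>
  As usual for upper gradients, curves are compact and nonconstant. (A constant curve at a point
  where \<open>u\<close> is infinite would rule out every upper gradient of \<open>u\<close>.)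
\<close>

definition rectifiable_curves :: "'a::metric_space measure \<Rightarrow> (real \<Rightarrow> 'a) set" where
  "rectifiable_curves N = {\<gamma>. path \<gamma> \<and> path_image \<gamma> \<subseteq> space N \<and>
     0 < curve_length \<gamma> 0 1 \<and> curve_length \<gamma> 0 1 < \<infinity>}"

text \<open>
  The choice of \<open>t\<close> does not matter, since \<open>\<gamma>\<close> is constant wherever its length function is.
\<close>

definition arc_length_param :: "(real \<Rightarrow> 'a::metric_space) \<Rightarrow> real \<Rightarrow> 'a" where
  "arc_length_param \<gamma> \<tau> = \<gamma> (SOME t. t \<in> {0..1} \<and> curve_length \<gamma> 0 t = ennreal \<tau>)"

definition line_integral :: "('a::metric_space \<Rightarrow> ennreal) \<Rightarrow> (real \<Rightarrow> 'a) \<Rightarrow> ennreal" where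
  "line_integral g \<gamma> =
    (\<integral>\<^sup>+\<tau>\<in>{0..enn2real (curve_length \<gamma> 0 1)}. g (arc_length_param \<gamma> \<tau>) \<partial>lborel)"


subsection \<open>Upper gradients and Newtonian spaces\<close>

definition endpoint_diff :: "('a \<Rightarrow> ereal) \<Rightarrow> (real \<Rightarrow> 'a::metric_space) \<Rightarrow> ennreal" where
  "endpoint_diff u \<gamma> =
    (if \<bar>u (pathstart \<gamma>)\<bar> = \<infinity> \<or> \<bar>u (pathfinish \<gamma>)\<bar> = \<infinity> then \<infinity>
     else e2ennreal \<bar>u (pathfinish \<gamma>) - u (pathstart \<gamma>)\<bar>)"

definition upper_gradient ::
    "'a::metric_space measure \<Rightarrow> ('a \<Rightarrow> ereal) \<Rightarrow> ('a \<Rightarrow> ennreal) \<Rightarrow> bool" where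
  "upper_gradient N u g \<longleftrightarrow> g \<in> borel_measurable N \<and>
    (\<forall>\<gamma>\<in>rectifiable_curves N. endpoint_diff u \<gamma> \<le> line_integral g \<gamma>)"

definition p_modulus ::
    "real \<Rightarrow> 'a::metric_space measure \<Rightarrow> (real \<Rightarrow> 'a) set \<Rightarrow> ennreal" where
  "p_modulus p N \<Gamma> =
    (INF \<rho>\<in>{\<rho> \<in> borel_measurable N. \<forall>\<gamma>\<in>\<Gamma>. 1 \<le> line_integral \<rho> \<gamma>}.
      \<integral>\<^sup>+x. ennreal_powr (\<rho> x) p \<partial>N)"

definition weak_upper_gradient ::
    "real \<Rightarrow> 'a::metric_space measure \<Rightarrow> ('a \<Rightarrow> ereal) \<Rightarrow> ('a \<Rightarrow> ennreal) \<Rightarrow> bool" where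
  "weak_upper_gradient p N u g \<longleftrightarrow> g \<in> borel_measurable N \<and>
    p_modulus p N {\<gamma> \<in> rectifiable_curves N. \<not> endpoint_diff u \<gamma> \<le> line_integral g \<gamma>} = 0"

definition minimal_weak_upper_gradient ::
    "real \<Rightarrow> 'a::metric_space measure \<Rightarrow> ('a \<Rightarrow> ereal) \<Rightarrow> ('a \<Rightarrow> ennreal) \<Rightarrow> bool" where
  "minimal_weak_upper_gradient p N u g \<longleftrightarrow>
    weak_upper_gradient p N u g \<and> (\<integral>\<^sup>+x. ennreal_powr (g x) p \<partial>N) < \<infinity> \<and>
    (\<forall>h. weak_upper_gradient p N u h \<and> (\<integral>\<^sup>+x. ennreal_powr (h x) p \<partial>N) < \<infinity> \<longrightarrow>
      (AE x in N. g x \<le> h x))"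

text \<open>The minimal gradient \<open>g\<^sub>u\<close>, unique up to null sets.\<close>

definition min_gradient ::
    "real \<Rightarrow> 'a::metric_space measure \<Rightarrow> ('a \<Rightarrow> ereal) \<Rightarrow> 'a \<Rightarrow> ennreal" where
  "min_gradient p N u = (SOME g. minimal_weak_upper_gradient p N u g)"

definition newtonian :: "real \<Rightarrow> 'a::metric_space measure \<Rightarrow> ('a \<Rightarrow> ereal) set" where
  "newtonian p N = {u \<in> borel_measurable (completion N).
     (\<integral>\<^sup>+x. ennreal_powr (e2ennreal \<bar>u x\<bar>) p \<partial>completion N) < \<infinity> \<and>
     (\<exists>g. upper_gradient N u g \<and> (\<integral>\<^sup>+x. ennreal_powr (g x) p \<partial>N) < \<infinity>)}"

text \<open>
  Elements of \<open>N\<^sup>1\<^sup>,\<^sup>p\<close> are finite almost everywhere, so \<^const>\<open>real_of_ereal\<close> changes them on a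
  null set only.
\<close>

definition newtonian_mean_zero :: "real \<Rightarrow> 'a::metric_space measure \<Rightarrow> ('a \<Rightarrow> ereal) set" where
  "newtonian_mean_zero p N =
    {u \<in> newtonian p N. (LINT x|completion N. real_of_ereal (u x)) = 0}"


subsection \<open>Doubling and the Poincare inequality\<close>

definition doubling_measure :: "'a::metric_space measure \<Rightarrow> bool" where
  "doubling_measure M \<longleftrightarrow> (\<exists>C::real. \<forall>z. \<forall>r>0.
     0 < emeasure M (ball z (2 * r)) \<and>
     emeasure M (ball z (2 * r)) \<le> ennreal C * emeasure M (ball z r) \<and>
     ennreal C * emeasure M (ball z r) < \<infinity>)"

definition lower_mass_bound :: "real \<Rightarrow> 'a::metric_space measure \<Rightarrow> bool" where
  "lower_mass_bound s M \<longleftrightarrow> (\<exists>C::real. C > 0 \<and> (\<forall>r R y. \<forall>x\<in>ball y R. 0 < r \<and> r \<le> R \<longrightarrow>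
     measure M (ball x r) / measure M (ball y R) \<ge> C * (r / R) powr s))"

definition mean_deviation ::
    "'a measure \<Rightarrow> 'a set \<Rightarrow> ('a \<Rightarrow> ereal) \<Rightarrow> real \<Rightarrow> ennreal" where
  "mean_deviation N A u c =
    (\<integral>\<^sup>+x\<in>A. e2ennreal \<bar>u x - ereal c\<bar> \<partial>completion N) / emeasure N A"

definition mean_value :: "'a measure \<Rightarrow> 'a set \<Rightarrow> ('a \<Rightarrow> ereal) \<Rightarrow> real" where
  "mean_value N A u = (LINT x:A|completion N. real_of_ereal (u x)) / measure N A"

definition integrable_on_bounded ::
    "'a::metric_space measure \<Rightarrow> ('a \<Rightarrow> ereal) \<Rightarrow> bool" where
  "integrable_on_bounded N u \<longleftrightarrow> u \<in> borel_measurable (completion N) \<and>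
    (\<forall>A\<in>sets N. bounded A \<longrightarrow> (\<integral>\<^sup>+x\<in>A. e2ennreal \<bar>u x\<bar> \<partial>completion N) < \<infinity>)"

definition poincare :: "real \<Rightarrow> real \<Rightarrow> 'a::metric_space measure \<Rightarrow> bool" where
  "poincare p l N \<longleftrightarrow> (\<exists>C>0. \<forall>z\<in>space N. \<forall>r>0. \<forall>u g.
     integrable_on_bounded N u \<and> upper_gradient N u g \<longrightarrow>
     (let B = ball z r \<inter> space N; lB = ball z (l * r) \<inter> space N in
      mean_deviation N B u (mean_value N B u) \<le>
      ennreal (C * r) *
      ennreal_powr ((\<integral>\<^sup>+x\<in>lB. ennreal_powr (g x) p \<partial>N) / emeasure N lB) (1 / p)))"


subsection \<open>Perimeter\<close>

definition perimeter_open :: "'a::metric_space measure \<Rightarrow> 'a set \<Rightarrow> 'a set \<Rightarrow> ennreal" where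
  "perimeter_open M E U =
    (INF u\<in>{u :: nat \<Rightarrow> 'a \<Rightarrow> ereal.
        (\<forall>k. u k \<in> newtonian 1 (restrict_space M U)) \<and>
        (\<lambda>k. \<integral>\<^sup>+x. e2ennreal \<bar>u k x - indicator E x\<bar> \<partial>completion (restrict_space M U))
          \<longlonglongrightarrow> 0}.
      liminf (\<lambda>k. \<integral>\<^sup>+x. min_gradient 1 (restrict_space M U) (u k) x \<partial>restrict_space M U))"

text \<open>
  The extension of the perimeter from open sets to a Borel measure. For a set of finite
  perimeter the set function below is indeed a measure on the Borel sets (Miranda).
\<close>

definition perimeter_measure :: "'a::metric_space measure \<Rightarrow> 'a set \<Rightarrow> 'a measure" where
  "perimeter_measure M E = measure_of UNIV (sets borel)
    (\<lambda>A. INF U\<in>{U. open U \<and> A \<subseteq> U}. perimeter_open M E U)"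


subsection \<open>Trace\<close>

text \<open>Covers are countable, possibly finite.\<close>

definition codim1_content ::
    "'a::metric_space measure \<Rightarrow> real \<Rightarrow> 'a set \<Rightarrow> ennreal" where
  "codim1_content M R A =
    (INF (I, c, r) \<in> {(I :: nat set, c :: nat \<Rightarrow> 'a, r :: nat \<Rightarrow> real).
        (\<forall>i\<in>I. 0 < r i \<and> r i \<le> R) \<and> A \<subseteq> (\<Union>i\<in>I. ball (c i) (r i))}.
      \<Sum>\<^sub>\<infinity>i\<in>I. emeasure M (ball (c i) (r i)) / ennreal (r i))"

definition codim1_hausdorff :: "'a::metric_space measure \<Rightarrow> 'a set \<Rightarrow> ennreal" where
  "codim1_hausdorff M A = (SUP R\<in>{0<..}. codim1_content M R A)"

definition is_trace ::
    "'a::metric_space measure \<Rightarrow> 'a set \<Rightarrow> ('a \<Rightarrow> ereal) \<Rightarrow> ('a \<Rightarrow> real) \<Rightarrow> bool" where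
  "is_trace M \<Omega> u \<tau> \<longleftrightarrow>
    codim1_hausdorff M {x \<in> frontier \<Omega>.
      \<not> ((\<lambda>r. mean_deviation (restrict_space M \<Omega>) (ball x r \<inter> \<Omega>) u (\<tau> x)) \<longlongrightarrow> 0)
          (at_right 0)} = 0"

text \<open>
  The trace is determined up to a null set of the codimension 1 Hausdorff measure.
\<close>

definition trace_op ::
    "'a::metric_space measure \<Rightarrow> 'a set \<Rightarrow> ('a \<Rightarrow> ereal) \<Rightarrow> 'a \<Rightarrow> real" where
  "trace_op M \<Omega> u = (SOME \<tau>. is_trace M \<Omega> u \<tau>)"


subsection \<open>The domain and the functional\<close>

definition admissible_domain :: "real \<Rightarrow> 'a::metric_space measure \<Rightarrow> 'a set \<Rightarrow> bool" where
  "admissible_domain p M \<Omega> \<longleftrightarrow>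
    open \<Omega> \<and> connected \<Omega> \<and> \<Omega> \<noteq> {} \<and> bounded \<Omega> \<and>
    perimeter_open M \<Omega> UNIV < \<infinity> \<and>
    emeasure M (- \<Omega>) > 0 \<and>
    (\<exists>C::real. C \<ge> 1 \<and> (\<forall>r. 0 < r \<and> r \<le> diameter \<Omega> \<longrightarrow>
      (\<forall>z\<in>\<Omega>. emeasure M (ball z r \<inter> \<Omega>) \<ge> ennreal (1 / C) * emeasure M (ball z r)) \<and>
      (\<forall>x\<in>frontier \<Omega>.
        ennreal (1 / C) * (emeasure M (ball x r) / ennreal r)
          \<le> emeasure (perimeter_measure M \<Omega>) (ball x r) \<and>
        emeasure (perimeter_measure M \<Omega>) (ball x r)
          \<le> ennreal C * (emeasure M (ball x r) / ennreal r)))) \<and>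
    poincare p 1 (restrict_space M \<Omega>)"

text \<open>
  Values in \<^typ>\<open>ereal\<close>, so that the infimum of the functional exists unconditionally.
\<close>

definition neumann_functional ::
    "real \<Rightarrow> 'a::metric_space measure \<Rightarrow> 'a set \<Rightarrow> ('a \<Rightarrow> real) \<Rightarrow> ('a \<Rightarrow> ereal) \<Rightarrow> ereal" where
  "neumann_functional p M \<Omega> f v =
    enn2ereal (\<integral>\<^sup>+x. ennreal_powr (min_gradient p (restrict_space M \<Omega>) v x) p
      \<partial>restrict_space M \<Omega>) +
    ereal (LINT x:frontier \<Omega>|completion (perimeter_measure M \<Omega>). trace_op M \<Omega> v x * f x)"

end

theory Submission
  imports Defs "HOL-Library.Diagonal_Subsequence"
begin

text \<open>
  The direct method, with compactness in place of weak convergence. Comparing averages over dyadic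
  balls, the Poincare inequality on \<open>\<Omega>\<close> bounds the oscillation of \<open>v\<close> at scale \<open>r\<close> by the integral of
  \<open>g\<^sup>p\<close> over a ball, and these bounds can be summed against any measure whose balls of radius \<open>r\<close>
  have at most \<open>r\<^sup>-\<^sup>1\<close> times their \<open>\<mu>\<close>-mass, because \<open>p > 1\<close>. This gives at once the existence of traces,
  the compactness of bounded sets of \<open>N\<^sup>1\<^sup>,\<^sup>p(\<Omega>)\<close> in \<open>L\<^sup>1\<close>, the continuity of the boundary term along such
  sets with respect to \<open>L\<^sup>1\<close> convergence, and \<open>v \<in> L\<^sup>p\<close>. In particular the functional is bounded below.
  For a minimizing sequence, uniform convexity of \<open>L\<^sup>p\<close> makes the upper gradients \<open>g\<^sub>n\<close> converge in norm.
  Along a fast subsequence \<open>G\<^sub>k = g\<^sub>k + (g\<^sub>k\<^sub>+\<^sub>1 - g\<^sub>k)\<^sup>+ + \<dots>\<close> is a common upper gradient of all later functions,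
  hence a weak upper gradient of their limit, and its norm is asymptotically that of \<open>g\<^sub>k\<close>.

  The minimal weak upper gradient exists because the minimum of two weak upper gradients is one again,
  so that a minimizing sequence for the norm can be taken decreasing.
\<close>

subsection \<open>Length of curves\<close>

text \<open>The minimal gradient and the trace enter the functional through choice operators, so the
  existence of both, and the uniqueness of the trace up to perimeter null sets, has to precede every
  estimate. Limits are delicate because upper gradients see the value at each point of a curve: they
  are taken as everywhere defined limits superior, and an exceptional family of curves is described
  by one function in L^p whose line integrals over it are infinite.

  The Poincare inequality bounds an oscillation by r * a^(1/p), where a is an average of g^p, and
  the boundary measure loses a factor r against \<mu>. Replacing this by r^(1+\<alpha>) * a +
  r^(1/2) with \<alpha> = (p-1)/2 makes the bound linear in g^p, so that bounded overlap of balls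
  applies, and leaves positive powers of r after the loss.

  Gradients depend on functions only sublinearly, so a weak limit of gradients is not directly a
  gradient of the limit. The boundary term is linear: it drops out when two almost minimizers are
  compared with their midpoint, and only the convexity of the p-th power remains.\<close>

lemma mono_min_const: "mono t \<Longrightarrow> mono (\<lambda>i. min (t i) (c::'a::linorder))"
  and mono_max_const: "mono t \<Longrightarrow> mono (\<lambda>i. max (t i) (c::'a::linorder))"
  by (auto intro!: monoI intro: min.mono max.mono dest: monoD)

lemma curve_length_sum_le:
  fixes t :: "nat \<Rightarrow> real"
  assumes "mono t" "range t \<subseteq> {a..b}"
  shows "ennreal (\<Sum>i<n. dist (\<gamma> (t i)) (\<gamma> (t (Suc i)))) \<le> curve_length \<gamma> a b"
  unfolding curve_length_def using assms by (intro SUP_upper2[where i="(n, t)"]) auto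

lemma curve_length_least:
  assumes "\<And>n t. mono t \<Longrightarrow> range t \<subseteq> {a..b} \<Longrightarrow>
    ennreal (\<Sum>i<n. dist (\<gamma> (t i)) (\<gamma> (t (Suc i)))) \<le> K"
  shows "curve_length \<gamma> a b \<le> K"
  unfolding curve_length_def using assms by (intro SUP_least) auto

lemma dist_le_curve_length:
  assumes "a \<le> b"
  shows "ennreal (dist (\<gamma> a) (\<gamma> b)) \<le> curve_length \<gamma> a b"
proof -
  have "mono (\<lambda>i::nat. if i = 0 then a else b)" using assms by (auto simp: mono_def)
  from curve_length_sum_le[OF this, of a b \<gamma> 1] assms show ?thesis by (auto simp: image_subset_iff)
qed

lemma curve_length_refl [simp]: "curve_length \<gamma> a a = 0"
proof -
  have "curve_length \<gamma> a a \<le> 0"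
  proof (rule curve_length_least)
    fix n and t :: "nat \<Rightarrow> real" assume "range t \<subseteq> {a..a}"
    then have "t i = a" for i by (auto simp: image_subset_iff)
    then show "ennreal (\<Sum>i<n. dist (\<gamma> (t i)) (\<gamma> (t (Suc i)))) \<le> 0" by simp
  qed
  then show ?thesis by simp
qed

text \<open>Clamping both points to the two sides of \<open>b\<close> replaces the insertion of
  \<open>b\<close> into a partition: if both lie on one side, one summand is zero, and otherwise
  this is the triangle inequality at \<open>b\<close>.\<close>

lemma dist_split_le:
  fixes s t b :: real
  assumes "s \<le> t"
  shows "dist (\<gamma> s) (\<gamma> t) \<le> dist (\<gamma> (min s b)) (\<gamma> (min t b)) + dist (\<gamma> (max s b)) (\<gamma> (max t b))"
  using assms by (cases "t \<le> b"; cases "b \<le> s") (auto simp: min_def max_def dist_triangle)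

lemma curve_length_add_le:
  assumes "a \<le> b" "b \<le> c"
  shows "curve_length \<gamma> a c \<le> curve_length \<gamma> a b + curve_length \<gamma> b c"
proof (rule curve_length_least)
  fix n and t :: "nat \<Rightarrow> real"
  assume t: "mono t" "range t \<subseteq> {a..c}"
  let ?f = "\<lambda>i. dist (\<gamma> (min (t i) b)) (\<gamma> (min (t (Suc i)) b))"
  let ?g = "\<lambda>i. dist (\<gamma> (max (t i) b)) (\<gamma> (max (t (Suc i)) b))"
  have "(\<Sum>i<n. dist (\<gamma> (t i)) (\<gamma> (t (Suc i)))) \<le> (\<Sum>i<n. ?f i) + (\<Sum>i<n. ?g i)"
    unfolding sum.distrib[symmetric]
    by (intro sum_mono dist_split_le monoD[OF t(1)]) auto
  then have "ennreal (\<Sum>i<n. dist (\<gamma> (t i)) (\<gamma> (t (Suc i)))) \<le> ennreal (\<Sum>i<n. ?f i) + ennreal (\<Sum>i<n. ?g i)"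
    by (simp add: sum_nonneg flip: ennreal_plus)
  also have "\<dots> \<le> curve_length \<gamma> a b + curve_length \<gamma> b c"
    using t assms
    by (intro add_mono curve_length_sum_le[of "\<lambda>i. min (t i) b"] curve_length_sum_le[of "\<lambda>i. max (t i) b"]
        mono_min_const mono_max_const) (auto simp: image_subset_iff min_def max_def)
  finally show "ennreal (\<Sum>i<n. dist (\<gamma> (t i)) (\<gamma> (t (Suc i)))) \<le> curve_length \<gamma> a b + curve_length \<gamma> b c" .
qed

lemma curve_length_add_ge:
  assumes "a \<le> b" "b \<le> c"
  shows "curve_length \<gamma> a b + curve_length \<gamma> b c \<le> curve_length \<gamma> a c"
proof -
  have *: "ennreal (\<Sum>i<n. dist (\<gamma> (s i)) (\<gamma> (s (Suc i)))) + ennreal (\<Sum>i<m. dist (\<gamma> (t i)) (\<gamma> (t (Suc i))))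
      \<le> curve_length \<gamma> a c"
    if s: "mono s" "range s \<subseteq> {a..b}" and t: "mono t" "range t \<subseteq> {b..c}" for n m s t
  proof -
    \<comment> \<open>Index \<open>n\<close> carries the last point of \<open>s\<close> and
      \<open>Suc n\<close> the first point of \<open>t\<close>. The edge between them belongs to
      neither given sum and is dropped at the end.\<close>
    define q where "q i = (if i \<le> n then s i else t (i - Suc n))" for i
    have st: "s i \<le> t j" for i j
      using s(2) t(2) by (meson atLeastAtMost_iff order_trans range_subsetD)
    have q: "mono q"
      unfolding q_def using st monoD[OF s(1)] monoD[OF t(1)] by (auto intro!: monoI)
    have qr: "range q \<subseteq> {a..c}"
    proof -
      have "a \<le> s i" "s i \<le> b" "b \<le> t i" "t i \<le> c" for i
        using s(2) t(2) by (auto simp: image_subset_iff)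
      moreover from this have "a \<le> t i" "s i \<le> c" for i using assms by (meson order_trans)+
      ultimately show ?thesis by (auto simp: q_def)
    qed
    have "(\<Sum>i<n. dist (\<gamma> (s i)) (\<gamma> (s (Suc i)))) = (\<Sum>i<n. dist (\<gamma> (q i)) (\<gamma> (q (Suc i))))"
      by (intro sum.cong) (auto simp: q_def)
    moreover have "(\<Sum>i<m. dist (\<gamma> (t i)) (\<gamma> (t (Suc i)))) =
        (\<Sum>i\<in>{Suc n..<Suc n + m}. dist (\<gamma> (q i)) (\<gamma> (q (Suc i))))"
      by (rule sum.reindex_bij_witness[where i="\<lambda>i. i - Suc n" and j="\<lambda>i. i + Suc n"])
        (auto simp: q_def)
    moreover have "(\<Sum>i<n. dist (\<gamma> (q i)) (\<gamma> (q (Suc i)))) + (\<Sum>i\<in>{Suc n..<Suc n + m}. dist (\<gamma> (q i)) (\<gamma> (q (Suc i))))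
       \<le> (\<Sum>i<Suc n + m. dist (\<gamma> (q i)) (\<gamma> (q (Suc i))))"
      by (subst sum.union_disjoint[symmetric]) (auto simp del: sum.lessThan_Suc add_Suc intro!: sum_mono2)
    ultimately have "ennreal (\<Sum>i<n. dist (\<gamma> (s i)) (\<gamma> (s (Suc i)))) + ennreal (\<Sum>i<m. dist (\<gamma> (t i)) (\<gamma> (t (Suc i))))
       \<le> ennreal (\<Sum>i<Suc n + m. dist (\<gamma> (q i)) (\<gamma> (q (Suc i))))"
      by (simp add: sum_nonneg flip: ennreal_plus)
    also have "\<dots> \<le> curve_length \<gamma> a c" by (rule curve_length_sum_le[OF q qr])
    finally show ?thesis .
  qed
  let ?P = "{(n::nat, t::nat \<Rightarrow> real). mono t \<and> range t \<subseteq> {a..b}}"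
  let ?Q = "{(n::nat, t::nat \<Rightarrow> real). mono t \<and> range t \<subseteq> {b..c}}"
  have ne: "(0, \<lambda>_. a) \<in> ?P" "(0, \<lambda>_. b) \<in> ?Q" using assms by (auto simp: mono_def)
  then have Pne: "?P \<noteq> {}" "?Q \<noteq> {}" by (metis empty_iff)+
  let ?F = "\<lambda>(n, t). ennreal (\<Sum>i<n. dist (\<gamma> (t i)) (\<gamma> (t (Suc i))))"
  have "curve_length \<gamma> a b + curve_length \<gamma> b c = (SUP x\<in>?P. ?F x + curve_length \<gamma> b c)"
    unfolding curve_length_def[of \<gamma> a b]
    by (rule ennreal_SUP_add_left[OF Pne(1), symmetric])
  also have "\<dots> = (SUP x\<in>?P. SUP y\<in>?Q. ?F x + ?F y)"
    unfolding curve_length_def[of \<gamma> b c]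
    by (intro SUP_cong refl ennreal_SUP_add_right[OF Pne(2)])
  also have "\<dots> \<le> curve_length \<gamma> a c"
    using * by (intro SUP_least) auto
  finally show ?thesis .
qed

lemma curve_length_add:
  assumes "a \<le> b" "b \<le> c"
  shows "curve_length \<gamma> a c = curve_length \<gamma> a b + curve_length \<gamma> b c"
  using curve_length_add_le[OF assms] curve_length_add_ge[OF assms] by (rule antisym)

text \<open>For a fixed partition the sum with all points capped at \<open>s\<close> is continuous
  in \<open>s\<close> and, for \<open>s < b\<close>, bounded by the length up to \<open>s\<close>.
  This and its mirror image serve to exclude jumps of the length function.\<close>

lemma curve_length_lsc_left:
  assumes "continuous_on {a..b} \<gamma>" "a < b" "\<And>t. a \<le> t \<Longrightarrow> t < b \<Longrightarrow> curve_length \<gamma> a t \<le> K"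
  shows "curve_length \<gamma> a b \<le> K"
proof (rule curve_length_least)
  fix n and t :: "nat \<Rightarrow> real"
  assume t: "mono t" "range t \<subseteq> {a..b}"
  have tr: "a \<le> t i" "t i \<le> b" for i using t(2) by (auto simp: image_subset_iff)
  let ?S = "\<lambda>s. ennreal (\<Sum>i<n. dist (\<gamma> (min (t i) s)) (\<gamma> (min (t (Suc i)) s)))"
  have "continuous_on {a..b} (\<lambda>s. \<Sum>i<n. dist (\<gamma> (min (t i) s)) (\<gamma> (min (t (Suc i)) s)))"
    by (intro continuous_intros continuous_on_compose2[OF assms(1)]) (auto simp: tr min_def)
  then have "((\<lambda>s. \<Sum>i<n. dist (\<gamma> (min (t i) s)) (\<gamma> (min (t (Suc i)) s))) \<longlongrightarrow>
      (\<Sum>i<n. dist (\<gamma> (min (t i) b)) (\<gamma> (min (t (Suc i)) b)))) (at b within {a..b})"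
    using assms(2) by (auto simp: continuous_on_def)
  then have lim: "(?S \<longlongrightarrow> ?S b) (at_left b)"
    using assms(2) by (intro tendsto_ennrealI) (simp add: at_within_Icc_at_left)
  have ev: "\<forall>\<^sub>F s in at_left b. ?S s \<le> K"
    using eventually_at_left_real[OF assms(2)]
  proof (rule eventually_mono)
    fix s assume "s \<in> {a<..<b}"
    then have "?S s \<le> curve_length \<gamma> a s"
      using tr t(1) \<open>s \<in> {a<..<b}\<close>
      by (intro curve_length_sum_le mono_min_const) (auto simp: image_subset_iff min_def)
    also have "\<dots> \<le> K" using \<open>s \<in> {a<..<b}\<close> by (intro assms(3)) auto
    finally show "?S s \<le> K" .
  qed
  have "?S b \<le> K" by (rule tendsto_upperbound[OF lim ev]) simp
  then show "ennreal (\<Sum>i<n. dist (\<gamma> (t i)) (\<gamma> (t (Suc i)))) \<le> K"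
    using tr by (simp add: min_def)
qed

lemma curve_length_lsc_right:
  assumes "continuous_on {a..b} \<gamma>" "a < b" "\<And>t. a < t \<Longrightarrow> t \<le> b \<Longrightarrow> curve_length \<gamma> t b \<le> K"
  shows "curve_length \<gamma> a b \<le> K"
proof (rule curve_length_least)
  fix n and t :: "nat \<Rightarrow> real"
  assume t: "mono t" "range t \<subseteq> {a..b}"
  have tr: "a \<le> t i" "t i \<le> b" for i using t(2) by (auto simp: image_subset_iff)
  let ?S = "\<lambda>s. ennreal (\<Sum>i<n. dist (\<gamma> (max (t i) s)) (\<gamma> (max (t (Suc i)) s)))"
  have "continuous_on {a..b} (\<lambda>s. \<Sum>i<n. dist (\<gamma> (max (t i) s)) (\<gamma> (max (t (Suc i)) s)))"
    by (intro continuous_intros continuous_on_compose2[OF assms(1)]) (auto simp: tr max_def)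
  then have "((\<lambda>s. \<Sum>i<n. dist (\<gamma> (max (t i) s)) (\<gamma> (max (t (Suc i)) s))) \<longlongrightarrow>
      (\<Sum>i<n. dist (\<gamma> (max (t i) a)) (\<gamma> (max (t (Suc i)) a)))) (at a within {a..b})"
    using assms(2) by (auto simp: continuous_on_def)
  then have lim: "(?S \<longlongrightarrow> ?S a) (at_right a)"
    using assms(2) by (intro tendsto_ennrealI) (simp add: at_within_Icc_at_right)
  have ev: "\<forall>\<^sub>F s in at_right a. ?S s \<le> K"
    using eventually_at_right_real[OF assms(2)]
  proof (rule eventually_mono)
    fix s assume "s \<in> {a<..<b}"
    then have "?S s \<le> curve_length \<gamma> s b"
      using tr t(1) \<open>s \<in> {a<..<b}\<close>
      by (intro curve_length_sum_le mono_max_const) (auto simp: image_subset_iff max_def)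
    also have "\<dots> \<le> K" using \<open>s \<in> {a<..<b}\<close> by (intro assms(3)) auto
    finally show "?S s \<le> K" .
  qed
  have "?S a \<le> K" by (rule tendsto_upperbound[OF lim ev]) simp
  then show "ennreal (\<Sum>i<n. dist (\<gamma> (t i)) (\<gamma> (t (Suc i)))) \<le> K"
    using tr by (simp add: max_absorb1)
qed

lemma curve_length_comp_le:
  assumes "mono \<phi>"
  shows "curve_length (\<gamma> \<circ> \<phi>) a b \<le> curve_length \<gamma> (\<phi> a) (\<phi> b)"
proof (rule curve_length_least)
  fix n and t :: "nat \<Rightarrow> real"
  assume t: "mono t" "range t \<subseteq> {a..b}"
  show "ennreal (\<Sum>i<n. dist ((\<gamma> \<circ> \<phi>) (t i)) ((\<gamma> \<circ> \<phi>) (t (Suc i)))) \<le> curve_length \<gamma> (\<phi> a) (\<phi> b)"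
    using t assms curve_length_sum_le[of "\<phi> \<circ> t" "\<phi> a" "\<phi> b" \<gamma> n]
    by (auto simp: mono_def image_subset_iff)
qed

lemma curve_length_rescale:
  assumes "u < v"
  shows "curve_length (\<lambda>x. \<gamma> ((v - u) * x + u)) a b = curve_length \<gamma> ((v - u) * a + u) ((v - u) * b + u)"
proof (rule antisym)
  define \<phi> \<psi> where "\<phi> x = (v - u) * x + u" and "\<psi> x = (x - u) / (v - u)" for x
  have m: "mono \<phi>" "mono \<psi>" using assms by (auto simp: mono_def \<phi>_def \<psi>_def divide_right_mono mult_left_mono)
  have i: "\<phi> (\<psi> x) = x" "\<psi> (\<phi> x) = x" for x using assms by (auto simp: \<phi>_def \<psi>_def)
  have s: "(\<lambda>x. \<gamma> ((v - u) * x + u)) = \<gamma> \<circ> \<phi>" by (auto simp: \<phi>_def)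
  show "curve_length (\<lambda>x. \<gamma> ((v - u) * x + u)) a b \<le> curve_length \<gamma> ((v - u) * a + u) ((v - u) * b + u)"
    using curve_length_comp_le[OF m(1), of \<gamma> a b] by (simp add: s \<phi>_def)
  have "curve_length ((\<gamma> \<circ> \<phi>) \<circ> \<psi>) (\<phi> a) (\<phi> b) \<le> curve_length (\<gamma> \<circ> \<phi>) (\<psi> (\<phi> a)) (\<psi> (\<phi> b))"
    by (rule curve_length_comp_le[OF m(2)])
  moreover have "(\<gamma> \<circ> \<phi>) \<circ> \<psi> = \<gamma>" using i by auto
  ultimately show "curve_length \<gamma> ((v - u) * a + u) ((v - u) * b + u) \<le> curve_length (\<lambda>x. \<gamma> ((v - u) * x + u)) a b"
    by (simp add: s i) (simp add: \<phi>_def)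
qed

section \<open>Arc length parametrization\<close>

definition arc_length :: "(real \<Rightarrow> 'a::metric_space) \<Rightarrow> real" where
  "arc_length \<gamma> = enn2real (curve_length \<gamma> 0 1)"

context
  fixes \<gamma> :: "real \<Rightarrow> 'a::metric_space" and N
  assumes rect: "\<gamma> \<in> rectifiable_curves N"
begin

lemma rectifiable_continuous: "continuous_on {0..1} \<gamma>"
  using rect by (auto simp: rectifiable_curves_def path_def)

lemma arc_length_pos: "0 < arc_length \<gamma>"
  using rect by (auto simp: rectifiable_curves_def arc_length_def enn2real_positive_iff)

lemma ennreal_arc_length: "ennreal (arc_length \<gamma>) = curve_length \<gamma> 0 1"
  using rect by (auto simp: rectifiable_curves_def arc_length_def)

lemma curve_length_sub_finite:
  assumes "0 \<le> a" "a \<le> b" "b \<le> 1"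
  shows "curve_length \<gamma> a b < \<infinity>"
proof -
  have "curve_length \<gamma> a b \<le> curve_length \<gamma> 0 1"
    using curve_length_add[of 0 a 1 \<gamma>] curve_length_add[of a b 1 \<gamma>] assms
    by (simp add: add_increasing add_increasing2)
  also have "\<dots> < \<infinity>" using rect by (auto simp: rectifiable_curves_def)
  finally show ?thesis .
qed

lemma curve_length_real:
  assumes "0 \<le> a" "a \<le> b" "b \<le> 1"
  shows "curve_length \<gamma> a b = ennreal (enn2real (curve_length \<gamma> 0 b) - enn2real (curve_length \<gamma> 0 a))"
proof -
  have "curve_length \<gamma> 0 b = curve_length \<gamma> 0 a + curve_length \<gamma> a b"
    using assms by (intro curve_length_add) auto
  moreover obtain x y where "curve_length \<gamma> 0 a = ennreal x" "curve_length \<gamma> a b = ennreal y" "0 \<le> x" "0 \<le> y"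
    using curve_length_sub_finite[of 0 a] curve_length_sub_finite[of a b] assms
    by (cases "curve_length \<gamma> 0 a"; cases "curve_length \<gamma> a b") auto
  ultimately show ?thesis by (simp flip: ennreal_plus)
qed

text \<open>An intermediate value argument that does not need continuity of the length function: at
  the supremum \<open>m\<close> of the points of length at most \<open>\<tau>\<close>,
  semicontinuity from the left gives \<open>L m \<le> \<tau>\<close>, and semicontinuity from the
  right of the remaining length gives the reverse.\<close>

lemma arc_length_attained:
  assumes "0 \<le> \<tau>" "\<tau> \<le> arc_length \<gamma>"
  shows "\<exists>t\<in>{0..1}. curve_length \<gamma> 0 t = ennreal \<tau>"
proof -
  define L where "L t = enn2real (curve_length \<gamma> 0 t)" for t
  have L: "curve_length \<gamma> a b = ennreal (L b - L a)" if "0 \<le> a" "a \<le> b" "b \<le> 1" for a b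
    using curve_length_real[OF that] by (simp add: L_def)
  have L0: "L 0 = 0" by (simp add: L_def)
  have L1: "L 1 = arc_length \<gamma>" by (simp add: L_def arc_length_def)
  have Lm: "L a \<le> L b" if "0 \<le> a" "a \<le> b" "b \<le> 1" for a b
    unfolding L_def using that curve_length_add[of 0 a b \<gamma>] curve_length_sub_finite[of 0 b]
    by (intro enn2real_mono) auto
  define S where "S = {t\<in>{0..1}. L t \<le> \<tau>}"
  have S0: "0 \<in> S" using assms L0 by (auto simp: S_def)
  have bdd: "bdd_above S" by (auto simp: S_def bdd_above_def)
  define m where "m = Sup S"
  have m: "0 \<le> m" "m \<le> 1"
    unfolding m_def using S0 bdd by (auto intro!: cSup_upper cSup_least simp: S_def)
  have low: "L t \<le> \<tau>" if t: "0 \<le> t" "t < m" for t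
  proof -
    obtain t' where "t' \<in> S" "t < t'" using less_cSupE[of t S] t S0 unfolding m_def by blast
    then show ?thesis using Lm[of t t'] that by (auto simp: S_def)
  qed
  have high: "\<tau> < L t" if "m < t" "t \<le> 1" for t
  proof (rule ccontr)
    assume "\<not> \<tau> < L t"
    then have "t \<in> S" using that m by (auto simp: S_def)
    then show False using cSup_upper[OF _ bdd, of t] that by (auto simp: m_def)
  qed
  have "L m \<le> \<tau>"
  proof (cases "m = 0")
    case False
    have "curve_length \<gamma> 0 m \<le> ennreal \<tau>"
    proof (rule curve_length_lsc_left)
      show "continuous_on {0..m} \<gamma>" using m by (intro continuous_on_subset[OF rectifiable_continuous]) auto
      show "curve_length \<gamma> 0 t \<le> ennreal \<tau>" if "0 \<le> t" "t < m" for t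
        using L[of 0 t] low[OF that] that m L0 by (simp add: ennreal_leI)
    qed (use False m in auto)
    then show ?thesis using L[of 0 m] m L0 assms by simp
  qed (use assms L0 in auto)
  moreover have "\<tau> \<le> L m"
  proof (cases "m = 1")
    case False
    have "curve_length \<gamma> m 1 \<le> ennreal (L 1 - \<tau>)"
    proof (rule curve_length_lsc_right)
      show "continuous_on {m..1} \<gamma>" using m by (intro continuous_on_subset[OF rectifiable_continuous]) auto
      show "curve_length \<gamma> t 1 \<le> ennreal (L 1 - \<tau>)" if "m < t" "t \<le> 1" for t
        using L[of t 1] high[OF that] that m by (simp add: ennreal_leI)
    qed (use False m in auto)
    then show ?thesis using L[of m 1] m assms L1 by simp
  qed (use assms L1 in auto)
  ultimately have "curve_length \<gamma> 0 m = ennreal \<tau>" using L[of 0 m] m L0 by simp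
  then show ?thesis using m by auto
qed

lemma arc_length_param_eq:
  assumes "t \<in> {0..1}" "curve_length \<gamma> 0 t = ennreal \<tau>"
  shows "arc_length_param \<gamma> \<tau> = \<gamma> t"
proof -
  define t' where "t' = (SOME t. t \<in> {0..1} \<and> curve_length \<gamma> 0 t = ennreal \<tau>)"
  have t': "t' \<in> {0..1}" "curve_length \<gamma> 0 t' = ennreal \<tau>"
    using someI[of "\<lambda>t. t \<in> {0..1} \<and> curve_length \<gamma> 0 t = ennreal \<tau>" t] assms by (auto simp: t'_def)
  have *: "\<gamma> a = \<gamma> b" if "a \<le> b" "a \<in> {0..1}" "b \<in> {0..1}"
    "curve_length \<gamma> 0 a = ennreal \<tau>" "curve_length \<gamma> 0 b = ennreal \<tau>" for a b
  proof -
    have "ennreal (dist (\<gamma> a) (\<gamma> b)) \<le> 0"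
      using dist_le_curve_length[of a b \<gamma>] curve_length_real[of a b] that by simp
    then show ?thesis by simp
  qed
  show ?thesis
    unfolding arc_length_param_def t'_def[symmetric]
    using *[of t t'] *[of t' t] t' assms linear[of t t'] by metis
qed

lemma arc_length_param_0: "arc_length_param \<gamma> 0 = pathstart \<gamma>"
  using arc_length_param_eq[of 0 0] by (simp add: pathstart_def)

lemma arc_length_param_arc_length: "arc_length_param \<gamma> (arc_length \<gamma>) = pathfinish \<gamma>"
  using arc_length_param_eq[of 1] ennreal_arc_length by (simp add: pathfinish_def)

lemma arc_length_param_in_space:
  assumes "0 \<le> \<tau>" "\<tau> \<le> arc_length \<gamma>"
  shows "arc_length_param \<gamma> \<tau> \<in> space N"
proof -
  obtain t where "t \<in> {0..1}" "curve_length \<gamma> 0 t = ennreal \<tau>"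
    using arc_length_attained[OF assms] by auto
  then show ?thesis
    using rect arc_length_param_eq[of t \<tau>] unfolding rectifiable_curves_def path_image_def by blast
qed

lemma arc_length_param_lipschitz:
  assumes "0 \<le> \<sigma>" "\<sigma> \<le> \<tau>" "\<tau> \<le> arc_length \<gamma>"
  shows "dist (arc_length_param \<gamma> \<sigma>) (arc_length_param \<gamma> \<tau>) \<le> \<tau> - \<sigma>"
proof (cases "\<sigma> = \<tau>")
  case False
  obtain a b where ab: "a \<in> {0..1}" "curve_length \<gamma> 0 a = ennreal \<sigma>" "b \<in> {0..1}" "curve_length \<gamma> 0 b = ennreal \<tau>"
    using arc_length_attained[of \<sigma>] arc_length_attained[of \<tau>] assms by force
  have "a \<le> b"
  proof (rule ccontr)
    assume "\<not> a \<le> b"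
    then have "ennreal \<tau> \<le> ennreal \<sigma>" using curve_length_add[of 0 b a \<gamma>] ab by auto
    with assms False show False by simp
  qed
  then have "ennreal (dist (\<gamma> a) (\<gamma> b)) \<le> ennreal (\<tau> - \<sigma>)"
    using dist_le_curve_length[of a b \<gamma>] curve_length_real[of a b] ab assms by simp
  then show ?thesis
    using arc_length_param_eq[of a \<sigma>] arc_length_param_eq[of b \<tau>] ab assms by simp
qed auto

lemma arc_length_param_continuous: "continuous_on {0..arc_length \<gamma>} (arc_length_param \<gamma>)"
proof -
  have "dist (arc_length_param \<gamma> x) (arc_length_param \<gamma> y) \<le> 1 * dist x y"
    if "x \<in> {0..arc_length \<gamma>}" "y \<in> {0..arc_length \<gamma>}" for x y
    using that arc_length_param_lipschitz[of x y] arc_length_param_lipschitz[of y x]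
    by (cases "x \<le> y") (auto simp: dist_real_def dist_commute)
  then have "1-lipschitz_on {0..arc_length \<gamma>} (arc_length_param \<gamma>)"
    by (intro lipschitz_onI) auto
  then show ?thesis by (rule lipschitz_on_continuous_on)
qed

lemma arc_length_param_measurable:
  assumes "sets N = sets (restrict_space borel (space N))"
  shows "arc_length_param \<gamma> \<in> measurable (restrict_space lborel {0..arc_length \<gamma>}) N"
proof -
  have "arc_length_param \<gamma> \<in> borel_measurable (restrict_space borel {0..arc_length \<gamma>})"
    by (rule borel_measurable_continuous_on_restrict[OF arc_length_param_continuous])
  then have "arc_length_param \<gamma> \<in> measurable (restrict_space lborel {0..arc_length \<gamma>}) (restrict_space borel (space N))"
    using arc_length_param_in_space
    by (intro measurable_restrict_space2) (auto simp: space_restrict_space measurable_cong_sets sets_restrict_space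
       cong: measurable_cong_sets)
  then show ?thesis using assms by (simp cong: measurable_cong_sets)
qed

lemma line_integral_eq:
  "line_integral g \<gamma> = (\<integral>\<^sup>+\<tau>. g (arc_length_param \<gamma> \<tau>) \<partial>restrict_space lborel {0..arc_length \<gamma>})"
  unfolding line_integral_def arc_length_def by (subst nn_integral_restrict_space) auto

end

text \<open>Gradient inequalities have to be localised to subarcs. Rescaling \<open>\<gamma>\<close>
  between two parameters of arc length \<open>\<sigma>\<close> and \<open>\<tau>\<close> gives a
  curve whose own arc length parameter is shifted by \<open>\<sigma>\<close>, so its line integrals
  become integrals over \<open>{\<sigma>..\<tau>}\<close>.\<close>

lemma rectifiable_subcurve:
  fixes \<gamma> :: "real \<Rightarrow> 'a::metric_space"
  assumes rect: "\<gamma> \<in> rectifiable_curves N" and "0 \<le> \<sigma>" "\<sigma> < \<tau>" "\<tau> \<le> arc_length \<gamma>" and N: "sets N = sets (restrict_space borel (space N))"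
  obtains \<gamma>' where "\<gamma>' \<in> rectifiable_curves N" "pathstart \<gamma>' = arc_length_param \<gamma> \<sigma>"
    "pathfinish \<gamma>' = arc_length_param \<gamma> \<tau>"
    "\<And>g. g \<in> borel_measurable N \<Longrightarrow> line_integral g \<gamma>' = (\<integral>\<^sup>+x\<in>{\<sigma>..\<tau>}. g (arc_length_param \<gamma> x) \<partial>lborel)"
proof -
  obtain a b where ab: "a \<in> {0..1}" "curve_length \<gamma> 0 a = ennreal \<sigma>" "b \<in> {0..1}" "curve_length \<gamma> 0 b = ennreal \<tau>"
    using arc_length_attained[OF rect, of \<sigma>] arc_length_attained[OF rect, of \<tau>] assms by force
  have "a < b"
  proof (rule ccontr)
    assume "\<not> a < b"
    then have "ennreal \<tau> \<le> ennreal \<sigma>" using curve_length_add[of 0 b a \<gamma>] ab by auto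
    with assms show False by simp
  qed
  define \<gamma>' where "\<gamma>' = (\<lambda>x. \<gamma> ((b - a) * x + a))"
  have len: "curve_length \<gamma>' 0 t = curve_length \<gamma> a ((b - a) * t + a)" for t
    unfolding \<gamma>'_def using curve_length_rescale[OF \<open>a < b\<close>, of \<gamma> 0 t] by simp
  have len1: "curve_length \<gamma>' 0 1 = ennreal (\<tau> - \<sigma>)"
    using len[of 1] curve_length_real[OF rect, of a b] ab \<open>a < b\<close> assms by simp
  then have al: "arc_length \<gamma>' = \<tau> - \<sigma>" using assms by (simp add: arc_length_def)
  have bd: "0 \<le> (b - a) * t + a" "(b - a) * t + a \<le> 1" "a \<le> (b - a) * t + a" if "0 \<le> t" "t \<le> 1" for t
  proof -
    show "a \<le> (b - a) * t + a" using \<open>a < b\<close> that by simp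
    with ab show "0 \<le> (b - a) * t + a" by (auto intro: order_trans)
    have "(b - a) * t \<le> (b - a) * 1" using that \<open>a < b\<close> by (intro mult_left_mono) auto
    then show "(b - a) * t + a \<le> 1" using ab by simp
  qed
  have cont: "continuous_on {0..1} \<gamma>'"
    unfolding \<gamma>'_def using bd
    by (intro continuous_on_compose2[OF rectifiable_continuous[OF rect]] continuous_intros) auto
  have "\<gamma>' ` {0..1} \<subseteq> \<gamma> ` {0..1}" using bd by (auto simp: \<gamma>'_def)
  then have rect': "\<gamma>' \<in> rectifiable_curves N"
    using rect cont len1 assms unfolding rectifiable_curves_def path_def path_image_def by auto
  have par: "arc_length_param \<gamma>' x = arc_length_param \<gamma> (\<sigma> + x)" if x: "0 \<le> x" "x \<le> \<tau> - \<sigma>" for x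
  proof -
    obtain t where t: "t \<in> {0..1}" "curve_length \<gamma>' 0 t = ennreal x"
      using x al arc_length_attained[OF rect', of x] by auto
    let ?s = "(b - a) * t + a"
    have "curve_length \<gamma> 0 ?s = curve_length \<gamma> 0 a + curve_length \<gamma> a ?s"
      using bd[of t] t ab by (intro curve_length_add) auto
    then have "curve_length \<gamma> 0 ?s = ennreal (\<sigma> + x)"
      using t len[of t] ab assms that by simp
    then have "arc_length_param \<gamma> (\<sigma> + x) = \<gamma> ?s"
      using bd[of t] t by (intro arc_length_param_eq[OF rect]) auto
    moreover have "arc_length_param \<gamma>' x = \<gamma>' t"
      by (rule arc_length_param_eq[OF rect' t])
    ultimately show ?thesis by (simp add: \<gamma>'_def)
  qed
  show ?thesis
  proof (rule that[OF rect'])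
    show "pathstart \<gamma>' = arc_length_param \<gamma> \<sigma>"
      using arc_length_param_eq[OF rect ab(1,2)] by (simp add: \<gamma>'_def pathstart_def)
    show "pathfinish \<gamma>' = arc_length_param \<gamma> \<tau>"
      using arc_length_param_eq[OF rect ab(3,4)] by (simp add: \<gamma>'_def pathfinish_def)
    fix g :: "'a \<Rightarrow> ennreal" assume g: "g \<in> borel_measurable N"
    have "(\<lambda>x. g (arc_length_param \<gamma> x)) \<in> borel_measurable (restrict_space lborel {0..arc_length \<gamma>})"
      using measurable_compose[OF arc_length_param_measurable[OF rect N] g] .
    then have m0: "(\<lambda>x. g (arc_length_param \<gamma> x) * indicator {0..arc_length \<gamma>} x) \<in> borel_measurable lborel"
      by (subst (asm) borel_measurable_restrict_space_iff_ennreal) auto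
    have "(\<lambda>x. (g (arc_length_param \<gamma> x) * indicator {0..arc_length \<gamma>} x) * indicator {\<sigma>..\<tau>} x) \<in> borel_measurable lborel"
      by (rule borel_measurable_times_ennreal[OF m0]) auto
    also have "(\<lambda>x. (g (arc_length_param \<gamma> x) * indicator {0..arc_length \<gamma>} x) * indicator {\<sigma>..\<tau>} x) =
        (\<lambda>x. g (arc_length_param \<gamma> x) * indicator {\<sigma>..\<tau>} x)"
      using assms by (auto simp: indicator_def fun_eq_iff)
    finally have m: "(\<lambda>x. g (arc_length_param \<gamma> x) * indicator {\<sigma>..\<tau>} x) \<in> borel_measurable lborel" .
    have "line_integral g \<gamma>' = (\<integral>\<^sup>+x\<in>{0..\<tau> - \<sigma>}. g (arc_length_param \<gamma>' x) \<partial>lborel)"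
      unfolding line_integral_def using al by (simp add: arc_length_def)
    also have "\<dots> = (\<integral>\<^sup>+x. g (arc_length_param \<gamma> (\<sigma> + 1 * x)) * indicator {\<sigma>..\<tau>} (\<sigma> + 1 * x) \<partial>lborel)"
      by (intro nn_integral_cong) (auto simp: par indicator_def)
    also have "\<dots> = (\<integral>\<^sup>+x\<in>{\<sigma>..\<tau>}. g (arc_length_param \<gamma> x) \<partial>lborel)"
      using nn_integral_real_affine[of "\<lambda>x. g (arc_length_param \<gamma> x) * indicator {\<sigma>..\<tau>} x" 1 \<sigma>] m
      by simp
    finally show "line_integral g \<gamma>' = (\<integral>\<^sup>+x\<in>{\<sigma>..\<tau>}. g (arc_length_param \<gamma> x) \<partial>lborel)" .
  qed
qed

section \<open>Powers on the extended half line\<close>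

lemma ennreal_powr_ennreal: "0 \<le> a \<Longrightarrow> ennreal_powr (ennreal a) p = ennreal (a powr p)"
  by (simp add: ennreal_powr_def)

lemma ennreal_powr_top [simp]: "ennreal_powr top p = top"
  by (simp add: ennreal_powr_def)

lemma ennreal_powr_0 [simp]: "ennreal_powr 0 p = 0"
  by (simp add: ennreal_powr_def)

lemma ennreal_powr_mono:
  assumes "0 \<le> p" "x \<le> y"
  shows "ennreal_powr x p \<le> ennreal_powr y p"
  using assms by (cases x; cases y) (auto simp: ennreal_powr_ennreal top_unique intro!: ennreal_leI powr_mono2)

lemma ennreal_powr_less_top_iff [simp]: "ennreal_powr x p < top \<longleftrightarrow> x < top"
  by (cases x) (auto simp: ennreal_powr_ennreal)

lemma ennreal_powr_measurable [measurable]: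
  assumes [measurable]: "f \<in> borel_measurable M"
  shows "(\<lambda>x. ennreal_powr (f x) p) \<in> borel_measurable M"
  unfolding ennreal_powr_def by measurable

lemma ennreal_powr_cmult:
  assumes "0 < c"
  shows "ennreal_powr (ennreal c * x) p = ennreal (c powr p) * ennreal_powr x p"
  using assms
  by (cases x) (auto simp: ennreal_powr_ennreal powr_mult ennreal_mult_top simp flip: ennreal_mult)

lemma ennreal_powr_inverse:
  assumes "p \<noteq> 0"
  shows "ennreal_powr (ennreal_powr x p) (1 / p) = x"
  using assms by (cases x) (auto simp: ennreal_powr_ennreal powr_powr)

text \<open>Convexity for \<open>a + b = (1 - t) * (a / (1 - t)) + t * (b / t)\<close>. The free
  \<open>t\<close> lets the factor of \<open>a powr p\<close> come as close to 1 as needed, at the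
  expense of that of \<open>b powr p\<close>.\<close>

lemma powr_add_le:
  fixes a b t p :: real
  assumes "0 \<le> a" "0 \<le> b" "0 < t" "t < 1" "1 \<le> p"
  shows "(a + b) powr p \<le> (1 - t) powr (1 - p) * a powr p + t powr (1 - p) * b powr p"
proof -
  have one: "1 \<le> s powr (1 - p)" if "0 < s" "s < 1" for s
    using that assms(5) powr_mono2'[of "1 - p" s 1] by simp
  consider "a = 0" | "b = 0" | "0 < a" "0 < b" using assms by linarith
  then show ?thesis
  proof cases
    case 1
    then show ?thesis using mult_right_mono[OF one[of t], of "b powr p"] assms by simp
  next
    case 2
    then show ?thesis using mult_right_mono[OF one[of "1 - t"], of "a powr p"] assms by simp
  next
    case 3
    have *: "s * (x / s) powr p = s powr (1 - p) * x powr p" if "0 < s" "0 < x" for s x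
      using that by (simp add: powr_divide powr_diff)
    have "((1 - t) *\<^sub>R (a / (1 - t)) + t *\<^sub>R (b / t)) powr p
        \<le> (1 - t) * (a / (1 - t)) powr p + t * (b / t) powr p"
      using 3 assms by (intro convex_onD[OF powr_convex]) auto
    then show ?thesis using assms 3 *[of t b] *[of "1 - t" a] by simp
  qed
qed

lemma ennreal_powr_add_le:
  assumes "0 < t" "t < 1" "1 \<le> p"
  shows "ennreal_powr (x + y) p \<le>
    ennreal ((1 - t) powr (1 - p)) * ennreal_powr x p + ennreal (t powr (1 - p)) * ennreal_powr y p"
proof (cases "x = top \<or> y = top")
  case True
  have "0 < (1 - t) powr (1 - p)" "0 < t powr (1 - p)" using assms by auto
  then have "ennreal ((1 - t) powr (1 - p)) * ennreal_powr x p + ennreal (t powr (1 - p)) * ennreal_powr y p = top"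
    using True by (auto simp: ennreal_mult_top)
  then show ?thesis by (simp only: top_greatest)
next
  case False
  then obtain a b where ab: "x = ennreal a" "y = ennreal b" "0 \<le> a" "0 \<le> b"
    by (metis ennreal_cases)
  have "ennreal_powr (x + y) p = ennreal ((a + b) powr p)"
    using ab by (simp add: ennreal_powr_ennreal flip: ennreal_plus)
  also have "\<dots> \<le> ennreal ((1 - t) powr (1 - p) * a powr p + t powr (1 - p) * b powr p)"
    by (intro ennreal_leI powr_add_le ab assms)
  also have "\<dots> = ennreal ((1 - t) powr (1 - p)) * ennreal_powr x p + ennreal (t powr (1 - p)) * ennreal_powr y p"
    using ab by (simp add: ennreal_powr_ennreal ennreal_mult)
  finally show ?thesis .
qed

text \<open>Splitting off the first summand with \<open>t = 1/2\<close> costs a factor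
  \<open>2 powr (p - 1)\<close> on both parts, so the summand with index \<open>i\<close> collects
  \<open>Suc i\<close> of them. Such weights are harmless for fast decaying sequences.\<close>

lemma ennreal_powr_sum_le:
  assumes "1 \<le> p"
  shows "ennreal_powr (\<Sum>i<n. f i) p \<le> (\<Sum>i<n. ennreal (2 powr ((p - 1) * real (Suc i))) * ennreal_powr (f i) p)"
proof (induction n arbitrary: f)
  case (Suc n)
  define c where "c = (2::real) powr (p - 1)"
  have c: "(1 / 2 :: real) powr (1 - p) = c" by (simp add: c_def powr_divide powr_diff powr_minus field_simps)
  have cs: "c * 2 powr ((p - 1) * real k) = 2 powr ((p - 1) * real (Suc k))" for k
    by (simp add: c_def algebra_simps flip: powr_add)
  have cs': "ennreal c * (ennreal (2 powr ((p - 1) * real k)) * y) = ennreal (2 powr ((p - 1) * real (Suc k))) * y" for k y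
    using cs[of k] by (simp add: c_def mult.assoc[symmetric] ennreal_mult[symmetric] del: of_nat_Suc)
  have c0: "ennreal c = ennreal (2 powr ((p - 1) * real (Suc 0)))" by (simp add: c_def)
  have "ennreal_powr (\<Sum>i<Suc n. f i) p = ennreal_powr (f 0 + (\<Sum>i<n. f (Suc i))) p"
    by (subst sum.lessThan_Suc_shift) simp
  also have "\<dots> \<le> ennreal c * ennreal_powr (f 0) p + ennreal c * ennreal_powr (\<Sum>i<n. f (Suc i)) p"
    using ennreal_powr_add_le[of "1/2" p "f 0" "\<Sum>i<n. f (Suc i)"] assms c by simp
  also have "\<dots> \<le> ennreal c * ennreal_powr (f 0) p +
      ennreal c * (\<Sum>i<n. ennreal (2 powr ((p - 1) * real (Suc i))) * ennreal_powr (f (Suc i)) p)"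
    by (intro add_left_mono mult_left_mono Suc.IH) auto
  also have "\<dots> = (\<Sum>i<Suc n. ennreal (2 powr ((p - 1) * real (Suc i))) * ennreal_powr (f i) p)"
    unfolding sum.lessThan_Suc_shift[of _ n] sum_distrib_left
    by (simp only: cs') (simp only: c0)
  finally show ?case .
qed simp

text \<open>The power is increasing with increasing inverse, the power \<open>1 / p\<close>; hence
  it commutes with suprema without any continuity argument.\<close>

lemma ennreal_powr_SUP:
  assumes "0 < p"
  shows "ennreal_powr (SUP i\<in>I. f i) p = (SUP i\<in>I. ennreal_powr (f i) p)"
proof (rule antisym)
  let ?s = "SUP i\<in>I. ennreal_powr (f i) p"
  show "?s \<le> ennreal_powr (SUP i\<in>I. f i) p"
    using assms by (intro SUP_least ennreal_powr_mono SUP_upper) auto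
  have "f i \<le> ennreal_powr ?s (1 / p)" if "i \<in> I" for i
    using ennreal_powr_mono[of "1 / p" "ennreal_powr (f i) p" ?s] assms SUP_upper[OF that, of "\<lambda>i. ennreal_powr (f i) p"]
    by (simp add: ennreal_powr_inverse)
  then have "ennreal_powr (SUP i\<in>I. f i) p \<le> ennreal_powr (ennreal_powr ?s (1 / p)) p"
    using assms by (intro ennreal_powr_mono SUP_least) auto
  also have "\<dots> = ?s" using ennreal_powr_inverse[of "1 / p" ?s] assms by simp
  finally show "ennreal_powr (SUP i\<in>I. f i) p \<le> ?s" .
qed

lemma ennreal_powr_suminf_le:
  assumes "1 \<le> p"
  shows "ennreal_powr (\<Sum>i. f i) p \<le> (\<Sum>i. ennreal (2 powr ((p - 1) * real (Suc i))) * ennreal_powr (f i) p)"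
proof -
  have "ennreal_powr (\<Sum>i. f i) p = (SUP n. ennreal_powr (\<Sum>i<n. f i) p)"
    using assms by (simp add: suminf_eq_SUP ennreal_powr_SUP)
  also have "\<dots> \<le> (\<Sum>i. ennreal (2 powr ((p - 1) * real (Suc i))) * ennreal_powr (f i) p)"
    by (intro SUP_least order_trans[OF ennreal_powr_sum_le[OF assms]] sum_le_suminf) auto
  finally show ?thesis .
qed

subsection \<open>Exceptional families of curves\<close>

definition Lp :: "real \<Rightarrow> 'a measure \<Rightarrow> ('a \<Rightarrow> ennreal) set" where
  "Lp p N = {g \<in> borel_measurable N. (\<integral>\<^sup>+x. ennreal_powr (g x) p \<partial>N) < \<infinity>}"

lemma Lp_measurable: "g \<in> Lp p N \<Longrightarrow> g \<in> borel_measurable N"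
  by (simp add: Lp_def)

lemma Lp_finite: "g \<in> Lp p N \<Longrightarrow> (\<integral>\<^sup>+x. ennreal_powr (g x) p \<partial>N) < \<infinity>"
  by (simp add: Lp_def)

lemma Lp_mono:
  assumes "g \<in> Lp p N" "h \<in> borel_measurable N" "\<And>x. x \<in> space N \<Longrightarrow> h x \<le> g x" "0 \<le> p"
  shows "h \<in> Lp p N"
proof -
  have "(\<integral>\<^sup>+x. ennreal_powr (h x) p \<partial>N) \<le> (\<integral>\<^sup>+x. ennreal_powr (g x) p \<partial>N)"
    by (intro nn_integral_mono ennreal_powr_mono assms)
  also have "\<dots> < \<infinity>" using assms by (simp add: Lp_def)
  finally show ?thesis using assms by (simp add: Lp_def)
qed

lemma nn_integral_ennreal_powr_add_le:
  assumes "0 < t" "t < 1" "1 \<le> p" "g \<in> borel_measurable N" "h \<in> borel_measurable N"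
  shows "(\<integral>\<^sup>+x. ennreal_powr (g x + h x) p \<partial>N) \<le>
    ennreal ((1 - t) powr (1 - p)) * (\<integral>\<^sup>+x. ennreal_powr (g x) p \<partial>N) +
    ennreal (t powr (1 - p)) * (\<integral>\<^sup>+x. ennreal_powr (h x) p \<partial>N)"
proof -
  note [measurable] = assms(4,5)
  have "(\<integral>\<^sup>+x. ennreal_powr (g x + h x) p \<partial>N) \<le>
    (\<integral>\<^sup>+x. ennreal ((1 - t) powr (1 - p)) * ennreal_powr (g x) p + ennreal (t powr (1 - p)) * ennreal_powr (h x) p \<partial>N)"
    by (intro nn_integral_mono ennreal_powr_add_le assms)
  also have "\<dots> = ennreal ((1 - t) powr (1 - p)) * (\<integral>\<^sup>+x. ennreal_powr (g x) p \<partial>N) +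
    ennreal (t powr (1 - p)) * (\<integral>\<^sup>+x. ennreal_powr (h x) p \<partial>N)"
    by (simp add: nn_integral_add nn_integral_cmult)
  finally show ?thesis .
qed

lemma Lp_add:
  assumes "g \<in> Lp p N" "h \<in> Lp p N" "1 \<le> p"
  shows "(\<lambda>x. g x + h x) \<in> Lp p N"
proof -
  have [measurable]: "g \<in> borel_measurable N" "h \<in> borel_measurable N"
    using assms by (auto simp: Lp_def)
  have "(\<integral>\<^sup>+x. ennreal_powr (g x + h x) p \<partial>N) < \<infinity>"
    using assms by (intro le_less_trans[OF nn_integral_ennreal_powr_add_le[of "1/2"]])
      (auto simp: Lp_def ennreal_mult_less_top)
  then show ?thesis by (auto simp: Lp_def)
qed

lemma nn_integral_ennreal_powr_cmult:
  assumes "0 < c" "g \<in> borel_measurable N"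
  shows "(\<integral>\<^sup>+x. ennreal_powr (ennreal c * g x) p \<partial>N) = ennreal (c powr p) * (\<integral>\<^sup>+x. ennreal_powr (g x) p \<partial>N)"
proof -
  note [measurable] = assms(2)
  show ?thesis using assms(1) by (simp add: ennreal_powr_cmult nn_integral_cmult)
qed

lemma Lp_cmult:
  assumes "g \<in> Lp p N" "0 < c"
  shows "(\<lambda>x. ennreal c * g x) \<in> Lp p N"
  using assms nn_integral_ennreal_powr_cmult[OF assms(2) Lp_measurable[OF assms(1)]]
  by (auto simp: Lp_def ennreal_mult_less_top)

lemma nn_integral_ennreal_powr_suminf_le:
  assumes "1 \<le> p" "\<And>n. g n \<in> borel_measurable N"
  shows "(\<integral>\<^sup>+x. ennreal_powr (\<Sum>n. g n x) p \<partial>N) \<le>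
    (\<Sum>n. ennreal (2 powr ((p - 1) * real (Suc n))) * (\<integral>\<^sup>+x. ennreal_powr (g n x) p \<partial>N))"
proof -
  note [measurable] = assms(2)
  have "(\<integral>\<^sup>+x. ennreal_powr (\<Sum>n. g n x) p \<partial>N) \<le>
    (\<integral>\<^sup>+x. (\<Sum>n. ennreal (2 powr ((p - 1) * real (Suc n))) * ennreal_powr (g n x) p) \<partial>N)"
    by (intro nn_integral_mono ennreal_powr_suminf_le assms)
  also have "\<dots> = (\<Sum>n. ennreal (2 powr ((p - 1) * real (Suc n))) * (\<integral>\<^sup>+x. ennreal_powr (g n x) p \<partial>N))"
    by (simp add: nn_integral_suminf nn_integral_cmult del: of_nat_Suc)
  finally show ?thesis .
qed

lemma Lp_suminf:
  assumes "1 \<le> p" "\<And>n. g n \<in> borel_measurable N"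
    and small: "\<And>n. ennreal (2 powr ((p - 1) * real (Suc n))) * (\<integral>\<^sup>+x. ennreal_powr (g n x) p \<partial>N) \<le> ennreal ((1/2) ^ n)"
  shows "(\<lambda>x. \<Sum>n. g n x) \<in> Lp p N"
proof -
  have [measurable]: "g n \<in> borel_measurable N" for n by (rule assms(2))
  have "(\<integral>\<^sup>+x. ennreal_powr (\<Sum>n. g n x) p \<partial>N) \<le> (\<Sum>n. ennreal ((1/2) ^ n))"
    by (intro order_trans[OF nn_integral_ennreal_powr_suminf_le] suminf_le small) (auto intro: assms)
  also have "\<dots> = ennreal (\<Sum>n. (1/2) ^ n)"
    by (intro suminf_ennreal2) (auto simp: summable_geometric)
  also have "\<dots> < \<infinity>" by simp
  finally show ?thesis by (simp add: Lp_def)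
qed

text \<open>One function takes care of countably many exceptional families: a curve with finite
  integral of \<open>\<rho>\<close> has finite integral of every \<open>g n\<close>.\<close>

lemma Lp_countable_dominating:
  assumes "1 \<le> p" "\<And>n. g n \<in> Lp p N"
  obtains \<rho> c where "\<rho> \<in> Lp p N" "\<And>n::nat. 0 < c n" "\<And>n x. ennreal (c n) * g n x \<le> \<rho> x"
proof -
  define I where "I n = enn2real (\<integral>\<^sup>+x. ennreal_powr (g n x) p \<partial>N)" for n
  have I: "(\<integral>\<^sup>+x. ennreal_powr (g n x) p \<partial>N) = ennreal (I n)" "0 \<le> I n" for n
    using Lp_finite[OF assms(2), of n] by (auto simp: I_def)
  \<comment> \<open>Solves \<open>2 powr ((p - 1) * Suc n) * (c n powr p * (I n + 1)) = (1/2) ^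
    n\<close>; the summand 1 avoids a division by zero.\<close>
  define c where "c n = ((1/2) ^ n / (2 powr ((p - 1) * real (Suc n)) * (I n + 1))) powr (1 / p)" for n
  have c: "0 < c n" for n using I(2)[of n] by (simp add: c_def del: of_nat_Suc)
  have m: "g n \<in> borel_measurable N" for n using assms(2) Lp_measurable by blast
  have "(\<lambda>x. \<Sum>n. ennreal (c n) * g n x) \<in> Lp p N"
  proof (rule Lp_suminf[OF assms(1)])
    show "(\<lambda>x. ennreal (c n) * g n x) \<in> borel_measurable N" for n using m by measurable
    fix n
    let ?a = "2 powr ((p - 1) * real (Suc n))"
    have cp: "c n powr p = (1/2) ^ n / (?a * (I n + 1))"
      using assms(1) I(2)[of n] by (simp add: c_def powr_powr del: of_nat_Suc)
    have "ennreal ?a * (\<integral>\<^sup>+x. ennreal_powr (ennreal (c n) * g n x) p \<partial>N) = ennreal (?a * (c n powr p * I n))"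
      using I(2)[of n] by (simp add: nn_integral_ennreal_powr_cmult[OF c m] I(1) ennreal_mult)
    also have "?a * (c n powr p * I n) \<le> (1/2) ^ n"
    proof -
      have "?a * (c n powr p * I n) = (1/2) ^ n * (I n / (I n + 1))"
        unfolding cp by (simp del: of_nat_Suc)
      also have "\<dots> \<le> (1/2) ^ n * 1" using I(2)[of n] by (intro mult_left_mono) (auto simp: divide_simps)
      finally show ?thesis by simp
    qed
    finally show "ennreal ?a * (\<integral>\<^sup>+x. ennreal_powr (ennreal (c n) * g n x) p \<partial>N) \<le> ennreal ((1/2) ^ n)"
      by (simp add: ennreal_leI)
  qed
  moreover have "ennreal (c n) * g n x \<le> (\<Sum>n. ennreal (c n) * g n x)" for n x
  proof -
    have "(\<Sum>n\<in>{n}. ennreal (c n) * g n x) \<le> (\<Sum>n. ennreal (c n) * g n x)" by (intro sum_le_suminf) auto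
    then show ?thesis by simp
  qed
  ultimately show ?thesis using that c by blast
qed

lemma line_integral_measurable:
  assumes "\<gamma> \<in> rectifiable_curves N" "sets N = sets (restrict_space borel (space N))" "g \<in> borel_measurable N"
  shows "(\<lambda>\<tau>. g (arc_length_param \<gamma> \<tau>)) \<in> borel_measurable (restrict_space lborel {0..arc_length \<gamma>})"
  using measurable_compose[OF arc_length_param_measurable[OF assms(1,2)] assms(3)] .

lemma line_integral_mono:
  assumes "\<gamma> \<in> rectifiable_curves N" "\<And>x. x \<in> space N \<Longrightarrow> g x \<le> h x"
  shows "line_integral g \<gamma> \<le> line_integral h \<gamma>"
  unfolding line_integral_eq[OF assms(1)]
  by (intro nn_integral_mono assms(2) arc_length_param_in_space[OF assms(1)]) (auto simp: space_restrict_space)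

lemma line_integral_add:
  assumes "\<gamma> \<in> rectifiable_curves N" "sets N = sets (restrict_space borel (space N))"
    "g \<in> borel_measurable N" "h \<in> borel_measurable N"
  shows "line_integral (\<lambda>x. g x + h x) \<gamma> = line_integral g \<gamma> + line_integral h \<gamma>"
  unfolding line_integral_eq[OF assms(1)]
  by (intro nn_integral_add line_integral_measurable[OF assms(1,2)] assms)

lemma line_integral_cmult:
  assumes "\<gamma> \<in> rectifiable_curves N" "sets N = sets (restrict_space borel (space N))" "g \<in> borel_measurable N"
  shows "line_integral (\<lambda>x. c * g x) \<gamma> = c * line_integral g \<gamma>"
  unfolding line_integral_eq[OF assms(1)]
  by (intro nn_integral_cmult line_integral_measurable[OF assms(1,2)] assms)

lemma line_integral_suminf:
  assumes "\<gamma> \<in> rectifiable_curves N" "sets N = sets (restrict_space borel (space N))"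
    "\<And>n. g n \<in> borel_measurable N"
  shows "line_integral (\<lambda>x. \<Sum>n. g n x) \<gamma> = (\<Sum>n. line_integral (g n) \<gamma>)"
  unfolding line_integral_eq[OF assms(1)]
  by (intro nn_integral_suminf line_integral_measurable[OF assms(1,2)] assms)

text \<open>Functions admissible for the modulus, with rapidly decreasing energies, are summed: the
  sum is still in \<open>Lp\<close>, but every curve of the family receives at least 1 from each
  term.\<close>

lemma p_modulus_zeroD:
  assumes p: "1 < p" and N: "sets N = sets (restrict_space borel (space N))"
    and \<Gamma>: "\<Gamma> \<subseteq> rectifiable_curves N" "p_modulus p N \<Gamma> = 0"
  obtains \<rho> where "\<rho> \<in> Lp p N" "\<And>\<gamma>. \<gamma> \<in> \<Gamma> \<Longrightarrow> line_integral \<rho> \<gamma> = \<infinity>"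
proof -
  have "\<exists>\<rho>\<in>borel_measurable N. (\<forall>\<gamma>\<in>\<Gamma>. 1 \<le> line_integral \<rho> \<gamma>) \<and>
      ennreal (2 powr ((p - 1) * real (Suc n))) * (\<integral>\<^sup>+x. ennreal_powr (\<rho> x) p \<partial>N) \<le> ennreal ((1/2) ^ n)" for n
  proof -
    let ?a = "2 powr ((p - 1) * real (Suc n))"
    let ?d = "(1/2) ^ n / ?a"
    have "p_modulus p N \<Gamma> < ennreal ?d" using \<Gamma>(2) by (simp del: of_nat_Suc)
    then obtain \<rho> where \<rho>: "\<rho> \<in> borel_measurable N" "\<forall>\<gamma>\<in>\<Gamma>. 1 \<le> line_integral \<rho> \<gamma>"
      and i: "(\<integral>\<^sup>+x. ennreal_powr (\<rho> x) p \<partial>N) < ennreal ?d"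
      unfolding p_modulus_def INF_less_iff by auto
    have "ennreal ?a * (\<integral>\<^sup>+x. ennreal_powr (\<rho> x) p \<partial>N) \<le> ennreal ?a * ennreal ?d"
      using i by (intro mult_left_mono) auto
    also have "\<dots> = ennreal ((1/2) ^ n)" by (simp del: of_nat_Suc flip: ennreal_mult)
    finally show ?thesis using \<rho> by blast
  qed
  then obtain \<rho> where \<rho>: "\<And>n. \<rho> n \<in> borel_measurable N" "\<And>n \<gamma>. \<gamma> \<in> \<Gamma> \<Longrightarrow> 1 \<le> line_integral (\<rho> n) \<gamma>"
    "\<And>n. ennreal (2 powr ((p - 1) * real (Suc n))) * (\<integral>\<^sup>+x. ennreal_powr (\<rho> n x) p \<partial>N) \<le> ennreal ((1/2) ^ n)"
    by metis
  have "(\<lambda>x. \<Sum>n. \<rho> n x) \<in> Lp p N" using p by (intro Lp_suminf \<rho>) auto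
  moreover have "line_integral (\<lambda>x. \<Sum>n. \<rho> n x) \<gamma> = \<infinity>" if "\<gamma> \<in> \<Gamma>" for \<gamma>
  proof -
    have top: "(\<Sum>n::nat. (1::ennreal)) = top"
      by (simp add: suminf_eq_SUP ennreal_SUP_of_nat_eq_top)
    have "(\<Sum>n::nat. (1::ennreal)) \<le> (\<Sum>n. line_integral (\<rho> n) \<gamma>)"
      by (intro suminf_le \<rho>(2) that) auto
    also have "\<dots> = line_integral (\<lambda>x. \<Sum>n. \<rho> n x) \<gamma>"
      using line_integral_suminf[OF _ N \<rho>(1), of \<gamma>] that \<Gamma>(1) by auto
    finally show ?thesis using top by (simp add: top_unique)
  qed
  ultimately show ?thesis using that by blast
qed

text \<open>Every positive multiple of \<open>\<rho>\<close> is admissible for the modulus, and its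
  energy tends to 0 with the factor.\<close>

lemma p_modulus_zeroI:
  assumes p: "1 < p" and N: "sets N = sets (restrict_space borel (space N))"
    and \<Gamma>: "\<Gamma> \<subseteq> rectifiable_curves N" and \<rho>: "\<rho> \<in> Lp p N" "\<And>\<gamma>. \<gamma> \<in> \<Gamma> \<Longrightarrow> line_integral \<rho> \<gamma> = \<infinity>"
  shows "p_modulus p N \<Gamma> = 0"
proof -
  obtain I where I: "(\<integral>\<^sup>+x. ennreal_powr (\<rho> x) p \<partial>N) = ennreal I" "0 \<le> I"
    using Lp_finite[OF \<rho>(1)] by (cases "\<integral>\<^sup>+x. ennreal_powr (\<rho> x) p \<partial>N") auto
  have *: "p_modulus p N \<Gamma> \<le> ennreal (c powr p * I)" if "0 < c" for c
  proof -
    have m: "(\<lambda>x. ennreal c * \<rho> x) \<in> borel_measurable N"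
      using Lp_measurable[OF \<rho>(1)] by measurable
    have "line_integral (\<lambda>x. ennreal c * \<rho> x) \<gamma> = \<infinity>" if "\<gamma> \<in> \<Gamma>" for \<gamma>
      using line_integral_cmult[OF _ N Lp_measurable[OF \<rho>(1)], of \<gamma> "ennreal c"] \<rho>(2)[OF that] that \<Gamma> \<open>0 < c\<close>
      by (auto simp: ennreal_mult_top)
    then have "p_modulus p N \<Gamma> \<le> (\<integral>\<^sup>+x. ennreal_powr (ennreal c * \<rho> x) p \<partial>N)"
      unfolding p_modulus_def using m by (intro INF_lower) auto
    also have "\<dots> = ennreal (c powr p * I)"
      using nn_integral_ennreal_powr_cmult[OF that Lp_measurable[OF \<rho>(1)]] I by (simp add: ennreal_mult)
    finally show ?thesis .
  qed
  have "p_modulus p N \<Gamma> \<le> ennreal \<epsilon>" if "0 < \<epsilon>" for \<epsilon>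
  proof -
    let ?c = "(\<epsilon> / (I + 1)) powr (1 / p)"
    have "?c powr p * I = \<epsilon> * (I / (I + 1))" using p I that by (simp add: powr_powr)
    also have "\<dots> \<le> \<epsilon> * 1" using I that by (intro mult_left_mono) auto
    finally have "ennreal (?c powr p * I) \<le> ennreal \<epsilon>" by (simp add: ennreal_leI)
    moreover have "0 < ?c" using that I by simp
    ultimately show ?thesis using *[of ?c] by (meson order_trans)
  qed
  then show ?thesis
    by (metis ennreal_le_epsilon add_0 le_zero_eq zero_le)
qed

text \<open>The working form of "almost every curve": the curves with
  \<open>line_integral \<rho> \<gamma> < \<infinity>\<close> for one \<open>\<rho>\<close> in
  \<open>Lp\<close>. Unions of exceptional families correspond to sums of such functions, and a
  subarc of a good curve is good.\<close>

lemma weak_upper_gradient_iff: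
  assumes "1 < p" "sets N = sets (restrict_space borel (space N))"
  shows "weak_upper_gradient p N u g \<longleftrightarrow> g \<in> borel_measurable N \<and>
    (\<exists>\<rho>\<in>Lp p N. \<forall>\<gamma>\<in>rectifiable_curves N. line_integral \<rho> \<gamma> < \<infinity> \<longrightarrow> endpoint_diff u \<gamma> \<le> line_integral g \<gamma>)"
proof (intro iffI conjI)
  assume w: "weak_upper_gradient p N u g"
  then show "g \<in> borel_measurable N" by (simp add: weak_upper_gradient_def)
  have z: "p_modulus p N {\<gamma> \<in> rectifiable_curves N. \<not> endpoint_diff u \<gamma> \<le> line_integral g \<gamma>} = 0"
    using w by (simp add: weak_upper_gradient_def)
  obtain \<rho> where "\<rho> \<in> Lp p N"
    "\<And>\<gamma>. \<gamma> \<in> {\<gamma> \<in> rectifiable_curves N. \<not> endpoint_diff u \<gamma> \<le> line_integral g \<gamma>} \<Longrightarrow> line_integral \<rho> \<gamma> = \<infinity>"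
    by (rule p_modulus_zeroD[OF assms _ z]) auto
  then show "\<exists>\<rho>\<in>Lp p N. \<forall>\<gamma>\<in>rectifiable_curves N. line_integral \<rho> \<gamma> < \<infinity> \<longrightarrow> endpoint_diff u \<gamma> \<le> line_integral g \<gamma>"
    by (intro bexI[of _ \<rho>]) (force simp: less_top)+
next
  assume "g \<in> borel_measurable N \<and>
    (\<exists>\<rho>\<in>Lp p N. \<forall>\<gamma>\<in>rectifiable_curves N. line_integral \<rho> \<gamma> < \<infinity> \<longrightarrow> endpoint_diff u \<gamma> \<le> line_integral g \<gamma>)"
  then obtain \<rho> where g: "g \<in> borel_measurable N" and \<rho>: "\<rho> \<in> Lp p N"
    "\<And>\<gamma>. \<gamma> \<in> rectifiable_curves N \<Longrightarrow> line_integral \<rho> \<gamma> < \<infinity> \<Longrightarrow> endpoint_diff u \<gamma> \<le> line_integral g \<gamma>"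
    by blast
  have "p_modulus p N {\<gamma> \<in> rectifiable_curves N. \<not> endpoint_diff u \<gamma> \<le> line_integral g \<gamma>} = 0"
  proof (rule p_modulus_zeroI[OF assms _ \<rho>(1)])
    fix \<gamma> assume "\<gamma> \<in> {\<gamma> \<in> rectifiable_curves N. \<not> endpoint_diff u \<gamma> \<le> line_integral g \<gamma>}"
    then show "line_integral \<rho> \<gamma> = \<infinity>" using \<rho>(2)[of \<gamma>] by (cases "line_integral \<rho> \<gamma> = top") (auto simp: less_top)
  qed auto
  then show "weak_upper_gradient p N u g" using g by (simp add: weak_upper_gradient_def)
qed

lemma upper_gradient_imp_weak:
  assumes "upper_gradient N u g" "1 < p" "sets N = sets (restrict_space borel (space N))"
  shows "weak_upper_gradient p N u g"
  using assms unfolding weak_upper_gradient_iff[OF assms(2,3)]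
  by (intro conjI bexI[of _ "\<lambda>_. 0"]) (auto simp: upper_gradient_def Lp_def)

text \<open>Adding a small multiple of \<open>\<rho>\<close> makes the line integral infinite on
  every exceptional curve, so that the inequality holds on all curves.\<close>

lemma weak_imp_upper_gradient:
  assumes p: "1 < p" and N: "sets N = sets (restrict_space borel (space N))"
    and w: "weak_upper_gradient p N u g" "g \<in> Lp p N" and "0 < \<epsilon>"
  obtains g' where "upper_gradient N u g'" "g' \<in> Lp p N"
    "(\<integral>\<^sup>+x. ennreal_powr (g' x) p \<partial>N) \<le> (\<integral>\<^sup>+x. ennreal_powr (g x) p \<partial>N) + ennreal \<epsilon>"
proof -
  obtain \<rho> where g: "g \<in> borel_measurable N" and \<rho>: "\<rho> \<in> Lp p N"
    "\<And>\<gamma>. \<gamma> \<in> rectifiable_curves N \<Longrightarrow> line_integral \<rho> \<gamma> < \<infinity> \<Longrightarrow> endpoint_diff u \<gamma> \<le> line_integral g \<gamma>"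
    using w(1) unfolding weak_upper_gradient_iff[OF p N] by blast
  note [measurable] = g Lp_measurable[OF \<rho>(1)]
  define I J where "I = enn2real (\<integral>\<^sup>+x. ennreal_powr (g x) p \<partial>N)" and "J = enn2real (\<integral>\<^sup>+x. ennreal_powr (\<rho> x) p \<partial>N)"
  have I: "(\<integral>\<^sup>+x. ennreal_powr (g x) p \<partial>N) = ennreal I" "0 \<le> I"
    using Lp_finite[OF w(2)] by (auto simp: I_def)
  have J: "(\<integral>\<^sup>+x. ennreal_powr (\<rho> x) p \<partial>N) = ennreal J" "0 \<le> J"
    using Lp_finite[OF \<rho>(1)] by (auto simp: J_def)
  \<comment> \<open>First \<open>t\<close> is fixed so that its factor on the energy of
    \<open>g\<close> costs at most \<open>\<epsilon> / 2\<close>; afterwards \<open>c\<close> is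
    taken small enough to absorb the factor \<open>t powr (1 - p)\<close> of the added term.\<close>
  have "((\<lambda>t. (1 - t) powr (1 - p) * I) \<longlongrightarrow> (1 - 0) powr (1 - p) * I) (at_right 0)"
    by (intro tendsto_intros) auto
  then have "\<forall>\<^sub>F t in at_right 0. (1 - t) powr (1 - p) * I < I + \<epsilon> / 2"
    using \<open>0 < \<epsilon>\<close> by (intro order_tendstoD) auto
  moreover have "\<forall>\<^sub>F t::real in at_right 0. 0 < t \<and> t < 1"
    using eventually_at_right_real[of 0 "1::real"] by (auto elim: eventually_mono)
  ultimately have "\<forall>\<^sub>F t in at_right (0::real). (0 < t \<and> t < 1) \<and> (1 - t) powr (1 - p) * I < I + \<epsilon> / 2"
    by eventually_elim auto
  then obtain t where t: "0 < t" "t < 1" "(1 - t) powr (1 - p) * I < I + \<epsilon> / 2"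
    using eventually_happens'[OF trivial_limit_at_right_real] by blast
  define c where "c = (\<epsilon> / (2 * (t powr (1 - p) * J + 1))) powr (1 / p)"
  have d: "0 < t powr (1 - p) * J + 1" using J t by (intro add_nonneg_pos) auto
  have c: "0 < c" using \<open>0 < \<epsilon>\<close> d by (simp add: c_def)
  have cp: "c powr p = \<epsilon> / (2 * (t powr (1 - p) * J + 1))" using p d \<open>0 < \<epsilon>\<close> by (simp add: c_def powr_powr)
  have "t powr (1 - p) * (c powr p * J) = \<epsilon> / 2 * ((t powr (1 - p) * J) / (t powr (1 - p) * J + 1))"
    unfolding cp using d by (simp add: field_simps)
  also have "\<dots> \<le> \<epsilon> / 2 * 1" using \<open>0 < \<epsilon>\<close> d by (intro mult_left_mono) (auto simp: divide_simps)
  finally have e2: "t powr (1 - p) * (c powr p * J) \<le> \<epsilon> / 2" by simp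
  define g' where "g' x = g x + ennreal c * \<rho> x" for x
  have [measurable]: "g' \<in> borel_measurable N" by (simp add: g'_def[abs_def])
  have "(\<integral>\<^sup>+x. ennreal_powr (g' x) p \<partial>N) \<le> ennreal ((1 - t) powr (1 - p)) * (\<integral>\<^sup>+x. ennreal_powr (g x) p \<partial>N) +
    ennreal (t powr (1 - p)) * (\<integral>\<^sup>+x. ennreal_powr (ennreal c * \<rho> x) p \<partial>N)"
    unfolding g'_def using p t by (intro nn_integral_ennreal_powr_add_le) auto
  also have "\<dots> = ennreal ((1 - t) powr (1 - p) * I + t powr (1 - p) * (c powr p * J))"
    using c I J by (simp add: nn_integral_ennreal_powr_cmult ennreal_mult)
  also have "\<dots> \<le> ennreal (I + \<epsilon>)" using t e2 by (intro ennreal_leI) auto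
  also have "\<dots> = (\<integral>\<^sup>+x. ennreal_powr (g x) p \<partial>N) + ennreal \<epsilon>" using I \<open>0 < \<epsilon>\<close> by simp
  finally have le: "(\<integral>\<^sup>+x. ennreal_powr (g' x) p \<partial>N) \<le> (\<integral>\<^sup>+x. ennreal_powr (g x) p \<partial>N) + ennreal \<epsilon>" .
  have "endpoint_diff u \<gamma> \<le> line_integral g' \<gamma>" if \<gamma>: "\<gamma> \<in> rectifiable_curves N" for \<gamma>
  proof (cases "line_integral \<rho> \<gamma> < \<infinity>")
    case True
    have "endpoint_diff u \<gamma> \<le> line_integral g \<gamma>" by (rule \<rho>(2)[OF \<gamma> True])
    also have "\<dots> \<le> line_integral g' \<gamma>" by (rule line_integral_mono[OF \<gamma>]) (simp add: g'_def)
    finally show ?thesis .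
  next
    case False
    then have "line_integral (\<lambda>x. ennreal c * \<rho> x) \<gamma> = \<infinity>"
      using c line_integral_cmult[OF \<gamma> N, of \<rho> "ennreal c"] by (simp add: less_top[symmetric] ennreal_mult_top)
    moreover have "line_integral (\<lambda>x. ennreal c * \<rho> x) \<gamma> \<le> line_integral g' \<gamma>"
      by (rule line_integral_mono[OF \<gamma>]) (simp add: g'_def)
    ultimately show ?thesis by (simp add: top_unique)
  qed
  then have "upper_gradient N u g'" by (simp add: upper_gradient_def)
  moreover have "g' \<in> Lp p N" using le_less_trans[OF le, of top] I by (simp add: Lp_def)
  ultimately show ?thesis using that le by blast
qed

subsection \<open>The minimal weak upper gradient\<close>

lemma nn_integral_split_Icc:
  fixes K :: "real \<Rightarrow> ennreal"
  assumes [measurable]: "K \<in> borel_measurable lborel" and "a \<le> b" "b \<le> c"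
  shows "(\<integral>\<^sup>+x\<in>{a..c}. K x \<partial>lborel) = (\<integral>\<^sup>+x\<in>{a..b}. K x \<partial>lborel) + (\<integral>\<^sup>+x\<in>{b..c}. K x \<partial>lborel)"
proof -
  have "AE x in lborel. x \<notin> {b}" by (rule AE_not_in) auto
  then have "(\<integral>\<^sup>+x\<in>{a..c}. K x \<partial>lborel) = (\<integral>\<^sup>+x. K x * indicator {a..b} x + K x * indicator {b..c} x \<partial>lborel)"
    using assms by (intro nn_integral_cong_AE) (auto simp: indicator_def)
  then show ?thesis by (simp add: nn_integral_add)
qed

text \<open>
  For weights that are constant on an interval the bound is the corresponding convex combination of
  the two hypotheses; a continuous \<open>\<psi>\<close> is almost constant on short intervals. Letting \<open>\<psi>\<close> tend to the
  indicator function of \<open>{x. G x \<le> H x}\<close> then gives the bound by \<open>min G H\<close>.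
\<close>

lemma increment_le_continuous_mix:
  fixes F :: "real \<Rightarrow> real" and G H :: "real \<Rightarrow> ennreal"
  assumes [measurable]: "G \<in> borel_measurable lborel" "H \<in> borel_measurable lborel"
    and G: "\<And>s t. 0 \<le> s \<Longrightarrow> s < t \<Longrightarrow> t \<le> l \<Longrightarrow> ennreal \<bar>F t - F s\<bar> \<le> (\<integral>\<^sup>+x\<in>{s..t}. G x \<partial>lborel)"
    and H: "\<And>s t. 0 \<le> s \<Longrightarrow> s < t \<Longrightarrow> t \<le> l \<Longrightarrow> ennreal \<bar>F t - F s\<bar> \<le> (\<integral>\<^sup>+x\<in>{s..t}. H x \<partial>lborel)"
    and fin: "(\<integral>\<^sup>+x\<in>{0..l}. G x \<partial>lborel) < \<infinity>" "(\<integral>\<^sup>+x\<in>{0..l}. H x \<partial>lborel) < \<infinity>"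
    and \<psi>: "continuous_on UNIV \<psi>" "\<And>x. 0 \<le> \<psi> x \<and> \<psi> x \<le> 1" and "0 < l"
  shows "ennreal \<bar>F l - F 0\<bar> \<le> (\<integral>\<^sup>+x\<in>{0..l}. (ennreal (\<psi> x) * G x + ennreal (1 - \<psi> x) * H x) \<partial>lborel)"
proof -
  have [measurable]: "\<psi> \<in> borel_measurable lborel"
    using borel_measurable_continuous_onI[OF \<psi>(1)] by simp
  have approx: "ennreal \<bar>F l - F 0\<bar> \<le> (\<integral>\<^sup>+x\<in>{0..l}. (ennreal (\<psi> x + \<eta>) * G x + ennreal (1 - \<psi> x + \<eta>) * H x) \<partial>lborel)"
    if "0 < \<eta>" for \<eta>
  proof -
    define K where "K x = ennreal (\<psi> x + \<eta>) * G x + ennreal (1 - \<psi> x + \<eta>) * H x" for x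
    have [measurable]: "K \<in> borel_measurable lborel" unfolding K_def by measurable
    have "uniformly_continuous_on {0..l} \<psi>"
      by (intro compact_uniformly_continuous continuous_on_subset[OF \<psi>(1)]) auto
    then obtain \<delta> where \<delta>: "0 < \<delta>" "\<And>x y. x \<in> {0..l} \<Longrightarrow> y \<in> {0..l} \<Longrightarrow> dist x y < \<delta> \<Longrightarrow> dist (\<psi> x) (\<psi> y) < \<eta>"
      unfolding uniformly_continuous_on_def using \<open>0 < \<eta>\<close> by metis
    obtain n :: nat where n: "l / \<delta> < n" using reals_Archimedean2 by blast
    then have n0: "0 < n" using \<open>0 < l\<close> \<delta> by (metis divide_pos_pos less_le_trans not_less of_nat_0_less_iff order_less_trans)
    define h where "h = l / n"
    have h: "0 < h" "h < \<delta>" "h * n = l"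
      using n n0 \<delta> \<open>0 < l\<close> by (auto simp: h_def field_simps)
    \<comment> \<open>On an interval shorter than \<open>\<delta>\<close> the weight is frozen at
      its value in the left endpoint; returning to \<open>\<psi> x\<close> costs at most
      \<open>\<eta>\<close> in each coefficient.\<close>
    have step: "ennreal \<bar>F t - F s\<bar> \<le> (\<integral>\<^sup>+x\<in>{s..t}. K x \<partial>lborel)" if st: "0 \<le> s" "s < t" "t \<le> l" "t - s < \<delta>" for s t
    proof -
      let ?D = "\<bar>F t - F s\<bar>"
      have "ennreal ?D = ennreal (\<psi> s * ?D + (1 - \<psi> s) * ?D)" by (simp add: algebra_simps)
      also have "\<dots> = ennreal (\<psi> s) * ennreal ?D + ennreal (1 - \<psi> s) * ennreal ?D"
        using \<psi>(2)[of s] by (subst ennreal_plus) (auto simp: ennreal_mult)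
      also have "\<dots> \<le> ennreal (\<psi> s) * (\<integral>\<^sup>+x\<in>{s..t}. G x \<partial>lborel) + ennreal (1 - \<psi> s) * (\<integral>\<^sup>+x\<in>{s..t}. H x \<partial>lborel)"
        using st by (intro add_mono mult_left_mono G H) auto
      also have "\<dots> = (\<integral>\<^sup>+x\<in>{s..t}. (ennreal (\<psi> s) * G x + ennreal (1 - \<psi> s) * H x) \<partial>lborel)"
        by (simp add: nn_integral_add nn_integral_cmult[symmetric] distrib_right mult.assoc)
      also have "\<dots> \<le> (\<integral>\<^sup>+x\<in>{s..t}. K x \<partial>lborel)"
      proof (intro nn_integral_mono)
        fix x
        show "(ennreal (\<psi> s) * G x + ennreal (1 - \<psi> s) * H x) * indicator {s..t} x \<le> K x * indicator {s..t} x"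
        proof (cases "x \<in> {s..t}")
          case True
          then have "dist (\<psi> s) (\<psi> x) < \<eta>" using st by (intro \<delta>) (auto simp: dist_real_def)
          then show ?thesis unfolding K_def using True
            by (auto simp: dist_real_def intro!: add_mono mult_right_mono ennreal_leI)
        qed auto
      qed
      finally show ?thesis .
    qed
    have "ennreal \<bar>F (h * k) - F 0\<bar> \<le> (\<integral>\<^sup>+x\<in>{0..h * k}. K x \<partial>lborel)" if "k \<le> n" for k :: nat
      using that
    proof (induction k)
      case (Suc k)
      have hk: "h * Suc k \<le> l" using Suc.prems h mult_left_mono[of "real (Suc k)" n h] by simp
      have "ennreal \<bar>F (h * Suc k) - F 0\<bar> \<le> ennreal \<bar>F (h * k) - F 0\<bar> + ennreal \<bar>F (h * Suc k) - F (h * k)\<bar>"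
        by (simp flip: ennreal_plus)
      also have "\<dots> \<le> (\<integral>\<^sup>+x\<in>{0..h * k}. K x \<partial>lborel) + (\<integral>\<^sup>+x\<in>{h * k..h * Suc k}. K x \<partial>lborel)"
        using Suc.prems h hk by (intro add_mono[OF Suc.IH step]) (auto simp: algebra_simps)
      also have "\<dots> = (\<integral>\<^sup>+x\<in>{0..h * Suc k}. K x \<partial>lborel)"
        using h by (intro nn_integral_split_Icc[symmetric]) (auto simp: algebra_simps)
      finally show ?case .
    qed simp
    from this[of n] h show ?thesis by (simp add: K_def)
  qed
  define A B where "A = (\<integral>\<^sup>+x\<in>{0..l}. (ennreal (\<psi> x) * G x + ennreal (1 - \<psi> x) * H x) \<partial>lborel)"
    and "B = (\<integral>\<^sup>+x\<in>{0..l}. G x \<partial>lborel) + (\<integral>\<^sup>+x\<in>{0..l}. H x \<partial>lborel)"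
  have AB: "ennreal \<bar>F l - F 0\<bar> \<le> A + ennreal \<eta> * B" if "0 < \<eta>" for \<eta>
  proof -
    have "(\<integral>\<^sup>+x\<in>{0..l}. (ennreal (\<psi> x + \<eta>) * G x + ennreal (1 - \<psi> x + \<eta>) * H x) \<partial>lborel) =
      (\<integral>\<^sup>+x. (ennreal (\<psi> x) * G x + ennreal (1 - \<psi> x) * H x) * indicator {0..l} x +
         (ennreal \<eta> * (G x * indicator {0..l} x) + ennreal \<eta> * (H x * indicator {0..l} x)) \<partial>lborel)"
      using \<psi>(2) \<open>0 < \<eta>\<close> by (intro nn_integral_cong) (auto simp: indicator_def distrib_right add_ac)
    also have "\<dots> = A + ennreal \<eta> * B"
      unfolding A_def B_def by (simp add: nn_integral_add nn_integral_cmult distrib_left)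
    finally show ?thesis using approx[OF that] by simp
  qed
  have "B < \<infinity>" using fin by (simp add: B_def)
  then obtain b where b: "B = ennreal b" "0 \<le> b" by (cases B) auto
  have "ennreal \<bar>F l - F 0\<bar> \<le> A"
  proof (rule ennreal_le_epsilon)
    fix e :: real assume e: "0 < e"
    have "ennreal \<bar>F l - F 0\<bar> \<le> A + ennreal (e / (b + 1)) * B" using AB[of "e / (b + 1)"] e b by simp
    also have "ennreal (e / (b + 1)) * B = ennreal (e * (b / (b + 1)))"
      using b e by (simp flip: ennreal_mult)
    also have "\<dots> \<le> ennreal (e * 1)" using e b by (intro ennreal_leI mult_left_mono) auto
    finally show "ennreal \<bar>F l - F 0\<bar> \<le> A + ennreal e" by (simp add: add_left_mono order_trans)
  qed
  then show ?thesis by (simp add: A_def)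
qed

lemma increment_le_min:
  fixes F :: "real \<Rightarrow> real" and G H :: "real \<Rightarrow> ennreal"
  assumes [measurable]: "G \<in> borel_measurable lborel" "H \<in> borel_measurable lborel"
    and G: "\<And>s t. 0 \<le> s \<Longrightarrow> s < t \<Longrightarrow> t \<le> l \<Longrightarrow> ennreal \<bar>F t - F s\<bar> \<le> (\<integral>\<^sup>+x\<in>{s..t}. G x \<partial>lborel)"
    and H: "\<And>s t. 0 \<le> s \<Longrightarrow> s < t \<Longrightarrow> t \<le> l \<Longrightarrow> ennreal \<bar>F t - F s\<bar> \<le> (\<integral>\<^sup>+x\<in>{s..t}. H x \<partial>lborel)"
    and fin: "(\<integral>\<^sup>+x\<in>{0..l}. G x \<partial>lborel) < \<infinity>" "(\<integral>\<^sup>+x\<in>{0..l}. H x \<partial>lborel) < \<infinity>"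
    and "0 < l"
  shows "ennreal \<bar>F l - F 0\<bar> \<le> (\<integral>\<^sup>+x\<in>{0..l}. min (G x) (H x) \<partial>lborel)"
proof -
  define E where "E = {x. G x \<le> H x}"
  have E: "E \<in> sets lebesgue"
  proof -
    have "E \<in> sets lborel" unfolding E_def by (simp add: space_lborel[symmetric] del: space_lborel) measurable
    then show ?thesis by simp
  qed
  \<comment> \<open>This notion of measurability unfolds to continuous functions converging almost
    everywhere to the indicator of \<open>E\<close>. Clamping them to [0,1] keeps the limit.\<close>
  then have "(\<lambda>x. 1::real) measurable_on E" by simp
  then obtain Z and \<psi>0 :: "nat \<Rightarrow> real \<Rightarrow> real" where Z: "negligible Z" and \<psi>0: "\<And>n. continuous_on UNIV (\<psi>0 n)"
    "\<And>x. x \<notin> Z \<Longrightarrow> (\<lambda>n. \<psi>0 n x) \<longlonglongrightarrow> (if x \<in> E then 1 else 0)"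
    unfolding measurable_on_def by blast
  define \<psi> where "\<psi> n x = max 0 (min 1 (\<psi>0 n x))" for n x
  have c: "continuous_on UNIV (\<psi> n)" for n
    unfolding \<psi>_def by (intro continuous_intros \<psi>0)
  have \<psi>01: "0 \<le> \<psi> n x \<and> \<psi> n x \<le> 1" for n x by (simp add: \<psi>_def)
  have lim: "(\<lambda>n. \<psi> n x) \<longlonglongrightarrow> indicator E x" if "x \<notin> Z" for x
  proof -
    have "(\<lambda>n. \<psi> n x) \<longlonglongrightarrow> max 0 (min 1 (if x \<in> E then 1 else 0))"
      unfolding \<psi>_def by (intro tendsto_intros \<psi>0(2) that)
    then show ?thesis by (auto simp: indicator_def split: if_splits)
  qed
  have [measurable]: "\<psi> n \<in> borel_measurable lborel" for n
    using borel_measurable_continuous_onI[OF c] by simp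
  have "AE x in lebesgue. x \<notin> Z"
    using Z by (intro AE_not_in) (simp add: negligible_iff_null_sets)
  then have aeZ: "AE x in lborel. x \<notin> Z" by (simp add: AE_completion_iff)
  have aefin: "AE x in lborel. G x * indicator {0..l} x \<noteq> \<infinity>" "AE x in lborel. H x * indicator {0..l} x \<noteq> \<infinity>"
    using fin by (intro nn_integral_PInf_AE; simp)+
  have "(\<lambda>n. \<integral>\<^sup>+x\<in>{0..l}. (ennreal (\<psi> n x) * G x + ennreal (1 - \<psi> n x) * H x) \<partial>lborel)
      \<longlonglongrightarrow> (\<integral>\<^sup>+x\<in>{0..l}. min (G x) (H x) \<partial>lborel)"
  proof (rule nn_integral_dominated_convergence[where w="\<lambda>x. G x * indicator {0..l} x + H x * indicator {0..l} x"])
    show "(\<integral>\<^sup>+x. (G x * indicator {0..l} x + H x * indicator {0..l} x) \<partial>lborel) < \<infinity>"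
      using fin by (simp add: nn_integral_add)
    show "AE x in lborel. (ennreal (\<psi> n x) * G x + ennreal (1 - \<psi> n x) * H x) * indicator {0..l} x
        \<le> G x * indicator {0..l} x + H x * indicator {0..l} x" for n
    proof (rule AE_I2)
      fix x
      have "ennreal (\<psi> n x) * G x \<le> 1 * G x" "ennreal (1 - \<psi> n x) * H x \<le> 1 * H x"
        using \<psi>01[of n x] by (intro mult_right_mono; simp add: ennreal_le_1)+
      then show "(ennreal (\<psi> n x) * G x + ennreal (1 - \<psi> n x) * H x) * indicator {0..l} x
        \<le> G x * indicator {0..l} x + H x * indicator {0..l} x"
        by (auto simp: indicator_def intro: add_mono)
    qed
    show "AE x in lborel. (\<lambda>n. (ennreal (\<psi> n x) * G x + ennreal (1 - \<psi> n x) * H x) * indicator {0..l} x)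
        \<longlonglongrightarrow> min (G x) (H x) * indicator {0..l} x"
      using aeZ aefin
    proof eventually_elim
      case (elim x)
      show ?case
      proof (cases "x \<in> {0..l}")
        case True
        then have f: "G x < top" "H x < top" using elim by (auto simp: less_top)
        have "(\<lambda>n. G x * ennreal (\<psi> n x) + H x * ennreal (1 - \<psi> n x)) \<longlonglongrightarrow>
            G x * ennreal (indicator E x) + H x * ennreal (1 - indicator E x)"
          by (intro tendsto_add ennreal_tendsto_cmult f tendsto_ennrealI tendsto_diff tendsto_const lim[OF elim(1)])
        moreover have "G x * ennreal (indicator E x) + H x * ennreal (1 - indicator E x) = min (G x) (H x)"
          by (auto simp: E_def indicator_def min_def)
        ultimately show ?thesis using True by (simp add: mult.commute)
      qed auto
    qed
  qed measurable
  moreover have "ennreal \<bar>F l - F 0\<bar> \<le>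
      (\<integral>\<^sup>+x\<in>{0..l}. (ennreal (\<psi> n x) * G x + ennreal (1 - \<psi> n x) * H x) \<partial>lborel)" for n
    by (rule increment_le_continuous_mix[OF assms(1,2) G H fin c \<psi>01 \<open>0 < l\<close>])
  ultimately show ?thesis by (intro tendsto_lowerbound[OF _ always_eventually]) auto
qed

lemma real_endpoint_diff:
  assumes "endpoint_diff u \<gamma> < \<infinity>"
  shows "endpoint_diff u \<gamma> = ennreal \<bar>real_of_ereal (u (pathfinish \<gamma>)) - real_of_ereal (u (pathstart \<gamma>))\<bar>"
  using assms unfolding endpoint_diff_def
  by (cases "u (pathfinish \<gamma>)"; cases "u (pathstart \<gamma>)") (auto split: if_splits simp: e2ennreal_ereal)

lemma subcurve_finite:
  assumes "\<gamma> \<in> rectifiable_curves N" "\<gamma>' \<in> rectifiable_curves N" "0 \<le> s" "s < t" "t \<le> arc_length \<gamma>"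
    and "line_integral \<rho> \<gamma>' = (\<integral>\<^sup>+x\<in>{s..t}. \<rho> (arc_length_param \<gamma> x) \<partial>lborel)"
  shows "line_integral \<rho> \<gamma>' \<le> line_integral \<rho> \<gamma>"
proof -
  have "(\<integral>\<^sup>+x\<in>{s..t}. \<rho> (arc_length_param \<gamma> x) \<partial>lborel) \<le> line_integral \<rho> \<gamma>"
    unfolding line_integral_def using assms(3-5)
    by (intro nn_integral_mono) (auto simp: indicator_def arc_length_def)
  then show ?thesis by (simp add: assms(6))
qed

lemma weak_upper_gradient_measurable: "weak_upper_gradient p N u g \<Longrightarrow> g \<in> borel_measurable N"
  by (simp add: weak_upper_gradient_def)

text \<open>Along a good curve \<open>u\<close> is finite, and its increment over every subarc is
  bounded by the integrals of both \<open>g\<close> and \<open>h\<close> over that subarc;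
  \<open>increment_le_min\<close> then applies to \<open>u\<close> as a function of arc
  length.\<close>

lemma weak_upper_gradient_min:
  assumes p: "1 < p" and N: "sets N = sets (restrict_space borel (space N))"
    and g: "weak_upper_gradient p N u g" "g \<in> Lp p N" and h: "weak_upper_gradient p N u h" "h \<in> Lp p N"
  shows "weak_upper_gradient p N u (\<lambda>x. min (g x) (h x))"
proof -
  obtain \<rho>1 \<rho>2 where \<rho>1: "\<rho>1 \<in> Lp p N"
      "\<And>\<gamma>. \<gamma> \<in> rectifiable_curves N \<Longrightarrow> line_integral \<rho>1 \<gamma> < \<infinity> \<Longrightarrow> endpoint_diff u \<gamma> \<le> line_integral g \<gamma>"
    and \<rho>2: "\<rho>2 \<in> Lp p N"
      "\<And>\<gamma>. \<gamma> \<in> rectifiable_curves N \<Longrightarrow> line_integral \<rho>2 \<gamma> < \<infinity> \<Longrightarrow> endpoint_diff u \<gamma> \<le> line_integral h \<gamma>"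
    using g(1) h(1) unfolding weak_upper_gradient_iff[OF p N] by blast
  \<comment> \<open>\<open>g\<close> and \<open>h\<close> are included so that their own integrals
    along the remaining curves are finite, as \<open>increment_le_min\<close> requires.\<close>
  define \<rho> where "\<rho> x = (g x + h x) + (\<rho>1 x + \<rho>2 x)" for x
  have \<rho>: "\<rho> \<in> Lp p N" unfolding \<rho>_def[abs_def] using p by (intro Lp_add g h \<rho>1 \<rho>2) auto
  note [measurable] = Lp_measurable[OF g(2)] Lp_measurable[OF h(2)]
  have "endpoint_diff u \<gamma> \<le> line_integral (\<lambda>x. min (g x) (h x)) \<gamma>"
    if \<gamma>: "\<gamma> \<in> rectifiable_curves N" and fin: "line_integral \<rho> \<gamma> < \<infinity>" for \<gamma>
  proof -
    define l where "l = arc_length \<gamma>"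
    define c where "c = arc_length_param \<gamma>"
    define F where "F x = real_of_ereal (u (c x))" for x
    define G H where "G x = g (c x) * indicator {0..l} x" and "H x = h (c x) * indicator {0..l} x" for x
    have m: "(\<lambda>x. k (c x) * indicator {0..l} x) \<in> borel_measurable lborel" if "k \<in> borel_measurable N" for k :: "_ \<Rightarrow> ennreal"
      using line_integral_measurable[OF \<gamma> N that]
      by (subst (asm) borel_measurable_restrict_space_iff_ennreal) (auto simp: c_def l_def)
    have ge: "line_integral \<rho>1 \<gamma>' \<le> line_integral \<rho> \<gamma>'" "line_integral \<rho>2 \<gamma>' \<le> line_integral \<rho> \<gamma>'"
        "line_integral g \<gamma>' \<le> line_integral \<rho> \<gamma>'" "line_integral h \<gamma>' \<le> line_integral \<rho> \<gamma>'"
      if "\<gamma>' \<in> rectifiable_curves N" for \<gamma>'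
      by (rule line_integral_mono[OF that], simp add: \<rho>_def add_increasing add_increasing2)+
    have sub: "ennreal \<bar>F t - F s\<bar> \<le> (\<integral>\<^sup>+x\<in>{s..t}. G x \<partial>lborel)" "ennreal \<bar>F t - F s\<bar> \<le> (\<integral>\<^sup>+x\<in>{s..t}. H x \<partial>lborel)"
      if st: "0 \<le> s" "s < t" "t \<le> l" for s t
    proof -
      obtain \<gamma>' where \<gamma>': "\<gamma>' \<in> rectifiable_curves N" "pathstart \<gamma>' = c s" "pathfinish \<gamma>' = c t"
        and li: "\<And>g. g \<in> borel_measurable N \<Longrightarrow> line_integral g \<gamma>' = (\<integral>\<^sup>+x\<in>{s..t}. g (c x) \<partial>lborel)"
        using rectifiable_subcurve[OF \<gamma> st(1,2) _ N] st(3) unfolding c_def l_def by blast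
      have "line_integral \<rho> \<gamma>' \<le> line_integral \<rho> \<gamma>"
        using st li[OF Lp_measurable[OF \<rho>]] by (intro subcurve_finite[OF \<gamma> \<gamma>'(1)]) (auto simp: l_def c_def)
      then have fin': "line_integral \<rho> \<gamma>' < \<infinity>" using fin by (rule le_less_trans)
      have 1: "endpoint_diff u \<gamma>' \<le> line_integral g \<gamma>'" and 2: "endpoint_diff u \<gamma>' \<le> line_integral h \<gamma>'"
        by (rule \<rho>1(2)[OF \<gamma>'(1) le_less_trans[OF ge(1)[OF \<gamma>'(1)] fin']],
            rule \<rho>2(2)[OF \<gamma>'(1) le_less_trans[OF ge(2)[OF \<gamma>'(1)] fin']])
      have "endpoint_diff u \<gamma>' < \<infinity>" by (rule le_less_trans[OF 1 le_less_trans[OF ge(3)[OF \<gamma>'(1)] fin']])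
      then have d: "endpoint_diff u \<gamma>' = ennreal \<bar>F t - F s\<bar>"
        by (subst real_endpoint_diff) (auto simp: F_def \<gamma>')
      have "(\<integral>\<^sup>+x\<in>{s..t}. g (c x) \<partial>lborel) = (\<integral>\<^sup>+x\<in>{s..t}. G x \<partial>lborel)"
        "(\<integral>\<^sup>+x\<in>{s..t}. h (c x) \<partial>lborel) = (\<integral>\<^sup>+x\<in>{s..t}. H x \<partial>lborel)"
        using st by (auto intro!: nn_integral_cong simp: G_def H_def indicator_def)
      then show "ennreal \<bar>F t - F s\<bar> \<le> (\<integral>\<^sup>+x\<in>{s..t}. G x \<partial>lborel)" "ennreal \<bar>F t - F s\<bar> \<le> (\<integral>\<^sup>+x\<in>{s..t}. H x \<partial>lborel)"
        using 1 2 d li[of g] li[of h] by auto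
    qed
    have li: "line_integral k \<gamma> = (\<integral>\<^sup>+x\<in>{0..l}. k (c x) \<partial>lborel)" for k
      by (simp add: line_integral_def l_def c_def arc_length_def)
    have GH: "(\<integral>\<^sup>+x\<in>{0..l}. G x \<partial>lborel) = line_integral g \<gamma>" "(\<integral>\<^sup>+x\<in>{0..l}. H x \<partial>lborel) = line_integral h \<gamma>"
      unfolding li by (auto intro!: nn_integral_cong simp: G_def H_def indicator_def)
    have l0: "0 < l" using arc_length_pos[OF \<gamma>] by (simp add: l_def)
    have "ennreal \<bar>F l - F 0\<bar> \<le> (\<integral>\<^sup>+x\<in>{0..l}. min (G x) (H x) \<partial>lborel)"
    proof (rule increment_le_min[OF _ _ sub])
      show "G \<in> borel_measurable lborel" "H \<in> borel_measurable lborel"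
        unfolding G_def[abs_def] H_def[abs_def] by (intro m; measurable)+
    qed (use GH le_less_trans[OF ge(3)[OF \<gamma>] fin] le_less_trans[OF ge(4)[OF \<gamma>] fin] l0 in auto)
    also have "\<dots> = line_integral (\<lambda>x. min (g x) (h x)) \<gamma>"
      unfolding li by (auto intro!: nn_integral_cong simp: G_def H_def indicator_def)
    finally have *: "ennreal \<bar>F l - F 0\<bar> \<le> line_integral (\<lambda>x. min (g x) (h x)) \<gamma>" .
    have "endpoint_diff u \<gamma> \<le> line_integral g \<gamma>" by (rule \<rho>1(2)[OF \<gamma> le_less_trans[OF ge(1)[OF \<gamma>] fin]])
    then have "endpoint_diff u \<gamma> < \<infinity>" by (rule le_less_trans[OF _ le_less_trans[OF ge(3)[OF \<gamma>] fin]])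
    then have "endpoint_diff u \<gamma> = ennreal \<bar>F l - F 0\<bar>"
      by (subst real_endpoint_diff)
        (auto simp: F_def c_def l_def arc_length_param_0[OF \<gamma>] arc_length_param_arc_length[OF \<gamma>])
    with * show ?thesis by simp
  qed
  then show ?thesis
    unfolding weak_upper_gradient_iff[OF p N] by (intro conjI bexI[OF _ \<rho>] ballI impI) measurable
qed

lemma weak_upper_gradient_INF:
  assumes p: "1 < p" and N: "sets N = sets (restrict_space borel (space N))"
    and g: "\<And>n::nat. weak_upper_gradient p N u (g n)" "\<And>n. g n \<in> Lp p N" "\<And>x. decseq (\<lambda>n. g n x)"
  shows "weak_upper_gradient p N u (\<lambda>x. INF n. g n x)"
proof -
  have [measurable]: "g n \<in> borel_measurable N" for n using g(2) Lp_measurable by blast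
  have "\<exists>\<rho>\<in>Lp p N. \<forall>\<gamma>\<in>rectifiable_curves N. line_integral \<rho> \<gamma> < \<infinity> \<longrightarrow> endpoint_diff u \<gamma> \<le> line_integral (g n) \<gamma>" for n
    using g(1)[of n] unfolding weak_upper_gradient_iff[OF p N] by blast
  then obtain \<rho> where \<rho>: "\<And>n. \<rho> n \<in> Lp p N"
    "\<And>n \<gamma>. \<gamma> \<in> rectifiable_curves N \<Longrightarrow> line_integral (\<rho> n) \<gamma> < \<infinity> \<Longrightarrow> endpoint_diff u \<gamma> \<le> line_integral (g n) \<gamma>"
    by metis
  obtain \<sigma> c where \<sigma>: "\<sigma> \<in> Lp p N" and c: "\<And>n::nat. 0 < c n" "\<And>n x. ennreal (c n) * \<rho> n x \<le> \<sigma> x"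
    by (rule Lp_countable_dominating[where g=\<rho>, OF less_imp_le[OF p] \<rho>(1)]) blast
  \<comment> \<open>\<open>g 0\<close> is added because monotone convergence from above needs one
    finite integral.\<close>
  define \<tau> where "\<tau> x = \<sigma> x + g 0 x" for x
  have \<tau>: "\<tau> \<in> Lp p N" unfolding \<tau>_def[abs_def] using p by (intro Lp_add \<sigma> g) auto
  have "endpoint_diff u \<gamma> \<le> line_integral (\<lambda>x. INF n. g n x) \<gamma>"
    if \<gamma>: "\<gamma> \<in> rectifiable_curves N" and fin: "line_integral \<tau> \<gamma> < \<infinity>" for \<gamma>
  proof -
    have "line_integral \<sigma> \<gamma> \<le> line_integral \<tau> \<gamma>" "line_integral (g 0) \<gamma> \<le> line_integral \<tau> \<gamma>"
      by (rule line_integral_mono[OF \<gamma>], simp add: \<tau>_def)+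
    then have f: "line_integral \<sigma> \<gamma> < \<infinity>" "line_integral (g 0) \<gamma> < \<infinity>" using fin le_less_trans by blast+
    have le: "endpoint_diff u \<gamma> \<le> line_integral (g n) \<gamma>" for n
    proof (rule \<rho>(2)[OF \<gamma>])
      have "ennreal (c n) * line_integral (\<rho> n) \<gamma> \<le> line_integral \<sigma> \<gamma>"
        unfolding line_integral_cmult[OF \<gamma> N Lp_measurable[OF \<rho>(1)], symmetric]
        by (rule line_integral_mono[OF \<gamma> c(2)])
      then have "ennreal (c n) * line_integral (\<rho> n) \<gamma> < \<infinity>" using f(1) by (rule le_less_trans)
      then show "line_integral (\<rho> n) \<gamma> < \<infinity>" using c(1)[of n] by (auto simp: ennreal_mult_less_top)
    qed
    have d: "decseq (\<lambda>n x. g n (arc_length_param \<gamma> x))"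
      by (rule decseq_SucI, rule le_funI, rule decseq_SucD[OF g(3)])
    have "(\<integral>\<^sup>+x. (INF n. g n (arc_length_param \<gamma> x)) \<partial>restrict_space lborel {0..arc_length \<gamma>}) =
        (INF n. \<integral>\<^sup>+x. g n (arc_length_param \<gamma> x) \<partial>restrict_space lborel {0..arc_length \<gamma>})"
      by (rule nn_integral_monotone_convergence_INF_decseq[of "\<lambda>n x. g n (arc_length_param \<gamma> x)" _ 0])
        (use d f in \<open>auto simp: line_integral_eq[OF \<gamma>] intro!: line_integral_measurable[OF \<gamma> N]\<close>)
    then have "line_integral (\<lambda>x. INF n. g n x) \<gamma> = (INF n. line_integral (g n) \<gamma>)"
      by (simp add: line_integral_eq[OF \<gamma>])
    then show ?thesis using le by (simp add: le_INF_iff)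
  qed
  then show ?thesis
    unfolding weak_upper_gradient_iff[OF p N] by (intro conjI bexI[OF _ \<tau>] ballI impI) measurable
qed

theorem minimal_weak_upper_gradient_exists:
  assumes p: "1 < p" and N: "sets N = sets (restrict_space borel (space N))"
    and g: "weak_upper_gradient p N u g" "g \<in> Lp p N"
  shows "\<exists>g. minimal_weak_upper_gradient p N u g"
proof -
  define S where "S = {g. weak_upper_gradient p N u g \<and> g \<in> Lp p N}"
  define E where "E g = (\<integral>\<^sup>+x. ennreal_powr (g x) p \<partial>N)" for g :: "'a \<Rightarrow> ennreal"
  have minS: "(\<lambda>x. min (g x) (h x)) \<in> S" if "g \<in> S" "h \<in> S" for g h
  proof -
    have w: "weak_upper_gradient p N u (\<lambda>x. min (g x) (h x))"
      using that by (intro weak_upper_gradient_min[OF p N]) (auto simp: S_def)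
    moreover from this have "(\<lambda>x. min (g x) (h x)) \<in> Lp p N"
      using that p by (intro Lp_mono[OF _ weak_upper_gradient_measurable[OF w], of g]) (simp_all add: S_def)
    ultimately show ?thesis by (simp add: S_def)
  qed
  obtain e where e: "range e \<subseteq> E ` S" "Inf (E ` S) = (INF i::nat. e i)"
    using ennreal_Inf_countable_INF[of "E ` S"] g by (auto simp: S_def)
  have "\<forall>n. \<exists>k. k \<in> S \<and> e n = E k" using e(1) by blast
  then obtain k where k: "\<And>n. k n \<in> S" "\<And>n. e n = E (k n)" by metis
  define m where "m = rec_nat (k 0) (\<lambda>i h x. min (h x) (k (Suc i) x))"
  have m0: "m 0 = k 0" and ms: "m (Suc i) = (\<lambda>x. min (m i x) (k (Suc i) x))" for i by (auto simp: m_def)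
  have mS: "m n \<in> S" for n by (induction n) (auto simp: m0 ms k minS)
  have mle: "m n x \<le> k n x" for n x by (cases n) (auto simp: m0 ms)
  have dec: "decseq (\<lambda>n. m n x)" for x by (intro decseq_SucI) (auto simp: ms)
  define h where "h x = (INF n. m n x)" for x
  have hw: "weak_upper_gradient p N u h"
    unfolding h_def[abs_def] using mS dec by (intro weak_upper_gradient_INF[OF p N]) (auto simp: S_def)
  have hL: "h \<in> Lp p N"
    using mS[of 0] p by (intro Lp_mono[OF _ weak_upper_gradient_measurable[OF hw], of "m 0"])
      (simp_all add: h_def S_def INF_lower[of 0 UNIV "\<lambda>n. m n _", simplified])
  have hE: "E h \<le> E g" if "g \<in> S" for g
  proof -
    have "E h \<le> E (k n)" for n unfolding E_def
      using mle p by (intro nn_integral_mono ennreal_powr_mono) (simp_all add: h_def INF_lower2[of n])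
    then have "E h \<le> Inf (E ` S)" unfolding e(2) k(2) by (intro INF_greatest)
    also have "\<dots> \<le> E g" using that by (intro INF_lower)
    finally show ?thesis .
  qed
  \<comment> \<open>\<open>min (h x) (g x)\<close> is a competitor below \<open>h\<close>, and
    \<open>h\<close> has least energy; so the \<open>p\<close>th powers of the two functions agree
    almost everywhere.\<close>
  have "AE x in N. h x \<le> g x" if g: "weak_upper_gradient p N u g" "g \<in> Lp p N" for g
  proof -
    let ?f = "\<lambda>x. min (h x) (g x)"
    have S: "?f \<in> S" using minS[of h g] hw hL g by (simp add: S_def)
    have [measurable]: "h \<in> borel_measurable N" "g \<in> borel_measurable N" using hL g Lp_measurable by auto
    have fL: "(\<integral>\<^sup>+x. ennreal_powr (?f x) p \<partial>N) < \<infinity>" using S by (simp add: S_def Lp_def)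
    have "(\<integral>\<^sup>+x. ennreal_powr (h x) p - ennreal_powr (?f x) p \<partial>N) =
      (\<integral>\<^sup>+x. ennreal_powr (h x) p \<partial>N) - (\<integral>\<^sup>+x. ennreal_powr (?f x) p \<partial>N)"
      using fL p by (intro nn_integral_diff) (auto intro!: ennreal_powr_mono AE_I2)
    also have "\<dots> = 0" using hE[OF S] fL unfolding E_def
      by (simp add: diff_eq_0_iff_ennreal)
    finally have "AE x in N. ennreal_powr (h x) p - ennreal_powr (?f x) p = 0"
      by (subst (asm) nn_integral_0_iff_AE) auto
    moreover have "AE x in N. ennreal_powr (?f x) p \<noteq> \<infinity>"
      by (rule nn_integral_PInf_AE) (use fL in auto)
    ultimately show ?thesis
    proof eventually_elim
      case (elim x)
      then have "ennreal_powr (h x) p \<le> ennreal_powr (?f x) p" by (auto simp: diff_eq_0_iff_ennreal less_top)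
      then have "ennreal_powr (ennreal_powr (h x) p) (1 / p) \<le> ennreal_powr (ennreal_powr (?f x) p) (1 / p)"
        by (rule ennreal_powr_mono[rotated]) (use p in auto)
      then show ?case using p by (simp add: ennreal_powr_inverse)
    qed
  qed
  then have "minimal_weak_upper_gradient p N u h"
    unfolding minimal_weak_upper_gradient_def using hw hL by (simp add: Lp_def weak_upper_gradient_measurable)
  then show ?thesis by blast
qed

definition dirichlet_energy :: "real \<Rightarrow> 'a::metric_space measure \<Rightarrow> ('a \<Rightarrow> ereal) \<Rightarrow> ennreal" where
  "dirichlet_energy p N u = (\<integral>\<^sup>+x. ennreal_powr (min_gradient p N u x) p \<partial>N)"

lemma dirichlet_energy_le:
  assumes p: "1 < p" and N: "sets N = sets (restrict_space borel (space N))"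
    and g: "weak_upper_gradient p N u g" "g \<in> Lp p N"
  shows "dirichlet_energy p N u \<le> (\<integral>\<^sup>+x. ennreal_powr (g x) p \<partial>N)"
proof -
  have "minimal_weak_upper_gradient p N u (min_gradient p N u)"
    unfolding min_gradient_def by (rule someI_ex[OF minimal_weak_upper_gradient_exists[OF assms]])
  then have "AE x in N. min_gradient p N u x \<le> g x"
    using g by (simp add: minimal_weak_upper_gradient_def Lp_def)
  then show ?thesis unfolding dirichlet_energy_def
    using p by (intro nn_integral_mono_AE) (auto elim!: eventually_mono intro: ennreal_powr_mono)
qed

text \<open>The Poincare inequality is stated for upper gradients, not for weak ones; the minimal
  weak gradient is therefore replaced by an upper gradient of almost the same energy.\<close>

lemma dirichlet_energy_approx:
  assumes p: "1 < p" and N: "sets N = sets (restrict_space borel (space N))"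
    and g: "weak_upper_gradient p N u g" "g \<in> Lp p N" and "0 < \<epsilon>"
  obtains g' where "upper_gradient N u g'" "g' \<in> Lp p N"
    "(\<integral>\<^sup>+x. ennreal_powr (g' x) p \<partial>N) \<le> dirichlet_energy p N u + ennreal \<epsilon>"
proof -
  have "minimal_weak_upper_gradient p N u (min_gradient p N u)"
    unfolding min_gradient_def by (rule someI_ex[OF minimal_weak_upper_gradient_exists[OF assms(1-4)]])
  then have "weak_upper_gradient p N u (min_gradient p N u)" "min_gradient p N u \<in> Lp p N"
    using weak_upper_gradient_measurable by (auto simp add: minimal_weak_upper_gradient_def Lp_def)
  from weak_imp_upper_gradient[OF p N this \<open>0 < \<epsilon>\<close>] that show ?thesis
    unfolding dirichlet_energy_def by blast
qed

section \<open>Telescoping limits, doubling measures and nets\<close>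

lemma summable_telescope_limit:
  fixes s a :: "nat \<Rightarrow> real"
  assumes "\<And>j. \<bar>s (Suc j) - s j\<bar> \<le> c * a j" "summable a"
  shows "convergent s" "\<bar>lim s - s k\<bar> \<le> c * (\<Sum>j. a (j + k))"
proof -
  have "summable (\<lambda>j. s (Suc j) - s j)"
    by (rule summable_comparison_test'[OF summable_mult[OF assms(2), of c]]) (use assms(1) in auto)
  then have "convergent (\<lambda>n. \<Sum>j<n. s (Suc j) - s j)" by (simp add: summable_iff_convergent)
  then have "convergent (\<lambda>n. s n - s 0)" by (simp add: sum_lessThan_telescope)
  then have "convergent (\<lambda>n. (s n - s 0) + s 0)" by (intro convergent_add convergent_const)
  then show conv: "convergent s" by simp
  have sk: "summable (\<lambda>j. a (j + k))" using assms(2) by (simp add: summable_iff_shift)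
  have a0: "0 \<le> c * a j" for j using assms(1)[of j] by linarith
  have "\<bar>s (n + k) - s k\<bar> \<le> c * (\<Sum>j. a (j + k))" for n
  proof -
    have "s (n + k) - s k = (\<Sum>j<n. s (Suc j + k) - s (j + k))"
      using sum_lessThan_telescope[of "\<lambda>j. s (j + k)" n] by simp
    also have "\<bar>\<dots>\<bar> \<le> (\<Sum>j<n. c * a (j + k))"
      by (intro order_trans[OF sum_abs] sum_mono) (use assms(1) in auto)
    also have "\<dots> \<le> (\<Sum>j. c * a (j + k))"
      by (intro sum_le_suminf summable_mult sk) (auto intro: a0)
    also have "\<dots> = c * (\<Sum>j. a (j + k))" by (rule suminf_mult[OF sk])
    finally show ?thesis .
  qed
  moreover have "(\<lambda>n. \<bar>s (n + k) - s k\<bar>) \<longlonglongrightarrow> \<bar>lim s - s k\<bar>"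
    using LIMSEQ_ignore_initial_segment[OF convergent_LIMSEQ_iff[THEN iffD1, OF conv], of k]
    by (intro tendsto_intros)
  ultimately show "\<bar>lim s - s k\<bar> \<le> c * (\<Sum>j. a (j + k))"
    by (intro tendsto_upperbound[OF _ always_eventually]) auto
qed

text \<open>\<open>m\<close> will be the completion of a restricted measure and so is no Borel
  measure on the whole type: only relatively open subsets of \<open>\<Omega>\<close> are required to
  be measurable. Doubling is required on the closure because boundary points occur as
  centres.\<close>

locale doubling_domain =
  fixes \<Omega> :: "'a::metric_space set" and m :: "'a measure" and K :: real
  assumes space_m: "space m = \<Omega>" and finite_m: "finite_measure m"
    and sets_m: "\<And>U. open U \<Longrightarrow> U \<inter> \<Omega> \<in> sets m"
    and bounded_\<Omega>: "bounded \<Omega>" and nonempty: "\<Omega> \<noteq> {}" and K1: "1 \<le> K"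
    and ball_pos: "\<And>x r. x \<in> closure \<Omega> \<Longrightarrow> 0 < r \<Longrightarrow> 0 < measure m (ball x r \<inter> \<Omega>)"
    and ball_dbl: "\<And>x r. x \<in> closure \<Omega> \<Longrightarrow> 0 < r \<Longrightarrow>
      measure m (ball x (2 * r) \<inter> \<Omega>) \<le> K * measure m (ball x r \<inter> \<Omega>)"
begin

interpretation m: finite_measure m by (rule finite_m)

abbreviation "B x r \<equiv> ball x r \<inter> \<Omega>"
abbreviation "mm x r \<equiv> measure m (B x r)"
abbreviation "ib f x r \<equiv> (LINT y:B x r|m. f y)"
abbreviation "avg w x r \<equiv> ib w x r / mm x r"

lemma sets_B [measurable, simp]: "B x r \<in> sets m" by (rule sets_m) simp

lemma closure_I: "x \<in> \<Omega> \<Longrightarrow> x \<in> closure \<Omega>" using closure_subset by auto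

lemma set_integrable_B: "integrable m (f::_ \<Rightarrow> real) \<Longrightarrow> set_integrable m (B x r) f"
  unfolding set_integrable_def by (rule integrable_mult_indicator[OF sets_B])

lemma mm_mono: "B x r \<subseteq> B y s \<Longrightarrow> mm x r \<le> mm y s"
  by (rule m.finite_measure_mono) auto

lemma set_lint_mono_set:
  fixes f :: "'a \<Rightarrow> real"
  assumes "A \<in> sets m" "A' \<in> sets m" "A \<subseteq> A'" "integrable m f" "\<And>y. 0 \<le> f y"
  shows "(LINT y:A|m. f y) \<le> (LINT y:A'|m. f y)"
  unfolding set_lebesgue_integral_def using assms
  by (intro integral_mono integrable_mult_indicator) (auto simp: indicator_def)

lemma ib_mono_set: "B x r \<subseteq> B y s \<Longrightarrow> integrable m f \<Longrightarrow> (\<And>y. 0 \<le> (f y :: real)) \<Longrightarrow> ib f x r \<le> ib f y s"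
  by (rule set_lint_mono_set) auto

lemma ib_nonneg: "(\<And>y. 0 \<le> f y) \<Longrightarrow> 0 \<le> ib (f::_ \<Rightarrow> real) x r"
  unfolding set_lebesgue_integral_def by (intro Bochner_Integration.integral_nonneg) auto

lemma integrable_indicator_B: "integrable m (h::_ \<Rightarrow> real) \<Longrightarrow> integrable m (\<lambda>y. indicator (B x r) y * h y)"
  by (drule integrable_mult_indicator[OF sets_B]) simp

lemma B_subset: "dist x y + r \<le> s \<Longrightarrow> B x r \<subseteq> B y s"
  by (auto simp: dist_commute) (smt (verit) dist_commute dist_triangle)

lemma mm_pow:
  assumes "x \<in> closure \<Omega>" "0 < r"
  shows "mm x (2 ^ k * r) \<le> K ^ k * mm x r"
proof (induction k)
  case (Suc k)
  have "mm x (2 ^ Suc k * r) \<le> K * mm x (2 ^ k * r)"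
    using ball_dbl[OF assms(1), of "2 ^ k * r"] assms(2) by (simp add: mult.assoc)
  also have "\<dots> \<le> K * (K ^ k * mm x r)" using Suc K1 by (intro mult_left_mono) auto
  finally show ?case by (simp add: mult.assoc)
qed simp

lemma mm_le_pow:
  assumes "x \<in> closure \<Omega>" "y \<in> closure \<Omega>" "0 < r" "dist x y + s \<le> 2 ^ k * r"
  shows "mm x s \<le> K ^ k * mm y r"
  using mm_mono[OF B_subset[OF assms(4)]] mm_pow[OF assms(2,3), of k] by linarith

lemma \<Omega>_in_ball: "\<exists>D>0. \<forall>x\<in>closure \<Omega>. \<Omega> \<subseteq> ball x D"
proof -
  obtain d where d: "\<And>x y. x \<in> closure \<Omega> \<Longrightarrow> y \<in> closure \<Omega> \<Longrightarrow> dist x y \<le> d"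
    using bounded_closure[OF bounded_\<Omega>] by (auto simp: bounded_two_points)
  have "\<forall>x\<in>closure \<Omega>. \<Omega> \<subseteq> ball x (\<bar>d\<bar> + 1)"
    using d closure_I by (fastforce simp: abs_if)
  then show ?thesis by (intro exI[of _ "\<bar>d\<bar> + 1"]) auto
qed

lemma measure_\<Omega>_pos: "0 < measure m \<Omega>"
proof -
  obtain x where "x \<in> \<Omega>" using nonempty by auto
  then have "0 < mm x 1" by (intro ball_pos closure_I) auto
  also have "\<dots> \<le> measure m \<Omega>" using sets_m[of UNIV] by (intro m.finite_measure_mono) auto
  finally show ?thesis .
qed

text \<open>After finitely many doublings a ball of radius \<open>r\<close> covers
  \<open>\<Omega>\<close>, and their number does not depend on the centre.\<close>

lemma mm_lower:
  assumes "0 < r"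
  obtains c where "0 < c" "\<And>x. x \<in> closure \<Omega> \<Longrightarrow> c \<le> mm x r"
proof -
  obtain D where D: "0 < D" "\<And>x. x \<in> closure \<Omega> \<Longrightarrow> \<Omega> \<subseteq> ball x D" using \<Omega>_in_ball by auto
  obtain k where k: "D / r < 2 ^ k" using real_arch_pow[of 2 "D / r"] by auto
  have "measure m \<Omega> / K ^ k \<le> mm x r" if "x \<in> closure \<Omega>" for x
  proof -
    have "\<Omega> \<subseteq> ball x (2 ^ k * r)" using D(2)[OF that] k assms by (force simp: field_simps)
    then have "mm x (2 ^ k * r) = measure m \<Omega>" by (simp add: Int_absorb1)
    then show ?thesis using mm_pow[OF that assms, of k] K1 by (simp add: field_simps)
  qed
  then show ?thesis using that[of "measure m \<Omega> / K ^ k"] measure_\<Omega>_pos K1 by auto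
qed

definition separated :: "real \<Rightarrow> 'a set \<Rightarrow> bool" where
  "separated r F \<longleftrightarrow> finite F \<and> F \<subseteq> closure \<Omega> \<and> (\<forall>x\<in>F. \<forall>y\<in>F. x \<noteq> y \<longrightarrow> r \<le> dist x y)"

lemma separated_sum_le:
  assumes F: "separated r F" and sub: "\<And>x. x \<in> F \<Longrightarrow> B x (r / 2) \<subseteq> A" and "A \<in> sets m"
  shows "(\<Sum>x\<in>F. mm x (r / 2)) \<le> measure m A"
proof -
  have "B x (r / 2) \<inter> B y (r / 2) = {}" if "x \<in> F" "y \<in> F" "x \<noteq> y" for x y
  proof -
    have "r \<le> dist x y" using F that by (auto simp: separated_def)
    then show ?thesis by auto (smt (verit) dist_triangle2 field_sum_of_halves dist_commute)
  qed
  then have "(\<Sum>x\<in>F. mm x (r / 2)) = measure m (\<Union>x\<in>F. B x (r / 2))"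
    using F by (intro m.finite_measure_finite_Union[symmetric])
      (auto simp: separated_def disjoint_family_on_def)
  also have "\<dots> \<le> measure m A" using sub assms(3) by (intro m.finite_measure_mono) auto
  finally show ?thesis .
qed

text \<open>A volume argument: the half balls of a separated set are disjoint and each has mass at
  least \<open>c\<close>, which bounds the cardinality. A separated subset of maximal cardinality is
  then a net.\<close>

lemma net_exists:
  assumes "S \<subseteq> closure \<Omega>" "0 < r"
  obtains F where "separated r F" "F \<subseteq> S" "S \<subseteq> (\<Union>x\<in>F. ball x r)"
proof -
  obtain c where c: "0 < c" "\<And>x. x \<in> closure \<Omega> \<Longrightarrow> c \<le> mm x (r / 2)"
    using mm_lower[of "r / 2"] assms(2) by auto
  obtain n :: nat where n: "measure m \<Omega> / c < n" using reals_Archimedean2 by blast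
  have bnd: "card F \<le> n" if "separated r F" for F
  proof -
    have "c * card F \<le> (\<Sum>x\<in>F. mm x (r / 2))"
      using sum_bounded_below[of F c "\<lambda>x. mm x (r / 2)"] c(2) that by (auto simp: separated_def mult.commute)
    also have "\<dots> \<le> measure m \<Omega>" using that sets_m[of UNIV] by (intro separated_sum_le) auto
    finally have "card F \<le> measure m \<Omega> / c" using c(1) by (simp add: field_simps)
    with n show ?thesis by linarith
  qed
  have "separated r {} \<and> {} \<subseteq> S" by (simp add: separated_def)
  then obtain F where F: "separated r F" "F \<subseteq> S" and max: "\<And>F'. separated r F' \<Longrightarrow> F' \<subseteq> S \<Longrightarrow> card F' \<le> card F"
    using ex_has_greatest_nat[of "\<lambda>F. separated r F \<and> F \<subseteq> S" "{}" card n] bnd by fastforce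
  have "S \<subseteq> (\<Union>x\<in>F. ball x r)"
  proof
    fix y assume y: "y \<in> S"
    show "y \<in> (\<Union>x\<in>F. ball x r)"
    proof (rule ccontr)
      assume n: "y \<notin> (\<Union>x\<in>F. ball x r)"
      then have "y \<notin> F" "separated r (insert y F)"
        using F y assms by (force simp: separated_def dist_commute not_less)+
      then show False using max[of "insert y F"] F y by (simp add: separated_def)
    qed
  qed
  then show ?thesis using that F by blast
qed

text \<open>The same volume argument inside one ball. The factor 8 is an upper bound for all
  enlargements of net balls that occur later.\<close>

lemma overlap_card:
  assumes F: "separated r F" and "0 < r"
  shows "card {x\<in>F. y \<in> ball x (8 * r)} \<le> K ^ 7"
proof (cases "{x\<in>F. y \<in> ball x (8 * r)} = {}")
  case False
  define F' where "F' = {x\<in>F. y \<in> ball x (8 * r)}"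
  obtain x0 where x0: "x0 \<in> F'" using False by (auto simp: F'_def)
  have sep: "separated r F'" using F by (auto simp: separated_def F'_def)
  have cl: "F' \<subseteq> closure \<Omega>" using sep by (simp add: separated_def)
  have d: "dist x x0 < 16 * r" if "x \<in> F'" for x
    using that x0 dist_triangle2[of x x0 y] by (auto simp: F'_def)
  have "card F' * (mm x0 (32 * r) / K ^ 7) \<le> (\<Sum>x\<in>F'. mm x (r / 2))"
  proof (rule sum_bounded_below)
    fix x assume x: "x \<in> F'"
    \<comment> \<open>The exponent 7: \<open>x\<close> is less than \<open>16 * r\<close> away from
      \<open>x0\<close>, and \<open>16 * r + 32 * r \<le> 2 ^ 7 * (r / 2)\<close>.\<close>
    have "mm x0 (32 * r) \<le> K ^ 7 * mm x (r / 2)"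
      using d[OF x] x x0 cl assms(2) by (intro mm_le_pow) (auto simp: dist_commute)
    then show "mm x0 (32 * r) / K ^ 7 \<le> mm x (r / 2)" using K1 by (simp add: field_simps)
  qed
  also have "\<dots> \<le> mm x0 (32 * r)"
  proof (rule separated_sum_le[OF sep])
    show "B x (r / 2) \<subseteq> B x0 (32 * r)" if "x \<in> F'" for x
      using d[OF that] assms(2) by (intro B_subset) auto
  qed simp
  finally have "card F' * (mm x0 (32 * r) / K ^ 7) \<le> mm x0 (32 * r)" .
  moreover have "0 < mm x0 (32 * r)" using x0 cl assms(2) by (intro ball_pos) auto
  ultimately show ?thesis using K1 unfolding F'_def[symmetric] by (simp add: field_simps)
next
  case True
  show ?thesis unfolding True using K1 by simp
qed

lemma overlap_sum:
  fixes h :: "'a \<Rightarrow> real"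
  assumes F: "separated r F" and "0 < r" "s \<le> 8 * r" "integrable m h" "\<And>y. 0 \<le> h y"
  shows "(\<Sum>x\<in>F. ib h x s) \<le> K ^ 7 * (LINT y|m. h y)"
proof -
  have "(\<Sum>x\<in>F. ib h x s) = (LINT y|m. (\<Sum>x\<in>F. indicator (B x s) y * h y))"
    unfolding set_lebesgue_integral_def using assms(4)
    by (subst Bochner_Integration.integral_sum) (auto intro: integrable_indicator_B)
  also have "\<dots> \<le> (LINT y|m. K ^ 7 * h y)"
  proof (rule integral_mono)
    fix y
    have fin: "finite F" using F by (simp add: separated_def)
    have "(\<Sum>x\<in>F. indicator (B x s) y) = (\<Sum>x\<in>F. if y \<in> B x s then 1 else 0 :: real)"
      by (intro sum.cong) (simp_all add: indicator_def)
    also have "\<dots> = (\<Sum>x\<in>{x\<in>F. y \<in> B x s}. 1)" by (rule sum.inter_filter[OF fin, symmetric])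
    also have "\<dots> = real (card {x\<in>F. y \<in> B x s})" by simp
    also have "\<dots> \<le> real (card {x\<in>F. y \<in> ball x (8 * r)})"
      using F assms(3) by (intro of_nat_mono card_mono) (auto simp: separated_def)
    also have "\<dots> \<le> K ^ 7" by (rule overlap_card[OF F assms(2)])
    finally show "(\<Sum>x\<in>F. indicator (B x s) y * h y) \<le> K ^ 7 * h y"
      unfolding sum_distrib_right[symmetric] by (intro mult_right_mono assms(5))
  qed (use assms(4) in \<open>auto intro!: integrable_indicator_B\<close>)
  finally show ?thesis by simp
qed

lemma overlap_sum_mm:
  assumes F: "separated r F" and "0 < r" "s \<le> 8 * r"
  shows "(\<Sum>x\<in>F. mm x s) \<le> K ^ 7 * measure m \<Omega>"
  using overlap_sum[OF assms, of "\<lambda>_. 1"] by (simp add: set_lebesgue_integral_def space_m)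

subsection \<open>Averages over balls\<close>

lemma avg_dev_le:
  assumes "integrable m w" "x \<in> closure \<Omega>" "0 < r"
  shows "\<bar>avg w x r - c\<bar> * mm x r \<le> ib (\<lambda>y. \<bar>w y - c\<bar>) x r"
proof -
  have i: "integrable m (\<lambda>y. w y - c)" using assms(1) by simp
  have eq: "(avg w x r - c) * mm x r = ib (\<lambda>y. w y - c) x r"
    using ball_pos[OF assms(2,3)]
    by (subst set_integral_diff) (auto simp: set_integrable_B assms(1) field_simps set_lebesgue_integral_def)
  have "\<bar>avg w x r - c\<bar> * mm x r = \<bar>(avg w x r - c) * mm x r\<bar>" by (simp add: abs_mult)
  also have "\<dots> = \<bar>ib (\<lambda>y. w y - c) x r\<bar>" unfolding eq ..
  also have "\<dots> \<le> ib (\<lambda>y. \<bar>w y - c\<bar>) x r"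
    using set_integral_norm_bound[OF set_integrable_B[OF i], of x r] by simp
  finally show ?thesis .
qed

lemma avg_abs_le:
  assumes "integrable m w" "x \<in> closure \<Omega>" "0 < r"
  shows "\<bar>avg w x r\<bar> * mm x r \<le> (LINT y|m. \<bar>w y\<bar>)"
proof -
  have "\<bar>avg w x r\<bar> * mm x r \<le> ib (\<lambda>y. \<bar>w y\<bar>) x r" using avg_dev_le[OF assms, of 0] by simp
  also have "\<dots> \<le> (LINT y|m. \<bar>w y\<bar>)"
    unfolding set_lebesgue_integral_def using assms
    by (intro integral_mono integrable_mult_indicator) (auto simp: indicator_def)
  finally show ?thesis .
qed

text \<open>Among constants, the mean value is optimal up to the factor 2.\<close>

lemma dev_avg_le:
  assumes "integrable m w" "x \<in> closure \<Omega>" "0 < r"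
  shows "ib (\<lambda>y. \<bar>w y - avg w x r\<bar>) x r \<le> 2 * ib (\<lambda>y. \<bar>w y - c\<bar>) x r"
proof -
  have i: "integrable m (\<lambda>y. \<bar>w y - c\<bar>)" using assms(1) by simp
  have "ib (\<lambda>y. \<bar>w y - avg w x r\<bar>) x r \<le> ib (\<lambda>y. \<bar>w y - c\<bar> + \<bar>avg w x r - c\<bar>) x r"
    using assms(1) by (intro set_integral_mono set_integrable_B) auto
  also have "\<dots> = ib (\<lambda>y. \<bar>w y - c\<bar>) x r + \<bar>avg w x r - c\<bar> * mm x r"
    by (subst set_integral_add) (auto simp: set_integrable_B i set_lebesgue_integral_def mult.commute)
  also have "\<dots> \<le> 2 * ib (\<lambda>y. \<bar>w y - c\<bar>) x r" using avg_dev_le[OF assms, of c] by simp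
  finally show ?thesis .
qed

lemma avg_diff_le:
  assumes "integrable m w" "x \<in> closure \<Omega>" "0 < r" "B x r \<subseteq> B y s"
  shows "\<bar>avg w x r - c\<bar> \<le> ib (\<lambda>z. \<bar>w z - c\<bar>) y s / mm x r"
proof -
  have i: "integrable m (\<lambda>z. \<bar>w z - c\<bar>)" using assms(1) by simp
  have "\<bar>avg w x r - c\<bar> * mm x r \<le> ib (\<lambda>z. \<bar>w z - c\<bar>) x r" by (rule avg_dev_le[OF assms(1-3)])
  also have "\<dots> \<le> ib (\<lambda>z. \<bar>w z - c\<bar>) y s" by (rule ib_mono_set[OF assms(4) i]) auto
  finally show ?thesis using ball_pos[OF assms(2,3)] by (simp add: field_simps)
qed

end

section \<open>Poincare pairs and dyadic oscillation\<close>

text \<open>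
  \<open>C\<close> is the constant of the Poincare inequality and \<open>R\<close> the largest radius of the dyadic scales.
  The measure \<open>m\<close> plays the role of the restriction of \<open>\<mu>\<close> to the domain, and \<open>h\<close> that of \<open>g\<^sup>p\<close>.
\<close>

locale poincare_domain = doubling_domain \<Omega> m K for \<Omega> :: "'a::metric_space set" and m K +
  fixes p C R :: real
  assumes p1: "1 < p" and C0: "0 \<le> C" and R0: "0 < R"
begin

interpretation m: finite_measure m by (rule finite_m)

text \<open>The estimates of this locale use a function and its gradient through this relation only,
  so that curves, weak gradients and infinite values no longer appear.\<close>

definition poincare_pair :: "('a \<Rightarrow> real) \<Rightarrow> ('a \<Rightarrow> real) \<Rightarrow> bool" where
  "poincare_pair w h \<longleftrightarrow> integrable m w \<and> integrable m h \<and> (\<forall>y. 0 \<le> h y) \<and>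
    (\<forall>z\<in>\<Omega>. \<forall>r>0. ib (\<lambda>y. \<bar>w y - avg w z r\<bar>) z r \<le> C * r * mm z r * (ib h z r / mm z r) powr (1 / p))"

text \<open>The radii differ because a boundary point cannot be a centre in the Poincare inequality:
  for \<open>z\<close> in \<open>\<Omega>\<close> within distance \<open>r\<close> of
  \<open>x\<close> one has \<open>B x r \<subseteq> B z (2 * r)\<close> and
  \<open>B z (2 * r) \<subseteq> B x (3 * r)\<close>.\<close>

definition \<Phi> :: "('a \<Rightarrow> real) \<Rightarrow> 'a \<Rightarrow> real \<Rightarrow> real" where
  "\<Phi> h x r = ib h x (3 * r) / mm x r"

definition C1 :: real where "C1 = 4 * C * K ^ 2"

text \<open>
  Since the perimeter of a ball of radius \<open>r\<close> is comparable to its mass divided by \<open>r\<close>, integrating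
  \<open>r powr (1 + \<alpha>) * \<Phi> h x r\<close> over the boundary leaves the factor \<open>r powr \<alpha>\<close>, which is summable over
  the dyadic scales. Here the assumption \<open>1 < p\<close> enters.
\<close>

definition \<alpha> :: real where "\<alpha> = (p - 1) / 2"

definition scale :: "nat \<Rightarrow> real" where "scale k = R / 2 ^ k"

lemma poincare_pairD: "poincare_pair w h \<Longrightarrow> integrable m w" "poincare_pair w h \<Longrightarrow> integrable m h" "poincare_pair w h \<Longrightarrow> 0 \<le> h y"
  by (auto simp: poincare_pair_def)

lemma C1_nonneg: "0 \<le> C1" using C0 by (simp add: C1_def)

lemma \<alpha>_pos: "0 < \<alpha>" using p1 by (simp add: \<alpha>_def)

lemma scale_pos: "0 < scale k" using R0 by (simp add: scale_def)

lemma \<Phi>_nonneg: "(\<And>y. 0 \<le> h y) \<Longrightarrow> 0 \<le> \<Phi> h x r"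
  unfolding \<Phi>_def by (intro divide_nonneg_nonneg ib_nonneg) auto

text \<open>In \<open>C1 = 4 * C * K ^ 2\<close> one factor 2 comes from passing to the mean over
  \<open>B x r\<close>, the other from the radius \<open>2 * r\<close>, and \<open>K ^ 2\<close>
  from comparing the masses of \<open>B z (2 * r)\<close> and \<open>B x r\<close>.\<close>

lemma avg_dev_\<Phi>:
  assumes w: "poincare_pair w h" and x: "x \<in> closure \<Omega>" "0 < r"
  shows "ib (\<lambda>y. \<bar>w y - avg w x r\<bar>) x r \<le> C1 * r * mm x r * \<Phi> h x r powr (1 / p)"
proof -
  note int = poincare_pairD[OF w]
  obtain z where z: "z \<in> \<Omega>" "dist z x < r" using x closure_approachable[of x \<Omega>] by blast
  have zc: "z \<in> closure \<Omega>" using z closure_I by auto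
  have sub1: "B x r \<subseteq> B z (2 * r)" and sub2: "B z (2 * r) \<subseteq> B x (3 * r)"
    by (rule B_subset, use z in \<open>simp add: dist_commute\<close>)+
  have pos: "0 < mm x r" "0 < mm z (2 * r)" using x zc by (auto intro!: ball_pos)
  have m1: "mm z (2 * r) \<le> K ^ 2 * mm x r"
    using z x zc by (intro mm_le_pow) auto
  have m2: "mm x r \<le> mm z (2 * r)" by (rule mm_mono[OF sub1])
  have h: "ib h z (2 * r) / mm z (2 * r) \<le> \<Phi> h x r" unfolding \<Phi>_def
    using m2 pos ib_mono_set[OF sub2 int(2)] int(3) by (intro frac_le ib_nonneg) auto
  have i: "integrable m (\<lambda>y. \<bar>w y - avg w z (2 * r)\<bar>)" using int(1) by simp
  have "ib (\<lambda>y. \<bar>w y - avg w x r\<bar>) x r \<le> 2 * ib (\<lambda>y. \<bar>w y - avg w z (2 * r)\<bar>) x r"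
    by (rule dev_avg_le[OF int(1) x])
  also have "\<dots> \<le> 2 * ib (\<lambda>y. \<bar>w y - avg w z (2 * r)\<bar>) z (2 * r)"
    by (intro mult_left_mono ib_mono_set sub1 i) auto
  also have "\<dots> \<le> 2 * (C * (2 * r) * mm z (2 * r) * (ib h z (2 * r) / mm z (2 * r)) powr (1 / p))"
    using w z x by (intro mult_left_mono) (auto simp: poincare_pair_def)
  also have "\<dots> \<le> 2 * (C * (2 * r) * (K ^ 2 * mm x r) * \<Phi> h x r powr (1 / p))"
    using x C0 m1 h pos p1 int(3) by (intro mult_left_mono mult_mono powr_mono2) (auto intro!: divide_nonneg_nonneg ib_nonneg)
  finally show ?thesis by (simp add: C1_def mult_ac)
qed

lemma powr_inverse_le_1: "0 \<le> a \<Longrightarrow> a powr (1 / p) \<le> 1 + a"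
proof (cases "a \<le> 1")
  assume "0 \<le> a" "a \<le> 1"
  then have "a powr (1 / p) \<le> 1" using p1 by (intro powr_le1) auto
  with \<open>0 \<le> a\<close> show ?thesis by linarith
next
  assume "\<not> a \<le> 1"
  then show ?thesis using p1 powr_mono[of "1 / p" 1 a] by simp
qed

text \<open>The threshold is \<open>a = r powr (- (p / 2))\<close>: below it the root is at most
  \<open>r powr (- (1 / 2))\<close>, and above it \<open>a powr (1 / p) = a * a powr (- ((p - 1) /
  p)) \<le> a * r powr \<alpha>\<close>. The result is affine in \<open>a\<close>, so it can be
  integrated as soon as \<open>\<Phi>\<close> can.\<close>

lemma powr_inverse_young:
  assumes "0 \<le> a" "0 < r"
  shows "r * a powr (1 / p) \<le> r powr (1 + \<alpha>) * a + r powr (1 / 2)"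
proof -
  have "a powr (1 / p) \<le> r powr \<alpha> * a + r powr (- (1 / 2))"
  proof (cases "a \<le> r powr (- (p / 2))")
    case True
    then have "a powr (1 / p) \<le> (r powr (- (p / 2))) powr (1 / p)"
      using assms p1 by (intro powr_mono2) auto
    also have "\<dots> = r powr (- (1 / 2))" using p1 by (simp add: powr_powr)
    finally show ?thesis using assms by (simp add: add_increasing)
  next
    case False
    then have a: "r powr (- (p / 2)) < a" by simp
    then have a0: "0 < a" using assms powr_gt_zero[of r "- (p / 2)"] by linarith
    have "a powr (1 / p) = a * a powr (- ((p - 1) / p))"
    proof -
      have "a * a powr (- ((p - 1) / p)) = a powr (1 + (- ((p - 1) / p)))" using a0 by (simp only: powr_add powr_one)
      also have "1 + (- ((p - 1) / p)) = 1 / p" using p1 by (simp add: field_simps)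
      finally show ?thesis by simp
    qed
    also have "\<dots> \<le> a * (r powr (- (p / 2))) powr (- ((p - 1) / p))"
      using a a0 p1 assms by (intro mult_left_mono powr_mono2') auto
    also have "(r powr (- (p / 2))) powr (- ((p - 1) / p)) = r powr \<alpha>"
      using p1 by (simp add: powr_powr \<alpha>_def)
    finally show ?thesis using assms by (simp add: mult.commute add_increasing2)
  qed
  then have "r * a powr (1 / p) \<le> r * (r powr \<alpha> * a + r powr (- (1 / 2)))"
    using assms by (intro mult_left_mono) auto
  also have "\<dots> = r powr (1 + \<alpha>) * a + r powr (1 + (- (1 / 2)))"
    using assms by (simp only: distrib_left powr_add powr_one mult.assoc)
  finally show ?thesis by simp
qed

definition osc_bound :: "('a \<Rightarrow> real) \<Rightarrow> 'a \<Rightarrow> nat \<Rightarrow> real" where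
  "osc_bound h x k = scale k powr (1 + \<alpha>) * \<Phi> h x (scale k) + scale k powr (1 / 2)"

lemma osc_bound_nonneg: "(\<And>y. 0 \<le> h y) \<Longrightarrow> 0 \<le> osc_bound h x k"
  unfolding osc_bound_def by (intro add_nonneg_nonneg mult_nonneg_nonneg \<Phi>_nonneg) auto

lemma avg_half_le:
  assumes w: "poincare_pair w h" and x: "x \<in> closure \<Omega>" "0 < r"
  shows "\<bar>avg w x (r / 2) - avg w x r\<bar> \<le> K * C1 * (r * \<Phi> h x r powr (1 / p))"
proof -
  have pos: "0 < mm x (r / 2)" using x by (intro ball_pos) auto
  have "\<bar>avg w x (r / 2) - avg w x r\<bar> \<le> ib (\<lambda>y. \<bar>w y - avg w x r\<bar>) x r / mm x (r / 2)"
    using x by (intro avg_diff_le poincare_pairD[OF w]) auto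
  also have "\<dots> \<le> C1 * r * mm x r * \<Phi> h x r powr (1 / p) / mm x (r / 2)"
    using pos by (intro divide_right_mono avg_dev_\<Phi>[OF w x]) auto
  also have "\<dots> \<le> C1 * r * (K * mm x (r / 2)) * \<Phi> h x r powr (1 / p) / mm x (r / 2)"
    using ball_dbl[of x "r / 2"] x C1_nonneg pos
    by (intro divide_right_mono mult_right_mono mult_left_mono) auto
  finally show ?thesis using pos by (simp add: mult_ac)
qed

lemma avg_step_le:
  assumes w: "poincare_pair w h" and x: "x \<in> closure \<Omega>"
  shows "\<bar>avg w x (scale (Suc k)) - avg w x (scale k)\<bar> \<le> K * C1 * osc_bound h x k"
proof -
  have eq: "scale (Suc k) = scale k / 2" by (simp add: scale_def)
  have "\<bar>avg w x (scale (Suc k)) - avg w x (scale k)\<bar> \<le> K * C1 * (scale k * \<Phi> h x (scale k) powr (1 / p))"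
    unfolding eq by (rule avg_half_le[OF w x scale_pos])
  also have "\<dots> \<le> K * C1 * osc_bound h x k" unfolding osc_bound_def
    using K1 C1_nonneg scale_pos by (intro mult_left_mono powr_inverse_young \<Phi>_nonneg poincare_pairD[OF w]) auto
  finally show ?thesis .
qed

text \<open>The limit runs over countably many scales only and \<open>lim\<close> has a value also
  where the averages diverge; this makes a Borel function on the whole space.\<close>

definition trace_lim :: "('a \<Rightarrow> real) \<Rightarrow> 'a \<Rightarrow> real" where
  "trace_lim w x = lim (\<lambda>k. avg w x (scale k))"

lemma avg_converges:
  assumes w: "poincare_pair w h" and x: "x \<in> closure \<Omega>" and s: "summable (osc_bound h x)"
  shows "(\<lambda>k. avg w x (scale k)) \<longlonglongrightarrow> trace_lim w x"
    "\<bar>trace_lim w x - avg w x (scale k)\<bar> \<le> K * C1 * (\<Sum>j. osc_bound h x (j + k))"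
  using summable_telescope_limit[where s="\<lambda>k. avg w x (scale k)", OF avg_step_le[OF w x] s]
  unfolding trace_lim_def convergent_LIMSEQ_iff by auto

lemma scale_le: "scale k \<le> R"
  using R0 by (simp add: scale_def divide_le_eq)

lemma scale_tendsto: "scale \<longlonglongrightarrow> 0"
proof -
  have "(\<lambda>k. R * (1 / 2) ^ k) \<longlonglongrightarrow> R * 0" by (intro tendsto_intros) auto
  then show ?thesis by (simp add: scale_def[abs_def] power_divide)
qed

lemma scale_powr: "scale k powr a = R powr a * (2 powr - a) ^ k"
proof -
  have "scale k powr a = R powr a / (2 ^ k) powr a" using R0 by (simp add: scale_def powr_divide)
  also have "(2 ^ k :: real) powr a = (2 powr a) ^ k" by (simp add: powr_power powr_powr mult.commute flip: powr_realpow)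
  finally show ?thesis by (simp add: powr_minus divide_inverse power_inverse)
qed

lemma summable_scale_powr: "0 < a \<Longrightarrow> summable (\<lambda>k. scale k powr a)"
proof -
  assume a: "0 < a"
  have "(2::real) powr - a < 2 powr 0" using a by (intro powr_less_mono) auto
  then show ?thesis unfolding scale_powr by (intro summable_mult summable_geometric) auto
qed

lemma mean_dev_tendsto:
  assumes w: "poincare_pair w h" and x: "x \<in> closure \<Omega>" and s: "summable (osc_bound h x)"
  shows "((\<lambda>r. ib (\<lambda>y. \<bar>w y - trace_lim w x\<bar>) x r / mm x r) \<longlongrightarrow> 0) (at_right 0)"
proof -
  note int = poincare_pairD[OF w]
  have pos: "0 < mm x r" if "0 < r" for r using ball_pos[OF x that] .
  define f where "f k = K * (C1 * osc_bound h x k + \<bar>avg w x (scale k) - trace_lim w x\<bar>)" for k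
  have f: "f \<longlonglongrightarrow> 0"
  proof -
    have "f \<longlonglongrightarrow> K * (C1 * 0 + \<bar>trace_lim w x - trace_lim w x\<bar>)"
      unfolding f_def by (intro tendsto_intros summable_LIMSEQ_zero[OF s] avg_converges(1)[OF w x s])
    then show ?thesis by simp
  qed
  \<comment> \<open>For a radius between two consecutive scales the ball lies in the larger dyadic
    ball, whose mass is at most \<open>K\<close> times as large.\<close>
  have bd: "ib (\<lambda>y. \<bar>w y - trace_lim w x\<bar>) x r / mm x r \<le> f k" if r: "scale (Suc k) < r" "r \<le> scale k" for r k
  proof -
    have r0: "0 < r" using r scale_pos less_trans by blast
    have i: "integrable m (\<lambda>y. \<bar>w y - avg w x (scale k)\<bar>)" "integrable m (\<lambda>y. \<bar>w y - trace_lim w x\<bar>)" using int(1) by auto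
    have "scale k \<le> 2 * r" using r by (simp add: scale_def)
    then have "mm x (scale k) \<le> mm x (2 * r)" by (intro mm_mono B_subset) auto
    also have "\<dots> \<le> K * mm x r" by (rule ball_dbl[OF x r0])
    finally have mk: "mm x (scale k) \<le> K * mm x r" .
    have "ib (\<lambda>y. \<bar>w y - trace_lim w x\<bar>) x r \<le> ib (\<lambda>y. \<bar>w y - trace_lim w x\<bar>) x (scale k)"
      using r by (intro ib_mono_set B_subset i) auto
    also have "\<dots> \<le> ib (\<lambda>y. \<bar>w y - avg w x (scale k)\<bar> + \<bar>avg w x (scale k) - trace_lim w x\<bar>) x (scale k)"
      using int(1) by (intro set_integral_mono set_integrable_B) auto
    also have "\<dots> = ib (\<lambda>y. \<bar>w y - avg w x (scale k)\<bar>) x (scale k) + \<bar>avg w x (scale k) - trace_lim w x\<bar> * mm x (scale k)"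
      by (subst set_integral_add[OF set_integrable_B[OF i(1)] set_integrable_B])
        (auto simp: set_lebesgue_integral_def mult.commute)
    also have "\<dots> \<le> C1 * scale k * mm x (scale k) * \<Phi> h x (scale k) powr (1 / p) + \<bar>avg w x (scale k) - trace_lim w x\<bar> * mm x (scale k)"
      by (intro add_right_mono avg_dev_\<Phi>[OF w x scale_pos])
    also have "\<dots> = (C1 * (scale k * \<Phi> h x (scale k) powr (1 / p)) + \<bar>avg w x (scale k) - trace_lim w x\<bar>) * mm x (scale k)"
      by (simp add: algebra_simps)
    also have "\<dots> \<le> (C1 * osc_bound h x k + \<bar>avg w x (scale k) - trace_lim w x\<bar>) * mm x (scale k)"
      unfolding osc_bound_def using C1_nonneg scale_pos
      by (intro mult_right_mono add_right_mono mult_left_mono powr_inverse_young \<Phi>_nonneg int(3)) auto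
    also have "\<dots> \<le> (C1 * osc_bound h x k + \<bar>avg w x (scale k) - trace_lim w x\<bar>) * (K * mm x r)"
      using C1_nonneg by (intro mult_left_mono mk add_nonneg_nonneg mult_nonneg_nonneg osc_bound_nonneg int(3)) auto
    finally show ?thesis using pos[OF r0] by (simp add: f_def field_simps)
  qed
  show ?thesis
  proof (rule tendstoI)
    fix e :: real assume e: "0 < e"
    obtain k0 where k0: "\<And>k. k \<ge> k0 \<Longrightarrow> f k < e"
      using order_tendstoD(2)[OF f e] by (auto simp: eventually_sequentially)
    have "dist (ib (\<lambda>y. \<bar>w y - trace_lim w x\<bar>) x r / mm x r) 0 < e" if r: "0 < r" "r < scale k0" for r
    proof -
      obtain n where n: "scale n < r" using order_tendstoD(2)[OF scale_tendsto r(1)] by (auto simp: eventually_sequentially)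
      define k where "k = (LEAST n. scale n < r)"
      have k: "scale k < r" unfolding k_def by (rule LeastI[of _ n]) (rule n)
      have kk: "k0 < k"
      proof (rule ccontr)
        assume "\<not> k0 < k"
        then have "scale k0 \<le> scale k" using R0 by (auto simp: scale_def intro!: divide_left_mono power_increasing)
        then show False using k r by simp
      qed
      then obtain j where j: "k = Suc j" by (cases k) auto
      have "\<not> scale j < r" using not_less_Least[of j "\<lambda>n. scale n < r"] j by (simp add: k_def)
      then have "ib (\<lambda>y. \<bar>w y - trace_lim w x\<bar>) x r / mm x r \<le> f j" using k j by (intro bd) auto
      also have "\<dots> < e" using kk j by (intro k0) auto
      finally show ?thesis using pos[OF r(1)] ib_nonneg[of "\<lambda>y. \<bar>w y - trace_lim w x\<bar>" x r] by (simp add: dist_real_def)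
    qed
    then show "\<forall>\<^sub>F r in at_right 0. dist (ib (\<lambda>y. \<bar>w y - trace_lim w x\<bar>) x r / mm x r) 0 < e"
      unfolding eventually_at_right_field using scale_pos[of k0] by blast
  qed
qed

subsection \<open>Integrating the maximal-type function\<close>

lemma \<Phi>_near:
  assumes h: "integrable m h" "\<And>y. 0 \<le> h y" and xy: "x \<in> closure \<Omega>" "y \<in> closure \<Omega>" "dist x y < r"
  shows "\<Phi> h y r \<le> K * (ib h x (4 * r) / mm x r)"
proof -
  have r: "0 < r" using xy(3) zero_le_dist[of x y] by linarith
  have "mm x r \<le> mm y (2 * r)" using xy by (intro mm_mono B_subset) auto
  also have "\<dots> \<le> K * mm y r" by (rule ball_dbl[OF xy(2) r])
  finally have "mm x r \<le> K * mm y r" .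
  moreover have "0 < mm x r" "0 < mm y r" using ball_pos xy r by auto
  moreover have "ib h y (3 * r) \<le> ib h x (4 * r)" using xy by (intro ib_mono_set B_subset h) (auto simp: dist_commute)
  moreover have "0 \<le> ib h x (4 * r)" by (intro ib_nonneg h)
  ultimately have "\<Phi> h y r \<le> ib h x (4 * r) / (mm x r / K)"
    unfolding \<Phi>_def using K1 by (intro frac_le) (auto simp: field_simps)
  then show ?thesis using K1 by (simp add: field_simps)
qed

text \<open>On each ball of a net \<open>\<Phi>\<close> is dominated by a constant, and the bounded
  overlap of the balls of radius \<open>4 * r\<close> sums these constants; \<open>K ^ 8\<close> is
  the overlap \<open>K ^ 7\<close> times the loss in \<open>\<Phi>_near\<close>. With
  \<open>b = 1\<close> this serves \<open>m\<close> itself, with \<open>b = CP / r\<close> the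
  boundary measure.\<close>

lemma nn_integral_\<Phi>_le:
  assumes h: "integrable m h" "\<And>y. 0 \<le> h y" and S: "S \<subseteq> closure \<Omega>" "S \<in> sets \<nu>" and r: "0 < r" and b: "0 \<le> b"
    and ball: "\<And>x. x \<in> S \<Longrightarrow> ball x r \<inter> S \<in> sets \<nu>"
    and \<nu>: "\<And>x. x \<in> S \<Longrightarrow> emeasure \<nu> (ball x r \<inter> S) \<le> ennreal (b * mm x r)"
  shows "(\<integral>\<^sup>+y\<in>S. ennreal (\<Phi> h y r) \<partial>\<nu>) \<le> ennreal (b * K ^ 8 * (LINT y|m. h y))"
proof -
  obtain F where F: "separated r F" "F \<subseteq> S" "S \<subseteq> (\<Union>x\<in>F. ball x r)" using net_exists[OF S(1) r] .
  have fin: "finite F" using F by (simp add: separated_def)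
  define c where "c x = K * (ib h x (4 * r) / mm x r)" for x
  have c0: "0 \<le> c x" for x unfolding c_def using K1 by (intro mult_nonneg_nonneg divide_nonneg_nonneg ib_nonneg h) auto
  have "(\<integral>\<^sup>+y\<in>S. ennreal (\<Phi> h y r) \<partial>\<nu>) \<le> (\<integral>\<^sup>+y. (\<Sum>x\<in>F. ennreal (c x) * indicator (ball x r \<inter> S) y) \<partial>\<nu>)"
  proof (intro nn_integral_mono)
    fix y
    show "ennreal (\<Phi> h y r) * indicator S y \<le> (\<Sum>x\<in>F. ennreal (c x) * indicator (ball x r \<inter> S) y)"
    proof (cases "y \<in> S")
      case True
      then obtain x where x: "x \<in> F" "dist x y < r" using F by auto
      have "ennreal (\<Phi> h y r) \<le> ennreal (c x)"
        unfolding c_def using x F S True by (intro ennreal_leI \<Phi>_near h) auto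
      also have "\<dots> = ennreal (c x) * indicator (ball x r \<inter> S) y" using x True by simp
      also have "\<dots> \<le> (\<Sum>x\<in>F. ennreal (c x) * indicator (ball x r \<inter> S) y)"
        using x fin by (intro member_le_sum) auto
      finally show ?thesis using True by simp
    qed simp
  qed
  also have "\<dots> = (\<Sum>x\<in>F. ennreal (c x) * emeasure \<nu> (ball x r \<inter> S))"
    using F(2) by (subst nn_integral_sum)
      (auto simp: nn_integral_cmult_indicator ball subset_iff
        intro!: sum.cong borel_measurable_times_ennreal borel_measurable_indicator)
  also have "\<dots> \<le> (\<Sum>x\<in>F. ennreal (c x) * ennreal (b * mm x r))"
    using F(2) by (intro sum_mono mult_left_mono \<nu>) auto
  also have "\<dots> = ennreal (\<Sum>x\<in>F. c x * (b * mm x r))"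
    using c0 b by (simp add: sum_nonneg flip: ennreal_mult)
  also have "(\<Sum>x\<in>F. c x * (b * mm x r)) = (\<Sum>x\<in>F. b * K * ib h x (4 * r))"
  proof (intro sum.cong refl)
    fix x assume "x \<in> F"
    then have "0 < mm x r" using F S r by (intro ball_pos) auto
    then show "c x * (b * mm x r) = b * K * ib h x (4 * r)" by (simp add: c_def)
  qed
  also have "\<dots> = b * K * (\<Sum>x\<in>F. ib h x (4 * r))" by (simp add: sum_distrib_left)
  also have "\<dots> \<le> b * K * (K ^ 7 * (LINT y|m. h y))"
    using b K1 r by (intro mult_left_mono overlap_sum[OF F(1)] h) auto
  also have "b * K * (K ^ 7 * (LINT y|m. h y)) = b * K ^ 8 * (LINT y|m. h y)"
    by (simp add: eval_nat_numeral)
  finally show ?thesis by (simp add: ennreal_leI)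
qed

text \<open>Balls are open: a point of the ball about \<open>l\<close> lies in the balls about all
  late members of a sequence tending to \<open>l\<close>. By Fatou's lemma the integral is therefore
  lower semicontinuous in the centre.\<close>

lemma borel_measurable_nn_integral_ball:
  fixes f :: "'a \<Rightarrow> ennreal"
  assumes [measurable]: "f \<in> borel_measurable m"
  shows "(\<lambda>x. \<integral>\<^sup>+y\<in>B x r. f y \<partial>m) \<in> borel_measurable borel"
proof (rule borel_measurableI_greater)
  fix a
  have "closed {x. (\<integral>\<^sup>+y\<in>B x r. f y \<partial>m) \<le> a}"
    unfolding closed_sequential_limits
  proof (intro allI impI, elim conjE)
    fix x l assume x: "\<forall>n. x n \<in> {x. (\<integral>\<^sup>+y\<in>B x r. f y \<partial>m) \<le> a}" "x \<longlonglongrightarrow> l"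
    have "(\<integral>\<^sup>+y\<in>B l r. f y \<partial>m) \<le> (\<integral>\<^sup>+y. liminf (\<lambda>n. f y * indicator (B (x n) r) y) \<partial>m)"
    proof (rule nn_integral_mono)
      fix y
      show "f y * indicator (B l r) y \<le> liminf (\<lambda>n. f y * indicator (B (x n) r) y)"
      proof (cases "y \<in> B l r")
        case True
        then have "\<forall>\<^sub>F n in sequentially. dist (x n) y < r"
          using order_tendstoD(2)[OF tendsto_dist[OF x(2) tendsto_const], of y r] by simp
        then have "\<forall>\<^sub>F n in sequentially. f y \<le> f y * indicator (B (x n) r) y"
          by eventually_elim (use True in auto)
        then show ?thesis using True by (simp add: Liminf_bounded)
      qed simp
    qed
    also have "\<dots> \<le> liminf (\<lambda>n. \<integral>\<^sup>+y\<in>B (x n) r. f y \<partial>m)"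
      by (rule nn_integral_liminf) simp
    also have "\<dots> \<le> a"
      using x(1) by (intro order_trans[OF Liminf_le_Limsup Limsup_bounded]) auto
    finally show "l \<in> {x. (\<integral>\<^sup>+y\<in>B x r. f y \<partial>m) \<le> a}" by simp
  qed
  then have "open (- {x. (\<integral>\<^sup>+y\<in>B x r. f y \<partial>m) \<le> a})" by (rule open_Compl)
  moreover have "- {x. (\<integral>\<^sup>+y\<in>B x r. f y \<partial>m) \<le> a} = {x \<in> space borel. a < (\<integral>\<^sup>+y\<in>B x r. f y \<partial>m)}" by auto
  ultimately show "{x \<in> space borel. a < (\<integral>\<^sup>+y\<in>B x r. f y \<partial>m)} \<in> sets borel" by (metis borel_open)
qed

lemma borel_measurable_ib [measurable]:
  fixes f :: "'a \<Rightarrow> real"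
  assumes "integrable m f"
  shows "(\<lambda>x. ib f x r) \<in> borel_measurable borel"
proof -
  have [measurable]: "f \<in> borel_measurable m" using assms by simp
  have "ib f x r = enn2real (\<integral>\<^sup>+y\<in>B x r. ennreal (f y) \<partial>m) - enn2real (\<integral>\<^sup>+y\<in>B x r. ennreal (- f y) \<partial>m)" for x
  proof -
    have "ib f x r = enn2real (\<integral>\<^sup>+y. ennreal (indicator (B x r) y * f y) \<partial>m) - enn2real (\<integral>\<^sup>+y. ennreal (- (indicator (B x r) y * f y)) \<partial>m)"
      unfolding set_lebesgue_integral_def real_scaleR_def
      by (rule real_lebesgue_integral_def[OF integrable_indicator_B[OF assms]])
    also have "(\<integral>\<^sup>+y. ennreal (indicator (B x r) y * f y) \<partial>m) = (\<integral>\<^sup>+y\<in>B x r. ennreal (f y) \<partial>m)"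
      by (intro nn_integral_cong) (simp add: indicator_def)
    also have "(\<integral>\<^sup>+y. ennreal (- (indicator (B x r) y * f y)) \<partial>m) = (\<integral>\<^sup>+y\<in>B x r. ennreal (- f y) \<partial>m)"
      by (intro nn_integral_cong) (simp add: indicator_def)
    finally show ?thesis .
  qed
  moreover have "(\<lambda>x. enn2real (\<integral>\<^sup>+y\<in>B x r. ennreal (f y) \<partial>m) - enn2real (\<integral>\<^sup>+y\<in>B x r. ennreal (- f y) \<partial>m)) \<in> borel_measurable borel"
    by (intro borel_measurable_diff borel_measurable_enn2real borel_measurable_nn_integral_ball) measurable
  ultimately show ?thesis by simp
qed

lemma borel_measurable_mm [measurable]: "(\<lambda>x. mm x r) \<in> borel_measurable borel"
  using borel_measurable_ib[of "\<lambda>_. 1" r] by (simp add: set_lebesgue_integral_def)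

lemma borel_measurable_avg [measurable]: "integrable m w \<Longrightarrow> (\<lambda>x. avg w x r) \<in> borel_measurable borel"
  by (intro borel_measurable_divide borel_measurable_ib borel_measurable_mm)

lemma borel_measurable_\<Phi> [measurable]: "integrable m h \<Longrightarrow> (\<lambda>x. \<Phi> h x r) \<in> borel_measurable borel"
  unfolding \<Phi>_def by (intro borel_measurable_divide borel_measurable_ib borel_measurable_mm)

lemma borel_measurable_trace_lim [measurable]: "integrable m w \<Longrightarrow> trace_lim w \<in> borel_measurable borel"
  unfolding trace_lim_def[abs_def] by (rule borel_measurable_lim_metric) (rule borel_measurable_avg)

lemma borel_imp_m: "f \<in> borel_measurable borel \<Longrightarrow> (f :: 'a \<Rightarrow> real) \<in> borel_measurable m"
proof -
  assume f: "f \<in> borel_measurable borel"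
  have "(\<lambda>x. x) \<in> borel_measurable m"
    using sets_m by (intro borel_measurableI) (simp add: space_m)
  from measurable_compose[OF this f] show ?thesis .
qed

text \<open>Here the crude bound \<open>a powr (1 / p) \<le> 1 + a\<close> suffices: the gain is the
  factor \<open>s\<close>, while masses and energies are summed by bounded overlap.\<close>

lemma avg_dev_net:
  assumes w: "poincare_pair w h" and F: "separated r F" "0 < r" and s: "0 < s" "3 * s \<le> 8 * r"
  shows "(\<Sum>x\<in>F. ib (\<lambda>y. \<bar>w y - avg w x s\<bar>) x s) \<le> C1 * s * K ^ 7 * (measure m \<Omega> + (LINT y|m. h y))"
proof -
  note int = poincare_pairD[OF w]
  have "(\<Sum>x\<in>F. ib (\<lambda>y. \<bar>w y - avg w x s\<bar>) x s) \<le> (\<Sum>x\<in>F. C1 * s * (mm x s + ib h x (3 * s)))"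
  proof (rule sum_mono)
    fix x assume "x \<in> F"
    then have x: "x \<in> closure \<Omega>" using F by (auto simp: separated_def)
    have "ib (\<lambda>y. \<bar>w y - avg w x s\<bar>) x s \<le> C1 * s * mm x s * \<Phi> h x s powr (1 / p)"
      by (rule avg_dev_\<Phi>[OF w x s(1)])
    also have "\<dots> \<le> C1 * s * mm x s * (1 + \<Phi> h x s)"
      using C1_nonneg s by (intro mult_left_mono powr_inverse_le_1 \<Phi>_nonneg int) auto
    also have "\<dots> = C1 * s * (mm x s + ib h x (3 * s))"
      using ball_pos[OF x s(1)] by (simp add: \<Phi>_def field_simps)
    finally show "ib (\<lambda>y. \<bar>w y - avg w x s\<bar>) x s \<le> C1 * s * (mm x s + ib h x (3 * s))" .
  qed
  also have "\<dots> = C1 * s * ((\<Sum>x\<in>F. mm x s) + (\<Sum>x\<in>F. ib h x (3 * s)))"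
    by (simp only: sum_distrib_left[symmetric] sum.distrib)
  also have "\<dots> \<le> C1 * s * (K ^ 7 * measure m \<Omega> + K ^ 7 * (LINT y|m. h y))"
    using C1_nonneg s F by (intro mult_left_mono add_mono overlap_sum_mm[OF F] overlap_sum[OF F] int) auto
  finally show ?thesis by (simp add: algebra_simps)
qed

lemma set_lint_net_le:
  fixes f :: "'a \<Rightarrow> real"
  assumes "finite F" "\<Omega> \<subseteq> (\<Union>x\<in>F. ball x r)" "integrable m f" "\<And>y. 0 \<le> f y"
  shows "(LINT y|m. f y) \<le> (\<Sum>x\<in>F. ib f x r)"
proof -
  have "(LINT y|m. f y) \<le> (LINT y|m. (\<Sum>x\<in>F. indicator (B x r) y * f y))"
  proof (intro integral_mono assms(3) Bochner_Integration.integrable_sum integrable_indicator_B)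
    fix y assume "y \<in> space m"
    then obtain x where x: "x \<in> F" "y \<in> B x r" using assms(2) space_m by auto
    have "f y = indicator (B x r) y * f y" using x by simp
    also have "\<dots> \<le> (\<Sum>x\<in>F. indicator (B x r) y * f y)"
      using x assms by (intro member_le_sum) auto
    finally show "f y \<le> (\<Sum>x\<in>F. indicator (B x r) y * f y)" .
  qed
  also have "\<dots> = (\<Sum>x\<in>F. ib f x r)"
    unfolding set_lebesgue_integral_def
    by (subst Bochner_Integration.integral_sum) (auto intro: integrable_indicator_B assms)
  finally show ?thesis .
qed

text \<open>Near a net point \<open>x\<close> both \<open>w\<close> and its average at
  \<open>y\<close> are compared with the average over \<open>B x (2 * r)\<close>, a set that
  contains \<open>B y r\<close>. The point of the order \<open>r\<close> is that it is summable over
  the dyadic scales.\<close>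

lemma lint_avg_diff_le:
  assumes w: "poincare_pair w h" and r: "0 < r"
  shows "(LINT y|m. \<bar>w y - avg w y r\<bar>) \<le> 2 * C1 * (1 + K) * K ^ 7 * (measure m \<Omega> + (LINT y|m. h y)) * r"
    "integrable m (\<lambda>y. \<bar>w y - avg w y r\<bar>)"
proof -
  note int = poincare_pairD[OF w]
  have cl\<Omega>: "\<Omega> \<subseteq> closure \<Omega>" by (rule closure_subset)
  obtain F where F: "separated r F" "F \<subseteq> \<Omega>" "\<Omega> \<subseteq> (\<Union>x\<in>F. ball x r)" using net_exists[OF cl\<Omega> r] .
  have fin: "finite F" using F by (simp add: separated_def)
  obtain c where c: "0 < c" "\<And>x. x \<in> closure \<Omega> \<Longrightarrow> c \<le> mm x r" using mm_lower[OF r] by auto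
  have meas: "(\<lambda>y. avg w y r) \<in> borel_measurable m" by (rule borel_imp_m) (rule borel_measurable_avg[OF int(1)])
  have "integrable m (\<lambda>y. avg w y r)"
  proof (rule m.integrable_const_bound[OF AE_I2 meas])
    fix y assume "y \<in> space m"
    then have y: "y \<in> closure \<Omega>" using space_m closure_I by auto
    have "\<bar>avg w y r\<bar> * c \<le> \<bar>avg w y r\<bar> * mm y r" by (intro mult_left_mono c y) auto
    also have "\<dots> \<le> (LINT y|m. \<bar>w y\<bar>)" by (rule avg_abs_le[OF int(1) y r])
    finally show "norm (avg w y r) \<le> (LINT y|m. \<bar>w y\<bar>) / c" using c(1) by (simp add: field_simps)
  qed
  then show i: "integrable m (\<lambda>y. \<bar>w y - avg w y r\<bar>)" using int(1) by simp
  have "(LINT y|m. \<bar>w y - avg w y r\<bar>) \<le> (\<Sum>x\<in>F. ib (\<lambda>y. \<bar>w y - avg w y r\<bar>) x r)"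
    by (rule set_lint_net_le[OF fin F(3) i]) auto
  also have "\<dots> \<le> (\<Sum>x\<in>F. (1 + K) * ib (\<lambda>y. \<bar>w y - avg w x (2 * r)\<bar>) x (2 * r))"
  proof (rule sum_mono)
    fix x assume x: "x \<in> F"
    then have xc: "x \<in> closure \<Omega>" using F cl\<Omega> by auto
    define c where "c = avg w x (2 * r)"
    define d where "d = ib (\<lambda>y. \<bar>w y - c\<bar>) x (2 * r)"
    have ic: "integrable m (\<lambda>y. \<bar>w y - c\<bar>)" using int(1) by simp
    have d0: "0 \<le> d" unfolding d_def by (rule ib_nonneg) auto
    have mx: "0 < mm x r" using ball_pos[OF xc r] .
    have "\<bar>w y - avg w y r\<bar> \<le> \<bar>w y - c\<bar> + K * d / mm x r" if y: "y \<in> B x r" for y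
    proof -
      have yc: "y \<in> closure \<Omega>" using y closure_I by auto
      have my: "0 < mm y r" using ball_pos[OF yc r] .
      have "mm x r \<le> mm y (2 * r)" using y by (intro mm_mono B_subset) auto
      also have "\<dots> \<le> K * mm y r" by (rule ball_dbl[OF yc r])
      finally have mk: "mm x r / K \<le> mm y r" using K1 by (simp add: field_simps)
      have "\<bar>avg w y r - c\<bar> \<le> d / mm y r" unfolding d_def
        using y by (intro avg_diff_le int(1) yc r B_subset) (auto simp: dist_commute)
      also have "\<dots> \<le> d / (mm x r / K)" using mk mx my K1 d0 by (intro divide_left_mono) auto
      finally show ?thesis by (simp add: mult.commute)
    qed
    then have "ib (\<lambda>y. \<bar>w y - avg w y r\<bar>) x r \<le> ib (\<lambda>y. \<bar>w y - c\<bar> + K * d / mm x r) x r"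
      using ic by (intro set_integral_mono[OF set_integrable_B[OF i] set_integrable_B]) auto
    also have "\<dots> = ib (\<lambda>y. \<bar>w y - c\<bar>) x r + K * d / mm x r * mm x r"
      by (subst set_integral_add[OF set_integrable_B[OF ic] set_integrable_B])
        (auto simp: set_lebesgue_integral_def mult.commute)
    also have "\<dots> \<le> d + K * d" unfolding d_def using r mx
      by (intro add_mono ib_mono_set ic) (auto simp: d_def)
    finally show "ib (\<lambda>y. \<bar>w y - avg w y r\<bar>) x r \<le> (1 + K) * ib (\<lambda>y. \<bar>w y - avg w x (2 * r)\<bar>) x (2 * r)"
      by (simp add: d_def c_def algebra_simps)
  qed
  also have "\<dots> = (1 + K) * (\<Sum>x\<in>F. ib (\<lambda>y. \<bar>w y - avg w x (2 * r)\<bar>) x (2 * r))" by (simp add: sum_distrib_left)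
  also have "\<dots> \<le> (1 + K) * (C1 * (2 * r) * K ^ 7 * (measure m \<Omega> + (LINT y|m. h y)))"
    using K1 r by (intro mult_left_mono avg_dev_net[OF w F(1)]) auto
  finally show "(LINT y|m. \<bar>w y - avg w y r\<bar>) \<le> 2 * C1 * (1 + K) * K ^ 7 * (measure m \<Omega> + (LINT y|m. h y)) * r"
    by (simp add: mult_ac)
qed

end

lemma suminf_shift_tendsto_0:
  fixes f :: "nat \<Rightarrow> real"
  assumes "summable f"
  shows "(\<lambda>k. \<Sum>j. f (j + k)) \<longlonglongrightarrow> 0"
proof -
  have "(\<lambda>k. suminf f - (\<Sum>j<k. f j)) \<longlonglongrightarrow> suminf f - suminf f"
    by (intro tendsto_intros summable_LIMSEQ assms)
  then show ?thesis using suminf_minus_initial_segment[OF assms] by simp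
qed

section \<open>Mean zero bound, recovery of a function from its averages, integrability\<close>

context poincare_domain
begin

interpretation m: finite_measure m by (rule finite_m)

text \<open>This is the Poincare inequality on one ball that contains all of
  \<open>\<Omega>\<close>, where the average is 0.\<close>

lemma poincare_pair_mean_zero_bound:
  obtains c where "0 \<le> c" "\<And>w h. poincare_pair w h \<Longrightarrow> (LINT y|m. w y) = 0 \<Longrightarrow>
    (LINT y|m. \<bar>w y\<bar>) \<le> c * (LINT y|m. h y) powr (1 / p)"
proof -
  obtain D where D: "0 < D" "\<And>x. x \<in> closure \<Omega> \<Longrightarrow> \<Omega> \<subseteq> ball x D" using \<Omega>_in_ball by auto
  obtain z where z: "z \<in> \<Omega>" using nonempty by auto
  have B: "B z D = \<Omega>" using D(2)[OF closure_I[OF z]] by auto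
  define c where "c = C * D * measure m \<Omega> * (1 / measure m \<Omega>) powr (1 / p)"
  have full: "(LINT y:\<Omega>|m. f y) = (LINT y|m. f y)" for f :: "'a \<Rightarrow> real"
    unfolding set_lebesgue_integral_def by (intro Bochner_Integration.integral_cong) (auto simp: space_m)
  show ?thesis
  proof (rule that[of c])
    show "0 \<le> c" using C0 D by (simp add: c_def)
    fix w h assume w: "poincare_pair w h" and 0: "(LINT y|m. w y) = 0"
    have "ib (\<lambda>y. \<bar>w y - avg w z D\<bar>) z D \<le> C * D * mm z D * (ib h z D / mm z D) powr (1 / p)"
      using w z D by (auto simp: poincare_pair_def)
    then have "(LINT y|m. \<bar>w y\<bar>) \<le> C * D * measure m \<Omega> * ((LINT y|m. h y) / measure m \<Omega>) powr (1 / p)"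
      by (simp add: B full 0)
    also have "\<dots> = c * (LINT y|m. h y) powr (1 / p)"
      using measure_\<Omega>_pos poincare_pairD[OF w] by (simp add: c_def powr_divide integral_nonneg)
    finally show "(LINT y|m. \<bar>w y\<bar>) \<le> c * (LINT y|m. h y) powr (1 / p)" .
  qed
qed

text \<open>A substitute for Lebesgue differentiation: the L1 distance between \<open>w\<close> and
  its averages at scale \<open>k\<close> is of order \<open>scale k\<close>, so the sum of the
  differences over all scales is integrable and hence finite almost everywhere.\<close>

lemma AE_avg_tendsto:
  assumes w: "poincare_pair w h"
  shows "AE y in m. (\<lambda>k. avg w y (scale k)) \<longlonglongrightarrow> w y"
proof -
  note int = poincare_pairD[OF w]
  define A where "A = 2 * C1 * (1 + K) * K ^ 7 * (measure m \<Omega> + (LINT y|m. h y))"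
  have A0: "0 \<le> A" unfolding A_def using C1_nonneg K1 int by (intro mult_nonneg_nonneg add_nonneg_nonneg integral_nonneg) auto
  have [measurable]: "w \<in> borel_measurable m" using int by simp
  have [measurable]: "(\<lambda>y. avg w y r) \<in> borel_measurable m" for r
    by (rule borel_imp_m) (rule borel_measurable_avg[OF int(1)])
  have s: "summable (\<lambda>k. A * scale k)"
    using summable_mult[OF summable_scale_powr[of 1], of A] scale_pos by (simp add: less_imp_le)
  have "(\<integral>\<^sup>+y. (\<Sum>k. ennreal \<bar>w y - avg w y (scale k)\<bar>) \<partial>m) = (\<Sum>k. \<integral>\<^sup>+y. ennreal \<bar>w y - avg w y (scale k)\<bar> \<partial>m)"
    by (rule nn_integral_suminf) measurable
  also have "\<dots> \<le> (\<Sum>k. ennreal (A * scale k))"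
  proof (intro suminf_le)
    fix k
    have "(\<integral>\<^sup>+y. ennreal \<bar>w y - avg w y (scale k)\<bar> \<partial>m) = ennreal (LINT y|m. \<bar>w y - avg w y (scale k)\<bar>)"
      using lint_avg_diff_le(2)[OF w scale_pos] by (intro nn_integral_eq_integral) auto
    then show "(\<integral>\<^sup>+y. ennreal \<bar>w y - avg w y (scale k)\<bar> \<partial>m) \<le> ennreal (A * scale k)"
      using lint_avg_diff_le(1)[OF w scale_pos, of k] by (simp add: A_def ennreal_leI)
  qed auto
  also have "\<dots> = ennreal (\<Sum>k. A * scale k)"
    using A0 scale_pos by (intro suminf_ennreal2 s) (auto simp: less_imp_le)
  also have "\<dots> < \<infinity>" by simp
  finally have "AE y in m. (\<Sum>k. ennreal \<bar>w y - avg w y (scale k)\<bar>) \<noteq> \<infinity>"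
    by (intro nn_integral_PInf_AE) auto
  then show ?thesis
  proof eventually_elim
    case (elim y)
    then have "summable (\<lambda>k. \<bar>w y - avg w y (scale k)\<bar>)" by (intro summable_suminf_not_top) auto
    then have "(\<lambda>k. \<bar>w y - avg w y (scale k)\<bar>) \<longlonglongrightarrow> 0" by (rule summable_LIMSEQ_zero)
    then have "(\<lambda>k. w y - avg w y (scale k)) \<longlonglongrightarrow> 0" by (simp add: tendsto_rabs_zero_iff)
    then have "(\<lambda>k. w y - (w y - avg w y (scale k))) \<longlonglongrightarrow> w y - 0" by (intro tendsto_intros)
    then show ?case by simp
  qed
qed

text \<open>Telescoping bounds \<open>\<bar>w y\<bar>\<close> almost everywhere by \<open>A\<close>
  plus the sum of all \<open>b y j\<close>. The weight \<open>2 powr ((p - 1) * Suc j)\<close> that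
  a sum of powers puts on term \<open>j\<close> is beaten by \<open>scale j powr p\<close>, which is
  of order \<open>2 powr (- (p * j))\<close>; a geometric series with ratio 1/2 is left.\<close>

theorem poincare_pair_imp_Lp:
  assumes w: "poincare_pair w h"
  shows "(\<integral>\<^sup>+y. ennreal_powr (ennreal \<bar>w y\<bar>) p \<partial>m) < \<infinity>"
proof -
  note int = poincare_pairD[OF w]
  obtain c where c: "0 < c" "\<And>x. x \<in> closure \<Omega> \<Longrightarrow> c \<le> mm x R" using mm_lower[OF R0] by auto
  define A where "A = (LINT y|m. \<bar>w y\<bar>) / c"
  have A: "\<bar>avg w x (scale 0)\<bar> \<le> A" if x: "x \<in> closure \<Omega>" for x
  proof -
    have "\<bar>avg w x R\<bar> * c \<le> \<bar>avg w x R\<bar> * mm x R" by (intro mult_left_mono c x) auto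
    also have "\<dots> \<le> (LINT y|m. \<bar>w y\<bar>)" by (rule avg_abs_le[OF int(1) x R0])
    finally show ?thesis using c(1) by (simp add: A_def scale_def field_simps)
  qed
  \<comment> \<open>The bound is kept as it is before \<open>powr_inverse_young\<close>, because its
    \<open>p\<close>th power is exactly linear in \<open>\<Phi>\<close>.\<close>
  define b where "b y j = K * C1 * (scale j * \<Phi> h y (scale j) powr (1 / p))" for y j
  have b0: "0 \<le> b y j" for y j unfolding b_def using K1 C1_nonneg scale_pos[of j] by (intro mult_nonneg_nonneg) auto
  have step: "\<bar>avg w y (scale (Suc j)) - avg w y (scale j)\<bar> \<le> b y j" if "y \<in> closure \<Omega>" for y j
  proof -
    have eq: "scale (Suc j) = scale j / 2" by (simp add: scale_def)
    show ?thesis unfolding b_def eq by (rule avg_half_le[OF w that scale_pos])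
  qed
  have tel: "\<bar>avg w y (scale k)\<bar> \<le> A + (\<Sum>j<k. b y j)" if y: "y \<in> closure \<Omega>" for y k
  proof (induction k)
    case (Suc k)
    then show ?case using step[OF y, of k] unfolding sum.lessThan_Suc by linarith
  qed (use A[OF y] in simp)
  have meas: "\<Phi> h y r \<ge> 0" for y r by (intro \<Phi>_nonneg int)
  have [measurable]: "(\<lambda>y. \<Phi> h y r) \<in> borel_measurable m" for r
    by (rule borel_imp_m) (rule borel_measurable_\<Phi>[OF int(2)])
  have [measurable]: "(\<lambda>y. ennreal (b y j)) \<in> borel_measurable m" for j
    unfolding b_def by measurable
  have "AE y in m. ennreal \<bar>w y\<bar> \<le> ennreal A + (\<Sum>j. ennreal (b y j))"
    using AE_avg_tendsto[OF w] AE_space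
  proof eventually_elim
    case (elim y)
    then have y: "y \<in> closure \<Omega>" using space_m closure_I by auto
    have lim: "(\<lambda>k. ennreal \<bar>avg w y (scale k)\<bar>) \<longlonglongrightarrow> ennreal \<bar>w y\<bar>" using elim by (intro tendsto_ennrealI tendsto_rabs) auto
    have bd: "ennreal \<bar>avg w y (scale k)\<bar> \<le> ennreal A + (\<Sum>j. ennreal (b y j))" for k
    proof -
      have A0: "0 \<le> A" using A[OF y] by linarith
      have "ennreal \<bar>avg w y (scale k)\<bar> \<le> ennreal (A + (\<Sum>j<k. b y j))" by (rule ennreal_leI[OF tel[OF y]])
      also have "\<dots> = ennreal A + (\<Sum>j<k. ennreal (b y j))" using A0 b0 by (simp add: sum_nonneg)
      also have "\<dots> \<le> ennreal A + (\<Sum>j. ennreal (b y j))" by (intro add_left_mono sum_le_suminf) auto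
      finally show ?thesis .
    qed
    show ?case by (rule LIMSEQ_le_const2[OF lim]) (use bd in blast)
  qed
  then have "(\<integral>\<^sup>+y. ennreal_powr (ennreal \<bar>w y\<bar>) p \<partial>m) \<le> (\<integral>\<^sup>+y. ennreal_powr (ennreal A + (\<Sum>j. ennreal (b y j))) p \<partial>m)"
    using p1 by (intro nn_integral_mono_AE) (auto elim!: eventually_mono intro: ennreal_powr_mono)
  also have "\<dots> \<le> ennreal ((1 - 1/2) powr (1 - p)) * (\<integral>\<^sup>+y. ennreal_powr (ennreal A) p \<partial>m) +
      ennreal ((1/2) powr (1 - p)) * (\<integral>\<^sup>+y. ennreal_powr (\<Sum>j. ennreal (b y j)) p \<partial>m)"
    using p1 by (intro nn_integral_ennreal_powr_add_le) auto
  also have "\<dots> < \<infinity>"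
  proof -
    have "emeasure m (space m) < top" using m.emeasure_finite[of "space m"] unfolding less_top .
    then have 1: "(\<integral>\<^sup>+y. ennreal_powr (ennreal A) p \<partial>m) < \<infinity>"
      by (simp add: ennreal_mult_less_top)
    define I where "I = K ^ 8 * (LINT y|m. h y)"
    define q where "q = 2 powr (p - 1) * ((K * C1) powr p * R powr p * I)"
    have I0: "0 \<le> I" unfolding I_def using K1 int by (intro mult_nonneg_nonneg integral_nonneg) auto
    have q0: "0 \<le> q" using I0 by (simp add: q_def)
    have "(\<integral>\<^sup>+y. ennreal_powr (\<Sum>j. ennreal (b y j)) p \<partial>m) \<le>
        (\<Sum>j. ennreal (2 powr ((p - 1) * real (Suc j))) * (\<integral>\<^sup>+y. ennreal_powr (ennreal (b y j)) p \<partial>m))"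
      using p1 by (intro nn_integral_ennreal_powr_suminf_le) auto
    also have "\<dots> \<le> (\<Sum>j. ennreal (q * (1/2) ^ j))"
    proof (intro suminf_le)
      fix j
      have bp: "ennreal_powr (ennreal (b y j)) p = ennreal ((K * C1) powr p * scale j powr p) * ennreal (\<Phi> h y (scale j))" for y
      proof -
        have "b y j powr p = (K * C1) powr p * scale j powr p * \<Phi> h y (scale j)"
          unfolding b_def using K1 C1_nonneg scale_pos[of j] meas[of y "scale j"] p1 by (simp add: powr_mult powr_powr)
        then show ?thesis using b0 meas by (simp add: ennreal_powr_ennreal ennreal_mult)
      qed
      have "(\<integral>\<^sup>+y. ennreal (\<Phi> h y (scale j)) \<partial>m) = (\<integral>\<^sup>+y\<in>\<Omega>. ennreal (\<Phi> h y (scale j)) \<partial>m)"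
        by (intro nn_integral_cong) (auto simp: space_m)
      also have "\<dots> \<le> ennreal (1 * K ^ 8 * (LINT y|m. h y))"
      proof (rule nn_integral_\<Phi>_le[OF int(2,3) closure_subset _ scale_pos])
        show "\<Omega> \<in> sets m" using sets_m[of UNIV] by simp
        show "emeasure m (ball x (scale j) \<inter> \<Omega>) \<le> ennreal (1 * mm x (scale j))" for x
          by (simp add: m.emeasure_eq_measure)
      qed auto
      finally have \<Phi>: "(\<integral>\<^sup>+y. ennreal (\<Phi> h y (scale j)) \<partial>m) \<le> ennreal I" by (simp add: I_def)
      have "(\<integral>\<^sup>+y. ennreal_powr (ennreal (b y j)) p \<partial>m) \<le> ennreal ((K * C1) powr p * scale j powr p) * ennreal I"
        unfolding bp by (subst nn_integral_cmult) (auto intro!: mult_left_mono \<Phi>)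
      then have "ennreal (2 powr ((p - 1) * real (Suc j))) * (\<integral>\<^sup>+y. ennreal_powr (ennreal (b y j)) p \<partial>m) \<le>
          ennreal (2 powr ((p - 1) * real (Suc j))) * (ennreal ((K * C1) powr p * scale j powr p) * ennreal I)"
        by (intro mult_left_mono) auto
      also have "\<dots> = ennreal (2 powr ((p - 1) * real (Suc j)) * ((K * C1) powr p * scale j powr p * I))"
        using I0 by (simp add: ennreal_mult del: of_nat_Suc)
      also have "2 powr ((p - 1) * real (Suc j)) * ((K * C1) powr p * scale j powr p * I) = q * (1/2) ^ j"
      proof -
        have "(2::real) powr ((p - 1) * real (Suc j)) * scale j powr p = 2 powr (p - 1) * R powr p * (2 powr ((p - 1) * j) * 2 powr (- (p * j)))"
        proof -
          have eq1: "scale j powr p = R powr p * 2 powr (- (p * j))"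
            unfolding scale_powr by (simp add: powr_powr flip: powr_realpow)
          have eq2: "(2::real) powr ((p - 1) * real (Suc j)) = 2 powr (p - 1) * 2 powr ((p - 1) * j)"
            by (simp add: distrib_left powr_add)
          have *: "(T * Z) * (S * X) = T * S * (Z * X)" for T Z S X :: real by simp
          show ?thesis unfolding eq1 eq2 by (rule *)
        qed
        also have "(2::real) powr ((p - 1) * j) * 2 powr (- (p * j)) = 2 powr (- real j)"
          by (simp add: algebra_simps flip: powr_add)
        also have "(2::real) powr (- real j) = (1/2) ^ j" by (simp add: powr_minus_divide powr_realpow power_divide)
        finally show ?thesis by (simp add: q_def mult_ac)
      qed
      finally show "ennreal (2 powr ((p - 1) * real (Suc j))) * (\<integral>\<^sup>+y. ennreal_powr (ennreal (b y j)) p \<partial>m)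
         \<le> ennreal (q * (1/2) ^ j)" .
    qed auto
    also have "\<dots> = ennreal (\<Sum>j. q * (1/2) ^ j)"
      using q0 by (intro suminf_ennreal2 summable_mult summable_geometric) auto
    also have "\<dots> < \<infinity>" by simp
    finally show ?thesis using 1 by (auto simp: ennreal_mult_less_top)
  qed
  finally show ?thesis .
qed

subsection \<open>Compactness\<close>

text \<open>Up to an L1 error of order \<open>r\<close>, a function is determined by its finitely
  many averages over the balls of a net; this is the source of compactness.\<close>

lemma lint_diff_net_le:
  assumes w: "poincare_pair w h" "poincare_pair w' h'" and F: "separated r F" "\<Omega> \<subseteq> (\<Union>x\<in>F. ball x r)" and r: "0 < r"
  shows "(LINT y|m. \<bar>w y - w' y\<bar>) \<le>
    C1 * r * K ^ 7 * (2 * measure m \<Omega> + (LINT y|m. h y) + (LINT y|m. h' y)) +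
    (\<Sum>x\<in>F. \<bar>avg w x r - avg w' x r\<bar> * measure m \<Omega>)"
proof -
  note int = poincare_pairD[OF w(1)] and int' = poincare_pairD[OF w(2)]
  have fin: "finite F" using F by (simp add: separated_def)
  have i: "integrable m (\<lambda>y. \<bar>w y - w' y\<bar>)" using int int' by simp
  have "(LINT y|m. \<bar>w y - w' y\<bar>) \<le> (\<Sum>x\<in>F. ib (\<lambda>y. \<bar>w y - w' y\<bar>) x r)"
    by (rule set_lint_net_le[OF fin F(2) i]) auto
  also have "\<dots> \<le> (\<Sum>x\<in>F. ib (\<lambda>y. \<bar>w y - avg w x r\<bar>) x r + ib (\<lambda>y. \<bar>w' y - avg w' x r\<bar>) x r +
      \<bar>avg w x r - avg w' x r\<bar> * measure m \<Omega>)"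
  proof (rule sum_mono)
    fix x
    have i1: "integrable m (\<lambda>y. \<bar>w y - avg w x r\<bar>)" "integrable m (\<lambda>y. \<bar>w' y - avg w' x r\<bar>)" using int int' by auto
    then have i2: "integrable m (\<lambda>y. \<bar>w y - avg w x r\<bar> + \<bar>w' y - avg w' x r\<bar>)" by simp
    have "ib (\<lambda>y. \<bar>w y - w' y\<bar>) x r \<le> ib (\<lambda>y. (\<bar>w y - avg w x r\<bar> + \<bar>w' y - avg w' x r\<bar>) + \<bar>avg w x r - avg w' x r\<bar>) x r"
      using i1 by (intro set_integral_mono[OF set_integrable_B[OF i] set_integrable_B]) auto
    also have "\<dots> = ib (\<lambda>y. \<bar>w y - avg w x r\<bar>) x r + ib (\<lambda>y. \<bar>w' y - avg w' x r\<bar>) x r +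
      \<bar>avg w x r - avg w' x r\<bar> * mm x r"
      by (subst set_integral_add[OF set_integrable_B[OF i2] set_integrable_B], simp,
        subst set_integral_add[OF set_integrable_B[OF i1(1)] set_integrable_B[OF i1(2)]])
        (auto simp: set_lebesgue_integral_def mult.commute)
    also have "\<dots> \<le> ib (\<lambda>y. \<bar>w y - avg w x r\<bar>) x r + ib (\<lambda>y. \<bar>w' y - avg w' x r\<bar>) x r +
      \<bar>avg w x r - avg w' x r\<bar> * measure m \<Omega>"
      using sets_m[of UNIV] by (intro add_left_mono mult_left_mono m.finite_measure_mono) auto
    finally show "ib (\<lambda>y. \<bar>w y - w' y\<bar>) x r \<le> ib (\<lambda>y. \<bar>w y - avg w x r\<bar>) x r + ib (\<lambda>y. \<bar>w' y - avg w' x r\<bar>) x r +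
      \<bar>avg w x r - avg w' x r\<bar> * measure m \<Omega>" .
  qed
  also have "\<dots> = (\<Sum>x\<in>F. ib (\<lambda>y. \<bar>w y - avg w x r\<bar>) x r) + (\<Sum>x\<in>F. ib (\<lambda>y. \<bar>w' y - avg w' x r\<bar>) x r) +
      (\<Sum>x\<in>F. \<bar>avg w x r - avg w' x r\<bar> * measure m \<Omega>)"
    by (simp only: sum.distrib)
  also have "\<dots> \<le> C1 * r * K ^ 7 * (measure m \<Omega> + (LINT y|m. h y)) + C1 * r * K ^ 7 * (measure m \<Omega> + (LINT y|m. h' y))
     + (\<Sum>x\<in>F. \<bar>avg w x r - avg w' x r\<bar> * measure m \<Omega>)"
    using r by (intro add_mono avg_dev_net[OF w(1) F(1)] avg_dev_net[OF w(2) F(1)]) auto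
  finally show ?thesis by (simp add: algebra_simps)
qed

text \<open>Along a diagonal subsequence every average over a net ball converges. Such a subsequence
  is Cauchy in L1, since for a given accuracy \<open>lint_diff_net_le\<close> involves the averages
  of one net only.\<close>

theorem poincare_pair_compact:
  assumes w: "\<And>n. poincare_pair (w n) (h n)" and hb: "\<And>n. (LINT y|m. h n y) \<le> b" and wb: "\<And>n. (LINT y|m. \<bar>w n y\<bar>) \<le> b"
  obtains \<sigma> :: "nat \<Rightarrow> nat" where "strict_mono \<sigma>"
    "\<And>e. 0 < e \<Longrightarrow> \<exists>N. \<forall>i\<ge>N. \<forall>j\<ge>N. (LINT y|m. \<bar>w (\<sigma> i) y - w (\<sigma> j) y\<bar>) < e"
proof -
  have "\<exists>L. separated (scale k) (set L) \<and> set L \<subseteq> \<Omega> \<and> \<Omega> \<subseteq> (\<Union>x\<in>set L. ball x (scale k))" for k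
  proof -
    obtain F where "separated (scale k) F" "F \<subseteq> \<Omega>" "\<Omega> \<subseteq> (\<Union>x\<in>F. ball x (scale k))"
      using net_exists[OF closure_subset scale_pos] by blast
    moreover obtain L where "set L = F" using finite_list[of F] calculation by (auto simp: separated_def)
    ultimately show ?thesis by blast
  qed
  then obtain L where L: "\<And>k. separated (scale k) (set (L k))" "\<And>k. set (L k) \<subseteq> \<Omega>"
    "\<And>k. \<Omega> \<subseteq> (\<Union>x\<in>set (L k). ball x (scale k))" by metis
  \<comment> \<open>All averages over the net balls of all scales in one numbering, as the diagonal
    argument needs; indices without a ball get 0.\<close>
  define X where "X i n = (case prod_decode i of (k, j) \<Rightarrow>
      if j < length (L k) then avg (w n) (L k ! j) (scale k) else 0)" for i n
  have Xb: "\<exists>c. \<forall>n. \<bar>X i n\<bar> \<le> c" for i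
  proof -
    obtain k j where kj: "prod_decode i = (k, j)" by (cases "prod_decode i")
    show ?thesis
    proof (cases "j < length (L k)")
      case True
      then have x: "L k ! j \<in> closure \<Omega>" using nth_mem[OF True] L(2)[of k] closure_I by blast
      have mx: "0 < mm (L k ! j) (scale k)" by (rule ball_pos[OF x scale_pos])
      have "\<bar>X i n\<bar> \<le> b / mm (L k ! j) (scale k)" for n
      proof -
        have "\<bar>avg (w n) (L k ! j) (scale k)\<bar> * mm (L k ! j) (scale k) \<le> b"
          by (rule order_trans[OF avg_abs_le[OF poincare_pairD(1)[OF w] x scale_pos] wb])
        then show ?thesis using mx True by (simp add: X_def kj field_simps)
      qed
      then show ?thesis by blast
    qed (auto simp: X_def kj)
  qed
  interpret subseqs "\<lambda>i s. convergent (\<lambda>n. X i (s n))"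
  proof
    fix i and s :: "nat \<Rightarrow> nat" assume "strict_mono s"
    obtain c where c: "\<forall>n. \<bar>X i n\<bar> \<le> c" using Xb by blast
    then have "\<forall>n. X i (s n) \<in> {-c..c}" by (simp add: abs_le_iff minus_le_iff)
    then obtain l r where "strict_mono (r :: nat \<Rightarrow> nat)" "((\<lambda>n. X i (s n)) \<circ> r) \<longlonglongrightarrow> l"
      using seq_compactE[OF compact_imp_seq_compact[OF compact_Icc[of "-c" c]], of "\<lambda>n. X i (s n)"] by metis
    then show "\<exists>r. strict_mono r \<and> convergent (\<lambda>n. X i ((s \<circ> r) n))"
      by (intro exI[of _ r]) (auto simp: convergent_def o_def)
  qed
  have conv: "convergent (\<lambda>n. X i (diagseq n))" for i
  proof -
    have "convergent (\<lambda>n. X i ((diagseq \<circ> (+) (Suc i)) n))"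
      by (rule diagseq_holds) (auto simp: o_def intro: convergent_subseq_convergent[unfolded o_def])
    then have "convergent (\<lambda>n. X i (diagseq (n + Suc i)))" by (simp add: add.commute)
    then show ?thesis by (rule convergent_ignore_initial_segment[THEN iffD1])
  qed
  show ?thesis
  proof (rule that[OF subseq_diagseq])
    fix e :: real assume e: "0 < e"
    define A where "A = C1 * K ^ 7 * (2 * measure m \<Omega> + b + b)"
    have "(\<lambda>k. A * scale k) \<longlonglongrightarrow> A * 0" by (intro tendsto_intros scale_tendsto)
    then have "\<forall>\<^sub>F k in sequentially. A * scale k < e / 2" using e by (intro order_tendstoD) auto
    then obtain k where k: "A * scale k < e / 2" by (auto simp: eventually_sequentially)
    define F where "F = set (L k)"
    \<comment> \<open>Chosen so that the deviations at all points of \<open>F\<close> together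
      contribute at most \<open>e / 2\<close>.\<close>
    define d where "d = e / (2 * (card F * measure m \<Omega> + 1))"
    have pos: "0 < card F * measure m \<Omega> + 1" by (intro add_nonneg_pos) auto
    have d: "0 < d" using e pos by (simp add: d_def)
    have "\<exists>N. \<forall>i\<ge>N. \<forall>j\<ge>N. \<bar>avg (w (diagseq i)) x (scale k) - avg (w (diagseq j)) x (scale k)\<bar> < d" if "x \<in> F" for x
    proof -
      obtain l where l: "l < length (L k)" "L k ! l = x" using \<open>x \<in> F\<close> by (auto simp: F_def in_set_conv_nth)
      have "Cauchy (\<lambda>n. X (prod_encode (k, l)) (diagseq n))" using conv convergent_Cauchy by blast
      then show ?thesis unfolding Cauchy_def using d l by (simp add: X_def dist_real_def)
    qed
    then obtain N where N: "\<And>x i j. x \<in> F \<Longrightarrow> i \<ge> N x \<Longrightarrow> j \<ge> N x \<Longrightarrow>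
        \<bar>avg (w (diagseq i)) x (scale k) - avg (w (diagseq j)) x (scale k)\<bar> < d"
      by metis
    define N0 where "N0 = Max (insert 0 (N ` F))"
    have fin: "finite F" by (simp add: F_def)
    have N0: "N x \<le> N0" if "x \<in> F" for x unfolding N0_def using fin that by (intro Max_ge) auto
    have "(LINT y|m. \<bar>w (diagseq i) y - w (diagseq j) y\<bar>) < e" if ij: "i \<ge> N0" "j \<ge> N0" for i j
    proof -
      have "(LINT y|m. \<bar>w (diagseq i) y - w (diagseq j) y\<bar>) \<le>
        C1 * scale k * K ^ 7 * (2 * measure m \<Omega> + (LINT y|m. h (diagseq i) y) + (LINT y|m. h (diagseq j) y)) +
        (\<Sum>x\<in>F. \<bar>avg (w (diagseq i)) x (scale k) - avg (w (diagseq j)) x (scale k)\<bar> * measure m \<Omega>)"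
        unfolding F_def by (rule lint_diff_net_le[OF w w L(1) L(3) scale_pos])
      also have "\<dots> \<le> C1 * scale k * K ^ 7 * (2 * measure m \<Omega> + b + b) + (\<Sum>x\<in>F. d * measure m \<Omega>)"
        using C1_nonneg K1 scale_pos[of k]
        by (intro add_mono mult_left_mono hb sum_mono mult_right_mono
            less_imp_le[OF N[OF _ order_trans[OF N0 ij(1)] order_trans[OF N0 ij(2)]]]) auto
      also have "\<dots> = A * scale k + d * (card F * measure m \<Omega>)" by (simp add: A_def mult_ac)
      also have "\<dots> < e / 2 + d * (card F * measure m \<Omega> + 1)"
        using k d by (intro add_less_le_mono mult_left_mono) auto
      also have "\<dots> = e" using pos by (simp add: d_def field_simps)
      finally show ?thesis .
    qed
    then show "\<exists>N. \<forall>i\<ge>N. \<forall>j\<ge>N. (LINT y|m. \<bar>w (diagseq i) y - w (diagseq j) y\<bar>) < e" by blast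
  qed
qed

end

lemma ennreal_mult_add_mult:
  assumes "0 \<le> a" "0 \<le> b" "0 \<le> c" "0 \<le> d"
  shows "ennreal a * ennreal b + ennreal c * ennreal d = ennreal (a * b + c * d)"
  using assms by (subst ennreal_plus) (auto simp: ennreal_mult)

subsection \<open>Codimension one content\<close>

text \<open>A sequence of finite families of balls is flattened into one countable cover by
  \<open>prod_encode\<close>; each finite partial sum then involves only finitely many
  families.\<close>

lemma codim1_content_le_cover:
  fixes L :: "nat \<Rightarrow> 'a::metric_space list"
  assumes r: "\<And>k. 0 < r k \<and> r k \<le> \<rho>" and A: "A \<subseteq> (\<Union>k. \<Union>x\<in>set (L k). ball x (r k))"
    and L: "\<And>k. distinct (L k)"
  shows "codim1_content M \<rho> A \<le> (\<Sum>k. \<Sum>x\<in>set (L k). emeasure M (ball x (r k)) / ennreal (r k))"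
proof -
  define I where "I = prod_encode ` (SIGMA k:UNIV. {..<length (L k)})"
  define c where "c i = (case prod_decode i of (k, j) \<Rightarrow> L k ! j)" for i
  define s where "s i = r (fst (prod_decode i))" for i
  define f where "f i = emeasure M (ball (c i) (s i)) / ennreal (s i)" for i
  have "A \<subseteq> (\<Union>i\<in>I. ball (c i) (s i))"
  proof
    fix y assume "y \<in> A"
    then obtain k x where x: "x \<in> set (L k)" "y \<in> ball x (r k)" using A by blast
    then obtain j where "j < length (L k)" "L k ! j = x" by (auto simp: in_set_conv_nth)
    then have "prod_encode (k, j) \<in> I" "c (prod_encode (k, j)) = x" "s (prod_encode (k, j)) = r k"
      by (auto simp: I_def c_def s_def)
    then show "y \<in> (\<Union>i\<in>I. ball (c i) (s i))" using x by force
  qed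
  then have "codim1_content M \<rho> A \<le> infsum f I"
    unfolding codim1_content_def f_def using r
    by (intro INF_lower2[where i="(I, c, s)"]) (auto simp: s_def)
  also have "\<dots> = (SUP G\<in>{G. finite G \<and> G \<subseteq> I}. sum f G)" by (rule nonneg_infsum_complete) auto
  also have "\<dots> \<le> (\<Sum>k. \<Sum>x\<in>set (L k). emeasure M (ball x (r k)) / ennreal (r k))"
  proof (rule SUP_least)
    fix G assume "G \<in> {G. finite G \<and> G \<subseteq> I}"
    then have G: "finite G" "G \<subseteq> I" by auto
    define n where "n = Suc (Max (insert 0 ((fst \<circ> prod_decode) ` G)))"
    let ?S = "SIGMA k:{..<n}. {..<length (L k)}"
    have "G \<subseteq> prod_encode ` ?S"
    proof
      fix i assume i: "i \<in> G"
      then obtain k j where kj: "i = prod_encode (k, j)" "j < length (L k)" using G by (auto simp: I_def)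
      have "fst (prod_decode i) \<le> Max (insert 0 ((fst \<circ> prod_decode) ` G))"
        using i G(1) by (intro Max_ge) auto
      then have "k < n" using kj by (simp add: n_def)
      then show "i \<in> prod_encode ` ?S" using kj by auto
    qed
    then have "sum f G \<le> sum f (prod_encode ` ?S)" by (intro sum_mono2) auto
    also have "\<dots> = (\<Sum>x\<in>?S. f (prod_encode x))"
      by (subst sum.reindex) (auto intro: inj_on_subset[OF inj_prod_encode])
    also have "\<dots> = (\<Sum>k<n. \<Sum>j<length (L k). f (prod_encode (k, j)))"
      by (subst sum.Sigma) auto
    also have "\<dots> = (\<Sum>k<n. \<Sum>x\<in>set (L k). emeasure M (ball x (r k)) / ennreal (r k))"
    proof (intro sum.cong refl)
      fix k
      show "(\<Sum>j<length (L k). f (prod_encode (k, j))) = (\<Sum>x\<in>set (L k). emeasure M (ball x (r k)) / ennreal (r k))"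
        using L[of k] by (intro sum.reindex_bij_betw[OF bij_betw_nth[OF L refl refl], THEN trans[rotated]])
          (simp add: f_def c_def s_def)
    qed
    also have "\<dots> \<le> (\<Sum>k. \<Sum>x\<in>set (L k). emeasure M (ball x (r k)) / ennreal (r k))"
      by (rule sum_le_suminf) auto
    finally show "sum f G \<le> (\<Sum>k. \<Sum>x\<in>set (L k). emeasure M (ball x (r k)) / ennreal (r k))" .
  qed
  finally show ?thesis .
qed

lemma codim1_content_mono: "A \<subseteq> A' \<Longrightarrow> codim1_content M \<rho> A \<le> codim1_content M \<rho> A'"
  unfolding codim1_content_def by (intro INF_superset_mono) auto

lemma codim1_hausdorff_mono: "A \<subseteq> A' \<Longrightarrow> codim1_hausdorff M A \<le> codim1_hausdorff M A'"
  unfolding codim1_hausdorff_def by (intro SUP_mono) (auto intro: codim1_content_mono)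

text \<open>The measure of \<open>A\<close> is estimated on the covers that make its content small.
  \<open>A\<close> itself need not be measurable, whence a null set containing it.\<close>

lemma codim1_null_imp_null:
  fixes M P :: "'a::metric_space measure"
  assumes null: "codim1_hausdorff M A = 0" and R: "0 < R" and c: "0 \<le> c" and P: "sets P = sets borel"
    and bound: "\<And>x y r. x \<in> A \<Longrightarrow> 0 < r \<Longrightarrow> r \<le> R \<Longrightarrow> x \<in> ball y r \<Longrightarrow>
      emeasure P (ball y r) \<le> ennreal c * (emeasure M (ball y r) / ennreal r)"
  shows "\<exists>N\<in>null_sets P. A \<subseteq> N"
proof -
  have "\<exists>U\<in>sets P. A \<subseteq> U \<and> emeasure P U \<le> ennreal (1 / Suc n)" for n
  proof -
    let ?e = "1 / ((c + 1) * real (Suc n))"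
    have e: "0 < ?e" using c by simp
    have "codim1_content M R A \<le> codim1_hausdorff M A"
      unfolding codim1_hausdorff_def using R by (intro SUP_upper) auto
    then have "codim1_content M R A < ennreal ?e" using null e by simp
    then obtain I :: "nat set" and z r where I: "\<forall>i\<in>I. 0 < r i \<and> r i \<le> R" "A \<subseteq> (\<Union>i\<in>I. ball (z i) (r i))"
      and small: "(\<Sum>\<^sub>\<infinity>i\<in>I. emeasure M (ball (z i) (r i)) / ennreal (r i)) < ennreal ?e"
      unfolding codim1_content_def INF_less_iff by auto
    \<comment> \<open>\<open>bound\<close> is available only for balls that meet \<open>A\<close>;
      the others can be removed from the cover.\<close>
    define J where "J = {i\<in>I. A \<inter> ball (z i) (r i) \<noteq> {}}"
    define f where "f i = (if i \<in> J then ball (z i) (r i) else {})" for i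
    define g where "g i = emeasure M (ball (z i) (r i)) / ennreal (r i)" for i
    have fs: "f i \<in> sets P" for i using P by (simp add: f_def)
    have "emeasure P (\<Union>i. f i) \<le> (\<Sum>i. emeasure P (f i))"
      by (rule emeasure_subadditive_countably) (use fs in auto)
    also have "\<dots> = (SUP n. \<Sum>i<n. emeasure P (f i))" by (rule suminf_eq_SUP)
    also have "\<dots> \<le> ennreal c * infsum g I"
    proof (rule SUP_least)
      fix k
      have "(\<Sum>i<k. emeasure P (f i)) = (\<Sum>i\<in>{..<k} \<inter> J. emeasure P (f i))"
        by (intro sum.mono_neutral_right) (auto simp: f_def)
      also have "\<dots> \<le> (\<Sum>i\<in>{..<k} \<inter> J. ennreal c * g i)"
      proof (rule sum_mono)
        fix i assume i: "i \<in> {..<k} \<inter> J"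
        then obtain x where "x \<in> A" "x \<in> ball (z i) (r i)" by (auto simp: J_def)
        then show "emeasure P (f i) \<le> ennreal c * g i"
          using i I by (auto simp: f_def g_def J_def intro!: bound)
      qed
      also have "\<dots> = ennreal c * sum g ({..<k} \<inter> J)" by (simp add: sum_distrib_left)
      also have "\<dots> \<le> ennreal c * infsum g I"
      proof (rule mult_left_mono)
        have "sum g ({..<k} \<inter> J) \<le> (SUP G\<in>{G. finite G \<and> G \<subseteq> I}. sum g G)"
          by (rule SUP_upper) (auto simp: J_def)
        then show "sum g ({..<k} \<inter> J) \<le> infsum g I" by (subst nonneg_infsum_complete) auto
      qed simp
      finally show "(\<Sum>i<k. emeasure P (f i)) \<le> ennreal c * infsum g I" .
    qed
    also have "\<dots> \<le> ennreal c * ennreal ?e"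
      using small by (intro mult_left_mono) (auto simp: g_def[abs_def])
    also have "\<dots> = ennreal (c * ?e)" using c e by (intro ennreal_mult[symmetric]) auto
    also have "c * ?e \<le> 1 / Suc n" using c by (simp add: divide_simps)
    finally have "emeasure P (\<Union>i. f i) \<le> ennreal (1 / Suc n)" by (simp add: ennreal_leI)
    moreover have "A \<subseteq> (\<Union>i. f i)" using I(2) by (fastforce simp: f_def J_def)
    moreover have "(\<Union>i. f i) \<in> sets P" using fs by auto
    ultimately show ?thesis by blast
  qed
  then obtain U where U: "\<And>n. U n \<in> sets P" "\<And>n. A \<subseteq> U n" "\<And>n. emeasure P (U n) \<le> ennreal (1 / Suc n)" by metis
  have "emeasure P (\<Inter>n. U n) \<le> ennreal (1 / Suc n)" for n
    using U by (intro order_trans[OF emeasure_mono U(3)]) auto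
  moreover have "(\<lambda>n. ennreal (1 / Suc n)) \<longlonglongrightarrow> ennreal 0"
    by (intro tendsto_ennrealI LIMSEQ_Suc[OF lim_inverse_n', unfolded o_def])
  ultimately have "emeasure P (\<Inter>n. U n) \<le> ennreal 0"
    by (intro LIMSEQ_le_const) auto
  then have "(\<Inter>n. U n) \<in> null_sets P" using U(1) by (intro null_setsI) auto
  then show ?thesis using U(2) by blast
qed

subsection \<open>Traces\<close>

locale trace_domain = poincare_domain \<Omega> m K p C R for \<Omega> :: "'a::metric_space set" and m K p C R +
  fixes M P :: "'a measure" and CP CM :: real
  assumes sets_P: "sets P = sets borel" and finite_P: "finite_measure P"
    and CP0: "0 \<le> CP" and CM0: "0 \<le> CM"
    and P_ball: "\<And>x r. x \<in> frontier \<Omega> \<Longrightarrow> 0 < r \<Longrightarrow> r \<le> R \<Longrightarrow>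
      emeasure P (ball x r) \<le> ennreal (CP * mm x r / r)"
    and M_ball: "\<And>x r. x \<in> frontier \<Omega> \<Longrightarrow> 0 < r \<Longrightarrow> r \<le> R \<Longrightarrow>
      emeasure M (ball x r) \<le> ennreal (CM * mm x r)"
begin

interpretation m: finite_measure m by (rule finite_m)
interpretation P: finite_measure P by (rule finite_P)

lemma frontier_closure: "frontier \<Omega> \<subseteq> closure \<Omega>" by (auto simp: frontier_def)

text \<open>A Borel-Cantelli argument: a bad point lies in \<open>E k\<close> for infinitely many
  \<open>k\<close>, and covering \<open>E k\<close> by the balls of a net costs at most a multiple
  of \<open>scale k powr (\<alpha> / 2)\<close>, so the covers from a late index on have arbitrarily
  small cost.\<close>

lemma trace_exists_codim1:
  assumes w: "poincare_pair w h"
  shows "codim1_hausdorff M {x\<in>frontier \<Omega>. \<not> summable (osc_bound h x)} = 0"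
proof -
  note int = poincare_pairD[OF w]
  define Z where "Z = {x\<in>frontier \<Omega>. \<not> summable (osc_bound h x)}"
  \<comment> \<open>The threshold spends half of the spare power \<open>\<alpha>\<close>: outside
    \<open>E k\<close> the terms are at most \<open>scale k powr (\<alpha> / 2)\<close>, which is
    summable, and inside the other half makes the costs of the covers summable.\<close>
  define E where "E k = {x\<in>frontier \<Omega>. scale k powr (1 + \<alpha>) * \<Phi> h x (scale k) > scale k powr (\<alpha> / 2)}" for k
  have ZE: "\<exists>k\<ge>k0. x \<in> E k" if "x \<in> Z" for x k0
  proof (rule ccontr)
    assume "\<not> (\<exists>k\<ge>k0. x \<in> E k)"
    then have le: "scale k powr (1 + \<alpha>) * \<Phi> h x (scale k) \<le> scale k powr (\<alpha> / 2)" if "k \<ge> k0" for k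
      using that \<open>x \<in> Z\<close> by (auto simp: E_def Z_def not_less)
    have "summable (\<lambda>k. scale k powr (1 + \<alpha>) * \<Phi> h x (scale k))"
      by (rule summable_comparison_test'[of "\<lambda>k. scale k powr (\<alpha> / 2)" k0])
        (use le \<alpha>_pos \<Phi>_nonneg[of h x] int(3) in \<open>auto intro!: summable_scale_powr\<close>)
    then have "summable (osc_bound h x)"
      unfolding osc_bound_def[abs_def] by (intro summable_add summable_scale_powr) auto
    then show False using that by (simp add: Z_def)
  qed
  have "\<exists>L. distinct L \<and> separated (scale k) (set L) \<and> set L \<subseteq> E k \<and> E k \<subseteq> (\<Union>x\<in>set L. ball x (scale k))" for k
  proof -
    have "E k \<subseteq> closure \<Omega>" using frontier_closure by (auto simp: E_def)
    then obtain F where "separated (scale k) F" "F \<subseteq> E k" "E k \<subseteq> (\<Union>x\<in>F. ball x (scale k))"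
      using net_exists[OF _ scale_pos] by blast
    moreover obtain L where "set L = F" "distinct L" using finite_distinct_list[of F] calculation by (auto simp: separated_def)
    ultimately show ?thesis by blast
  qed
  then obtain L where L: "\<And>k. distinct (L k)" "\<And>k. separated (scale k) (set (L k))" "\<And>k. set (L k) \<subseteq> E k"
    "\<And>k. E k \<subseteq> (\<Union>x\<in>set (L k). ball x (scale k))" by metis
  define D where "D = CM * K ^ 7 * (LINT y|m. h y)"
  have D0: "0 \<le> D" unfolding D_def using CM0 K1 int by (intro mult_nonneg_nonneg integral_nonneg) auto
  have cost: "(\<Sum>x\<in>set (L k). emeasure M (ball x (scale k)) / ennreal (scale k)) \<le> ennreal (D * scale k powr (\<alpha> / 2))" for k
  proof -
    let ?r = "scale k"
    have r: "0 < ?r" by (rule scale_pos)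
    have "(\<Sum>x\<in>set (L k). emeasure M (ball x ?r) / ennreal ?r) \<le> (\<Sum>x\<in>set (L k). ennreal (CM * (?r powr (\<alpha> / 2) * ib h x (3 * ?r))))"
    proof (rule sum_mono)
      fix x assume "x \<in> set (L k)"
      then have x: "x \<in> frontier \<Omega>" "?r powr (\<alpha> / 2) < ?r powr (1 + \<alpha>) * \<Phi> h x ?r" using L(3)[of k] by (auto simp: E_def)
      have mx: "0 < mm x ?r" using x frontier_closure by (intro ball_pos r) auto
      have "?r powr (\<alpha> / 2) * mm x ?r \<le> ?r powr (1 + \<alpha>) * ib h x (3 * ?r)"
        using x(2) mx by (simp add: \<Phi>_def field_simps)
      then have "mm x ?r / ?r \<le> ?r powr (1 + \<alpha>) * ib h x (3 * ?r) / (?r powr (\<alpha> / 2) * ?r)"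
        using r by (simp add: field_simps)
      also have "\<dots> = ?r powr (\<alpha> / 2) * ib h x (3 * ?r)"
      proof -
        have "?r powr (1 + \<alpha>) = ?r powr (\<alpha> / 2) * (?r powr (\<alpha> / 2) * ?r)"
          using r by (simp add: powr_add powr_add[symmetric] mult.assoc[symmetric])
        then show ?thesis using r by simp
      qed
      finally have le: "mm x ?r / ?r \<le> ?r powr (\<alpha> / 2) * ib h x (3 * ?r)" .
      have "emeasure M (ball x ?r) / ennreal ?r \<le> ennreal (CM * mm x ?r) / ennreal ?r"
        by (intro divide_right_mono_ennreal M_ball x r scale_le)
      also have "\<dots> = ennreal (CM * (mm x ?r / ?r))" using r CM0 by (simp add: divide_ennreal)
      also have "\<dots> \<le> ennreal (CM * (?r powr (\<alpha> / 2) * ib h x (3 * ?r)))"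
        using le CM0 by (intro ennreal_leI mult_left_mono) auto
      finally show "emeasure M (ball x ?r) / ennreal ?r \<le> ennreal (CM * (?r powr (\<alpha> / 2) * ib h x (3 * ?r)))" .
    qed
    also have "\<dots> = ennreal (\<Sum>x\<in>set (L k). CM * (?r powr (\<alpha> / 2) * ib h x (3 * ?r)))"
      using CM0 ib_nonneg[of h] int(3) by (intro sum_ennreal) auto
    also have "(\<Sum>x\<in>set (L k). CM * (?r powr (\<alpha> / 2) * ib h x (3 * ?r))) = CM * ?r powr (\<alpha> / 2) * (\<Sum>x\<in>set (L k). ib h x (3 * ?r))"
      by (simp add: sum_distrib_left mult.assoc)
    also have "\<dots> \<le> CM * ?r powr (\<alpha> / 2) * (K ^ 7 * (LINT y|m. h y))"
      using CM0 r by (intro mult_left_mono overlap_sum[OF L(2)] int) auto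
    finally show ?thesis by (simp add: D_def mult_ac ennreal_leI)
  qed
  have content: "codim1_content M \<rho> Z = 0" if \<rho>: "0 < \<rho>" for \<rho>
  proof -
    obtain k1 where k1: "\<And>k. k \<ge> k1 \<Longrightarrow> scale k < \<rho>"
      using order_tendstoD(2)[OF scale_tendsto \<rho>] by (auto simp: eventually_sequentially)
    have bound: "codim1_content M \<rho> Z \<le> ennreal (D * (\<Sum>k. scale (k + k0) powr (\<alpha> / 2)))" if k0: "k0 \<ge> k1" for k0
    proof -
      have s: "summable (\<lambda>k. scale (k + k0) powr (\<alpha> / 2))"
        using summable_scale_powr[of "\<alpha> / 2"] \<alpha>_pos by (subst summable_iff_shift) auto
      have "codim1_content M \<rho> Z \<le> (\<Sum>k. \<Sum>x\<in>set (L (k + k0)). emeasure M (ball x (scale (k + k0))) / ennreal (scale (k + k0)))"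
      proof (rule codim1_content_le_cover)
        show "0 < scale (k + k0) \<and> scale (k + k0) \<le> \<rho>" for k using k1[of "k + k0"] k0 scale_pos by simp
        show "Z \<subseteq> (\<Union>k. \<Union>x\<in>set (L (k + k0)). ball x (scale (k + k0)))"
        proof
          fix x assume "x \<in> Z"
          then obtain k where k: "k \<ge> k0" "x \<in> E k" using ZE by blast
          then have "x \<in> (\<Union>x\<in>set (L ((k - k0) + k0)). ball x (scale ((k - k0) + k0)))"
            using L(4)[of k] by (simp del: mem_ball) blast
          then show "x \<in> (\<Union>k. \<Union>x\<in>set (L (k + k0)). ball x (scale (k + k0)))" by blast
        qed
      qed (rule L(1))
      also have "\<dots> \<le> (\<Sum>k. ennreal (D * scale (k + k0) powr (\<alpha> / 2)))" by (intro suminf_le cost) auto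
      also have "\<dots> = ennreal (\<Sum>k. D * scale (k + k0) powr (\<alpha> / 2))"
        using D0 by (intro suminf_ennreal2 summable_mult s) auto
      finally show ?thesis using suminf_mult[OF s, of D] by simp
    qed
    have "(\<lambda>k0. ennreal (D * (\<Sum>k. scale (k + k0) powr (\<alpha> / 2)))) \<longlonglongrightarrow> ennreal (D * 0)"
      using summable_scale_powr[of "\<alpha> / 2"] \<alpha>_pos
      by (intro tendsto_ennrealI tendsto_intros suminf_shift_tendsto_0[of "\<lambda>k. scale k powr (\<alpha> / 2)"]) auto
    then have "codim1_content M \<rho> Z \<le> ennreal (D * 0)"
      by (rule LIMSEQ_le_const) (use bound in blast)
    then show ?thesis by simp
  qed
  then have "codim1_hausdorff M Z = 0"
    unfolding codim1_hausdorff_def by (intro SUP_eq_const) auto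
  then show ?thesis by (simp add: Z_def)
qed

text \<open>Telescoping starts at a scale so fine that the later steps contribute only the terms
  with \<open>\<eta>\<close>; the average at that scale is paid for by the L1 norm with a large
  \<open>c\<close>. The small coefficient of the energy is what later gives continuity with respect
  to L1 convergence on sets of bounded energy.\<close>

theorem trace_bound:
  assumes "0 < \<eta>"
  obtains c where "0 \<le> c" "\<And>w h. poincare_pair w h \<Longrightarrow>
    (\<integral>\<^sup>+x\<in>frontier \<Omega>. ennreal \<bar>trace_lim w x\<bar> \<partial>P) \<le> ennreal (c * (LINT y|m. \<bar>w y\<bar>) + \<eta> * (LINT y|m. h y) + \<eta>)"
proof -
  define A where "A = (K * C1 + 1) * CP * K ^ 8"
  define A' where "A' = (K * C1 + 1) * measure P UNIV"
  have s: "summable (\<lambda>j. scale j powr \<alpha>)" "summable (\<lambda>j. scale j powr (1 / 2))"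
    using \<alpha>_pos by (auto intro: summable_scale_powr)
  have "(\<lambda>k. A * (\<Sum>j. scale (j + k) powr \<alpha>)) \<longlonglongrightarrow> A * 0" "(\<lambda>k. A' * (\<Sum>j. scale (j + k) powr (1 / 2))) \<longlonglongrightarrow> A' * 0"
    by (intro tendsto_intros suminf_shift_tendsto_0[OF s(1)] suminf_shift_tendsto_0[OF s(2)])+
  then have "\<forall>\<^sub>F k in sequentially. A * (\<Sum>j. scale (j + k) powr \<alpha>) < \<eta> \<and> A' * (\<Sum>j. scale (j + k) powr (1 / 2)) < \<eta>"
    using assms by (intro eventually_conj order_tendstoD) auto
  then obtain k where k: "A * (\<Sum>j. scale (j + k) powr \<alpha>) < \<eta>" "A' * (\<Sum>j. scale (j + k) powr (1 / 2)) < \<eta>"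
    by (auto simp: eventually_sequentially)
  obtain c where c: "0 < c" "\<And>x. x \<in> closure \<Omega> \<Longrightarrow> c \<le> mm x (scale k)" using mm_lower[OF scale_pos] by auto
  have sk: "summable (\<lambda>j. scale (j + k) powr \<alpha>)" "summable (\<lambda>j. scale (j + k) powr (1 / 2))"
    by (rule summable_ignore_initial_segment[OF s(1)], rule summable_ignore_initial_segment[OF s(2)])
  have S: "frontier \<Omega> \<in> sets P" unfolding sets_P by (intro borel_closed frontier_closed)
  show ?thesis
  proof (rule that[of "measure P UNIV / c"])
    show "0 \<le> measure P UNIV / c" using c by simp
    fix w h assume w: "poincare_pair w h"
    note int = poincare_pairD[OF w]
    define W where "W = (LINT y|m. \<bar>w y\<bar>)"
    define H where "H = (LINT y|m. h y)"
    have W0: "0 \<le> W" "0 \<le> H" unfolding W_def H_def using int by (auto intro!: integral_nonneg)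
    have pt: "ennreal \<bar>trace_lim w x\<bar> \<le> ennreal (W / c) + ennreal (K * C1 + 1) * (\<Sum>j. ennreal (osc_bound h x (j + k)))"
      if x: "x \<in> frontier \<Omega>" for x
    proof (cases "(\<Sum>j. ennreal (osc_bound h x (j + k))) = top")
      case True
      \<comment> \<open>The summand 1 keeps the coefficient positive even if \<open>C1 = 0\<close>,
        so that the right-hand side is infinite here.\<close>
      have "ennreal (K * C1 + 1) \<noteq> 0" using K1 C1_nonneg by (simp add: add_nonneg_pos)
      then show ?thesis by (simp add: True ennreal_mult_top)
    next
      case False
      have xc: "x \<in> closure \<Omega>" using x frontier_closure by auto
      have a0: "0 \<le> osc_bound h x j" for j by (rule osc_bound_nonneg[OF int(3)])
      have sh: "summable (\<lambda>j. osc_bound h x (j + k))" using False a0 by (intro summable_suminf_not_top) auto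
      then have s: "summable (osc_bound h x)" by (simp add: summable_iff_shift)
      have "\<bar>avg w x (scale k)\<bar> * c \<le> \<bar>avg w x (scale k)\<bar> * mm x (scale k)" by (intro mult_left_mono c xc) auto
      also have "\<dots> \<le> W" unfolding W_def by (rule avg_abs_le[OF int(1) xc scale_pos])
      finally have "\<bar>avg w x (scale k)\<bar> \<le> W / c" using c(1) by (simp add: field_simps)
      moreover have "\<bar>trace_lim w x - avg w x (scale k)\<bar> \<le> K * C1 * (\<Sum>j. osc_bound h x (j + k))"
        by (rule avg_converges(2)[OF w xc s])
      moreover have "0 \<le> (\<Sum>j. osc_bound h x (j + k))" by (intro suminf_nonneg sh a0)
      ultimately have "\<bar>trace_lim w x\<bar> \<le> W / c + (K * C1 + 1) * (\<Sum>j. osc_bound h x (j + k))"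
        unfolding distrib_right mult_1 by linarith
      then have "ennreal \<bar>trace_lim w x\<bar> \<le> ennreal (W / c + (K * C1 + 1) * (\<Sum>j. osc_bound h x (j + k)))" by (rule ennreal_leI)
      also have "\<dots> = ennreal (W / c) + ennreal (K * C1 + 1) * (\<Sum>j. ennreal (osc_bound h x (j + k)))"
        using W0 c K1 C1_nonneg \<open>0 \<le> (\<Sum>j. osc_bound h x (j + k))\<close>
        by (simp add: suminf_ennreal2[OF a0 sh] ennreal_mult)
      finally show ?thesis .
    qed
    have [measurable]: "(\<lambda>x. \<Phi> h x r) \<in> borel_measurable P" for r
      using borel_measurable_\<Phi>[OF int(2), of r] by (simp add: measurable_cong_sets[OF sets_P refl])
    have [measurable]: "(\<lambda>x. ennreal (osc_bound h x j)) \<in> borel_measurable P" for j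
      unfolding osc_bound_def by measurable
    have aaint: "(\<integral>\<^sup>+x\<in>frontier \<Omega>. ennreal (osc_bound h x j) \<partial>P) \<le> ennreal (CP * K ^ 8 * H * scale j powr \<alpha> + measure P UNIV * scale j powr (1 / 2))" for j
    proof -
      let ?r = "scale j"
      have "(\<integral>\<^sup>+x\<in>frontier \<Omega>. ennreal (osc_bound h x j) \<partial>P) =
          (\<integral>\<^sup>+x. ennreal (?r powr (1 + \<alpha>)) * (ennreal (\<Phi> h x ?r) * indicator (frontier \<Omega>) x) + ennreal (?r powr (1 / 2)) * indicator (frontier \<Omega>) x \<partial>P)"
        unfolding osc_bound_def using \<Phi>_nonneg[OF int(3)]
        by (intro nn_integral_cong) (auto simp: indicator_def ennreal_mult)
      also have "\<dots> = ennreal (?r powr (1 + \<alpha>)) * (\<integral>\<^sup>+x\<in>frontier \<Omega>. ennreal (\<Phi> h x ?r) \<partial>P) + ennreal (?r powr (1 / 2)) * emeasure P (frontier \<Omega>)"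
        using S by (simp add: nn_integral_add nn_integral_cmult)
      also have "\<dots> \<le> ennreal (?r powr (1 + \<alpha>)) * ennreal (CP / ?r * K ^ 8 * H) + ennreal (?r powr (1 / 2)) * ennreal (measure P UNIV)"
      proof (intro add_mono mult_left_mono)
        show "(\<integral>\<^sup>+x\<in>frontier \<Omega>. ennreal (\<Phi> h x ?r) \<partial>P) \<le> ennreal (CP / ?r * K ^ 8 * H)"
          unfolding H_def
        proof (rule nn_integral_\<Phi>_le[OF int(2,3) frontier_closure S scale_pos])
          show "0 \<le> CP / ?r" using CP0 scale_pos[of j] by simp
          show "ball x ?r \<inter> frontier \<Omega> \<in> sets P" for x using S by (simp add: sets_P)
          fix x assume x: "x \<in> frontier \<Omega>"
          have "emeasure P (ball x ?r \<inter> frontier \<Omega>) \<le> emeasure P (ball x ?r)" by (intro emeasure_mono) (auto simp: sets_P)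
          also have "\<dots> \<le> ennreal (CP * mm x ?r / ?r)" by (rule P_ball[OF x scale_pos scale_le])
          finally show "emeasure P (ball x ?r \<inter> frontier \<Omega>) \<le> ennreal (CP / ?r * mm x ?r)" by simp
        qed
        show "emeasure P (frontier \<Omega>) \<le> ennreal (measure P UNIV)"
          unfolding P.emeasure_eq_measure[symmetric] by (intro emeasure_mono) (auto simp: sets_P)
      qed auto
      also have "\<dots> = ennreal (?r powr (1 + \<alpha>) * (CP / ?r * K ^ 8 * H) + ?r powr (1 / 2) * measure P UNIV)"
      proof -
        have "0 \<le> CP / ?r * K ^ 8 * H" using CP0 K1 W0 scale_pos[of j] by (intro mult_nonneg_nonneg divide_nonneg_nonneg) auto
        then show ?thesis by (intro ennreal_mult_add_mult) auto
      qed
      also have "?r powr (1 + \<alpha>) * (CP / ?r * K ^ 8 * H) = CP * K ^ 8 * H * ?r powr \<alpha>"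
        using scale_pos[of j] by (simp add: powr_add)
      finally show ?thesis by (simp add: mult.commute)
    qed
    let ?t = "\<lambda>j. CP * K ^ 8 * H * scale (j + k) powr \<alpha> + measure P UNIV * scale (j + k) powr (1 / 2)"
    have t0: "0 \<le> ?t j" for j using CP0 K1 W0 by (intro add_nonneg_nonneg mult_nonneg_nonneg) auto
    have ts: "summable ?t" by (intro summable_add summable_mult sk)
    define G where "G j x = ennreal (osc_bound h x (j + k)) * indicator (frontier \<Omega>) x" for j x
    have [measurable]: "G j \<in> borel_measurable P" for j unfolding G_def using S by measurable
    have "(\<integral>\<^sup>+x\<in>frontier \<Omega>. ennreal \<bar>trace_lim w x\<bar> \<partial>P) \<le>
        (\<integral>\<^sup>+x. ennreal (W / c) * indicator (frontier \<Omega>) x + ennreal (K * C1 + 1) * (\<Sum>j. G j x) \<partial>P)"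
    proof (rule nn_integral_mono)
      fix x
      show "ennreal \<bar>trace_lim w x\<bar> * indicator (frontier \<Omega>) x \<le>
        ennreal (W / c) * indicator (frontier \<Omega>) x + ennreal (K * C1 + 1) * (\<Sum>j. G j x)"
        using pt[of x] by (cases "x \<in> frontier \<Omega>") (auto simp: G_def)
    qed
    also have "\<dots> = ennreal (W / c) * emeasure P (frontier \<Omega>) +
        ennreal (K * C1 + 1) * (\<Sum>j. \<integral>\<^sup>+x. G j x \<partial>P)"
      using S by (simp add: nn_integral_add nn_integral_cmult nn_integral_suminf)
    also have "\<dots> \<le> ennreal (W / c) * ennreal (measure P UNIV) + ennreal (K * C1 + 1) * (\<Sum>j. ennreal (?t j))"
    proof (intro add_mono mult_left_mono suminf_le)
      show "emeasure P (frontier \<Omega>) \<le> ennreal (measure P UNIV)"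
        unfolding P.emeasure_eq_measure[symmetric] by (intro emeasure_mono) (auto simp: sets_P)
      show "(\<integral>\<^sup>+x. G j x \<partial>P) \<le> ennreal (?t j)" for j unfolding G_def by (rule aaint)
    qed auto
    also have "(\<Sum>j. ennreal (?t j)) = ennreal (\<Sum>j. ?t j)" by (rule suminf_ennreal2[OF t0 ts])
    also have "(\<Sum>j. ?t j) = CP * K ^ 8 * H * (\<Sum>j. scale (j + k) powr \<alpha>) + measure P UNIV * (\<Sum>j. scale (j + k) powr (1 / 2))"
      by (subst suminf_add[symmetric]) (auto intro!: summable_mult sk simp: suminf_mult[OF sk(1)] suminf_mult[OF sk(2)])
    also have "ennreal (W / c) * ennreal (measure P UNIV) + ennreal (K * C1 + 1) * ennreal \<dots> =
        ennreal (measure P UNIV / c * W + (H * (A * (\<Sum>j. scale (j + k) powr \<alpha>)) + A' * (\<Sum>j. scale (j + k) powr (1 / 2))))"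
    proof -
      have n: "0 \<le> (\<Sum>j. scale (j + k) powr \<alpha>)" "0 \<le> (\<Sum>j. scale (j + k) powr (1 / 2))" by (auto intro!: suminf_nonneg sk)
      have "0 \<le> CP * K ^ 8 * H * (\<Sum>j. scale (j + k) powr \<alpha>) + measure P UNIV * (\<Sum>j. scale (j + k) powr (1 / 2))"
        using n CP0 K1 W0 by (intro add_nonneg_nonneg mult_nonneg_nonneg) auto
      moreover have "0 \<le> K * C1 + 1" using K1 C1_nonneg by simp
      moreover have "0 \<le> W / c" using W0 c by simp
      ultimately show ?thesis
        by (subst ennreal_mult_add_mult) (auto simp: A_def A'_def algebra_simps)
    qed
    also have "\<dots> \<le> ennreal (measure P UNIV / c * W + (H * \<eta> + \<eta>))"
      using k W0 c(1) by (intro ennreal_leI add_mono mult_left_mono) auto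
    finally show "(\<integral>\<^sup>+x\<in>frontier \<Omega>. ennreal \<bar>trace_lim w x\<bar> \<partial>P) \<le>
        ennreal (measure P UNIV / c * (LINT y|m. \<bar>w y\<bar>) + \<eta> * (LINT y|m. h y) + \<eta>)"
      by (simp add: W_def H_def algebra_simps)
  qed
qed

end

section \<open>The boundary term\<close>

lemma measurable_completion_AE:
  assumes g: "g \<in> borel_measurable (completion N)" and ae: "AE x in completion N. f x = g x"
  shows "f \<in> borel_measurable (completion N)"
proof (rule measurableI)
  fix A :: "'b set" assume "A \<in> sets borel"
  then have s: "g -` A \<inter> space (completion N) \<in> sets (completion N)" by (rule measurable_sets[OF g])
  show "f -` A \<inter> space (completion N) \<in> sets (completion N)"
    by (rule completion.in_sets_AE[OF _ s]) (use ae in \<open>auto elim!: eventually_mono\<close>)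
qed auto

text \<open>\<open>P_outer\<close> admits arbitrary centres because the covers in the codimension 1
  content do; it turns null sets of the codimension 1 Hausdorff measure into null sets of
  \<open>P\<close>.\<close>

locale boundary_functional = trace_domain \<Omega> m K p C R M P CP CM
  for \<Omega> :: "'a::metric_space set" and m K p C R M P CP CM +
  fixes f :: "'a \<Rightarrow> real" and F c0 R1 :: real
  assumes f_meas: "f \<in> borel_measurable (restrict_space (completion P) (frontier \<Omega>))"
    and f_bound: "\<And>x. x \<in> frontier \<Omega> \<Longrightarrow> \<bar>f x\<bar> \<le> F" and F0: "0 \<le> F"
    and R1: "0 < R1" and c0: "0 \<le> c0"
    and P_outer: "\<And>x y r. x \<in> frontier \<Omega> \<Longrightarrow> 0 < r \<Longrightarrow> r \<le> R1 \<Longrightarrow> x \<in> ball y r \<Longrightarrow>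
      emeasure P (ball y r) \<le> ennreal c0 * (emeasure M (ball y r) / ennreal r)"
begin

interpretation m: finite_measure m by (rule finite_m)
interpretation P: finite_measure P by (rule finite_P)

definition boundary_integral :: "('a \<Rightarrow> real) \<Rightarrow> real" where
  "boundary_integral w = (LINT x:frontier \<Omega>|completion P. trace_lim w x * f x)"

lemma space_P: "space P = UNIV" using sets_eq_imp_space_eq[OF sets_P] by simp

lemma codim1_null_AE:
  assumes "codim1_hausdorff M {x\<in>frontier \<Omega>. \<not> Q x} = 0"
  shows "AE x in P. x \<in> frontier \<Omega> \<longrightarrow> Q x"
proof -
  obtain N where N: "N \<in> null_sets P" "{x\<in>frontier \<Omega>. \<not> Q x} \<subseteq> N"
    using codim1_null_imp_null[OF assms R1 c0 sets_P] P_outer by blast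
  then show ?thesis by (intro AE_I'[OF N(1)]) auto
qed

lemma AE_avg_tendsto_trace_lim:
  assumes "poincare_pair w h"
  shows "AE x in P. x \<in> frontier \<Omega> \<longrightarrow> (\<lambda>k. avg w x (scale k)) \<longlonglongrightarrow> trace_lim w x"
  using codim1_null_AE[OF trace_exists_codim1[OF assms]]
proof eventually_elim
  case (elim x)
  then show ?case using avg_converges(1)[OF assms, of x] frontier_closure by blast
qed

text \<open>Averages are linear, and the identity passes to the limit at the points where all three
  sequences of averages converge.\<close>

lemma trace_lim_linear_AE:
  assumes "poincare_pair w h" "poincare_pair w' h'" "poincare_pair (\<lambda>y. a * w y + b * w' y) h''"
  shows "AE x in P. x \<in> frontier \<Omega> \<longrightarrow> trace_lim (\<lambda>y. a * w y + b * w' y) x = a * trace_lim w x + b * trace_lim w' x"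
  using AE_avg_tendsto_trace_lim[OF assms(1)] AE_avg_tendsto_trace_lim[OF assms(2)] AE_avg_tendsto_trace_lim[OF assms(3)]
proof eventually_elim
  case (elim x)
  show ?case
  proof
    assume x: "x \<in> frontier \<Omega>"
    have "avg (\<lambda>y. a * w y + b * w' y) x r = a * avg w x r + b * avg w' x r" for r
    proof -
      have "integrable m (\<lambda>y. a * w y)" "integrable m (\<lambda>y. b * w' y)" using poincare_pairD assms by auto
      then have "ib (\<lambda>y. a * w y + b * w' y) x r = a * ib w x r + b * ib w' x r"
        by (subst set_integral_add[OF set_integrable_B set_integrable_B]) auto
      then show ?thesis by (simp add: add_divide_distrib)
    qed
    moreover have "(\<lambda>k. a * avg w x (scale k) + b * avg w' x (scale k)) \<longlonglongrightarrow> a * trace_lim w x + b * trace_lim w' x"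
      using elim x by (intro tendsto_intros) auto
    ultimately have "(\<lambda>k. avg (\<lambda>y. a * w y + b * w' y) x (scale k)) \<longlonglongrightarrow> a * trace_lim w x + b * trace_lim w' x" by simp
    then show "trace_lim (\<lambda>y. a * w y + b * w' y) x = a * trace_lim w x + b * trace_lim w' x"
      using elim x LIMSEQ_unique by blast
  qed
qed

lemma indicator_f_measurable: "(\<lambda>x. indicator (frontier \<Omega>) x * f x) \<in> borel_measurable (completion P)"
proof -
  have "frontier \<Omega> \<in> sets P" unfolding sets_P by (intro borel_closed frontier_closed)
  then have "frontier \<Omega> \<inter> space (completion P) \<in> sets (completion P)"
    using sets_completionI_sets by (simp add: space_P)
  from borel_measurable_restrict_space_iff[OF this, THEN iffD1, OF f_meas] show ?thesis
    by (simp only: real_scaleR_def)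
qed

lemma trace_lim_measurable_P: "integrable m w \<Longrightarrow> trace_lim w \<in> borel_measurable P"
  unfolding measurable_cong_sets[OF sets_P refl] by (rule borel_measurable_trace_lim)

lemma trace_lim_measurable_completion: "integrable m w \<Longrightarrow> trace_lim w \<in> borel_measurable (completion P)"
  by (intro measurable_completion trace_lim_measurable_P)

lemma trace_lim_integrable:
  assumes "poincare_pair w h"
  shows "(\<integral>\<^sup>+x\<in>frontier \<Omega>. ennreal \<bar>trace_lim w x\<bar> \<partial>P) < \<infinity>"
proof (rule trace_bound[OF zero_less_one])
  fix c :: real
  assume c: "\<And>w h. poincare_pair w h \<Longrightarrow>
    (\<integral>\<^sup>+x\<in>frontier \<Omega>. ennreal \<bar>trace_lim w x\<bar> \<partial>P) \<le> ennreal (c * (LINT y|m. \<bar>w y\<bar>) + 1 * (LINT y|m. h y) + 1)"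
  show ?thesis by (rule le_less_trans[OF c[OF assms]]) simp
qed

lemma boundary_integrand_bound:
  "(\<integral>\<^sup>+x. ennreal (norm (indicator (frontier \<Omega>) x *\<^sub>R (trace_lim w x * f x))) \<partial>completion P) \<le>
    ennreal F * (\<integral>\<^sup>+x\<in>frontier \<Omega>. ennreal \<bar>trace_lim w x\<bar> \<partial>P)" if "integrable m w"
proof -
  have trm': "(\<lambda>x. ennreal \<bar>trace_lim w x\<bar>) \<in> borel_measurable P"
    by (rule measurable_compose[OF borel_measurable_abs[OF trace_lim_measurable_P[OF that]] measurable_ennreal])
  have S: "frontier \<Omega> \<in> sets P" unfolding sets_P by (intro borel_closed frontier_closed)
  have "(\<integral>\<^sup>+x. ennreal (norm (indicator (frontier \<Omega>) x *\<^sub>R (trace_lim w x * f x))) \<partial>completion P) \<le>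
      (\<integral>\<^sup>+x. ennreal F * (ennreal \<bar>trace_lim w x\<bar> * indicator (frontier \<Omega>) x) \<partial>completion P)"
  proof (rule nn_integral_mono)
    fix x
    have "\<bar>trace_lim w x\<bar> * \<bar>f x\<bar> \<le> F * \<bar>trace_lim w x\<bar>" if "x \<in> frontier \<Omega>"
      using f_bound[OF that] by (simp add: mult.commute mult_right_mono)
    then show "ennreal (norm (indicator (frontier \<Omega>) x *\<^sub>R (trace_lim w x * f x))) \<le> ennreal F * (ennreal \<bar>trace_lim w x\<bar> * indicator (frontier \<Omega>) x)"
      using F0 by (auto simp: indicator_def abs_mult simp flip: ennreal_mult intro!: ennreal_leI)
  qed
  also have "\<dots> = ennreal F * (\<integral>\<^sup>+x\<in>frontier \<Omega>. ennreal \<bar>trace_lim w x\<bar> \<partial>P)"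
    unfolding nn_integral_completion
    by (intro nn_integral_cmult borel_measurable_times_ennreal trm' borel_measurable_indicator S)
  finally show ?thesis .
qed

lemma boundary_integrable:
  assumes "poincare_pair w h"
  shows "set_integrable (completion P) (frontier \<Omega>) (\<lambda>x. trace_lim w x * f x)"
  unfolding set_integrable_def
proof (rule integrableI_bounded)
  have "(\<lambda>x. trace_lim w x * (indicator (frontier \<Omega>) x * f x)) \<in> borel_measurable (completion P)"
    by (intro borel_measurable_times trace_lim_measurable_completion indicator_f_measurable poincare_pairD[OF assms])
  then show "(\<lambda>x. indicator (frontier \<Omega>) x *\<^sub>R (trace_lim w x * f x)) \<in> borel_measurable (completion P)"
    by (simp add: mult.left_commute mult.commute)
  show "(\<integral>\<^sup>+x. ennreal (norm (indicator (frontier \<Omega>) x *\<^sub>R (trace_lim w x * f x))) \<partial>completion P) < \<infinity>"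
    by (rule le_less_trans[OF boundary_integrand_bound[OF poincare_pairD(1)[OF assms]]])
      (use trace_lim_integrable[OF assms] in \<open>auto simp: ennreal_mult_less_top\<close>)
qed

lemma boundary_integral_bound:
  assumes "0 < \<eta>"
  obtains c where "0 \<le> c" "\<And>w h. poincare_pair w h \<Longrightarrow> \<bar>boundary_integral w\<bar> \<le> c * (LINT y|m. \<bar>w y\<bar>) + \<eta> * (LINT y|m. h y) + \<eta>"
proof -
  define \<eta>' where "\<eta>' = \<eta> / (F + 1)"
  have \<eta>': "0 < \<eta>'" "F * \<eta>' \<le> \<eta>" using assms F0 by (auto simp: \<eta>'_def field_simps)
  obtain c where c: "0 \<le> c" "\<And>w h. poincare_pair w h \<Longrightarrow>
    (\<integral>\<^sup>+x\<in>frontier \<Omega>. ennreal \<bar>trace_lim w x\<bar> \<partial>P) \<le> ennreal (c * (LINT y|m. \<bar>w y\<bar>) + \<eta>' * (LINT y|m. h y) + \<eta>')"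
    using trace_bound[OF \<eta>'(1)] by blast
  show ?thesis
  proof (rule that[of "F * c"])
    show "0 \<le> F * c" using F0 c by simp
    fix w h assume w: "poincare_pair w h"
    have n: "0 \<le> (LINT y|m. \<bar>w y\<bar>)" "0 \<le> (LINT y|m. h y)" using poincare_pairD[OF w] by (auto intro!: integral_nonneg)
    have "ennreal \<bar>boundary_integral w\<bar> \<le> ennreal F * (\<integral>\<^sup>+x\<in>frontier \<Omega>. ennreal \<bar>trace_lim w x\<bar> \<partial>P)"
      using order_trans[OF integral_norm_bound_ennreal[OF boundary_integrable[OF w, unfolded set_integrable_def]]
          boundary_integrand_bound[OF poincare_pairD(1)[OF w]]]
      by (simp add: boundary_integral_def set_lebesgue_integral_def)
    also have "\<dots> \<le> ennreal F * ennreal (c * (LINT y|m. \<bar>w y\<bar>) + \<eta>' * (LINT y|m. h y) + \<eta>')"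
      by (intro mult_left_mono c w) auto
    also have "\<dots> = ennreal (F * (c * (LINT y|m. \<bar>w y\<bar>) + \<eta>' * (LINT y|m. h y) + \<eta>'))"
      using F0 c n \<eta>' by (intro ennreal_mult[symmetric]) auto
    finally have "\<bar>boundary_integral w\<bar> \<le> F * (c * (LINT y|m. \<bar>w y\<bar>) + \<eta>' * (LINT y|m. h y) + \<eta>')"
      using F0 c n \<eta>' by (subst (asm) ennreal_le_iff) auto
    also have "\<dots> = F * c * (LINT y|m. \<bar>w y\<bar>) + F * \<eta>' * (LINT y|m. h y) + F * \<eta>'" by (simp add: algebra_simps)
    also have "\<dots> \<le> F * c * (LINT y|m. \<bar>w y\<bar>) + \<eta> * (LINT y|m. h y) + \<eta>"
      using \<eta>' n by (intro add_mono[OF add_mono[OF order_refl mult_right_mono]]) auto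
    finally show "\<bar>boundary_integral w\<bar> \<le> F * c * (LINT y|m. \<bar>w y\<bar>) + \<eta> * (LINT y|m. h y) + \<eta>" .
  qed
qed

text \<open>Nothing is assumed about \<open>\<tau>\<close> on the exceptional null set; the
  measurability of its integrand comes from the completion. This is what allows the trace picked by
  \<open>trace_op\<close>.\<close>

lemma boundary_integral_cong_AE:
  assumes w: "poincare_pair w h" and ae: "AE x in P. x \<in> frontier \<Omega> \<longrightarrow> \<tau> x = trace_lim w x"
  shows "(LINT x:frontier \<Omega>|completion P. \<tau> x * f x) = boundary_integral w"
proof -
  have ae': "AE x in completion P. indicator (frontier \<Omega>) x *\<^sub>R (\<tau> x * f x) = indicator (frontier \<Omega>) x *\<^sub>R (trace_lim w x * f x)"
    using AE_completion[OF ae] by eventually_elim (auto simp: indicator_def)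
  have m: "(\<lambda>x. indicator (frontier \<Omega>) x *\<^sub>R (trace_lim w x * f x)) \<in> borel_measurable (completion P)"
    using boundary_integrable[OF w] by (auto simp: set_integrable_def)
  show ?thesis unfolding boundary_integral_def set_lebesgue_integral_def
    by (rule integral_cong_AE[OF measurable_completion_AE[OF m ae'] m ae'])
qed

lemma boundary_integral_linear:
  assumes "poincare_pair w h" "poincare_pair w' h'" "poincare_pair (\<lambda>y. a * w y + b * w' y) h''"
  shows "boundary_integral (\<lambda>y. a * w y + b * w' y) = a * boundary_integral w + b * boundary_integral w'"
proof -
  have ae: "AE x in P. x \<in> frontier \<Omega> \<longrightarrow> a * trace_lim w x + b * trace_lim w' x = trace_lim (\<lambda>y. a * w y + b * w' y) x"
    using trace_lim_linear_AE[OF assms] by eventually_elim auto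
  have "boundary_integral (\<lambda>y. a * w y + b * w' y) = (LINT x:frontier \<Omega>|completion P. (a * trace_lim w x + b * trace_lim w' x) * f x)"
    by (rule boundary_integral_cong_AE[OF assms(3) ae, symmetric])
  also have "\<dots> = (LINT x:frontier \<Omega>|completion P. a * (trace_lim w x * f x) + b * (trace_lim w' x * f x))"
    by (simp add: algebra_simps)
  also have "\<dots> = a * boundary_integral w + b * boundary_integral w'"
    unfolding boundary_integral_def using boundary_integrable[OF assms(1)] boundary_integrable[OF assms(2)]
    by (subst set_integral_add) auto
  finally show ?thesis .
qed

text \<open>The energies of the differences are bounded but not small. In
  \<open>boundary_integral_bound\<close> a small \<open>\<eta>\<close> absorbs them, and what is
  left is a multiple of the L1 norm of the difference.\<close>

theorem boundary_integral_continuous: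
  assumes w: "\<And>n. poincare_pair (w n) (h n)" "poincare_pair w0 h0" and d: "\<And>n. poincare_pair (\<lambda>y. 1 * w n y + (-1) * w0 y) (h' n)"
    and b: "\<And>n. (LINT y|m. h' n y) \<le> b" and lim: "(\<lambda>n. LINT y|m. \<bar>w n y - w0 y\<bar>) \<longlonglongrightarrow> 0"
  shows "(\<lambda>n. boundary_integral (w n)) \<longlonglongrightarrow> boundary_integral w0"
proof (rule LIMSEQ_I)
  fix e :: real assume e: "0 < e"
  have "0 \<le> (LINT y|m. h' 0 y)" using poincare_pairD(3)[OF d] by (intro Bochner_Integration.integral_nonneg) auto
  then have b0: "0 \<le> b" using b[of 0] by linarith
  define \<eta> where "\<eta> = e / (2 * (b + 1))"
  have "\<eta> * b + \<eta> = \<eta> * (b + 1)" by (simp add: algebra_simps)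
  also have "\<dots> = e / 2"
  proof -
    have "(e / (2 * c)) * c = e / 2" if "c \<noteq> 0" for c using that by simp
    then show ?thesis unfolding \<eta>_def using b0 by (metis add_nonneg_pos less_irrefl zero_less_one)
  qed
  finally have \<eta>: "0 < \<eta>" "\<eta> * b + \<eta> = e / 2" using e b0 by (auto simp: \<eta>_def)
  obtain c where c: "0 \<le> c" "\<And>w h. poincare_pair w h \<Longrightarrow> \<bar>boundary_integral w\<bar> \<le> c * (LINT y|m. \<bar>w y\<bar>) + \<eta> * (LINT y|m. h y) + \<eta>"
    using boundary_integral_bound[OF \<eta>(1)] by blast
  have "(\<lambda>n. c * (LINT y|m. \<bar>w n y - w0 y\<bar>)) \<longlonglongrightarrow> c * 0" by (intro tendsto_intros lim)
  then have "\<forall>\<^sub>F n in sequentially. c * (LINT y|m. \<bar>w n y - w0 y\<bar>) < e / 2" using e by (intro order_tendstoD) auto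
  then obtain N where N: "\<And>n. n \<ge> N \<Longrightarrow> c * (LINT y|m. \<bar>w n y - w0 y\<bar>) < e / 2" by (auto simp: eventually_sequentially)
  have "norm (boundary_integral (w n) - boundary_integral w0) < e" if "n \<ge> N" for n
  proof -
    have "\<bar>boundary_integral (\<lambda>y. 1 * w n y + (-1) * w0 y)\<bar> \<le> c * (LINT y|m. \<bar>1 * w n y + (-1) * w0 y\<bar>) + \<eta> * (LINT y|m. h' n y) + \<eta>"
      by (rule c(2)[OF d])
    also have "\<dots> \<le> c * (LINT y|m. \<bar>w n y - w0 y\<bar>) + \<eta> * b + \<eta>"
      using mult_left_mono[OF b[of n], of \<eta>] \<eta> by simp
    also have "\<dots> < e" using N[OF that] \<eta>(2) by linarith
    finally show ?thesis using boundary_integral_linear[OF w(1) w(2) d, of n] by simp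
  qed
  then show "\<exists>N. \<forall>n\<ge>N. norm (boundary_integral (w n) - boundary_integral w0) < e" by blast
qed

text \<open>For mean zero the L1 norm is at most \<open>c2\<close> times the \<open>p\<close>th root
  of the energy, which is sublinear and can be absorbed into a quarter of the energy; the other
  quarter is the energy term of \<open>boundary_integral_bound\<close>.\<close>

lemma boundary_integral_coercive:
  obtains c where "\<And>w h. poincare_pair w h \<Longrightarrow> (LINT y|m. w y) = 0 \<Longrightarrow> \<bar>boundary_integral w\<bar> \<le> (LINT y|m. h y) / 2 + c"
    "\<And>w h. poincare_pair w h \<Longrightarrow> (LINT y|m. w y) = 0 \<Longrightarrow> (LINT y|m. \<bar>w y\<bar>) \<le> c * (1 + (LINT y|m. h y))"
proof -
  obtain c1 where c1: "0 \<le> c1" "\<And>w h. poincare_pair w h \<Longrightarrow> \<bar>boundary_integral w\<bar> \<le> c1 * (LINT y|m. \<bar>w y\<bar>) + 1/4 * (LINT y|m. h y) + 1/4"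
    using boundary_integral_bound[of "1/4"] by auto
  obtain c2 where c2: "0 \<le> c2" "\<And>w h. poincare_pair w h \<Longrightarrow> (LINT y|m. w y) = 0 \<Longrightarrow>
      (LINT y|m. \<bar>w y\<bar>) \<le> c2 * (LINT y|m. h y) powr (1 / p)"
    using poincare_pair_mean_zero_bound by blast
  \<comment> \<open>With \<open>r powr \<alpha> = s\<close>, \<open>powr_inverse_young\<close>
    divided by \<open>r\<close> bounds \<open>H powr (1 / p)\<close> by \<open>s * H\<close> plus a
    constant; \<open>s\<close> is such that \<open>c1 * c2 * s \<le> 1/4\<close>.\<close>
  define s where "s = 1 / (4 * (c1 * c2 + 1))"
  define r where "r = s powr (1 / \<alpha>)"
  have cc: "0 < c1 * c2 + 1" using c1 c2 by (simp add: add_nonneg_pos)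
  have s: "0 < s" "c1 * c2 * s \<le> 1/4" using cc by (auto simp: s_def field_simps)
  have r: "0 < r" "r powr \<alpha> = s" using s \<alpha>_pos by (auto simp: r_def powr_powr)
  define c3 where "c3 = 1/4 + c1 * c2 * (r powr (1 / 2) / r) + c2"
  have c30: "c2 \<le> c3" unfolding c3_def using c1 c2 r by (simp add: add_nonneg_nonneg)
  show ?thesis
  proof (rule that[of c3])
    fix w h assume w: "poincare_pair w h" "(LINT y|m. w y) = 0"
    define H where "H = (LINT y|m. h y)"
    have H0: "0 \<le> H" unfolding H_def using poincare_pairD[OF w(1)] by (auto intro!: integral_nonneg)
    have W: "(LINT y|m. \<bar>w y\<bar>) \<le> c2 * H powr (1 / p)" using c2(2)[OF w] by (simp add: H_def)
    have "r * H powr (1 / p) \<le> r powr (1 + \<alpha>) * H + r powr (1 / 2)" by (rule powr_inverse_young[OF H0 r(1)])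
    also have "r powr (1 + \<alpha>) = r * s" using r by (simp add: powr_add)
    finally have Y: "H powr (1 / p) \<le> s * H + r powr (1 / 2) / r" using r(1) by (simp add: field_simps)
    have "\<bar>boundary_integral w\<bar> \<le> c1 * (LINT y|m. \<bar>w y\<bar>) + 1/4 * H + 1/4" using c1(2)[OF w(1)] by (simp add: H_def)
    also have "\<dots> \<le> c1 * (c2 * (s * H + r powr (1 / 2) / r)) + 1/4 * H + 1/4"
      using order_trans[OF W mult_left_mono[OF Y c2(1)]] c1(1) by (intro add_right_mono mult_left_mono) auto
    also have "\<dots> = c1 * c2 * s * H + 1/4 * H + (1/4 + c1 * c2 * (r powr (1 / 2) / r))" by (simp add: algebra_simps)
    also have "\<dots> \<le> 1/4 * H + 1/4 * H + c3"
      using s(2) H0 c2(1) by (intro add_mono mult_right_mono) (auto simp: c3_def)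
    finally show "\<bar>boundary_integral w\<bar> \<le> (LINT y|m. h y) / 2 + c3" by (simp add: H_def)
    have "c2 * H powr (1 / p) \<le> c3 * (1 + H)" using c30 c2 H0 powr_inverse_le_1[OF H0] by (intro mult_mono) auto
    then show "(LINT y|m. \<bar>w y\<bar>) \<le> c3 * (1 + (LINT y|m. h y))" using W by (simp add: H_def)
  qed
qed

end

section \<open>From extended real functions and the given domain to the abstract setting\<close>

lemma e2ennreal_finite_diff: "\<bar>x\<bar> \<noteq> \<infinity> \<Longrightarrow> e2ennreal \<bar>x - ereal c\<bar> = ennreal \<bar>real_of_ereal x - c\<bar>"
  by (cases x) (auto simp: e2ennreal_ereal)

lemma e2ennreal_finite: "\<bar>x\<bar> \<noteq> \<infinity> \<Longrightarrow> e2ennreal \<bar>x\<bar> = ennreal \<bar>real_of_ereal x\<bar>"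
  by (cases x) (auto simp: e2ennreal_ereal)

lemma e2ennreal_abs_top: "e2ennreal \<bar>x\<bar> \<noteq> \<infinity> \<Longrightarrow> \<bar>x\<bar> \<noteq> \<infinity>"
  by (cases x) auto

lemma ennreal_mult_divide:
  assumes "0 \<le> a" "0 \<le> b" "0 < r"
  shows "ennreal a * (ennreal b / ennreal r) = ennreal (a * (b / r))"
  unfolding divide_ennreal[OF assms(2,3)] using assms by (intro ennreal_mult[symmetric]) auto

lemma doubling_measureE:
  assumes "doubling_measure (M :: 'a::metric_space measure)"
  obtains CD where "1 \<le> CD" "\<And>(z::'a) r. 0 < r \<Longrightarrow> emeasure M (ball z r) = ennreal (measure M (ball z r))"
    "\<And>(z::'a) r. 0 < r \<Longrightarrow> 0 < measure M (ball z r)"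
    "\<And>(z::'a) r. 0 < r \<Longrightarrow> measure M (ball z (2 * r)) \<le> CD * measure M (ball z r)"
proof -
  obtain C :: real where C: "\<And>(z::'a) r. 0 < r \<Longrightarrow> 0 < emeasure M (ball z (2 * r))"
    "\<And>(z::'a) r. 0 < r \<Longrightarrow> emeasure M (ball z (2 * r)) \<le> ennreal C * emeasure M (ball z r)"
    "\<And>(z::'a) r. 0 < r \<Longrightarrow> ennreal C * emeasure M (ball z r) < \<infinity>"
    using assms unfolding doubling_measure_def by blast
  have pos: "0 < emeasure M (ball z r)" if "0 < r" for z :: 'a and r using C(1)[of "r / 2" z] that by simp
  have fin: "emeasure M (ball z r) < \<infinity>" if "0 < r" for z :: 'a and r
    using le_less_trans[OF C(2)[of "r / 2" z] C(3)[of "r / 2" z]] that by simp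
  have eq: "emeasure M (ball z r) = ennreal (measure M (ball z r))" if "0 < r" for z :: 'a and r
    using fin[OF that, of z] by (intro emeasure_eq_ennreal_measure) auto
  have mpos: "0 < measure M (ball z r)" if "0 < r" for z :: 'a and r
    using pos[OF that, of z] eq[OF that, of z] by simp
  show ?thesis
  proof (rule that[of "max 1 C"])
    fix z :: 'a and r :: real assume r: "0 < r"
    have "ennreal (measure M (ball z (2 * r))) \<le> ennreal C * ennreal (measure M (ball z r))"
      using C(2)[OF r, of z] eq[of r z] eq[of "2 * r" z] r by simp
    also have "\<dots> \<le> ennreal (max 1 C * measure M (ball z r))"
      by (subst ennreal_mult) (auto intro!: mult_right_mono ennreal_leI)
    finally show "measure M (ball z (2 * r)) \<le> max 1 C * measure M (ball z r)"
      by (subst (asm) ennreal_le_iff) auto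
  qed (use eq mpos in auto)
qed

locale neumann_domain =
  fixes M :: "'a::complete_space measure" and \<Omega> :: "'a set" and p :: real
  assumes p1: "1 < p" and sets_M: "sets M = sets borel" and dbl: "doubling_measure M"
    and dom: "admissible_domain p M \<Omega>" and fr: "frontier \<Omega> \<noteq> {}"
begin

abbreviation "N \<equiv> restrict_space M \<Omega>"
abbreviation "m \<equiv> completion N"
abbreviation "P \<equiv> perimeter_measure M \<Omega>"

lemma open_\<Omega>: "open \<Omega>" and bounded_\<Omega>: "bounded \<Omega>" and \<Omega>_ne: "\<Omega> \<noteq> {}"
  using dom by (auto simp: admissible_domain_def)

lemma space_M: "space M = UNIV" using sets_eq_imp_space_eq[OF sets_M] by simp

lemma space_N: "space N = \<Omega>" by (simp add: space_restrict_space space_M)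

lemma space_m: "space m = \<Omega>" by (simp add: space_N)

lemma sets_N: "sets N = sets (restrict_space borel (space N))"
  unfolding space_N sets_restrict_space sets_M ..

lemma open_sets_N: "open U \<Longrightarrow> U \<inter> \<Omega> \<in> sets N"
  by (auto simp: sets_restrict_space sets_M)

lemma open_sets_m: "open U \<Longrightarrow> U \<inter> \<Omega> \<in> sets m"
  by (rule sets_completionI_sets[OF open_sets_N])

lemma \<Omega>_in_M: "\<Omega> \<inter> space M \<in> sets M" using open_\<Omega> by (auto simp: sets_M space_M)

lemma emeasure_m: "open U \<Longrightarrow> emeasure m (U \<inter> \<Omega>) = emeasure M (U \<inter> \<Omega>)"
  using open_sets_N[of U] by (simp add: emeasure_restrict_space[OF \<Omega>_in_M])

lemma measure_m: "open U \<Longrightarrow> measure m (U \<inter> \<Omega>) = measure M (U \<inter> \<Omega>)"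
  by (simp add: measure_def emeasure_m)

lemma sets_P: "sets P = sets borel"
  unfolding perimeter_measure_def by (simp add: sets_measure_of_conv sets.sigma_sets_eq[of borel, simplified])

text \<open>
  By definition of \<^const>\<open>measure_of\<close>, the perimeter measure is zero unless the set function in
  its definition is a measure, so no extension theorem is needed here.
\<close>

lemma finite_P: "finite_measure P"
proof (rule finite_measureI)
  have sp: "space P = UNIV" using sets_eq_imp_space_eq[OF sets_P] by simp
  have "emeasure P UNIV \<le> perimeter_open M \<Omega> UNIV"
    unfolding perimeter_measure_def emeasure_measure_of_conv by (auto intro!: INF_lower)
  also have "\<dots> < \<infinity>" using dom by (simp add: admissible_domain_def)
  finally show "emeasure P (space P) \<noteq> \<infinity>" by (simp add: sp)
qed

lemma dist_le_diameter: "x \<in> closure \<Omega> \<Longrightarrow> y \<in> closure \<Omega> \<Longrightarrow> dist x y \<le> diameter \<Omega>"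
  using diameter_bounded_bound[OF bounded_closure[OF bounded_\<Omega>], of x y] diameter_closure[OF bounded_\<Omega>] by simp

lemma \<Omega>_subset_ball:
  assumes "x \<in> closure \<Omega>" "diameter \<Omega> < r"
  shows "\<Omega> \<subseteq> ball x r"
proof
  fix y assume "y \<in> \<Omega>"
  then have "y \<in> closure \<Omega>" using closure_subset by auto
  from le_less_trans[OF dist_le_diameter[OF assms(1) this] assms(2)] show "y \<in> ball x r" by simp
qed

text \<open>A boundary point does not belong to the open set \<open>\<Omega>\<close>, so it has
  positive distance from any point of \<open>\<Omega>\<close>. The bounds of
  \<open>admissible_domain\<close> thus hold for a nonempty range of radii.\<close>

lemma diameter_pos: "0 < diameter \<Omega>"
proof -
  obtain x y where "x \<in> frontier \<Omega>" "y \<in> \<Omega>" using fr \<Omega>_ne by auto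
  then have "x \<in> closure \<Omega>" "y \<in> closure \<Omega>" "x \<noteq> y"
    using open_\<Omega> closure_subset by (auto simp: frontier_def interior_open)
  then show ?thesis using dist_le_diameter[of x y] by (smt (verit) zero_less_dist_iff)
qed

text \<open>Only integrability of \<open>u\<close> is required, since limits will be obtained in L1;
  \<open>poincare_pair_imp_Lp\<close> supplies the \<open>p\<close>th power afterwards.\<close>

definition sobolev_pair :: "('a \<Rightarrow> ereal) \<Rightarrow> ('a \<Rightarrow> ennreal) \<Rightarrow> bool" where
  "sobolev_pair u g \<longleftrightarrow> u \<in> borel_measurable m \<and> (\<integral>\<^sup>+x. e2ennreal \<bar>u x\<bar> \<partial>m) < \<infinity> \<and>
    upper_gradient N u g \<and> g \<in> Lp p N"

definition real_fun :: "('a \<Rightarrow> ereal) \<Rightarrow> 'a \<Rightarrow> real" where "real_fun u x = real_of_ereal (u x)"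

definition power_fun :: "('a \<Rightarrow> ennreal) \<Rightarrow> 'a \<Rightarrow> real" where "power_fun g x = enn2real (ennreal_powr (g x) p)"

lemma sobolev_pairD:
  assumes "sobolev_pair u g"
  shows "AE x in m. \<bar>u x\<bar> \<noteq> \<infinity>" "integrable m (real_fun u)" "integrable m (power_fun g)"
    "AE x in m. ennreal (power_fun g x) = ennreal_powr (g x) p"
    "(\<integral>\<^sup>+x. ennreal_powr (g x) p \<partial>N) = ennreal (LINT x|m. power_fun g x)"
proof -
  have u: "u \<in> borel_measurable m" "(\<integral>\<^sup>+x. e2ennreal \<bar>u x\<bar> \<partial>m) < \<infinity>" and g: "g \<in> Lp p N"
    using assms by (auto simp: sobolev_pair_def)
  note [measurable] = u(1) Lp_measurable[OF g]
  have gm[measurable]: "g \<in> borel_measurable m" by (rule measurable_completion[OF Lp_measurable[OF g]])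
  have "AE x in m. e2ennreal \<bar>u x\<bar> \<noteq> \<infinity>" by (rule nn_integral_PInf_AE) (use u in auto)
  then show ae: "AE x in m. \<bar>u x\<bar> \<noteq> \<infinity>" by eventually_elim (rule e2ennreal_abs_top)
  have "(\<integral>\<^sup>+x. ennreal (norm (real_fun u x)) \<partial>m) = (\<integral>\<^sup>+x. e2ennreal \<bar>u x\<bar> \<partial>m)"
    by (rule nn_integral_cong_AE) (use ae in \<open>auto elim!: eventually_mono simp: real_fun_def e2ennreal_finite\<close>)
  then show "integrable m (real_fun u)"
    using u(2) by (intro integrableI_bounded) (auto simp: real_fun_def[abs_def])
  have gf: "(\<integral>\<^sup>+x. ennreal_powr (g x) p \<partial>m) < \<infinity>" using Lp_finite[OF g] by (simp add: nn_integral_completion)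
  have "AE x in m. ennreal_powr (g x) p \<noteq> \<infinity>" by (rule nn_integral_PInf_AE) (use gf in auto)
  then show aeg: "AE x in m. ennreal (power_fun g x) = ennreal_powr (g x) p"
    by eventually_elim (auto simp: power_fun_def less_top[symmetric])
  have eq: "(\<integral>\<^sup>+x. ennreal (power_fun g x) \<partial>m) = (\<integral>\<^sup>+x. ennreal_powr (g x) p \<partial>m)"
    by (rule nn_integral_cong_AE[OF aeg])
  have n: "0 \<le> power_fun g x" for x by (simp add: power_fun_def)
  show i: "integrable m (power_fun g)"
    using gf eq n by (intro integrableI_bounded) (auto simp: power_fun_def[abs_def])
  show "(\<integral>\<^sup>+x. ennreal_powr (g x) p \<partial>N) = ennreal (LINT x|m. power_fun g x)"
    using nn_integral_eq_integral[OF i] n eq by (simp add: nn_integral_completion)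
qed

lemma mean_deviation_eq:
  assumes u: "sobolev_pair u g" and pos: "0 < measure m (ball x r \<inter> \<Omega>)" "finite_measure m"
  shows "mean_deviation N (ball x r \<inter> \<Omega>) u c =
    ennreal ((LINT y:ball x r \<inter> \<Omega>|m. \<bar>real_fun u y - c\<bar>) / measure m (ball x r \<inter> \<Omega>))"
proof -
  interpret finite_measure m by (rule pos)
  let ?B = "ball x r \<inter> \<Omega>"
  have B: "?B \<in> sets m" by (rule open_sets_m) simp
  have i: "integrable m (\<lambda>y. indicator ?B y * \<bar>real_fun u y - c\<bar>)"
    using integrable_mult_indicator[OF B, of "\<lambda>y. \<bar>real_fun u y - c\<bar>"] sobolev_pairD(2)[OF u] by simp
  have "(\<integral>\<^sup>+y\<in>?B. e2ennreal \<bar>u y - ereal c\<bar> \<partial>m) = (\<integral>\<^sup>+y. ennreal (indicator ?B y * \<bar>real_fun u y - c\<bar>) \<partial>m)"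
    by (rule nn_integral_cong_AE)
      (use sobolev_pairD(1)[OF u] in \<open>auto elim!: eventually_mono simp: real_fun_def e2ennreal_finite_diff indicator_def\<close>)
  also have "\<dots> = ennreal (LINT y:?B|m. \<bar>real_fun u y - c\<bar>)"
    using nn_integral_eq_integral[OF i] by (simp add: set_lebesgue_integral_def)
  finally have 1: "(\<integral>\<^sup>+y\<in>?B. e2ennreal \<bar>u y - ereal c\<bar> \<partial>m) = ennreal (LINT y:?B|m. \<bar>real_fun u y - c\<bar>)" .
  have "emeasure N ?B = emeasure m ?B" using open_sets_N[of "ball x r"] by simp
  also have "\<dots> = ennreal (measure m ?B)" by (rule emeasure_eq_measure)
  finally have 2: "emeasure N ?B = ennreal (measure m ?B)" .
  have "0 \<le> (LINT y:?B|m. \<bar>real_fun u y - c\<bar>)"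
    unfolding set_lebesgue_integral_def by (intro Bochner_Integration.integral_nonneg) auto
  then show ?thesis unfolding mean_deviation_def 1 2 using pos by (simp add: divide_ennreal)
qed

text \<open>All constants of the abstract locales are computed from those of doubling, density,
  perimeter and Poincare. The diameter \<open>D\<close>, up to which density and perimeter are
  controlled, becomes the largest scale.\<close>

lemma boundary_functional_exists:
  fixes f :: "'a \<Rightarrow> real" and F :: real
  assumes f: "f \<in> borel_measurable (restrict_space (completion P) (frontier \<Omega>))"
    and fb: "\<And>x. x \<in> frontier \<Omega> \<Longrightarrow> \<bar>f x\<bar> \<le> F" "0 \<le> F"
  obtains K C R CP CM c0 R1 where "boundary_functional \<Omega> m K p C R M P CP CM f F c0 R1"
    "\<And>u g. sobolev_pair u g \<Longrightarrow> poincare_domain.poincare_pair \<Omega> m p C (real_fun u) (power_fun g)"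
proof -
  obtain CD where CD: "1 \<le> CD" "\<And>z r. 0 < r \<Longrightarrow> emeasure M (ball z r) = ennreal (measure M (ball z r))"
    "\<And>z r. 0 < r \<Longrightarrow> 0 < measure M (ball z r)"
    "\<And>z r. 0 < r \<Longrightarrow> measure M (ball z (2 * r)) \<le> CD * measure M (ball z r)"
    using doubling_measureE[OF dbl] by metis
  define D where "D = diameter \<Omega>"
  have D: "0 < D" using diameter_pos by (simp add: D_def)
  obtain C where C: "1 \<le> C"
    "\<And>r z. 0 < r \<Longrightarrow> r \<le> D \<Longrightarrow> z \<in> \<Omega> \<Longrightarrow> emeasure M (ball z r \<inter> \<Omega>) \<ge> ennreal (1 / C) * emeasure M (ball z r)"
    "\<And>r x. 0 < r \<Longrightarrow> r \<le> D \<Longrightarrow> x \<in> frontier \<Omega> \<Longrightarrow> emeasure P (ball x r) \<le> ennreal C * (emeasure M (ball x r) / ennreal r)"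
    using dom unfolding admissible_domain_def D_def by blast
  have "poincare p 1 N" using dom by (simp add: admissible_domain_def)
  then obtain Cp where Cp: "0 < Cp" and poin: "\<And>z r u g. z \<in> \<Omega> \<Longrightarrow> 0 < r \<Longrightarrow> integrable_on_bounded N u \<Longrightarrow> upper_gradient N u g \<Longrightarrow>
      mean_deviation N (ball z r \<inter> \<Omega>) u (mean_value N (ball z r \<inter> \<Omega>) u) \<le>
      ennreal (Cp * r) * ennreal_powr ((\<integral>\<^sup>+x\<in>ball z r \<inter> \<Omega>. ennreal_powr (g x) p \<partial>N) / emeasure N (ball z r \<inter> \<Omega>)) (1 / p)"
    unfolding poincare_def Let_def space_N mult_1 by blast
  define \<mu> where "\<mu> x r = measure M (ball x r)" for x r
  let ?mm = "\<lambda>x r. measure m (ball x r \<inter> \<Omega>)"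
  have \<mu>: "0 < \<mu> x r" "\<mu> x (2 * r) \<le> CD * \<mu> x r" "emeasure M (ball x r) = ennreal (\<mu> x r)" if "0 < r" for x r
    using CD that by (auto simp: \<mu>_def)
  have \<mu>4: "\<mu> x (2 * (2 * r)) \<le> CD * (CD * \<mu> x r)" if "0 < r" for x r
    by (rule order_trans[OF \<mu>(2) mult_left_mono[OF \<mu>(2)]]) (use CD(1) that in auto)
  have \<mu>mono: "\<mu> x r \<le> \<mu> y s" if "ball x r \<subseteq> ball y s" "0 < s" for x r y s
    unfolding \<mu>_def using that CD(2)[of s y] by (intro measure_mono_fmeasurable) (auto simp: sets_M fmeasurable_def)
  have fin: "finite_measure m"
  proof (rule finite_measureI)
    obtain z where z: "z \<in> \<Omega>" using \<Omega>_ne by auto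
    have sub: "\<Omega> \<subseteq> ball z (2 * D)"
      using z closure_subset D by (intro \<Omega>_subset_ball) (auto simp: D_def)
    have "emeasure m (space m) = emeasure M (UNIV \<inter> \<Omega>)" using emeasure_m[of UNIV] by (simp add: space_m space_N)
    also have "\<dots> \<le> emeasure M (ball z (2 * D))" using sub by (intro emeasure_mono) (auto simp: sets_M)
    also have "\<dots> < \<infinity>" using CD(2)[of "2 * D" z] D by simp
    finally show "emeasure m (space m) \<noteq> \<infinity>" by simp
  qed
  interpret m: finite_measure m by (rule fin)
  interpret P: finite_measure P by (rule finite_P)
  have mm\<mu>: "?mm x r \<le> \<mu> x r" if "0 < r" for x r
    unfolding \<mu>_def measure_m[OF open_ball] using CD(2)[OF that, of x]
    by (intro measure_mono_fmeasurable) (auto simp: sets_M fmeasurable_def open_\<Omega>)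
  have dens: "\<mu> z r \<le> C * ?mm z r" if "z \<in> \<Omega>" "0 < r" "r \<le> D" for z r
  proof -
    have "ennreal (1 / C) * ennreal (\<mu> z r) \<le> emeasure M (ball z r \<inter> \<Omega>)" using C(2)[OF that(2,3,1)] \<mu>(3)[OF that(2)] by simp
    also have "\<dots> = ennreal (?mm z r)" using emeasure_m[OF open_ball] m.emeasure_eq_measure by metis
    finally have "1 / C * \<mu> z r \<le> ?mm z r" using C(1) \<mu>(1)[OF that(2), of z] by (simp flip: ennreal_mult)
    then show ?thesis using C(1) by (simp add: field_simps)
  qed
  \<comment> \<open>Density is assumed at points of \<open>\<Omega>\<close> only. For a closure
    point \<open>x\<close> it is borrowed from some \<open>z\<close> in \<open>\<Omega>\<close>
    within \<open>r / 2\<close>; \<open>ball x r\<close> lies in the ball of radius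
    \<open>4 * (r / 2)\<close> about \<open>z\<close>, whence two doublings.\<close>
  define C' where "C' = C * CD ^ 2"
  have C'1: "1 \<le> C'" using mult_mono[OF C(1) one_le_power[OF CD(1), of 2]] C(1) by (simp add: C'_def)
  have densc: "\<mu> x r \<le> C' * ?mm x r" if x: "x \<in> closure \<Omega>" and r: "0 < r" "r \<le> D" for x r
  proof -
    obtain z where z: "z \<in> \<Omega>" "dist z x < r / 2" using closure_approachable[of x \<Omega>] x r by (metis half_gt_zero)
    have "ball x r \<subseteq> ball z (2 * (2 * (r / 2)))"
    proof
      fix y assume "y \<in> ball x r"
      then show "y \<in> ball z (2 * (2 * (r / 2)))" using z r dist_triangle[of z y x] by simp
    qed
    then have "\<mu> x r \<le> \<mu> z (2 * (2 * (r / 2)))" using r by (intro \<mu>mono) auto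
    also have "\<dots> \<le> CD * (CD * \<mu> z (r / 2))"
      using r by (intro \<mu>4) simp
    also have "\<dots> \<le> CD * (CD * (C * ?mm z (r / 2)))"
      using z r CD(1) by (intro mult_left_mono dens) auto
    also have "?mm z (r / 2) \<le> ?mm x r"
    proof (rule m.finite_measure_mono)
      show "ball z (r / 2) \<inter> \<Omega> \<subseteq> ball x r \<inter> \<Omega>"
      proof
        fix y assume "y \<in> ball z (r / 2) \<inter> \<Omega>"
        then show "y \<in> ball x r \<inter> \<Omega>" using z r dist_triangle[of x y z] by (simp add: dist_commute)
      qed
    qed (auto intro: open_sets_m)
    finally show ?thesis using CD(1) C(1) by (simp add: C'_def power2_eq_square mult_ac mult_left_mono)
  qed
  have pos: "0 < ?mm x r" if x: "x \<in> closure \<Omega>" and r: "0 < r" for x r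
  proof -
    have "0 < \<mu> x (min r D)" using r D by (intro \<mu>) auto
    also have "\<dots> \<le> C' * ?mm x (min r D)" using x r D by (intro densc) auto
    finally have "0 < ?mm x (min r D)" using C'1 by (simp add: zero_less_mult_iff)
    also have "\<dots> \<le> ?mm x r" by (intro m.finite_measure_mono open_sets_m) auto
    finally show ?thesis .
  qed
  define K where "K = CD * C'"
  have K1: "1 \<le> K" using mult_mono[OF CD(1) C'1] CD(1) by (simp add: K_def)
  have dblm: "?mm x (2 * r) \<le> K * ?mm x r" if x: "x \<in> closure \<Omega>" and r: "0 < r" for x r
  proof (cases "r \<le> D")
    case True
    have "?mm x (2 * r) \<le> \<mu> x (2 * r)" using r by (intro mm\<mu>) auto
    also have "\<dots> \<le> CD * \<mu> x r" by (rule \<mu>(2)[OF r])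
    also have "\<dots> \<le> CD * (C' * ?mm x r)" using CD(1) by (intro mult_left_mono densc x r True) auto
    finally show ?thesis by (simp add: K_def)
  next
    case False
    \<comment> \<open>Beyond the diameter the ball already contains \<open>\<Omega>\<close>, and
      doubling is trivial.\<close>
    then have "\<Omega> \<subseteq> ball x r" by (intro \<Omega>_subset_ball x) (simp add: D_def)
    then have "?mm x (2 * r) \<le> 1 * ?mm x r" by (auto intro!: m.finite_measure_mono open_sets_m)
    also have "\<dots> \<le> K * ?mm x r" using K1 by (intro mult_right_mono) auto
    finally show ?thesis .
  qed
  interpret pd: poincare_domain \<Omega> m K p Cp D
    using space_m fin open_sets_m bounded_\<Omega> \<Omega>_ne K1 pos dblm p1 Cp D by unfold_locales auto
  have Pb: "emeasure P (ball x r) \<le> ennreal (C * C' * ?mm x r / r)" if x: "x \<in> frontier \<Omega>" and r: "0 < r" "r \<le> D" for x r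
  proof -
    have xc: "x \<in> closure \<Omega>" using x by (auto simp: frontier_def)
    have "emeasure P (ball x r) \<le> ennreal C * (ennreal (\<mu> x r) / ennreal r)" using C(3)[OF r x] \<mu>(3)[OF r(1)] by simp
    also have "\<dots> = ennreal (C * (\<mu> x r / r))"
      using r C(1) \<mu>(1)[OF r(1), of x] by (intro ennreal_mult_divide) auto
    also have "\<dots> \<le> ennreal (C * (C' * ?mm x r / r))"
      using C(1) r densc[OF xc r] by (intro ennreal_leI mult_left_mono divide_right_mono) auto
    finally show ?thesis by (simp add: mult.assoc)
  qed
  have Mb: "emeasure M (ball x r) \<le> ennreal (C' * ?mm x r)" if x: "x \<in> frontier \<Omega>" and r: "0 < r" "r \<le> D" for x r
    using densc[OF _ r, of x] x \<mu>(3)[OF r(1)] by (auto simp: frontier_def intro!: ennreal_leI)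
  \<comment> \<open>The ball is enclosed in \<open>ball x (2 * r)\<close> with boundary centre,
    whose radius must not exceed \<open>D\<close>; hence the limit \<open>D / 2\<close>. Returning
    to \<open>ball y r\<close> costs two doublings.\<close>
  have Po: "emeasure P (ball y r) \<le> ennreal (C * CD ^ 2) * (emeasure M (ball y r) / ennreal r)"
    if x: "x \<in> frontier \<Omega>" "x \<in> ball y r" and r: "0 < r" "r \<le> D / 2" for x y r
  proof -
    have s: "ball y r \<subseteq> ball x (2 * r)" "ball x (2 * r) \<subseteq> ball y (2 * (2 * r))"
    proof -
      show "ball y r \<subseteq> ball x (2 * r)"
      proof
        fix z assume "z \<in> ball y r"
        then show "z \<in> ball x (2 * r)" using x dist_triangle[of x z y] by (simp add: dist_commute)
      qed
      show "ball x (2 * r) \<subseteq> ball y (2 * (2 * r))"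
      proof
        fix z assume "z \<in> ball x (2 * r)"
        then show "z \<in> ball y (2 * (2 * r))" using x r dist_triangle[of y z x] by simp
      qed
    qed
    have "emeasure P (ball y r) \<le> emeasure P (ball x (2 * r))" by (rule emeasure_mono[OF s(1)]) (simp add: sets_P)
    also have "\<dots> \<le> ennreal C * (ennreal (\<mu> x (2 * r)) / ennreal (2 * r))" using C(3)[of "2 * r" x] x r \<mu>(3)[of "2 * r" x] by simp
    also have "\<dots> = ennreal (C * (\<mu> x (2 * r) / (2 * r)))"
      using r C(1) \<mu>(1)[of "2 * r" x] by (intro ennreal_mult_divide) auto
    also have "\<dots> \<le> ennreal (C * (CD * (CD * \<mu> y r) / r))"
    proof (intro ennreal_leI mult_left_mono frac_le)
      have "\<mu> x (2 * r) \<le> \<mu> y (2 * (2 * r))" using s r by (intro \<mu>mono) auto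
      also have "\<dots> \<le> CD * (CD * \<mu> y r)"
        by (rule \<mu>4[OF r(1)])
      finally show "\<mu> x (2 * r) \<le> CD * (CD * \<mu> y r)" .
    qed (use r C(1) CD(1) \<mu>(1)[OF r(1), of y] in auto)
    also have "C * (CD * (CD * \<mu> y r) / r) = C * CD ^ 2 * (\<mu> y r / r)" by (simp add: power2_eq_square)
    also have "ennreal \<dots> = ennreal (C * CD ^ 2) * (ennreal (\<mu> y r) / ennreal r)"
      using r C(1) CD(1) \<mu>(1)[OF r(1), of y] by (intro ennreal_mult_divide[symmetric]) auto
    finally show ?thesis using \<mu>(3)[OF r(1)] by simp
  qed
  show ?thesis
  proof (rule that)
    show "boundary_functional \<Omega> m K p Cp D M P (C * C') C' f F (C * CD ^ 2) (D / 2)"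
    proof unfold_locales
      show "sets P = sets borel" by (rule sets_P)
      show "0 \<le> C * C'" "0 \<le> C'" "0 \<le> C * CD ^ 2" using C(1) C'1 CD(1) by auto
      show "0 < D / 2" using D by simp
    qed (use Pb Mb Po f fb P.emeasure_finite in \<open>auto simp: mult.assoc\<close>)
  next
    fix u g assume u: "sobolev_pair u g"
    note sp = sobolev_pairD[OF u]
    have us: "u \<in> borel_measurable m" "(\<integral>\<^sup>+x. e2ennreal \<bar>u x\<bar> \<partial>m) < \<infinity>" "upper_gradient N u g" "g \<in> Lp p N"
      using u by (auto simp: sobolev_pair_def)
    have iob: "integrable_on_bounded N u"
      unfolding integrable_on_bounded_def
    proof (intro conjI ballI impI us(1))
      fix A
      have "(\<integral>\<^sup>+x\<in>A. e2ennreal \<bar>u x\<bar> \<partial>m) \<le> (\<integral>\<^sup>+x. e2ennreal \<bar>u x\<bar> \<partial>m)"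
        by (intro nn_integral_mono) (auto simp: indicator_def)
      then show "(\<integral>\<^sup>+x\<in>A. e2ennreal \<bar>u x\<bar> \<partial>m) < \<infinity>" using us(2) by (rule le_less_trans)
    qed
    show "pd.poincare_pair (real_fun u) (power_fun g)"
      unfolding pd.poincare_pair_def
    proof (intro conjI ballI allI impI sp)
      show "0 \<le> power_fun g y" for y by (simp add: power_fun_def)
      fix z r assume z: "z \<in> \<Omega>" and r: "(0::real) < r"
      let ?B = "ball z r \<inter> \<Omega>"
      have zc: "z \<in> closure \<Omega>" using z closure_subset by auto
      have mz: "0 < ?mm z r" by (rule pos[OF zc r])
      have mv: "mean_value N ?B u = (LINT y:?B|m. real_fun u y) / ?mm z r"
        using open_sets_N[of "ball z r"] by (simp add: mean_value_def real_fun_def)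
      have emB: "emeasure N ?B = ennreal (?mm z r)"
        using open_sets_N[of "ball z r"] m.emeasure_eq_measure[of ?B] by simp
      have B: "?B \<in> sets m" by (rule open_sets_m) simp
      have i: "integrable m (\<lambda>y. indicator ?B y * power_fun g y)"
        using integrable_mult_indicator[OF B sp(3)] by simp
      have "(\<integral>\<^sup>+x\<in>?B. ennreal_powr (g x) p \<partial>N) = (\<integral>\<^sup>+x\<in>?B. ennreal_powr (g x) p \<partial>m)"
        by (simp only: nn_integral_completion)
      also have "\<dots> = (\<integral>\<^sup>+x. ennreal (indicator ?B x * power_fun g x) \<partial>m)"
        by (rule nn_integral_cong_AE) (use sp(4) in \<open>auto elim!: eventually_mono simp: indicator_def\<close>)
      also have "\<dots> = ennreal (LINT x:?B|m. power_fun g x)"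
        using nn_integral_eq_integral[OF i] by (simp add: set_lebesgue_integral_def power_fun_def)
      finally have gB: "(\<integral>\<^sup>+x\<in>?B. ennreal_powr (g x) p \<partial>N) = ennreal (LINT x:?B|m. power_fun g x)" .
      have g0: "0 \<le> (LINT x:?B|m. power_fun g x)"
        unfolding set_lebesgue_integral_def by (intro Bochner_Integration.integral_nonneg) (auto simp: power_fun_def)
      have "ennreal ((LINT y:?B|m. \<bar>real_fun u y - (LINT y:?B|m. real_fun u y) / ?mm z r\<bar>) / ?mm z r) \<le>
          ennreal (Cp * r) * ennreal_powr (ennreal (LINT x:?B|m. power_fun g x) / ennreal (?mm z r)) (1 / p)"
        using poin[OF z r iob us(3)] unfolding mean_deviation_eq[OF u mz fin] mv emB gB .
      also have "\<dots> = ennreal (Cp * r * ((LINT x:?B|m. power_fun g x) / ?mm z r) powr (1 / p))"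
        using mz g0 Cp r by (simp add: divide_ennreal ennreal_powr_ennreal flip: ennreal_mult)
      finally have "(LINT y:?B|m. \<bar>real_fun u y - (LINT y:?B|m. real_fun u y) / ?mm z r\<bar>) / ?mm z r \<le>
          Cp * r * ((LINT x:?B|m. power_fun g x) / ?mm z r) powr (1 / p)"
        using Cp r by (subst (asm) ennreal_le_iff) auto
      then show "(LINT y:?B|m. \<bar>real_fun u y - (LINT y:?B|m. real_fun u y) / ?mm z r\<bar>) \<le>
          Cp * r * ?mm z r * ((LINT x:?B|m. power_fun g x) / ?mm z r) powr (1 / p)"
        using mz by (simp add: divide_le_eq mult_ac)
    qed
  qed
qed

text \<open>\<open>real_fun\<close> replaces infinite values by 0. This does no harm: if an endpoint
  value is infinite, the nonzero coefficients make the right-hand side infinite.\<close>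

lemma endpoint_diff_comb:
  assumes "a \<noteq> 0" "b \<noteq> 0"
  shows "endpoint_diff (\<lambda>x. ereal (a * real_fun u x + b * real_fun v x)) \<gamma> \<le>
    ennreal \<bar>a\<bar> * endpoint_diff u \<gamma> + ennreal \<bar>b\<bar> * endpoint_diff v \<gamma>"
proof (cases "endpoint_diff u \<gamma> < top \<and> endpoint_diff v \<gamma> < top")
  case True
  let ?s = "pathstart \<gamma>" and ?t = "pathfinish \<gamma>"
  have e: "endpoint_diff u \<gamma> = ennreal \<bar>real_fun u ?t - real_fun u ?s\<bar>" "endpoint_diff v \<gamma> = ennreal \<bar>real_fun v ?t - real_fun v ?s\<bar>"
    using True real_endpoint_diff[of u \<gamma>] real_endpoint_diff[of v \<gamma>] by (simp_all add: real_fun_def)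
  have "endpoint_diff (\<lambda>x. ereal (a * real_fun u x + b * real_fun v x)) \<gamma> =
      ennreal \<bar>a * real_fun u ?t + b * real_fun v ?t - (a * real_fun u ?s + b * real_fun v ?s)\<bar>"
    by (simp add: endpoint_diff_def e2ennreal_ereal)
  also have "a * real_fun u ?t + b * real_fun v ?t - (a * real_fun u ?s + b * real_fun v ?s) = a * (real_fun u ?t - real_fun u ?s) + b * (real_fun v ?t - real_fun v ?s)"
    by (simp add: algebra_simps)
  also have "ennreal \<bar>\<dots>\<bar> \<le> ennreal (\<bar>a\<bar> * \<bar>real_fun u ?t - real_fun u ?s\<bar> + \<bar>b\<bar> * \<bar>real_fun v ?t - real_fun v ?s\<bar>)"
    unfolding abs_mult[symmetric] by (intro ennreal_leI abs_triangle_ineq)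
  also have "\<dots> = ennreal \<bar>a\<bar> * endpoint_diff u \<gamma> + ennreal \<bar>b\<bar> * endpoint_diff v \<gamma>"
    unfolding e by (simp add: ennreal_mult)
  finally show ?thesis .
next
  case False
  then have "ennreal \<bar>a\<bar> * endpoint_diff u \<gamma> + ennreal \<bar>b\<bar> * endpoint_diff v \<gamma> = top"
    using assms by (auto simp: ennreal_mult_top less_top[symmetric] ennreal_eq_0_iff)
  then show ?thesis by (simp only: top_greatest)
qed

lemma sobolev_pair_comb:
  assumes u: "sobolev_pair u g" and v: "sobolev_pair v h" and ab: "a \<noteq> 0" "b \<noteq> 0"
  shows "sobolev_pair (\<lambda>x. ereal (a * real_fun u x + b * real_fun v x)) (\<lambda>x. ennreal \<bar>a\<bar> * g x + ennreal \<bar>b\<bar> * h x)"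
  unfolding sobolev_pair_def
proof (intro conjI)
  have i: "integrable m (\<lambda>x. a * real_fun u x + b * real_fun v x)"
    using sobolev_pairD(2)[OF u] sobolev_pairD(2)[OF v] by simp
  then have [measurable]: "(\<lambda>x. a * real_fun u x + b * real_fun v x) \<in> borel_measurable m" by (rule borel_measurable_integrable)
  show "(\<lambda>x. ereal (a * real_fun u x + b * real_fun v x)) \<in> borel_measurable m" by measurable
  show "(\<integral>\<^sup>+x. e2ennreal \<bar>ereal (a * real_fun u x + b * real_fun v x)\<bar> \<partial>m) < \<infinity>"
    using i unfolding integrable_iff_bounded by (simp add: e2ennreal_ereal)
  have g: "g \<in> Lp p N" "upper_gradient N u g" and h: "h \<in> Lp p N" "upper_gradient N v h"
    using u v by (auto simp: sobolev_pair_def)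
  show L: "(\<lambda>x. ennreal \<bar>a\<bar> * g x + ennreal \<bar>b\<bar> * h x) \<in> Lp p N"
    using p1 ab by (intro Lp_add Lp_cmult g h) auto
  show "upper_gradient N (\<lambda>x. ereal (a * real_fun u x + b * real_fun v x)) (\<lambda>x. ennreal \<bar>a\<bar> * g x + ennreal \<bar>b\<bar> * h x)"
    unfolding upper_gradient_def
  proof (intro conjI ballI Lp_measurable[OF L])
    fix \<gamma> assume \<gamma>: "\<gamma> \<in> rectifiable_curves N"
    have gm: "(\<lambda>x. ennreal \<bar>a\<bar> * g x) \<in> borel_measurable N" "(\<lambda>x. ennreal \<bar>b\<bar> * h x) \<in> borel_measurable N"
      using Lp_measurable[OF g(1)] Lp_measurable[OF h(1)] by measurable
    have "endpoint_diff (\<lambda>x. ereal (a * real_fun u x + b * real_fun v x)) \<gamma> \<le>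
      ennreal \<bar>a\<bar> * endpoint_diff u \<gamma> + ennreal \<bar>b\<bar> * endpoint_diff v \<gamma>" by (rule endpoint_diff_comb[OF ab])
    also have "\<dots> \<le> ennreal \<bar>a\<bar> * line_integral g \<gamma> + ennreal \<bar>b\<bar> * line_integral h \<gamma>"
      using g(2) h(2) \<gamma> by (intro add_mono mult_left_mono) (auto simp: upper_gradient_def)
    also have "\<dots> = line_integral (\<lambda>x. ennreal \<bar>a\<bar> * g x + ennreal \<bar>b\<bar> * h x) \<gamma>"
      by (simp add: line_integral_add[OF \<gamma> sets_N gm] line_integral_cmult[OF \<gamma> sets_N Lp_measurable[OF g(1)]]
          line_integral_cmult[OF \<gamma> sets_N Lp_measurable[OF h(1)]])
    finally show "endpoint_diff (\<lambda>x. ereal (a * real_fun u x + b * real_fun v x)) \<gamma> \<le>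
        line_integral (\<lambda>x. ennreal \<bar>a\<bar> * g x + ennreal \<bar>b\<bar> * h x) \<gamma>" .
  qed
qed

lemma real_fun_ereal [simp]: "real_fun (\<lambda>x. ereal (f x)) = f"
  by (simp add: real_fun_def fun_eq_iff)

text \<open>On every ball \<open>\<bar>a - b\<bar>\<close> is at most the sum of the two mean
  deviations. Any two candidates for the trace thus agree wherever both satisfy the limit
  condition.\<close>

lemma mean_dev_unique:
  assumes fin: "finite_measure m" and pos: "\<And>r. 0 < r \<Longrightarrow> 0 < measure m (ball x r \<inter> \<Omega>)"
    and u: "sobolev_pair u g"
    and a: "((\<lambda>r. mean_deviation N (ball x r \<inter> \<Omega>) u a) \<longlongrightarrow> 0) (at_right 0)"
    and b: "((\<lambda>r. mean_deviation N (ball x r \<inter> \<Omega>) u b) \<longlongrightarrow> 0) (at_right 0)"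
  shows "a = b"
proof -
  interpret finite_measure m by (rule fin)
  have le: "ennreal \<bar>a - b\<bar> \<le> mean_deviation N (ball x r \<inter> \<Omega>) u a + mean_deviation N (ball x r \<inter> \<Omega>) u b"
    if r: "0 < r" for r
  proof -
    let ?B = "ball x r \<inter> \<Omega>"
    have B: "?B \<in> sets m" by (rule open_sets_m) simp
    have i: "set_integrable m ?B (\<lambda>y. \<bar>real_fun u y - c\<bar>)" for c
      unfolding set_integrable_def using sobolev_pairD(2)[OF u] by (intro integrable_mult_indicator B) auto
    have k: "set_integrable m ?B (\<lambda>y. \<bar>a - b\<bar>)"
      unfolding set_integrable_def by (intro integrable_mult_indicator B) auto
    have "\<bar>a - b\<bar> * measure m ?B = (LINT y:?B|m. \<bar>a - b\<bar>)"
      by (simp add: set_lebesgue_integral_def mult.commute space_N Int_assoc)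
    also have "\<dots> \<le> (LINT y:?B|m. \<bar>real_fun u y - a\<bar> + \<bar>real_fun u y - b\<bar>)"
      by (rule set_integral_mono[OF k set_integral_add(1)[OF i i]]) auto
    also have "\<dots> = (LINT y:?B|m. \<bar>real_fun u y - a\<bar>) + (LINT y:?B|m. \<bar>real_fun u y - b\<bar>)"
      by (rule set_integral_add(2)[OF i i])
    finally have le: "\<bar>a - b\<bar> \<le> (LINT y:?B|m. \<bar>real_fun u y - a\<bar>) / measure m ?B + (LINT y:?B|m. \<bar>real_fun u y - b\<bar>) / measure m ?B"
      using pos[OF r] by (simp add: field_simps)
    have n: "0 \<le> (LINT y:?B|m. \<bar>real_fun u y - c\<bar>) / measure m ?B" for c
      unfolding set_lebesgue_integral_def
      by (intro divide_nonneg_nonneg Bochner_Integration.integral_nonneg) auto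
    show ?thesis
      unfolding mean_deviation_eq[OF u pos[OF r] fin] ennreal_plus[OF n n, symmetric] by (rule ennreal_leI[OF le])
  qed
  have "((\<lambda>r. mean_deviation N (ball x r \<inter> \<Omega>) u a + mean_deviation N (ball x r \<inter> \<Omega>) u b) \<longlongrightarrow> 0 + 0) (at_right 0)"
    by (intro tendsto_add a b)
  moreover have "\<forall>\<^sub>F r in at_right 0. ennreal \<bar>a - b\<bar> \<le> mean_deviation N (ball x r \<inter> \<Omega>) u a + mean_deviation N (ball x r \<inter> \<Omega>) u b"
    using eventually_at_right_less[of "0::real"] by eventually_elim (rule le)
  ultimately have "ennreal \<bar>a - b\<bar> \<le> 0 + 0" by (rule tendsto_lowerbound) simp
  then show ?thesis by simp
qed

lemma power_fun_comb_bound: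
  assumes g: "sobolev_pair u g" "sobolev_pair v h" "(LINT x|m. power_fun g x) \<le> b" "(LINT x|m. power_fun h x) \<le> b" "0 \<le> b"
  shows "(LINT x|m. power_fun (\<lambda>x. ennreal \<bar>1\<bar> * g x + ennreal \<bar>- 1\<bar> * h x) x) \<le> 2 * 2 powr (p - 1) * b"
proof -
  have hp: "(1 / 2 :: real) powr (1 - p) = 2 powr (p - 1)"
    by (simp add: powr_divide powr_diff powr_minus field_simps)
  have L: "g \<in> Lp p N" "h \<in> Lp p N" using g by (auto simp: sobolev_pair_def)
  have c: "sobolev_pair (\<lambda>x. ereal (1 * real_fun u x + (- 1) * real_fun v x)) (\<lambda>x. ennreal \<bar>1\<bar> * g x + ennreal \<bar>- 1\<bar> * h x)"
    by (rule sobolev_pair_comb[OF g(1,2)]) auto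
  have "ennreal (LINT x|m. power_fun (\<lambda>x. ennreal \<bar>1\<bar> * g x + ennreal \<bar>- 1\<bar> * h x) x) =
      (\<integral>\<^sup>+x. ennreal_powr (g x + h x) p \<partial>N)"
    using sobolev_pairD(5)[OF c] by simp
  also have "\<dots> \<le> ennreal ((1 - 1 / 2) powr (1 - p)) * (\<integral>\<^sup>+x. ennreal_powr (g x) p \<partial>N) +
      ennreal ((1 / 2) powr (1 - p)) * (\<integral>\<^sup>+x. ennreal_powr (h x) p \<partial>N)"
    using p1 by (intro nn_integral_ennreal_powr_add_le Lp_measurable[OF L(1)] Lp_measurable[OF L(2)]) auto
  also have "\<dots> \<le> ennreal (2 powr (p - 1)) * ennreal b + ennreal (2 powr (p - 1)) * ennreal b"
    unfolding sobolev_pairD(5)[OF g(1)] sobolev_pairD(5)[OF g(2)]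
    using g hp by (intro add_mono mult_mono ennreal_leI) auto
  also have "\<dots> = ennreal (2 * 2 powr (p - 1) * b)"
    using g(5) by (subst ennreal_mult_add_mult) auto
  finally show ?thesis using g(5) by (subst (asm) ennreal_le_iff) auto
qed

end

locale neumann_problem = neumann_domain +
  fixes f :: "'a \<Rightarrow> real" and F :: real
  assumes f_meas: "f \<in> borel_measurable (restrict_space (completion P) (frontier \<Omega>))"
    and f_bound: "\<And>x. x \<in> frontier \<Omega> \<Longrightarrow> \<bar>f x\<bar> \<le> F" and F0: "0 \<le> F"
begin

text \<open>The interface to the minimization: \<open>L\<close> is the boundary term as a functional
  of real representatives, followed by integrability, coercivity, linearity, continuity and
  compactness. Everything is stated for pairs of a function and an upper gradient.\<close>

theorem boundary_term:
  obtains L :: "('a \<Rightarrow> real) \<Rightarrow> real" and c :: real where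
    "\<And>u g. sobolev_pair u g \<Longrightarrow>
      neumann_functional p M \<Omega> f u = enn2ereal (dirichlet_energy p N u) + ereal (L (real_fun u))"
    "\<And>u g. sobolev_pair u g \<Longrightarrow> (\<integral>\<^sup>+x. ennreal_powr (ennreal \<bar>real_fun u x\<bar>) p \<partial>m) < \<infinity>"
    "\<And>u g. sobolev_pair u g \<Longrightarrow> (LINT x|m. real_fun u x) = 0 \<Longrightarrow> \<bar>L (real_fun u)\<bar> \<le> (LINT x|m. power_fun g x) / 2 + c"
    "\<And>u g. sobolev_pair u g \<Longrightarrow> (LINT x|m. real_fun u x) = 0 \<Longrightarrow> (LINT x|m. \<bar>real_fun u x\<bar>) \<le> c * (1 + (LINT x|m. power_fun g x))"
    "\<And>u g v h a b. sobolev_pair u g \<Longrightarrow> sobolev_pair v h \<Longrightarrow> a \<noteq> 0 \<Longrightarrow> b \<noteq> 0 \<Longrightarrow>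
      L (\<lambda>x. a * real_fun u x + b * real_fun v x) = a * L (real_fun u) + b * L (real_fun v)"
    "\<And>u g v h b. (\<And>n::nat. sobolev_pair (u n) (g n)) \<Longrightarrow> sobolev_pair v h \<Longrightarrow> (\<And>n. (LINT x|m. power_fun (g n) x) \<le> b) \<Longrightarrow>
      (\<lambda>n. LINT x|m. \<bar>real_fun (u n) x - real_fun v x\<bar>) \<longlonglongrightarrow> 0 \<Longrightarrow> (\<lambda>n. L (real_fun (u n))) \<longlonglongrightarrow> L (real_fun v)"
    "\<And>u g b. (\<And>n::nat. sobolev_pair (u n) (g n)) \<Longrightarrow> (\<And>n. (LINT x|m. power_fun (g n) x) \<le> b) \<Longrightarrow>
      (\<And>n. (LINT x|m. \<bar>real_fun (u n) x\<bar>) \<le> b) \<Longrightarrow>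
      \<exists>\<sigma>::nat\<Rightarrow>nat. strict_mono \<sigma> \<and> (\<forall>e>0. \<exists>k. \<forall>i\<ge>k. \<forall>j\<ge>k. (LINT x|m. \<bar>real_fun (u (\<sigma> i)) x - real_fun (u (\<sigma> j)) x\<bar>) < e)"
    "finite_measure m"
proof -
  obtain K C R CP CM c0 R1 where bf: "boundary_functional \<Omega> m K p C R M P CP CM f F c0 R1"
    and poincare_pair: "\<And>u g. sobolev_pair u g \<Longrightarrow> poincare_domain.poincare_pair \<Omega> m p C (real_fun u) (power_fun g)"
    using boundary_functional_exists[OF f_meas f_bound F0] by metis
  interpret bf: boundary_functional \<Omega> m K p C R M P CP CM f F c0 R1 by (rule bf)
  obtain c1 where c1: "\<And>w h. bf.poincare_pair w h \<Longrightarrow> (LINT y|m. w y) = 0 \<Longrightarrow> \<bar>bf.boundary_integral w\<bar> \<le> (LINT y|m. h y) / 2 + c1"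
    "\<And>w h. bf.poincare_pair w h \<Longrightarrow> (LINT y|m. w y) = 0 \<Longrightarrow> (LINT y|m. \<bar>w y\<bar>) \<le> c1 * (1 + (LINT y|m. h y))"
    using bf.boundary_integral_coercive by metis
  have picomb: "bf.poincare_pair (\<lambda>x. a * real_fun u x + b * real_fun v x) (power_fun (\<lambda>x. ennreal \<bar>a\<bar> * g x + ennreal \<bar>b\<bar> * h x))"
    if "sobolev_pair u g" "sobolev_pair v h" "a \<noteq> 0" "b \<noteq> 0" for u g v h a b
    using poincare_pair[OF sobolev_pair_comb[OF that]] by simp
  show ?thesis
  proof (rule that[of bf.boundary_integral c1])
    show "finite_measure m" by (rule bf.finite_m)
    fix u g assume u: "sobolev_pair u g"
    show "(\<integral>\<^sup>+x. ennreal_powr (ennreal \<bar>real_fun u x\<bar>) p \<partial>m) < \<infinity>" by (rule bf.poincare_pair_imp_Lp[OF poincare_pair[OF u]])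
    have posB: "0 < measure m (ball x r \<inter> \<Omega>)" if "x \<in> frontier \<Omega>" "0 < r" for x r
      using bf.ball_pos[of x r] bf.frontier_closure that by blast
    have md: "((\<lambda>r. mean_deviation N (ball x r \<inter> \<Omega>) u (bf.trace_lim (real_fun u) x)) \<longlongrightarrow> 0) (at_right 0)"
      if x: "x \<in> frontier \<Omega>" "summable (bf.osc_bound (power_fun g) x)" for x
    proof -
      have xc: "x \<in> closure \<Omega>" using x bf.frontier_closure by auto
      have "((\<lambda>r. ennreal ((LINT y:ball x r \<inter> \<Omega>|m. \<bar>real_fun u y - bf.trace_lim (real_fun u) x\<bar>) / measure m (ball x r \<inter> \<Omega>))) \<longlongrightarrow> ennreal 0) (at_right 0)"
        by (intro tendsto_ennrealI bf.mean_dev_tendsto[OF poincare_pair[OF u] xc x(2)])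
      moreover have "\<forall>\<^sub>F r in at_right 0. ennreal ((LINT y:ball x r \<inter> \<Omega>|m. \<bar>real_fun u y - bf.trace_lim (real_fun u) x\<bar>) / measure m (ball x r \<inter> \<Omega>)) =
          mean_deviation N (ball x r \<inter> \<Omega>) u (bf.trace_lim (real_fun u) x)"
        using eventually_at_right_less[of "0::real"]
        by eventually_elim (rule mean_deviation_eq[OF u posB[OF x(1)] bf.finite_m, symmetric])
      ultimately show ?thesis by (simp add: tendsto_cong)
    qed
    have "is_trace M \<Omega> u (bf.trace_lim (real_fun u))"
      unfolding is_trace_def
    proof (rule antisym)
      have "codim1_hausdorff M {x \<in> frontier \<Omega>. \<not> ((\<lambda>r. mean_deviation N (ball x r \<inter> \<Omega>) u (bf.trace_lim (real_fun u) x)) \<longlongrightarrow> 0) (at_right 0)}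
         \<le> codim1_hausdorff M {x \<in> frontier \<Omega>. \<not> summable (bf.osc_bound (power_fun g) x)}"
        using md by (intro codim1_hausdorff_mono) blast
      also have "\<dots> = 0" by (rule bf.trace_exists_codim1[OF poincare_pair[OF u]])
      finally show "codim1_hausdorff M {x \<in> frontier \<Omega>. \<not> ((\<lambda>r. mean_deviation N (ball x r \<inter> \<Omega>) u (bf.trace_lim (real_fun u) x)) \<longlongrightarrow> 0) (at_right 0)} \<le> 0" .
    qed simp
    \<comment> \<open>Since some trace exists, the one picked by \<open>trace_op\<close> is a trace
      too; uniqueness then identifies it with the dyadic limit almost everywhere on the
      boundary.\<close>
    then have "is_trace M \<Omega> u (trace_op M \<Omega> u)" unfolding trace_op_def by (rule someI[of "is_trace M \<Omega> u"])
    then have "AE x in P. x \<in> frontier \<Omega> \<longrightarrow> ((\<lambda>r. mean_deviation N (ball x r \<inter> \<Omega>) u (trace_op M \<Omega> u x)) \<longlongrightarrow> 0) (at_right 0)"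
      unfolding is_trace_def by (rule bf.codim1_null_AE)
    moreover have "AE x in P. x \<in> frontier \<Omega> \<longrightarrow> summable (bf.osc_bound (power_fun g) x)"
      by (rule bf.codim1_null_AE[OF bf.trace_exists_codim1[OF poincare_pair[OF u]]])
    ultimately have "AE x in P. x \<in> frontier \<Omega> \<longrightarrow> trace_op M \<Omega> u x = bf.trace_lim (real_fun u) x"
    proof eventually_elim
      case (elim x)
      show ?case
      proof
        assume x: "x \<in> frontier \<Omega>"
        show "trace_op M \<Omega> u x = bf.trace_lim (real_fun u) x"
          by (rule mean_dev_unique[OF bf.finite_m posB[OF x] u]) (use elim x md in auto)
      qed
    qed
    then have "(LINT x:frontier \<Omega>|completion P. trace_op M \<Omega> u x * f x) = bf.boundary_integral (real_fun u)"
      by (rule bf.boundary_integral_cong_AE[OF poincare_pair[OF u]])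
    then show "neumann_functional p M \<Omega> f u = enn2ereal (dirichlet_energy p N u) + ereal (bf.boundary_integral (real_fun u))"
      by (simp add: neumann_functional_def dirichlet_energy_def)
    assume "(LINT x|m. real_fun u x) = 0"
    then show "\<bar>bf.boundary_integral (real_fun u)\<bar> \<le> (LINT x|m. power_fun g x) / 2 + c1" "(LINT x|m. \<bar>real_fun u x\<bar>) \<le> c1 * (1 + (LINT x|m. power_fun g x))"
      by (rule c1[OF poincare_pair[OF u]])+
  next
    fix u g v h a b assume "sobolev_pair u g" "sobolev_pair v h" "a \<noteq> (0::real)" "b \<noteq> (0::real)"
    then show "bf.boundary_integral (\<lambda>x. a * real_fun u x + b * real_fun v x) = a * bf.boundary_integral (real_fun u) + b * bf.boundary_integral (real_fun v)"
      using bf.boundary_integral_linear[OF poincare_pair poincare_pair picomb] by blast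
  next
    fix u g v h b assume u: "\<And>n::nat. sobolev_pair (u n) (g n)" and v: "sobolev_pair v h"
      and b: "\<And>n. (LINT x|m. power_fun (g n) x) \<le> b" and lim: "(\<lambda>n. LINT x|m. \<bar>real_fun (u n) x - real_fun v x\<bar>) \<longlonglongrightarrow> 0"
    define b' where "b' = max (max b 0) (LINT x|m. power_fun h x)"
    have b': "(LINT x|m. power_fun (g n) x) \<le> b'" "(LINT x|m. power_fun h x) \<le> b'" "0 \<le> b'" for n
      using b[of n] by (auto simp: b'_def)
    show "(\<lambda>n. bf.boundary_integral (real_fun (u n))) \<longlonglongrightarrow> bf.boundary_integral (real_fun v)"
    proof (rule bf.boundary_integral_continuous[OF poincare_pair[OF u] poincare_pair[OF v] _ _ lim])
      show "bf.poincare_pair (\<lambda>y. 1 * real_fun (u n) y + - 1 * real_fun v y) (power_fun (\<lambda>x. ennreal \<bar>1\<bar> * g n x + ennreal \<bar>- 1\<bar> * h x))" for n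
        by (rule picomb[OF u v]) auto
      show "(LINT y|m. power_fun (\<lambda>x. ennreal \<bar>1\<bar> * g n x + ennreal \<bar>- 1\<bar> * h x) y) \<le> 2 * 2 powr (p - 1) * b'" for n
        by (rule power_fun_comb_bound[OF u v b'])
    qed
  next
    fix u g b assume u: "\<And>n::nat. sobolev_pair (u n) (g n)"
      and b: "\<And>n. (LINT x|m. power_fun (g n) x) \<le> b" "\<And>n. (LINT x|m. \<bar>real_fun (u n) x\<bar>) \<le> b"
    show "\<exists>\<sigma>::nat\<Rightarrow>nat. strict_mono \<sigma> \<and> (\<forall>e>0. \<exists>k. \<forall>i\<ge>k. \<forall>j\<ge>k. (LINT x|m. \<bar>real_fun (u (\<sigma> i)) x - real_fun (u (\<sigma> j)) x\<bar>) < e)"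
    proof (rule bf.poincare_pair_compact[of "\<lambda>n. real_fun (u n)" "\<lambda>n. power_fun (g n)" b, OF poincare_pair[OF u] b])
      fix \<sigma> :: "nat \<Rightarrow> nat"
      assume \<sigma>: "strict_mono \<sigma>" "\<And>e. 0 < e \<Longrightarrow> \<exists>k. \<forall>i\<ge>k. \<forall>j\<ge>k. (LINT x|m. \<bar>real_fun (u (\<sigma> i)) x - real_fun (u (\<sigma> j)) x\<bar>) < e"
      show ?thesis by (intro exI[of _ \<sigma>] conjI \<sigma>(1) allI impI \<sigma>(2))
    qed
  qed
qed

end

subsection \<open>Uniform convexity\<close>

text \<open>The strictness away from 1 is essential: it makes the convexity gap in
  \<open>powr_uniform_convexity\<close> positive off the diagonal.\<close>

lemma powr_gt_tangent:
  fixes x p :: real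
  assumes "1 < p" "0 \<le> x" "x \<noteq> 1"
  shows "1 + p * (x - 1) < x powr p"
proof -
  have der: "((\<lambda>x. x powr p) has_real_derivative p * z powr (p - 1)) (at z)" if "0 < z" for z
    using that by (auto intro!: derivative_eq_intros)
  consider "x = 0" | "0 < x" "x < 1" | "1 < x" using assms by linarith
  then show ?thesis
  proof cases
    case 2
    obtain z where z: "x < z" "z < 1" "1 powr p - x powr p = (1 - x) * (p * z powr (p - 1))"
      using MVT2[OF 2(2), of "\<lambda>x. x powr p" "\<lambda>z. p * z powr (p - 1)"] der 2 by auto
    have "z powr (p - 1) < 1 powr (p - 1)" using z 2 assms by (intro powr_less_mono2) auto
    then have "(1 - x) * (p * z powr (p - 1)) < (1 - x) * (p * 1)"
      using 2 assms by (intro mult_strict_left_mono) auto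
    then show ?thesis using z(3) by (simp add: algebra_simps)
  next
    case 3
    obtain z where z: "1 < z" "z < x" "x powr p - 1 powr p = (x - 1) * (p * z powr (p - 1))"
      using MVT2[OF 3, of "\<lambda>x. x powr p" "\<lambda>z. p * z powr (p - 1)"] der by auto
    have "1 powr (p - 1) < z powr (p - 1)" using z assms by (intro powr_less_mono2) auto
    then have "(x - 1) * (p * 1) < (x - 1) * (p * z powr (p - 1))"
      using 3 assms by (intro mult_strict_left_mono) auto
    then show ?thesis using z(3) by (simp add: algebra_simps)
  qed (use assms in auto)
qed

lemma powr_midpoint:
  fixes a b p :: real
  assumes "1 < p" "0 \<le> a" "0 \<le> b"
  shows "((a + b) / 2) powr p \<le> (a powr p + b powr p) / 2"
proof -
  have h: "(1 / 2 :: real) powr (1 - p) = 2 powr p / 2" by (simp add: powr_divide powr_diff)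
  have "(a + b) powr p \<le> (2 powr p / 2) * a powr p + (2 powr p / 2) * b powr p"
    using powr_add_le[of a b "1/2" p] assms h by simp
  then have "(a + b) powr p / 2 powr p \<le> ((2 powr p / 2) * a powr p + (2 powr p / 2) * b powr p) / 2 powr p"
    by (intro divide_right_mono) auto
  also have "\<dots> = (a powr p + b powr p) / 2" by (simp add: field_simps)
  also have "(a + b) powr p / 2 powr p = ((a + b) / 2) powr p" by (rule powr_divide[symmetric])
  finally show ?thesis .
qed

text \<open>By homogeneity the gap is governed by a function \<open>\<phi>\<close> of
  \<open>t = a / (a + b)\<close>. If \<open>a\<close> and \<open>b\<close> are close, the
  \<open>\<epsilon>\<close> term suffices; otherwise \<open>t\<close> lies in a compact set on which
  the continuous positive \<open>\<phi>\<close> has a positive minimum. One argument covers all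
  \<open>p > 1\<close>.\<close>

lemma powr_uniform_convexity:
  fixes p \<epsilon> :: real
  assumes p: "1 < p" and \<epsilon>: "0 < \<epsilon>"
  obtains c where "0 \<le> c" "\<And>a b. 0 \<le> a \<Longrightarrow> 0 \<le> b \<Longrightarrow>
    \<bar>a - b\<bar> powr p \<le> \<epsilon> * (a powr p + b powr p) + c * ((a powr p + b powr p) / 2 - ((a + b) / 2) powr p)"
proof -
  define \<phi> where "\<phi> t = (t powr p + (1 - t) powr p) / 2 - (1 / 2) powr p" for t :: real
  \<comment> \<open>Makes \<open>\<delta> powr p * 2 powr p = \<epsilon>\<close>, where
    \<open>2 powr p\<close> is the constant of \<open>sp\<close> below.\<close>
  define \<delta> where "\<delta> = (\<epsilon> / 2 powr p) powr (1 / p)"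
  have \<delta>: "0 < \<delta>" "\<delta> powr p = \<epsilon> / 2 powr p" using \<epsilon> p by (auto simp: \<delta>_def powr_powr)
  define S where "S = {t. 0 \<le> t \<and> t \<le> 1 \<and> \<delta> \<le> \<bar>2 * t - 1\<bar>}"
  have "closed S" unfolding S_def
    by (intro closed_Collect_conj closed_Collect_le continuous_intros)
  then have "compact ({0..1} \<inter> S)" by (intro compact_Int_closed) auto
  also have "{0..1} \<inter> S = S" by (auto simp: S_def)
  finally have comp: "compact S" .
  have cont: "continuous_on S \<phi>" unfolding \<phi>_def using p
    by (intro continuous_on_diff continuous_on_divide continuous_on_add continuous_on_powr'
        continuous_on_const continuous_on_id) (auto simp: S_def)
  have pos: "0 < \<phi> t" if "t \<in> S" for t
  proof -
    have t: "0 \<le> t" "t \<le> 1" "2 * t \<noteq> 1" using that \<delta>(1) by (auto simp: S_def)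
    have "1 + p * (2 * t - 1) < (2 * t) powr p" using t p by (intro powr_gt_tangent) auto
    moreover have "1 + p * (2 * (1 - t) - 1) < (2 * (1 - t)) powr p" using t p by (intro powr_gt_tangent) auto
    ultimately have "2 < (2 * t) powr p + (2 * (1 - t)) powr p" by (simp add: algebra_simps)
    also have "\<dots> = 2 powr p * (t powr p + (1 - t) powr p)" using t by (simp only: powr_mult distrib_left)
    finally show ?thesis by (simp add: \<phi>_def powr_divide field_simps)
  qed
  obtain c where c: "0 < c" "\<And>t. t \<in> S \<Longrightarrow> c \<le> \<phi> t"
  proof (cases "S = {}")
    case False
    obtain t0 where "t0 \<in> S" "\<forall>t\<in>S. \<phi> t0 \<le> \<phi> t" using continuous_attains_inf[OF comp False cont] by blast
    then show ?thesis using that[of "\<phi> t0"] pos by blast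
  qed (use that[of 1] in auto)
  show ?thesis
  proof (rule that[of "1 / c"])
    show "0 \<le> 1 / c" using c by simp
    fix a b :: real assume ab: "0 \<le> a" "0 \<le> b"
    have mid: "0 \<le> (a powr p + b powr p) / 2 - ((a + b) / 2) powr p" using powr_midpoint[OF p ab] by simp
    have sp: "(a + b) powr p \<le> 2 powr p * (a powr p + b powr p)"
    proof -
      have "(a + b) powr p = 2 powr p * ((a + b) / 2) powr p" using ab by (simp add: powr_divide)
      also have "\<dots> \<le> 2 powr p * ((a powr p + b powr p) / 2)" by (intro mult_left_mono powr_midpoint p ab) auto
      also have "\<dots> \<le> 2 powr p * (a powr p + b powr p)" by (intro mult_left_mono) (auto simp: add_nonneg_nonneg)
      finally show ?thesis .
    qed
    show "\<bar>a - b\<bar> powr p \<le> \<epsilon> * (a powr p + b powr p) + 1 / c * ((a powr p + b powr p) / 2 - ((a + b) / 2) powr p)"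
    proof (cases "\<bar>a - b\<bar> \<le> \<delta> * (a + b)")
      case True
      have "\<bar>a - b\<bar> powr p \<le> (\<delta> * (a + b)) powr p" using True p by (intro powr_mono2) auto
      also have "\<dots> = \<epsilon> / 2 powr p * (a + b) powr p" using \<delta> ab by (simp add: powr_mult)
      also have "\<dots> \<le> \<epsilon> / 2 powr p * (2 powr p * (a powr p + b powr p))" using \<epsilon> by (intro mult_left_mono sp) auto
      also have "\<dots> = \<epsilon> * (a powr p + b powr p)" by simp
      finally show ?thesis using mid c(1) by (simp add: add_increasing2)
    next
      case False
      define s where "s = a + b"
      have s: "0 < s" using False ab \<delta> by (cases "s = 0") (auto simp: s_def)
      define t where "t = a / s"
      have t1: "1 - t = b / s" using s by (simp add: t_def s_def field_simps)
      have t2: "\<bar>2 * t - 1\<bar> = \<bar>a - b\<bar> / s"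
      proof -
        have "2 * t - 1 = (a - b) / s" using s by (simp add: t_def s_def field_simps)
        then show ?thesis using s by simp
      qed
      have "t \<in> S" using False ab s t2 t1 by (auto simp: S_def t_def field_simps)
      then have "c \<le> \<phi> t" by (rule c(2))
      have "\<bar>a - b\<bar> powr p \<le> s powr p" using ab p by (intro powr_mono2) (auto simp: s_def)
      also have "\<dots> \<le> s powr p * (\<phi> t / c)"
        using mult_left_mono[of 1 "\<phi> t / c" "s powr p"] c(1) \<open>c \<le> \<phi> t\<close> by simp
      also have "\<dots> = 1 / c * (s powr p * \<phi> t)" by simp
      also have "s powr p * \<phi> t = (a powr p + b powr p) / 2 - (s / 2) powr p"
        unfolding \<phi>_def t1 using s ab by (simp add: t_def powr_divide algebra_simps)
      finally show ?thesis using \<epsilon> by (simp add: s_def add_increasing)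
    qed
  qed
qed

lemma cauchy_subsequence:
  assumes "\<And>n::nat. \<exists>k::nat. \<forall>i\<ge>k. \<forall>j\<ge>k. Q n i j"
  obtains \<tau> :: "nat \<Rightarrow> nat" where "strict_mono \<tau>" "\<And>n. Q n (\<tau> n) (\<tau> (Suc n))"
proof -
  obtain k where k: "\<And>n i j. i \<ge> k n \<Longrightarrow> j \<ge> k n \<Longrightarrow> Q n i j" using assms by metis
  define \<tau> where "\<tau> n = (\<Sum>i\<le>n. k i) + n" for n
  have m: "strict_mono \<tau>" by (intro strict_mono_Suc_iff[THEN iffD2]) (auto simp: \<tau>_def)
  have ge: "k n \<le> \<tau> n" for n using member_le_sum[of n "{..n}" k] by (simp add: \<tau>_def)
  have "Q n (\<tau> n) (\<tau> (Suc n))" for n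
    using ge[of n] strict_mono_less[OF m, of n "Suc n"] by (intro k) auto
  then show ?thesis using that m by blast
qed

subsection \<open>Limits of functions with a common upper gradient\<close>

lemma limsup_endpoint_le:
  fixes x y :: "nat \<Rightarrow> ereal"
  assumes "\<And>n. n \<ge> k \<Longrightarrow> x n \<le> y n + ereal A"
  shows "limsup x \<le> limsup y + ereal A"
proof -
  have "limsup x \<le> limsup (\<lambda>n. y n + ereal A)"
    using assms by (intro Limsup_mono) (auto simp: eventually_sequentially)
  also have "\<dots> = limsup y + ereal A" by (rule Limsup_add_ereal_right) auto
  finally show ?thesis .
qed

lemma endpoint_diff_finiteD:
  assumes "endpoint_diff u \<gamma> \<le> ennreal A" "0 \<le> A"
  shows "\<bar>u (pathstart \<gamma>)\<bar> \<noteq> \<infinity>" "\<bar>u (pathfinish \<gamma>)\<bar> \<noteq> \<infinity>"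
    "u (pathfinish \<gamma>) \<le> u (pathstart \<gamma>) + ereal A" "u (pathstart \<gamma>) \<le> u (pathfinish \<gamma>) + ereal A"
proof -
  have fin: "endpoint_diff u \<gamma> < \<infinity>" using assms(1) by (rule le_less_trans) simp
  show a: "\<bar>u (pathstart \<gamma>)\<bar> \<noteq> \<infinity>" and b: "\<bar>u (pathfinish \<gamma>)\<bar> \<noteq> \<infinity>"
    using fin by (auto simp: endpoint_diff_def split: if_splits)
  obtain s t where st: "u (pathstart \<gamma>) = ereal s" "u (pathfinish \<gamma>) = ereal t"
    using a b by (cases "u (pathstart \<gamma>)"; cases "u (pathfinish \<gamma>)") auto
  have "\<bar>t - s\<bar> \<le> A" using assms real_endpoint_diff[OF fin] st by simp
  then show "u (pathfinish \<gamma>) \<le> u (pathstart \<gamma>) + ereal A" "u (pathstart \<gamma>) \<le> u (pathfinish \<gamma>) + ereal A"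
    by (auto simp: st)
qed

text \<open>
  On almost every curve some point lies outside the exceptional set \<open>Z\<close>, and the common upper
  gradient \<open>G\<close> carries the convergence at that point over to the finiteness of the limit superior
  along the whole curve.
\<close>

lemma weak_upper_gradient_limsup:
  fixes N :: "'a::metric_space measure"
  assumes p: "1 < p" and N: "sets N = sets (restrict_space borel (space N))"
    and ug: "\<And>n::nat. upper_gradient N (v n) (g n)"
    and G: "G \<in> Lp p N" "\<And>n x. g n x \<le> G x"
    and Z: "Z \<in> null_sets N" "\<And>x. x \<in> space N - Z \<Longrightarrow> \<exists>r. (\<lambda>n. v n x) \<longlonglongrightarrow> ereal r"
    and H: "H \<in> Lp p N" "\<And>n x. n \<ge> k \<Longrightarrow> g n x \<le> H x"
  shows "weak_upper_gradient p N (\<lambda>x. limsup (\<lambda>n. v n x)) H"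
proof -
  \<comment> \<open>The term with \<open>top\<close> adds no energy because \<open>Z\<close> is
    null, but it excludes every curve that spends positive length in \<open>Z\<close>.
    \<open>G\<close> and \<open>H\<close> make the remaining line integrals finite.\<close>
  define \<rho> where "\<rho> x = (G x + H x) + top * indicator Z x" for x
  have Zs: "Z \<in> sets N" using Z by auto
  have GH: "(\<lambda>x. G x + H x) \<in> Lp p N" using p by (intro Lp_add G H) auto
  have \<rho>: "\<rho> \<in> Lp p N"
  proof -
    have m: "\<rho> \<in> borel_measurable N"
      unfolding \<rho>_def[abs_def] using Lp_measurable[OF GH] Zs by measurable
    have "(\<integral>\<^sup>+x. ennreal_powr (\<rho> x) p \<partial>N) = (\<integral>\<^sup>+x. ennreal_powr (G x + H x) p \<partial>N)"
      by (rule nn_integral_cong_AE) (use AE_not_in[OF Z(1)] in \<open>auto elim!: eventually_mono simp: \<rho>_def\<close>)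
    then show ?thesis using m GH by (simp add: Lp_def)
  qed
  have main: "endpoint_diff (\<lambda>x. limsup (\<lambda>n. v n x)) \<gamma> \<le> line_integral H \<gamma>"
    if \<gamma>: "\<gamma> \<in> rectifiable_curves N" and fin: "line_integral \<rho> \<gamma> < \<infinity>" for \<gamma>
  proof -
    define l where "l = arc_length \<gamma>"
    define c where "c = arc_length_param \<gamma>"
    have l: "0 < l" using arc_length_pos[OF \<gamma>] by (simp add: l_def)
    have G\<rho>: "line_integral G \<gamma> \<le> line_integral \<rho> \<gamma>" "line_integral H \<gamma> \<le> line_integral \<rho> \<gamma>"
      "line_integral (\<lambda>x. top * indicator Z x) \<gamma> \<le> line_integral \<rho> \<gamma>"
      by (rule line_integral_mono[OF \<gamma>], simp add: \<rho>_def add_increasing add_increasing2)+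
    obtain A where A: "line_integral G \<gamma> = ennreal A" "0 \<le> A"
      using le_less_trans[OF G\<rho>(1) fin] by (cases "line_integral G \<gamma>") auto
    obtain A' where A': "line_integral H \<gamma> = ennreal A'" "0 \<le> A'"
      using le_less_trans[OF G\<rho>(2) fin] by (cases "line_integral H \<gamma>") auto
    have "\<exists>s\<in>{0..l}. c s \<notin> Z"
    proof (rule ccontr)
      assume "\<not> (\<exists>s\<in>{0..l}. c s \<notin> Z)"
      then have "line_integral (\<lambda>x. top * indicator Z x) \<gamma> = (\<integral>\<^sup>+s. top * indicator {0..l} s \<partial>lborel)"
        unfolding line_integral_def c_def l_def arc_length_def by (intro nn_integral_cong) (auto simp: indicator_def)
      also have "\<dots> = top * emeasure lborel {0..l}" by (rule nn_integral_cmult_indicator) simp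
      also have "\<dots> = top" using l by (simp add: ennreal_top_mult)
      finally show False using le_less_trans[OF G\<rho>(3) fin] by simp
    qed
    then obtain s0 where s0: "0 \<le> s0" "s0 \<le> l" "c s0 \<notin> Z" by auto
    have cN: "c s \<in> space N" if "0 \<le> s" "s \<le> l" for s
      using arc_length_param_in_space[OF \<gamma>, of s] that by (simp add: c_def l_def)
    obtain r where r: "(\<lambda>n. v n (c s0)) \<longlonglongrightarrow> ereal r" using Z(2)[of "c s0"] s0 cN by auto
    have lr: "limsup (\<lambda>n. v n (c s0)) = ereal r" using lim_imp_Limsup[OF _ r] by simp
    have sub: "v n (c t) \<le> v n (c s) + ereal A \<and> v n (c s) \<le> v n (c t) + ereal A"
      if st: "0 \<le> s" "s < t" "t \<le> l" for n s t
    proof -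
      obtain \<gamma>' where \<gamma>': "\<gamma>' \<in> rectifiable_curves N" "pathstart \<gamma>' = c s" "pathfinish \<gamma>' = c t"
        and li: "\<And>g. g \<in> borel_measurable N \<Longrightarrow> line_integral g \<gamma>' = (\<integral>\<^sup>+x\<in>{s..t}. g (c x) \<partial>lborel)"
        using rectifiable_subcurve[OF \<gamma> st(1,2) _ N] st(3) unfolding c_def l_def by blast
      have "endpoint_diff (v n) \<gamma>' \<le> line_integral (g n) \<gamma>'" using ug \<gamma>'(1) by (simp add: upper_gradient_def)
      also have "\<dots> \<le> line_integral G \<gamma>'" by (rule line_integral_mono[OF \<gamma>'(1) G(2)])
      also have "\<dots> \<le> line_integral G \<gamma>"
        using st li[OF Lp_measurable[OF G(1)]] by (intro subcurve_finite[OF \<gamma> \<gamma>'(1)]) (auto simp: l_def c_def)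
      finally have "endpoint_diff (v n) \<gamma>' \<le> ennreal A" using A by simp
      from endpoint_diff_finiteD[OF this A(2)] show ?thesis by (simp add: \<gamma>')
    qed
    have near: "\<bar>limsup (\<lambda>n. v n (c s))\<bar> \<noteq> \<infinity>" if s: "0 \<le> s" "s \<le> l" for s
    proof -
      have "v n (c s) \<le> v n (c s0) + ereal A" "v n (c s0) \<le> v n (c s) + ereal A" for n
      proof -
        consider "s < s0" | "s = s0" | "s0 < s" by linarith
        then have "v n (c s) \<le> v n (c s0) + ereal A \<and> v n (c s0) \<le> v n (c s) + ereal A"
        proof cases
          case 2
          then show ?thesis using A(2) by (simp add: ereal_le_add_self)
        qed (use sub s s0 in blast)+
        then show "v n (c s) \<le> v n (c s0) + ereal A" "v n (c s0) \<le> v n (c s) + ereal A" by auto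
      qed
      then have "limsup (\<lambda>n. v n (c s)) \<le> ereal r + ereal A" "ereal r \<le> limsup (\<lambda>n. v n (c s)) + ereal A"
        unfolding lr[symmetric] by (intro limsup_endpoint_le[of 0]; simp)+
      then show ?thesis by (cases "limsup (\<lambda>n. v n (c s))") auto
    qed
    have ends: "c 0 = pathstart \<gamma>" "c l = pathfinish \<gamma>"
      by (simp_all add: c_def l_def arc_length_param_0[OF \<gamma>] arc_length_param_arc_length[OF \<gamma>])
    define us ut where "us = limsup (\<lambda>n. v n (pathstart \<gamma>))" and "ut = limsup (\<lambda>n. v n (pathfinish \<gamma>))"
    have f: "\<bar>us\<bar> \<noteq> \<infinity>" "\<bar>ut\<bar> \<noteq> \<infinity>" using near[of 0] near[of l] l by (auto simp: us_def ut_def ends)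
    \<comment> \<open>The limit superior ignores the indices below \<open>k\<close>, so
      \<open>H\<close> alone bounds the difference at the end points; \<open>G\<close> was used only
      for the finiteness of the limit superior.\<close>
    have step: "v n (pathfinish \<gamma>) \<le> v n (pathstart \<gamma>) + ereal A'" "v n (pathstart \<gamma>) \<le> v n (pathfinish \<gamma>) + ereal A'"
      if n: "n \<ge> k" for n
    proof -
      have "endpoint_diff (v n) \<gamma> \<le> line_integral (g n) \<gamma>" using ug \<gamma> by (simp add: upper_gradient_def)
      also have "\<dots> \<le> ennreal A'" unfolding A'(1)[symmetric] by (rule line_integral_mono[OF \<gamma> H(2)[OF n]])
      finally have "endpoint_diff (v n) \<gamma> \<le> ennreal A'" .
      from endpoint_diff_finiteD(3,4)[OF this A'(2)]
      show "v n (pathfinish \<gamma>) \<le> v n (pathstart \<gamma>) + ereal A'" "v n (pathstart \<gamma>) \<le> v n (pathfinish \<gamma>) + ereal A'" .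
    qed
    have "ut \<le> us + ereal A'" "us \<le> ut + ereal A'"
      unfolding us_def ut_def by (rule limsup_endpoint_le[of k], rule step, assumption)+
    then have "e2ennreal \<bar>ut - us\<bar> \<le> ennreal A'"
      using f by (cases ut; cases us) (auto simp: e2ennreal_ereal intro!: ennreal_leI)
    then show ?thesis using f A' by (simp add: endpoint_diff_def us_def ut_def)
  qed
  show ?thesis
    unfolding weak_upper_gradient_iff[OF p N]
    by (intro conjI bexI[OF _ \<rho>] ballI impI Lp_measurable[OF H(1)] main)
qed

lemma ennreal_le_1_plus_powr: "1 < p \<Longrightarrow> x \<le> 1 + ennreal_powr x p"
proof (cases x)
  case (real r)
  assume p: "1 < p"
  have "r \<le> 1 + r powr p"
  proof (cases "r \<le> 1")
    case False
    then show ?thesis using powr_mono[of 1 p r] p by simp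
  qed (simp add: add_increasing2)
  then have "ennreal r \<le> ennreal (1 + r powr p)" by (rule ennreal_leI)
  then show ?thesis using real by (simp add: ennreal_powr_ennreal)
qed simp

section \<open>Limits in the Newtonian space of the domain\<close>

context neumann_domain
begin

lemma newtonian_sobolev_pair:
  assumes fin: "finite_measure m" and u: "u \<in> newtonian p N"
  obtains g where "sobolev_pair u g"
proof -
  interpret finite_measure m by (rule fin)
  obtain g where g: "upper_gradient N u g" "(\<integral>\<^sup>+x. ennreal_powr (g x) p \<partial>N) < \<infinity>"
    using u by (auto simp: newtonian_def)
  have um: "u \<in> borel_measurable m" and ui: "(\<integral>\<^sup>+x. ennreal_powr (e2ennreal \<bar>u x\<bar>) p \<partial>m) < \<infinity>"
    using u by (auto simp: newtonian_def)
  note [measurable] = um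
  have "(\<integral>\<^sup>+x. e2ennreal \<bar>u x\<bar> \<partial>m) \<le> (\<integral>\<^sup>+x. 1 + ennreal_powr (e2ennreal \<bar>u x\<bar>) p \<partial>m)"
    using p1 by (intro nn_integral_mono ennreal_le_1_plus_powr)
  also have "\<dots> = emeasure m (space m) + (\<integral>\<^sup>+x. ennreal_powr (e2ennreal \<bar>u x\<bar>) p \<partial>m)"
    by (subst nn_integral_add) auto
  also have "\<dots> < \<infinity>" using ui emeasure_finite[of "space m"] unfolding less_top by (simp add: ennreal_add_eq_top less_top)
  finally have "sobolev_pair u g"
    using um g by (auto simp: sobolev_pair_def Lp_def upper_gradient_def)
  then show ?thesis by (rule that)
qed

lemma sobolev_pair_newtonian:
  assumes u: "sobolev_pair u g" and L: "(\<integral>\<^sup>+x. ennreal_powr (ennreal \<bar>real_fun u x\<bar>) p \<partial>m) < \<infinity>"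
  shows "u \<in> newtonian p N"
proof -
  have "(\<integral>\<^sup>+x. ennreal_powr (e2ennreal \<bar>u x\<bar>) p \<partial>m) = (\<integral>\<^sup>+x. ennreal_powr (ennreal \<bar>real_fun u x\<bar>) p \<partial>m)"
    by (rule nn_integral_cong_AE)
      (use sobolev_pairD(1)[OF u] in \<open>auto elim!: eventually_mono simp: real_fun_def e2ennreal_finite\<close>)
  then show ?thesis using u L by (auto simp: newtonian_def sobolev_pair_def Lp_def)
qed

lemma energy_finite:
  assumes u: "sobolev_pair u g"
  shows "dirichlet_energy p N u < \<infinity>" "enn2real (dirichlet_energy p N u) \<le> (LINT x|m. power_fun g x)"
proof -
  have g: "g \<in> Lp p N" "upper_gradient N u g" using u by (auto simp: sobolev_pair_def)
  have "dirichlet_energy p N u \<le> ennreal (LINT x|m. power_fun g x)"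
    using dirichlet_energy_le[OF p1 sets_N upper_gradient_imp_weak[OF g(2) p1 sets_N] g(1)] sobolev_pairD(5)[OF u] by simp
  moreover have "0 \<le> (LINT x|m. power_fun g x)" by (intro Bochner_Integration.integral_nonneg) (simp add: power_fun_def)
  ultimately show "dirichlet_energy p N u < \<infinity>" "enn2real (dirichlet_energy p N u) \<le> (LINT x|m. power_fun g x)"
    by (auto intro: le_less_trans enn2real_leI)
qed

lemma energy_approx:
  assumes u: "sobolev_pair u g" and "0 < \<epsilon>"
  obtains g' where "sobolev_pair u g'" "(LINT x|m. power_fun g' x) \<le> enn2real (dirichlet_energy p N u) + \<epsilon>"
proof -
  have g: "g \<in> Lp p N" "upper_gradient N u g" using u by (auto simp: sobolev_pair_def)
  obtain g' where g': "upper_gradient N u g'" "g' \<in> Lp p N"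
    and le: "(\<integral>\<^sup>+x. ennreal_powr (g' x) p \<partial>N) \<le> dirichlet_energy p N u + ennreal \<epsilon>"
    by (rule dirichlet_energy_approx[OF p1 sets_N upper_gradient_imp_weak[OF g(2) p1 sets_N] g(1) \<open>0 < \<epsilon>\<close>])
  have u': "sobolev_pair u g'" using u g' by (auto simp: sobolev_pair_def)
  have E: "dirichlet_energy p N u = ennreal (enn2real (dirichlet_energy p N u))"
    using energy_finite(1)[OF u] by simp
  have "ennreal (LINT x|m. power_fun g' x) \<le> ennreal (enn2real (dirichlet_energy p N u)) + ennreal \<epsilon>"
    using le sobolev_pairD(5)[OF u'] E by simp
  also have "\<dots> = ennreal (enn2real (dirichlet_energy p N u) + \<epsilon>)" using \<open>0 < \<epsilon>\<close> by simp
  finally have "(LINT x|m. power_fun g' x) \<le> enn2real (dirichlet_energy p N u) + \<epsilon>"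
    using \<open>0 < \<epsilon>\<close> by (subst (asm) ennreal_le_iff) auto
  then show ?thesis using that u' by blast
qed

lemma power_fun_eq: "power_fun g x = enn2real (g x) powr p"
  using p1 by (cases "g x") (auto simp: power_fun_def ennreal_powr_ennreal)

lemma AE_gradient_finite:
  assumes "sobolev_pair u g"
  shows "AE x in m. g x < \<infinity>"
proof -
  have "AE x in m. ennreal (power_fun g x) = ennreal_powr (g x) p" by (rule sobolev_pairD(4)[OF assms])
  then show ?thesis
  proof eventually_elim
    case (elim x)
    then have "ennreal_powr (g x) p < top" by (metis ennreal_less_top)
    then show ?case by simp
  qed
qed

text \<open>The rate \<open>2 powr (- (p * n))\<close> for the gradients is set to beat the weights
  of \<open>ennreal_powr_suminf_le\<close>. In the energy bound \<open>t\<close> stays free, so that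
  \<open>k\<close> can go to infinity first and \<open>t\<close> to 0 afterwards.\<close>

lemma limit_sobolev_pair:
  fixes v :: "nat \<Rightarrow> 'a \<Rightarrow> ereal" and g :: "nat \<Rightarrow> 'a \<Rightarrow> ennreal"
  assumes v: "\<And>n. sobolev_pair (v n) (g n)"
    and L1: "\<And>n. (LINT x|m. \<bar>real_fun (v (Suc n)) x - real_fun (v n) x\<bar>) \<le> (1/2) ^ n"
    and Li: "\<And>n. integrable m (\<lambda>x. \<bar>enn2real (g (Suc n) x) - enn2real (g n x)\<bar> powr p)"
    and Lg: "\<And>n. (LINT x|m. \<bar>enn2real (g (Suc n) x) - enn2real (g n x)\<bar> powr p) \<le> 2 powr (- (p * n))"
  obtains u g' where "sobolev_pair u g'" "(\<lambda>n. LINT x|m. \<bar>real_fun (v n) x - real_fun u x\<bar>) \<longlonglongrightarrow> 0"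
    "\<And>k t. 0 < t \<Longrightarrow> t < 1 \<Longrightarrow> enn2real (dirichlet_energy p N u) \<le>
      (1 - t) powr (1 - p) * (LINT x|m. power_fun (g k) x) + t powr (1 - p) * (2 powr p * 2 powr (- (p * k)))"
proof -
  define w where "w n = real_fun (v n)" for n
  \<comment> \<open>Defined at every point and not modulo null sets, since upper gradients concern
    the values at all points of a curve.\<close>
  define u where "u x = limsup (\<lambda>n. v n x)" for x
  have wi: "integrable m (w n)" for n using sobolev_pairD(2)[OF v] by (simp add: w_def)
  have [measurable]: "w n \<in> borel_measurable m" for n using wi by auto
  have gL: "g n \<in> Lp p N" and gU: "upper_gradient N (v n) (g n)" and vm[measurable]: "v n \<in> borel_measurable m" for n
    using v[of n] by (auto simp: sobolev_pair_def)
  have gm[measurable]: "g n \<in> borel_measurable N" for n by (rule Lp_measurable[OF gL])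
  have tail: "(\<integral>\<^sup>+x. (\<Sum>j. ennreal \<bar>w (Suc (j + n)) x - w (j + n) x\<bar>) \<partial>m) \<le> ennreal (2 * (1/2) ^ n)" for n
  proof -
    have "(\<integral>\<^sup>+x. (\<Sum>j. ennreal \<bar>w (Suc (j + n)) x - w (j + n) x\<bar>) \<partial>m) = (\<Sum>j. \<integral>\<^sup>+x. ennreal \<bar>w (Suc (j + n)) x - w (j + n) x\<bar> \<partial>m)"
      by (rule nn_integral_suminf) measurable
    also have "\<dots> \<le> (\<Sum>j. ennreal ((1/2) ^ n * (1/2) ^ j))"
    proof (rule suminf_le)
      fix j
      have i: "integrable m (\<lambda>x. \<bar>w (Suc (j + n)) x - w (j + n) x\<bar>)" using wi by simp
      have "(\<integral>\<^sup>+x. ennreal \<bar>w (Suc (j + n)) x - w (j + n) x\<bar> \<partial>m) = ennreal (LINT x|m. \<bar>w (Suc (j + n)) x - w (j + n) x\<bar>)"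
        by (rule nn_integral_eq_integral[OF i]) auto
      also have "\<dots> \<le> ennreal ((1/2) ^ n * (1/2) ^ j)"
        using L1[of "j + n"] by (intro ennreal_leI) (simp add: w_def power_add mult.commute)
      finally show "(\<integral>\<^sup>+x. ennreal \<bar>w (Suc (j + n)) x - w (j + n) x\<bar> \<partial>m) \<le> ennreal ((1/2) ^ n * (1/2) ^ j)" .
    qed auto
    also have "\<dots> = ennreal (\<Sum>j. (1/2) ^ n * (1/2) ^ j)"
      by (intro suminf_ennreal2 summable_mult summable_geometric) auto
    also have "(\<Sum>j. (1/2::real) ^ n * (1/2) ^ j) = (1/2) ^ n * (1 / (1 - 1/2))"
      by (subst suminf_mult) (auto simp: suminf_geometric summable_geometric)
    finally show ?thesis by (simp add: mult.commute)
  qed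
  define good where "good x \<longleftrightarrow> (\<forall>n. \<bar>v n x\<bar> \<noteq> \<infinity>) \<and> (\<Sum>j. ennreal \<bar>w (Suc j) x - w j x\<bar>) \<noteq> top" for x
  have "AE x in m. (\<Sum>j. ennreal \<bar>w (Suc j) x - w j x\<bar>) \<noteq> \<infinity>"
  proof (rule nn_integral_PInf_AE)
    show "(\<integral>\<^sup>+x. (\<Sum>j. ennreal \<bar>w (Suc j) x - w j x\<bar>) \<partial>m) \<noteq> \<infinity>"
      using le_less_trans[OF tail[of 0] ennreal_less_top] by simp
  qed measurable
  moreover have "AE x in m. \<forall>n. \<bar>v n x\<bar> \<noteq> \<infinity>"
    unfolding AE_all_countable using sobolev_pairD(1)[OF v] by blast
  ultimately have good: "AE x in m. good x" by eventually_elim (simp add: good_def)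
  have lim: "(\<lambda>n. v n x) \<longlonglongrightarrow> ereal (lim (\<lambda>n. w n x))" "u x = ereal (lim (\<lambda>n. w n x))"
    "ennreal \<bar>w n x - real_fun u x\<bar> \<le> (\<Sum>j. ennreal \<bar>w (Suc (j + n)) x - w (j + n) x\<bar>)" if x: "good x" for x n
  proof -
    have s: "summable (\<lambda>j. \<bar>w (Suc j) x - w j x\<bar>)"
      using x by (intro summable_suminf_not_top) (auto simp: good_def)
    have sn: "summable (\<lambda>j. \<bar>w (Suc (j + n)) x - w (j + n) x\<bar>)"
      using summable_ignore_initial_segment[OF s, of n] by simp
    note t = summable_telescope_limit[of "\<lambda>n. w n x" 1, OF _ s]
    have cw: "(\<lambda>n. w n x) \<longlonglongrightarrow> lim (\<lambda>n. w n x)" using t(1) by (simp add: convergent_LIMSEQ_iff)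
    have veq: "v n x = ereal (w n x)" for n using x by (auto simp: good_def w_def real_fun_def ereal_real)
    then show v: "(\<lambda>n. v n x) \<longlonglongrightarrow> ereal (lim (\<lambda>n. w n x))" using cw by simp
    show ux: "u x = ereal (lim (\<lambda>n. w n x))" unfolding u_def by (rule lim_imp_Limsup[OF _ v]) simp
    have "\<bar>w n x - real_fun u x\<bar> \<le> (\<Sum>j. \<bar>w (Suc (j + n)) x - w (j + n) x\<bar>)"
      using t(2)[of n] ux by (simp add: real_fun_def abs_minus_commute)
    then have "ennreal \<bar>w n x - real_fun u x\<bar> \<le> ennreal (\<Sum>j. \<bar>w (Suc (j + n)) x - w (j + n) x\<bar>)" by (rule ennreal_leI)
    also have "\<dots> = (\<Sum>j. ennreal \<bar>w (Suc (j + n)) x - w (j + n) x\<bar>)"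
      by (rule suminf_ennreal2[OF _ sn, symmetric]) simp
    finally show "ennreal \<bar>w n x - real_fun u x\<bar> \<le> (\<Sum>j. ennreal \<bar>w (Suc (j + n)) x - w (j + n) x\<bar>)" .
  qed
  have um[measurable]: "u \<in> borel_measurable m" unfolding u_def[abs_def] by measurable
  have rum[measurable]: "real_fun u \<in> borel_measurable m" unfolding real_fun_def[abs_def] by measurable
  have nn: "(\<integral>\<^sup>+x. ennreal \<bar>w n x - real_fun u x\<bar> \<partial>m) \<le> ennreal (2 * (1/2) ^ n)" for n
    by (rule order_trans[OF nn_integral_mono_AE tail[of n]]) (use good lim(3) in \<open>auto elim!: eventually_mono\<close>)
  have di: "integrable m (\<lambda>x. w n x - real_fun u x)" for n
  proof (rule integrableI_bounded)
    show "(\<integral>\<^sup>+x. ennreal (norm (w n x - real_fun u x)) \<partial>m) < \<infinity>"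
      using le_less_trans[OF nn[of n] ennreal_less_top] by simp
  qed measurable
  have ui: "integrable m (real_fun u)"
    using Bochner_Integration.integrable_diff[OF wi[of 0] di[of 0]] by simp
  have L1lim: "(LINT x|m. \<bar>w n x - real_fun u x\<bar>) \<le> 2 * (1/2) ^ n" for n
  proof -
    have "ennreal (LINT x|m. \<bar>w n x - real_fun u x\<bar>) = (\<integral>\<^sup>+x. ennreal \<bar>w n x - real_fun u x\<bar> \<partial>m)"
      using di[of n] by (intro nn_integral_eq_integral[symmetric]) auto
    then have "ennreal (LINT x|m. \<bar>w n x - real_fun u x\<bar>) \<le> ennreal (2 * (1/2) ^ n)" using nn[of n] by (simp only:)
    then show ?thesis by (subst (asm) ennreal_le_iff) auto
  qed
  have conv: "(\<lambda>n. LINT x|m. \<bar>real_fun (v n) x - real_fun u x\<bar>) \<longlonglongrightarrow> 0"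
  proof (rule tendsto_sandwich[OF _ _ tendsto_const])
    have "(\<lambda>n. 2 * (1/2::real) ^ n) \<longlonglongrightarrow> 2 * 0" by (intro tendsto_intros) auto
    then show "(\<lambda>n. 2 * (1/2::real) ^ n) \<longlonglongrightarrow> 0" by simp
  qed (use L1lim in \<open>auto simp: w_def intro!: always_eventually\<close>)
  \<comment> \<open>Truncated subtraction: the sum \<open>G k\<close> of \<open>g k\<close> and of the later increments dominates every \<open>g n\<close>
    with \<open>n \<ge> k\<close>.\<close>
  define d where "d n x = g (Suc n) x - g n x" for n x
  have [measurable]: "d n \<in> borel_measurable N" for n unfolding d_def[abs_def] by measurable
  have dp: "(\<integral>\<^sup>+x. ennreal_powr (d n x) p \<partial>N) \<le> ennreal (2 powr (- (p * n)))" for n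
  proof -
    have ae: "AE x in m. ennreal_powr (d n x) p \<le> ennreal (\<bar>enn2real (g (Suc n) x) - enn2real (g n x)\<bar> powr p)"
      using AE_gradient_finite[OF v, of n] AE_gradient_finite[OF v, of "Suc n"]
    proof eventually_elim
      case (elim x)
      then obtain r s where rs: "g (Suc n) x = ennreal r" "g n x = ennreal s" "0 \<le> r" "0 \<le> s"
        by (metis ennreal_cases infinity_ennreal_def less_irrefl)
      have "d n x = ennreal (r - s)" using rs by (simp add: d_def ennreal_minus)
      also have "\<dots> \<le> ennreal \<bar>r - s\<bar>" by (intro ennreal_leI) simp
      finally have "ennreal_powr (d n x) p \<le> ennreal_powr (ennreal \<bar>r - s\<bar>) p" using p1 by (intro ennreal_powr_mono) auto
      then show ?case using rs by (simp add: ennreal_powr_ennreal)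
    qed
    have "(\<integral>\<^sup>+x. ennreal_powr (d n x) p \<partial>N) = (\<integral>\<^sup>+x. ennreal_powr (d n x) p \<partial>m)" by (simp only: nn_integral_completion)
    also have "\<dots> \<le> (\<integral>\<^sup>+x. ennreal (\<bar>enn2real (g (Suc n) x) - enn2real (g n x)\<bar> powr p) \<partial>m)"
      by (rule nn_integral_mono_AE[OF ae])
    also have "\<dots> = ennreal (LINT x|m. \<bar>enn2real (g (Suc n) x) - enn2real (g n x)\<bar> powr p)"
      by (rule nn_integral_eq_integral[OF Li]) auto
    also have "\<dots> \<le> ennreal (2 powr (- (p * n)))" by (rule ennreal_leI[OF Lg])
    finally show ?thesis .
  qed
  define D where "D k x = (\<Sum>i. d (k + i) x)" for k x
  have [measurable]: "D k \<in> borel_measurable N" for k unfolding D_def[abs_def] by measurable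
  \<comment> \<open>The exponents of weight and rate add up to \<open>(p - 1) - p * k - i\<close>:
    the series is geometric in \<open>i\<close> with sum 2, which turns
    \<open>2 powr (p - 1)\<close> into \<open>2 powr p\<close>.\<close>
  have Dp: "(\<integral>\<^sup>+x. ennreal_powr (D k x) p \<partial>N) \<le> ennreal (2 powr p * 2 powr (- (p * k)))" for k
  proof -
    have "(\<integral>\<^sup>+x. ennreal_powr (D k x) p \<partial>N) \<le>
      (\<Sum>i. ennreal (2 powr ((p - 1) * real (Suc i))) * (\<integral>\<^sup>+x. ennreal_powr (d (k + i) x) p \<partial>N))"
      unfolding D_def using p1 by (intro nn_integral_ennreal_powr_suminf_le) auto
    also have "\<dots> \<le> (\<Sum>i. ennreal (2 powr (p - 1) * 2 powr (- (p * k)) * (1/2) ^ i))"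
    proof (rule suminf_le)
      fix i
      have "ennreal (2 powr ((p - 1) * real (Suc i))) * (\<integral>\<^sup>+x. ennreal_powr (d (k + i) x) p \<partial>N) \<le>
        ennreal (2 powr ((p - 1) * real (Suc i))) * ennreal (2 powr (- (p * real (k + i))))"
        by (intro mult_left_mono dp) auto
      also have "\<dots> = ennreal (2 powr ((p - 1) * real (Suc i) + (- (p * real (k + i)))))"
        by (simp only: powr_add ennreal_mult powr_ge_zero)
      also have "(p - 1) * real (Suc i) + (- (p * real (k + i))) = (p - 1) + (- (p * k)) + (- real i)"
        by (simp add: algebra_simps)
      also have "(2::real) powr \<dots> = 2 powr (p - 1) * 2 powr (- (p * k)) * (1/2) ^ i"
      proof -
        have "(2::real) powr (- real i) = (1/2) ^ i" by (simp add: powr_minus_divide powr_realpow power_divide)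
        then show ?thesis by (simp only: powr_add)
      qed
      finally show "ennreal (2 powr ((p - 1) * real (Suc i))) * (\<integral>\<^sup>+x. ennreal_powr (d (k + i) x) p \<partial>N) \<le>
        ennreal (2 powr (p - 1) * 2 powr (- (p * k)) * (1/2) ^ i)" .
    qed auto
    also have "\<dots> = ennreal (\<Sum>i. 2 powr (p - 1) * 2 powr (- (p * k)) * (1/2) ^ i)"
      by (intro suminf_ennreal2 summable_mult summable_geometric) auto
    also have "(\<Sum>i. 2 powr (p - 1) * 2 powr (- (p * k)) * (1/2::real) ^ i) = 2 powr (p - 1) * 2 powr (- (p * k)) * (1 / (1 - 1/2))"
      by (subst suminf_mult) (auto simp: suminf_geometric summable_geometric)
    also have "\<dots> = 2 powr p * 2 powr (- (p * k))" by (simp add: powr_diff)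
    finally show ?thesis .
  qed
  have DL: "D k \<in> Lp p N" for k using le_less_trans[OF Dp[of k] ennreal_less_top] by (simp add: Lp_def)
  define G where "G k x = g k x + D k x" for k x
  have GL: "G k \<in> Lp p N" for k unfolding G_def[abs_def] using p1 by (intro Lp_add gL DL) auto
  have gG: "g n x \<le> G k x" if "n \<ge> k" for n k x
  proof -
    have "g (k + i) x \<le> g k x + (\<Sum>j<i. d (k + j) x)" for i
    proof (induction i)
      case (Suc i)
      have "g (k + Suc i) x \<le> g (k + i) x + d (k + i) x"
        unfolding d_def by (metis add_Suc_right ennreal_minus_le_iff order_refl)
      also have "\<dots> \<le> (g k x + (\<Sum>j<i. d (k + j) x)) + d (k + i) x" by (intro add_right_mono Suc)
      finally show ?case by (simp add: add.assoc)
    qed simp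
    from this[of "n - k"] that have "g n x \<le> g k x + (\<Sum>j<n - k. d (k + j) x)" by simp
    also have "\<dots> \<le> G k x" unfolding G_def D_def by (intro add_left_mono sum_le_suminf) auto
    finally show ?thesis .
  qed
  \<comment> \<open>From the completion back to \<open>N\<close>: the exceptional set has to be
    enclosed in a measurable null set of \<open>N\<close>, since its indicator is integrated along
    curves.\<close>
  have "AE x in N. good x" using good by (simp add: AE_completion_iff)
  then obtain Z where Z: "Z \<in> null_sets N" "{x\<in>space N. \<not> good x} \<subseteq> Z"
    unfolding eventually_ae_filter by blast
  have weak: "weak_upper_gradient p N u (G k)" for k
    unfolding u_def[abs_def]
  proof (rule weak_upper_gradient_limsup[OF p1 sets_N gU GL[of 0] gG _ _ GL gG])
    show "Z \<in> null_sets N" by (rule Z)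
    fix x assume "x \<in> space N - Z"
    then have "good x" using Z(2) by blast
    then show "\<exists>r. (\<lambda>n. v n x) \<longlonglongrightarrow> ereal r" using lim(1) by blast
  qed auto
  obtain g' where g': "upper_gradient N u g'" "g' \<in> Lp p N"
    by (rule weak_imp_upper_gradient[OF p1 sets_N weak[of 0] GL[of 0] zero_less_one])
  have "(\<integral>\<^sup>+x. e2ennreal \<bar>u x\<bar> \<partial>m) = (\<integral>\<^sup>+x. ennreal (norm (real_fun u x)) \<partial>m)"
    by (rule nn_integral_cong_AE) (use good lim(2) in \<open>auto elim!: eventually_mono simp: real_fun_def e2ennreal_ereal\<close>)
  also have "\<dots> < \<infinity>" using ui by (simp add: integrable_iff_bounded)
  finally have u: "sobolev_pair u g'" using g' um by (simp add: sobolev_pair_def)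
  have energy: "enn2real (dirichlet_energy p N u) \<le>
      (1 - t) powr (1 - p) * (LINT x|m. power_fun (g k) x) + t powr (1 - p) * (2 powr p * 2 powr (- (p * k)))"
    if t: "0 < t" "t < 1" for k t
  proof -
    have "dirichlet_energy p N u \<le> (\<integral>\<^sup>+x. ennreal_powr (g k x + D k x) p \<partial>N)"
      using dirichlet_energy_le[OF p1 sets_N weak GL, of k] by (simp add: G_def)
    also have "\<dots> \<le> ennreal ((1 - t) powr (1 - p)) * (\<integral>\<^sup>+x. ennreal_powr (g k x) p \<partial>N) +
        ennreal (t powr (1 - p)) * (\<integral>\<^sup>+x. ennreal_powr (D k x) p \<partial>N)"
      using p1 t by (intro nn_integral_ennreal_powr_add_le) auto
    also have "\<dots> \<le> ennreal ((1 - t) powr (1 - p)) * ennreal (LINT x|m. power_fun (g k) x) +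
        ennreal (t powr (1 - p)) * ennreal (2 powr p * 2 powr (- (p * k)))"
      unfolding sobolev_pairD(5)[OF v] by (intro add_left_mono mult_left_mono Dp) auto
    also have "\<dots> = ennreal ((1 - t) powr (1 - p) * (LINT x|m. power_fun (g k) x) + t powr (1 - p) * (2 powr p * 2 powr (- (p * k))))"
      by (rule ennreal_mult_add_mult) (auto intro!: Bochner_Integration.integral_nonneg simp: power_fun_def)
    finally show ?thesis
      by (intro enn2real_leI) (auto intro!: add_nonneg_nonneg mult_nonneg_nonneg Bochner_Integration.integral_nonneg simp: power_fun_def)
  qed
  show ?thesis by (rule that[OF u conv energy])
qed

end

section \<open>The minimizing sequence\<close>

context neumann_problem
begin

theorem minimizer_exists:
  "\<exists>u\<in>newtonian_mean_zero p N. neumann_functional p M \<Omega> f u =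
    (INF v\<in>newtonian_mean_zero p N. neumann_functional p M \<Omega> f v)"
proof (rule boundary_term)
  let ?V = "newtonian_mean_zero p N"
  let ?I = "neumann_functional p M \<Omega> f"
  fix L :: "('a \<Rightarrow> real) \<Rightarrow> real" and c :: real
  assume L: "\<And>u g. sobolev_pair u g \<Longrightarrow> ?I u = enn2ereal (dirichlet_energy p N u) + ereal (L (real_fun u))"
    and Lp: "\<And>u g. sobolev_pair u g \<Longrightarrow> (\<integral>\<^sup>+x. ennreal_powr (ennreal \<bar>real_fun u x\<bar>) p \<partial>m) < \<infinity>"
    and coer: "\<And>u g. sobolev_pair u g \<Longrightarrow> (LINT x|m. real_fun u x) = 0 \<Longrightarrow> \<bar>L (real_fun u)\<bar> \<le> (LINT x|m. power_fun g x) / 2 + c"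
    and coer1: "\<And>u g. sobolev_pair u g \<Longrightarrow> (LINT x|m. real_fun u x) = 0 \<Longrightarrow> (LINT x|m. \<bar>real_fun u x\<bar>) \<le> c * (1 + (LINT x|m. power_fun g x))"
    and lin: "\<And>u g v h a b. sobolev_pair u g \<Longrightarrow> sobolev_pair v h \<Longrightarrow> a \<noteq> 0 \<Longrightarrow> b \<noteq> 0 \<Longrightarrow>
      L (\<lambda>x. a * real_fun u x + b * real_fun v x) = a * L (real_fun u) + b * L (real_fun v)"
    and cts: "\<And>u g v h b. (\<And>n::nat. sobolev_pair (u n) (g n)) \<Longrightarrow> sobolev_pair v h \<Longrightarrow> (\<And>n. (LINT x|m. power_fun (g n) x) \<le> b) \<Longrightarrow>
      (\<lambda>n. LINT x|m. \<bar>real_fun (u n) x - real_fun v x\<bar>) \<longlonglongrightarrow> 0 \<Longrightarrow> (\<lambda>n. L (real_fun (u n))) \<longlonglongrightarrow> L (real_fun v)"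
    and cpt: "\<And>u g b. (\<And>n::nat. sobolev_pair (u n) (g n)) \<Longrightarrow> (\<And>n. (LINT x|m. power_fun (g n) x) \<le> b) \<Longrightarrow>
      (\<And>n. (LINT x|m. \<bar>real_fun (u n) x\<bar>) \<le> b) \<Longrightarrow>
      \<exists>\<sigma>::nat\<Rightarrow>nat. strict_mono \<sigma> \<and> (\<forall>e>0. \<exists>k. \<forall>i\<ge>k. \<forall>j\<ge>k. (LINT x|m. \<bar>real_fun (u (\<sigma> i)) x - real_fun (u (\<sigma> j)) x\<bar>) < e)"
    and fin: "finite_measure m"
  interpret finite_measure m by (rule fin)
  have V_pair: "\<exists>g. sobolev_pair v g" and V_zero: "(LINT x|m. real_fun v x) = 0" if "v \<in> ?V" for v
    using that newtonian_sobolev_pair[OF fin, of v] by (auto simp: newtonian_mean_zero_def real_fun_def)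
  have VI: "u \<in> ?V" if "sobolev_pair u g" "(LINT x|m. real_fun u x) = 0" for u g
    using that sobolev_pair_newtonian[OF that(1) Lp[OF that(1)]] by (auto simp: newtonian_mean_zero_def real_fun_def)
  define E where "E u = enn2real (dirichlet_energy p N u)" for u
  have I_real: "?I u = ereal (E u + L (real_fun u))" if "sobolev_pair u g" for u g
  proof -
    have "dirichlet_energy p N u = ennreal (E u)" using energy_finite(1)[OF that] by (simp add: E_def)
    moreover have "0 \<le> E u" by (simp add: E_def)
    ultimately have "enn2ereal (dirichlet_energy p N u) = ereal (E u)" by (simp only: enn2ereal_ennreal)
    then show ?thesis using L[OF that] by (simp only: plus_ereal.simps)
  qed
  have pw0: "0 \<le> (LINT x|m. power_fun g x)" for g by (intro Bochner_Integration.integral_nonneg) (simp add: power_fun_def)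
  have zero: "sobolev_pair (\<lambda>_. 0) (\<lambda>_. 0)"
  proof -
    have "e2ennreal 0 = 0" using e2ennreal_ereal[of 0] by (simp add: zero_ereal_def)
    then show ?thesis by (auto simp: sobolev_pair_def upper_gradient_def endpoint_diff_def Lp_def)
  qed
  have zeroV: "(\<lambda>_. 0) \<in> ?V" by (rule VI[OF zero]) (simp add: real_fun_def)
  \<comment> \<open>Half of the energy survives the boundary term; the summand 1 absorbs the slack
    of an upper gradient that only nearly attains the energy.\<close>
  have low: "E v / 2 - (c + 1) \<le> E v + L (real_fun v)" if v: "v \<in> ?V" for v
  proof -
    obtain g where g: "sobolev_pair v g" using V_pair[OF v] by auto
    obtain g' where g': "sobolev_pair v g'" "(LINT x|m. power_fun g' x) \<le> E v + 1"
      using energy_approx[OF g, of 1] by (auto simp: E_def)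
    have "\<bar>L (real_fun v)\<bar> \<le> (LINT x|m. power_fun g' x) / 2 + c" by (rule coer[OF g'(1) V_zero[OF v]])
    then show ?thesis using g'(2) by linarith
  qed
  have E0: "0 \<le> E v" for v by (simp add: E_def)
  define J where "J = (INF v\<in>?V. ?I v)"
  have "ereal (- (c + 1)) \<le> J"
    unfolding J_def
  proof (rule INF_greatest)
    fix v assume v: "v \<in> ?V"
    obtain g where g: "sobolev_pair v g" using V_pair[OF v] by auto
    show "ereal (- (c + 1)) \<le> ?I v" using low[OF v] E0[of v] by (simp add: I_real[OF g])
  qed
  moreover have "J \<le> ?I (\<lambda>_. 0)" unfolding J_def by (rule INF_lower[OF zeroV])
  ultimately obtain j where j: "J = ereal j" using I_real[OF zero] by (cases J) auto
  have jle: "j \<le> E v + L (real_fun v)" if v: "v \<in> ?V" "sobolev_pair v g" for v g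
    using INF_lower[OF v(1), of ?I] j I_real[OF v(2)] by (simp add: J_def)
  \<comment> \<open>Two errors \<open>1 / Suc n\<close> are added up: one from the infimum, one from
    replacing the minimal gradient by an upper gradient.\<close>
  have "\<exists>v g. v \<in> ?V \<and> sobolev_pair v g \<and> (LINT x|m. power_fun g x) + L (real_fun v) \<le> j + 2 / Suc n" for n
  proof -
    have "J < ereal (j + 1 / Suc n)" using j by simp
    then obtain v where v: "v \<in> ?V" "?I v < ereal (j + 1 / Suc n)" unfolding J_def INF_less_iff by blast
    obtain g where g: "sobolev_pair v g" using V_pair[OF v(1)] by auto
    obtain g' where g': "sobolev_pair v g'" "(LINT x|m. power_fun g' x) \<le> E v + 1 / Suc n"
      using energy_approx[OF g, of "1 / Suc n"] by (auto simp: E_def)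
    have "E v + L (real_fun v) < j + 1 / Suc n" using v(2) I_real[OF g] by simp
    moreover have "2 / real (Suc n) = 1 / Suc n + 1 / Suc n" by (simp add: field_simps)
    ultimately have "(LINT x|m. power_fun g' x) + L (real_fun v) \<le> j + 2 / Suc n" using g'(2) by linarith
    then show ?thesis using v(1) g'(1) by blast
  qed
  then obtain v0 g0 where v0: "\<And>n. v0 n \<in> ?V" "\<And>n. sobolev_pair (v0 n) (g0 n)"
    "\<And>n. (LINT x|m. power_fun (g0 n) x) + L (real_fun (v0 n)) \<le> j + 2 / Suc n" by metis
  \<comment> \<open>For the energy \<open>I\<close> and the boundary term \<open>l\<close> of an
    almost minimizer, \<open>I + l \<le> j + 2\<close> and
    \<open>\<bar>l\<bar> \<le> I / 2 + c\<close> give \<open>I / 2 \<le> j + 2 + c\<close>.\<close>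
  define b where "b = 2 * (j + 2 + c)"
  have gb: "(LINT x|m. power_fun (g0 n) x) \<le> b" for n
  proof -
    have le: "2 / real (Suc n) \<le> 2" by (simp add: divide_le_eq)
    have arith: "I \<le> 2 * (j + 2 + c)" if "\<bar>l\<bar> \<le> I / 2 + c" "I + l \<le> j + q" "q \<le> 2" for I l q :: real
    proof -
      have "- l \<le> I / 2 + c" using that(1) abs_ge_minus_self[of l] by (rule order_trans[rotated])
      then have "I / 2 \<le> j + 2 + c" using that(2,3) by argo
      then show ?thesis by simp
    qed
    show ?thesis unfolding b_def by (rule arith[OF coer[OF v0(2) V_zero[OF v0(1)]] v0(3) le])
  qed
  define b' where "b' = max b (\<bar>c\<bar> * (1 + b))"
  have b'1: "(LINT x|m. power_fun (g0 n) x) \<le> b'" for n using gb[of n] by (simp add: b'_def)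
  have b'2: "(LINT x|m. \<bar>real_fun (v0 n) x\<bar>) \<le> b'" for n
  proof -
    have "(LINT x|m. \<bar>real_fun (v0 n) x\<bar>) \<le> c * (1 + (LINT x|m. power_fun (g0 n) x))" by (rule coer1[OF v0(2) V_zero[OF v0(1)]])
    also have "\<dots> \<le> \<bar>c\<bar> * (1 + (LINT x|m. power_fun (g0 n) x))" using pw0[of "g0 n"] by (intro mult_right_mono) auto
    also have "\<dots> \<le> \<bar>c\<bar> * (1 + b)" using gb[of n] by (intro mult_left_mono) auto
    finally show ?thesis by (simp add: b'_def)
  qed
  obtain \<sigma> :: "nat \<Rightarrow> nat" where \<sigma>: "strict_mono \<sigma>"
    "\<And>e. 0 < e \<Longrightarrow> \<exists>k. \<forall>i\<ge>k. \<forall>j\<ge>k. (LINT x|m. \<bar>real_fun (v0 (\<sigma> i)) x - real_fun (v0 (\<sigma> j)) x\<bar>) < e"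
    using cpt[of v0 g0 b', OF v0(2) b'1 b'2] by blast
  define v1 g1 where "v1 n = v0 (\<sigma> n)" and "g1 n = g0 (\<sigma> n)" for n
  have v1: "v1 n \<in> ?V" "sobolev_pair (v1 n) (g1 n)" "(LINT x|m. power_fun (g1 n) x) + L (real_fun (v1 n)) \<le> j + 2 / Suc n"
    "(LINT x|m. power_fun (g1 n) x) \<le> b" for n
  proof -
    have "2 / real (Suc (\<sigma> n)) \<le> 2 / real (Suc n)" using seq_suble[OF \<sigma>(1), of n] by (intro divide_left_mono) auto
    then show "(LINT x|m. power_fun (g1 n) x) + L (real_fun (v1 n)) \<le> j + 2 / Suc n"
      using v0(3)[of "\<sigma> n"] by (simp add: v1_def g1_def)
  qed (auto simp: v1_def g1_def v0 gb)
  define a where "a n x = enn2real (g1 n x)" for n x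
  have apw: "power_fun (g1 n) x = a n x powr p" for n x by (simp add: a_def power_fun_eq)
  have ai: "integrable m (\<lambda>x. a n x powr p)" for n
    using sobolev_pairD(3)[OF v1(2), of n] by (simp add: apw[abs_def])
  have am: "a n \<in> borel_measurable m" for n
  proof -
    have "g1 n \<in> borel_measurable N" using v1(2)[of n] by (auto simp: sobolev_pair_def Lp_def)
    from measurable_completion[OF this] show ?thesis unfolding a_def[abs_def] by measurable
  qed
  have b0: "0 \<le> b" using gb[of 0] pw0[of "g0 0"] by linarith
  \<comment> \<open>The average of two almost minimizers is admissible, so their gradients are nearly extremal in the
    midpoint inequality for \<open>t \<mapsto> t powr p\<close>.\<close>
  have mid: "integrable m (\<lambda>x. ((a i x + a k x) / 2) powr p)"
    "(LINT x|m. (a i x powr p + a k x powr p) / 2 - ((a i x + a k x) / 2) powr p) \<le> 2 / Suc n"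
    if ik: "i \<ge> n" "k \<ge> n" for n i k
  proof -
    let ?w = "\<lambda>x. ereal (1 / 2 * real_fun (v1 i) x + 1 / 2 * real_fun (v1 k) x)"
    let ?g = "\<lambda>x. ennreal \<bar>1 / 2\<bar> * g1 i x + ennreal \<bar>1 / 2\<bar> * g1 k x"
    have w: "sobolev_pair ?w ?g" by (rule sobolev_pair_comb[OF v1(2) v1(2)]) auto
    have w0: "(LINT x|m. real_fun ?w x) = 0"
      using V_zero[OF v1(1)] sobolev_pairD(2)[OF v1(2)] by simp
    have "AE x in m. g1 i x < \<infinity> \<and> g1 k x < \<infinity>"
      using AE_gradient_finite[OF v1(2), of i] AE_gradient_finite[OF v1(2), of k] by eventually_elim simp
    then have ae: "AE x in m. power_fun ?g x = ((a i x + a k x) / 2) powr p"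
    proof eventually_elim
      case (elim x)
      then obtain r s where rs: "g1 i x = ennreal r" "g1 k x = ennreal s" "0 \<le> r" "0 \<le> s"
        by (metis ennreal_cases infinity_ennreal_def less_irrefl)
      have "ennreal \<bar>1 / 2\<bar> * ennreal r + ennreal \<bar>1 / 2\<bar> * ennreal s = ennreal (\<bar>1 / 2\<bar> * r + \<bar>1 / 2\<bar> * s)"
        using rs by (intro ennreal_mult_add_mult) auto
      also have "\<bar>1 / 2\<bar> * r + \<bar>1 / 2\<bar> * s = (r + s) / 2" by simp
      finally show ?case unfolding power_fun_eq a_def rs using rs(3,4) by (simp only: enn2real_ennreal) simp
    qed
    have mm: "(\<lambda>x. ((a i x + a k x) / 2) powr p) \<in> borel_measurable m" using am by measurable
    have pm: "power_fun ?g \<in> borel_measurable m" using sobolev_pairD(3)[OF w] by simp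
    show ii: "integrable m (\<lambda>x. ((a i x + a k x) / 2) powr p)"
      by (rule integrable_cong_AE_imp[OF sobolev_pairD(3)[OF w] mm]) (use ae in \<open>auto elim!: eventually_mono\<close>)
    have eq: "(LINT x|m. power_fun ?g x) = (LINT x|m. ((a i x + a k x) / 2) powr p)"
      by (rule integral_cong_AE[OF pm mm ae])
    \<comment> \<open>By linearity the boundary term at the midpoint is the mean of the two boundary
      terms. It cancels against them, and minimality of \<open>j\<close> leaves a lower bound for
      the midpoint energy in terms of the two energies.\<close>
    have "j \<le> E ?w + L (real_fun ?w)" by (rule jle[OF VI[OF w w0] w])
    also have "E ?w \<le> (LINT x|m. power_fun ?g x)" unfolding E_def by (rule energy_finite(2)[OF w])
    also have "L (real_fun ?w) = 1 / 2 * L (real_fun (v1 i)) + 1 / 2 * L (real_fun (v1 k))"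
      unfolding real_fun_ereal by (rule lin[OF v1(2) v1(2)]) auto
    finally have lower: "j \<le> (LINT x|m. ((a i x + a k x) / 2) powr p) + (1 / 2 * L (real_fun (v1 i)) + 1 / 2 * L (real_fun (v1 k)))"
      unfolding eq by simp
    have qi: "2 / real (Suc i) \<le> 2 / real (Suc n)" and qk: "2 / real (Suc k) \<le> 2 / real (Suc n)"
      using ik by (auto intro!: divide_left_mono)
    have S: "(LINT x|m. (a i x powr p + a k x powr p) / 2 - ((a i x + a k x) / 2) powr p) =
        ((LINT x|m. a i x powr p) + (LINT x|m. a k x powr p)) / 2 - (LINT x|m. ((a i x + a k x) / 2) powr p)"
      using ai ii by simp
    have arith: "S \<le> q" if "qi \<le> q" "qk \<le> q" "S = (A + B) / 2 - Q" "A + li \<le> j + qi" "B + lk \<le> j + qk"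
      "j \<le> Q + (1 / 2 * li + 1 / 2 * lk)" for S A B Q q qi qk li lk :: real
      using that by argo
    show "(LINT x|m. (a i x powr p + a k x powr p) / 2 - ((a i x + a k x) / 2) powr p) \<le> 2 / Suc n"
      by (rule arith[OF qi qk S v1(3)[of i, unfolded apw] v1(3)[of k, unfolded apw] lower])
  qed
  have ginteg: "integrable m (\<lambda>x. \<bar>a i x - a k x\<bar> powr p)" for i k
  proof (rule Bochner_Integration.integrable_bound)
    show "integrable m (\<lambda>x. a i x powr p + a k x powr p)" using ai by simp
    show "(\<lambda>x. \<bar>a i x - a k x\<bar> powr p) \<in> borel_measurable m" using am by measurable
    have "\<bar>r - s\<bar> powr p \<le> r powr p + s powr p" if "0 \<le> r" "0 \<le> s" for r s :: real
    proof -
      have "\<bar>r - s\<bar> powr p \<le> (max r s) powr p" using that p1 by (intro powr_mono2) auto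
      also have "\<dots> \<le> r powr p + s powr p" by (auto simp: max_def)
      finally show ?thesis .
    qed
    then show "AE x in m. norm (\<bar>a i x - a k x\<bar> powr p) \<le> norm (a i x powr p + a k x powr p)"
      by (simp add: a_def)
  qed
  have gcauchy: "\<exists>n. \<forall>i\<ge>n. \<forall>k\<ge>n. (LINT x|m. \<bar>a i x - a k x\<bar> powr p) < e" if e: "0 < e" for e
  proof -
    \<comment> \<open>\<open>\<epsilon>\<close> depends only on \<open>e\<close> and the energy
      bound \<open>b\<close>; it determines \<open>C\<close>, and \<open>n\<close> then makes the
      convexity defect small even after multiplication by \<open>C\<close>.\<close>
    define \<epsilon> where "\<epsilon> = e / (2 * (2 * b + 1))"
    have \<epsilon>: "0 < \<epsilon>" "\<epsilon> * (2 * b) < e / 2" using e b0 by (auto simp: \<epsilon>_def field_simps)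
    obtain C where C: "0 \<le> C" "\<And>a b. 0 \<le> a \<Longrightarrow> 0 \<le> b \<Longrightarrow>
      \<bar>a - b\<bar> powr p \<le> \<epsilon> * (a powr p + b powr p) + C * ((a powr p + b powr p) / 2 - ((a + b) / 2) powr p)"
      using powr_uniform_convexity[OF p1 \<epsilon>(1)] by blast
    have "(\<lambda>n. C * (2 / real (Suc n))) \<longlonglongrightarrow> C * 0"
      by (intro tendsto_intros LIMSEQ_Suc[OF lim_const_over_n, unfolded o_def])
    then have "\<forall>\<^sub>F n in sequentially. C * (2 / real (Suc n)) < e / 2" using e by (intro order_tendstoD) auto
    then obtain n where n: "C * (2 / real (Suc n)) < e / 2" by (auto simp: eventually_sequentially)
    have "(LINT x|m. \<bar>a i x - a k x\<bar> powr p) < e" if ik: "i \<ge> n" "k \<ge> n" for i k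
    proof -
      have "(LINT x|m. \<bar>a i x - a k x\<bar> powr p) \<le>
        (LINT x|m. \<epsilon> * (a i x powr p + a k x powr p) + C * ((a i x powr p + a k x powr p) / 2 - ((a i x + a k x) / 2) powr p))"
        using ai mid(1)[OF ik] C(2) by (intro integral_mono ginteg) (auto simp: a_def)
      also have "\<dots> = \<epsilon> * ((LINT x|m. a i x powr p) + (LINT x|m. a k x powr p)) +
          C * (LINT x|m. (a i x powr p + a k x powr p) / 2 - ((a i x + a k x) / 2) powr p)"
        using ai mid(1)[OF ik] by simp
      also have "\<dots> \<le> \<epsilon> * (b + b) + C * (2 / real (Suc n))"
        using v1(4)[of i] v1(4)[of k] \<epsilon> C(1) mid(2)[OF ik] unfolding apw
        by (intro add_mono mult_left_mono) auto
      also have "\<dots> < e / 2 + e / 2" by (rule add_strict_mono[OF \<epsilon>(2)[unfolded mult_2] n])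
      finally show ?thesis by simp
    qed
    then show ?thesis by blast
  qed
  \<comment> \<open>Both rates are put into one relation, so that a single subsequence serves
    \<open>limit_sobolev_pair\<close>.\<close>
  define Q where "Q l i k \<longleftrightarrow> (LINT x|m. \<bar>real_fun (v1 k) x - real_fun (v1 i) x\<bar>) \<le> (1/2) ^ l \<and>
      (LINT x|m. \<bar>a k x - a i x\<bar> powr p) \<le> 2 powr (- (p * l))" for l i k :: nat
  have cauchy: "\<exists>n. \<forall>i\<ge>n. \<forall>k\<ge>n. Q l i k" for l
  proof -
    obtain n1 where n1: "\<forall>i\<ge>n1. \<forall>k\<ge>n1. (LINT x|m. \<bar>real_fun (v1 i) x - real_fun (v1 k) x\<bar>) < (1/2) ^ l"
      using \<sigma>(2)[of "(1/2) ^ l"] by (auto simp: v1_def)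
    obtain n2 where n2: "\<forall>i\<ge>n2. \<forall>k\<ge>n2. (LINT x|m. \<bar>a i x - a k x\<bar> powr p) < 2 powr (- (p * l))"
      using gcauchy[of "2 powr (- (p * l))"] by auto
    show ?thesis using n1 n2 unfolding Q_def by (intro exI[of _ "max n1 n2"]) (auto intro: less_imp_le)
  qed
  obtain \<tau> where \<tau>m: "strict_mono \<tau>" and \<tau>Q: "\<And>l. Q l (\<tau> l) (\<tau> (Suc l))"
    by (rule cauchy_subsequence[of Q, OF cauchy]) (rule that; assumption)
  note \<tau> = \<tau>m \<tau>Q[unfolded Q_def, THEN conjunct1] \<tau>Q[unfolded Q_def, THEN conjunct2]
  obtain u g' where u: "sobolev_pair u g'" "(\<lambda>n. LINT x|m. \<bar>real_fun (v1 (\<tau> n)) x - real_fun u x\<bar>) \<longlonglongrightarrow> 0"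
    "\<And>k t. 0 < t \<Longrightarrow> t < 1 \<Longrightarrow> E u \<le>
      (1 - t) powr (1 - p) * (LINT x|m. power_fun (g1 (\<tau> k)) x) + t powr (1 - p) * (2 powr p * 2 powr (- (p * k)))"
    unfolding E_def
    by (rule limit_sobolev_pair[of "\<lambda>n. v1 (\<tau> n)" "\<lambda>n. g1 (\<tau> n)", OF v1(2) \<tau>(2) ginteg[unfolded a_def] \<tau>(3)[unfolded a_def]])
      (rule that[unfolded E_def]; assumption)
  have Llim: "(\<lambda>n. L (real_fun (v1 (\<tau> n)))) \<longlonglongrightarrow> L (real_fun u)"
    by (rule cts[of "\<lambda>n. v1 (\<tau> n)" "\<lambda>n. g1 (\<tau> n)" u g' b, OF v1(2) u(1) v1(4) u(2)])
  have u0: "(LINT x|m. real_fun u x) = 0"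
  proof -
    have "\<bar>LINT x|m. real_fun u x\<bar> \<le> (LINT x|m. \<bar>real_fun (v1 (\<tau> n)) x - real_fun u x\<bar>)" for n
    proof -
      have i: "integrable m (real_fun (v1 (\<tau> n)))" "integrable m (real_fun u)" using sobolev_pairD(2) v1(2) u(1) by blast+
      have "(LINT x|m. real_fun (v1 (\<tau> n)) x - real_fun u x) = - (LINT x|m. real_fun u x)"
        using i V_zero[OF v1(1)] by simp
      then show ?thesis using integral_abs_bound[of m "\<lambda>x. real_fun (v1 (\<tau> n)) x - real_fun u x"] by simp
    qed
    then have "\<bar>LINT x|m. real_fun u x\<bar> \<le> 0" by (intro LIMSEQ_le_const[OF u(2)]) auto
    then show ?thesis by simp
  qed
  \<comment> \<open>With \<open>t\<close> fixed, \<open>k\<close> tends to infinity; this removes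
    the second summand in spite of its factor \<open>t powr (1 - p)\<close>, which blows up as
    \<open>t\<close> tends to 0. Only then \<open>t\<close> goes to 0.\<close>
  have Eu: "E u \<le> (1 - t) powr (1 - p) * (j - L (real_fun u))" if t: "0 < t" "t < 1" for t
  proof -
    have "E u \<le> (1 - t) powr (1 - p) * (j + 2 / real (Suc k) - L (real_fun (v1 (\<tau> k)))) + t powr (1 - p) * (2 powr p * 2 powr (- (p * k)))" for k
    proof -
      have "2 / real (Suc (\<tau> k)) \<le> 2 / real (Suc k)" using seq_suble[OF \<tau>(1), of k] by (intro divide_left_mono) auto
      then have "(LINT x|m. power_fun (g1 (\<tau> k)) x) \<le> j + 2 / real (Suc k) - L (real_fun (v1 (\<tau> k)))"
        using add_left_mono[of _ _ j] order_trans[OF v1(3)[of "\<tau> k"]] by (simp only: le_diff_eq)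
      then show ?thesis using u(3)[OF t, of k] by (meson add_right_mono mult_left_mono order_trans powr_ge_zero)
    qed
    moreover have "(\<lambda>k. (1 - t) powr (1 - p) * (j + 2 / real (Suc k) - L (real_fun (v1 (\<tau> k)))) + t powr (1 - p) * (2 powr p * 2 powr (- (p * k))))
      \<longlonglongrightarrow> (1 - t) powr (1 - p) * (j + 0 - L (real_fun u)) + t powr (1 - p) * (2 powr p * 0)"
    proof (intro tendsto_intros Llim LIMSEQ_Suc[OF lim_const_over_n, unfolded o_def])
      have "(\<lambda>k. (2 powr - p) ^ k) \<longlonglongrightarrow> 0"
        using p1 powr_less_mono[of "-p" 0 2] by (intro LIMSEQ_power_zero) simp
      then show "(\<lambda>k. 2 powr (- (p * real k))) \<longlonglongrightarrow> 0" by (simp add: powr_powr flip: powr_realpow)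
    qed
    ultimately have "E u \<le> (1 - t) powr (1 - p) * (j + 0 - L (real_fun u)) + t powr (1 - p) * (2 powr p * 0)"
      by (intro LIMSEQ_le_const) auto
    then show ?thesis by simp
  qed
  have "((\<lambda>t. (1 - t) powr (1 - p) * (j - L (real_fun u))) \<longlongrightarrow> (1 - 0) powr (1 - p) * (j - L (real_fun u))) (at_right 0)"
    by (intro tendsto_intros) auto
  moreover have "\<forall>\<^sub>F t in at_right 0. E u \<le> (1 - t) powr (1 - p) * (j - L (real_fun u))"
    using eventually_at_right_real[of 0 "1::real"] by (auto elim!: eventually_mono intro: Eu)
  ultimately have "E u \<le> (1 - 0) powr (1 - p) * (j - L (real_fun u))" by (rule tendsto_lowerbound) simp
  then have "E u + L (real_fun u) \<le> j" by simp
  moreover have uV: "u \<in> ?V" by (rule VI[OF u(1) u0])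
  moreover have "j \<le> E u + L (real_fun u)" by (rule jle[OF uV u(1)])
  ultimately have "?I u = J" using I_real[OF u(1)] j by simp
  then show ?thesis using uV unfolding J_def by blast
qed

end

subsection \<open>The minimization problem\<close>

theorem theorem4p3:
  fixes M :: "'a::complete_space measure"
    and \<Omega> :: "'a set"
    and f :: "'a \<Rightarrow> real"
    and p s :: real
  assumes "1 < p"
    and "sets M = sets borel"
    and "doubling_measure M"
    and "1 < s" and "lower_mass_bound s M"
    and "\<exists>l\<ge>1. poincare p l M"
    and "admissible_domain p M \<Omega>"
    and "f \<in> borel_measurable (restrict_space (completion (perimeter_measure M \<Omega>)) (frontier \<Omega>))"
    and "bounded (f ` frontier \<Omega>)"
    and "(LINT x:frontier \<Omega>|completion (perimeter_measure M \<Omega>). f x) = 0"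
  shows "\<exists>u \<in> newtonian_mean_zero p (restrict_space M \<Omega>).
    neumann_functional p M \<Omega> f u =
      (INF v \<in> newtonian_mean_zero p (restrict_space M \<Omega>). neumann_functional p M \<Omega> f v)"
proof (cases "frontier \<Omega> = {}")
  \<comment> \<open>The boundary term is an integral over the empty set, so the zero function
    minimizes the energy. The case is separated because the positive diameter behind the other one
    comes from a boundary point.\<close>
  case True
  let ?N = "restrict_space M \<Omega>"
  have sp: "space M = UNIV" using sets_eq_imp_space_eq[OF assms(2)] by simp
  have N: "sets ?N = sets (restrict_space borel (space ?N))"
    by (simp add: space_restrict_space sp sets_restrict_space assms(2))
  have e0: "e2ennreal 0 = 0" using e2ennreal_ereal[of 0] by (simp add: zero_ereal_def)
  have ug: "upper_gradient ?N (\<lambda>_. 0) (\<lambda>_. 0)" and L: "(\<lambda>_. 0) \<in> Lp p ?N"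
    by (simp_all add: upper_gradient_def endpoint_diff_def Lp_def e0)
  have zero: "(\<lambda>_. 0) \<in> newtonian_mean_zero p ?N"
    using ug L by (auto simp: newtonian_mean_zero_def newtonian_def Lp_def e0)
  have I: "neumann_functional p M \<Omega> f v = enn2ereal (dirichlet_energy p ?N v)" for v
    by (simp add: neumann_functional_def dirichlet_energy_def True set_lebesgue_integral_def
        flip: zero_ereal_def)
  have "dirichlet_energy p ?N (\<lambda>_. 0) = 0"
    using dirichlet_energy_le[OF assms(1) N upper_gradient_imp_weak[OF ug assms(1) N] L] by simp
  then have "neumann_functional p M \<Omega> f (\<lambda>_. 0) \<le> (INF v\<in>newtonian_mean_zero p ?N. neumann_functional p M \<Omega> f v)"
    by (intro INF_greatest) (simp add: I zero_ennreal.rep_eq)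
  then show ?thesis using zero by (intro bexI[OF _ zero] antisym INF_lower)
next
  case False
  obtain F where F: "\<And>x. x \<in> frontier \<Omega> \<Longrightarrow> \<bar>f x\<bar> \<le> F" using assms(9) by (auto simp: bounded_iff)
  have "0 \<le> F" using False F by (meson abs_ge_zero all_not_in_conv order_trans)
  interpret neumann_problem M \<Omega> p f F
    by unfold_locales (use assms False F \<open>0 \<le> F\<close> in auto)
  show ?thesis by (rule minimizer_exists)
qed

end
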